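(* Let $b:[0,\infty)\times\mathbb R^d\times\mathscr P_2(\mathbb R^d)\to\mathbb R^d$ and $\sigma:[0,\infty)\times\mathscr P_2(\mathbb R^d)\to\mathbb R^d\otimes\mathbb R^n$ be measurable (so the diffusion coefficient $\sigma_t(x,\gamma)=\sigma_t(\gamma)$ does not depend on $x$), with $b$ bounded on bounded sets and $b_t(\cdot,\gamma)$ continuous on $\mathbb R^d$ for all $t\ge 0$, $\gamma\in\mathscr P_2(\mathbb R^d)$. Assume there exist constants $K_1,K_I,\delta_1>0$ such that for all $t\ge0$, $x,y\in\mathbb R^d$, $\gamma,\tilde\gamma\in\mathscr P_2(\mathbb R^d)$, $$2\langle b_t(x,\gamma)-b_t(y,\tilde\gamma),x-y\rangle+\|\sigma_t(\gamma)-\sigma_t(\tilde\gamma)\|_{HS}^2\le K_1|x-y|^2+K_I\mathbb W_2(\gamma,\tilde\gamma)^2,$$ $$\|\sigma_t(\gamma)\|_{HS}^2\le K_1\big(1+|x|^2+\gamma(|\cdot|^2)\big),\qquad \sigma_t(\gamma)\sigma_t(\gamma)^*\le\delta_1 I_{d\times d}.$$ Then for every $\mu_\cdot\in C([0,\infty),\mathscr P_2(\mathbb R^d))$, every $f\in C_b^\infty(\mathbb R^d)$ with $f>0$, and all $0\le s\le t$, $$P_{s,t}^\mu(f\log f)-P_{s,t}^\mu f\,\log P_{s,t}^\mu f\le\frac{2\delta_1}{K_1}\big(e^{K_1(t-s)}-1\big)P_{s,t}^\mu\big(|\nabla f^{1/2}|^2\big).$$ If moreover $\gamma\in\mathscr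 P_2(\mathbb R^d)$ satisfies, for some $L_0\ge0$, $$\gamma(f\log f)\le\gamma(f)\log\gamma(f)+2L_0\,\gamma\big(|\nabla f^{1/2}|^2\big),\qquad f\in C_b^\infty(\mathbb R^d),\ f>0,$$ then for all $t\ge0$ and all $f\in C_b^\infty(\mathbb R^d)$ with $f>0$, $$(P_t^*\gamma)(f\log f)-(P_t^*\gamma)(f)\log(P_t^*\gamma)(f)\le2\Big(L_0e^{K_1t}+\frac{\delta_1}{K_1}(e^{K_1t}-1)\Big)(P_t^*\gamma)\big(|\nabla f^{1/2}|^2\big).$$
   Context: $\mathscr P_2(\mathbb R^d)$ is the set of probability measures on $\mathbb R^d$ with finite second moment, with the $L^2$-Wasserstein distance $\mathbb W_2$; $\gamma(f)=\int f\,d\gamma$. $\|\cdot\|_{HS}$ is the Hilbert–Schmidt norm. $C_b^\infty(\mathbb R^d)=\{f\in C^\infty(\mathbb R^d):\|\nabla^if\|_\infty<\infty\text{ for all }i\ge1\}$ (note $f$ itself need not be bounded). $W_t$ is an $n$-dimensional Brownian motion on a complete filtered probability space. For $\mu_\cdot\in C([0,\infty),\mathscr P_2(\mathbb R^d))$, $X_{s,t}^{\mu,x}$ denotes the unique solution of $dX_{s,t}^\mu=b_t(X_{s,t}^\mu,\mu_t)\,dt+\sigma_t(\mu_t)\,dW_t$, $t\ge s\ge0$, with $X_{s,s}^{\mu,x}=x$, and $P_{s,t}^\mu f(x)=\mathbb E f(X_{s,t}^{\mu,x})$. For $\gamma\in\mathscr P_2(\mathbb R^d)$, $P_t^*\gamma$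 denotes the law of $X_t$, where $X$ is the solution of the McKean–Vlasov SDE $dX_t=b_t(X_t,\mathscr L_{X_t})\,dt+\sigma_t(\mathscr L_{X_t})\,dW_t$ with $\mathscr L_{X_0}=\gamma$ ($\mathscr L_{X_t}$ is the law of $X_t$). Under the stated assumptions both equations are well-posed. *)

theory Defs
  imports "HOL-Probability.Probability"
begin

section \<open>Smooth test functions\<close>

definition gradient :: "(real^'d \<Rightarrow> real) \<Rightarrow> real^'d \<Rightarrow> real^'d" where
  "gradient f x = (\<chi> i. frechet_derivative f (at x) (axis i 1))"

text \<open>\<open>partials [i\<^sub>1, \<dots>, i\<^sub>k] f\<close> is \<open>\<partial>\<^sub>i\<^sub>1 \<dots> \<partial>\<^sub>i\<^sub>k f\<close>.\<close>

fun partials :: "'d list \<Rightarrow> (real^'d \<Rightarrow> real) \<Rightarrow> real^'d \<Rightarrow> real" where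
  "partials [] f = f"
| "partials (i # I) f = (\<lambda>x. gradient (partials I f) x $ i)"

text \<open>If the iterated partial derivatives of every order exist and are all differentiable, they
  are all continuous, so this is membership in \<open>C\<^sup>\<infinity>\<close>.\<close>

definition smooth :: "(real^'d \<Rightarrow> real) \<Rightarrow> bool" where
  "smooth f \<longleftrightarrow> (\<forall>I x. partials I f differentiable (at x))"

text \<open>The Euclidean norm of the tensor \<open>\<nabla>\<^sup>k f x\<close> of all partial derivatives of order \<open>k\<close>.\<close>

definition nabla_norm :: "nat \<Rightarrow> (real^'d \<Rightarrow> real) \<Rightarrow> real^'d \<Rightarrow> real" where
  "nabla_norm k f x = L2_set (\<lambda>I. partials I f x) {I. length I = k}"

definition Cb_infty :: "(real^'d \<Rightarrow> real) set" where
  "Cb_infty = {f. smooth f \<and> (\<forall>k\<ge>1. \<exists>C. \<forall>x. nabla_norm k f x \<le> C)}"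


section \<open>The Wasserstein space\<close>

definition P2 :: "(real^'d) measure set" where
  "P2 = {\<gamma>. prob_space \<gamma> \<and> sets \<gamma> = sets borel \<and> integrable \<gamma> (\<lambda>x. (norm x)\<^sup>2)}"

definition couplings ::
    "(real^'d) measure \<Rightarrow> (real^'d) measure \<Rightarrow> ((real^'d) \<times> (real^'d)) measure set" where
  "couplings \<gamma> \<nu> = {\<pi>. sets \<pi> = sets (borel \<Otimes>\<^sub>M borel) \<and>
     distr \<pi> borel fst = \<gamma> \<and> distr \<pi> borel snd = \<nu>}"

definition W2 :: "(real^'d) measure \<Rightarrow> (real^'d) measure \<Rightarrow> real" where
  "W2 \<gamma> \<nu> = sqrt (INF \<pi>\<in>couplings \<gamma> \<nu>. \<integral>z. (norm (fst z - snd z))\<^sup>2 \<partial>\<pi>)"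

text \<open>The Borel \<open>\<sigma>\<close>-algebra of the metric space \<open>(P2, W2)\<close>, generated by its open sets.\<close>

definition P2_borel :: "(real^'d) measure measure" where
  "P2_borel = sigma P2 {U. U \<subseteq> P2 \<and> (\<forall>\<gamma>\<in>U. \<exists>r>0. \<forall>\<nu>\<in>P2. W2 \<gamma> \<nu> < r \<longrightarrow> \<nu> \<in> U)}"

text \<open>\<open>C([0,\<infinity>), P2)\<close>; only the values at nonnegative times matter.\<close>

definition C_P2 :: "(real \<Rightarrow> (real^'d) measure) set" where
  "C_P2 = {\<mu>. (\<forall>t\<ge>0. \<mu> t \<in> P2) \<and>
     (\<forall>t\<ge>0. ((\<lambda>r. W2 (\<mu> r) (\<mu> t)) \<longlongrightarrow> 0) (at t within {0..}))}"

text \<open>Boundedness on the bounded subsets of \<open>[0,\<infinity>) \<times> \<real>\<^sup>d \<times> P2\<close>; a subset of \<open>P2\<close> is bounded iff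
  it lies in a \<open>W2\<close>-ball around the Dirac mass at the origin.\<close>

definition bounded_on_bounded ::
    "(real \<Rightarrow> real^'d \<Rightarrow> (real^'d) measure \<Rightarrow> real^'d) \<Rightarrow> bool" where
  "bounded_on_bounded b \<longleftrightarrow> (\<forall>R. \<exists>C. \<forall>t\<in>{0..R}. \<forall>x. \<forall>\<gamma>\<in>P2.
     norm x \<le> R \<longrightarrow> W2 \<gamma> (return borel 0) \<le> R \<longrightarrow> norm (b t x \<gamma>) \<le> C)"

definition loewner_le :: "real^'d^'d \<Rightarrow> real^'d^'d \<Rightarrow> bool" where
  "loewner_le A B \<longleftrightarrow> (\<forall>v. v \<bullet> (A *v v) \<le> v \<bullet> (B *v v))"

definition hs_norm :: "real^'n^'d \<Rightarrow> real" where
  "hs_norm A = sqrt (\<Sum>i\<in>UNIV. \<Sum>j\<in>UNIV. (A $ i $ j)\<^sup>2)"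


section \<open>Brownian motion and the Ito integral\<close>

text \<open>Time is \<open>[0,\<infinity>)\<close>; processes and filtrations are indexed by \<open>real\<close>, and only their values at
  nonnegative times are constrained or used.\<close>

locale complete_filtered_prob_space = prob_space M + complete_measure M
  for M :: "'w measure" +
  fixes F :: "real \<Rightarrow> 'w measure"
  assumes subalgebra_F: "0 \<le> t \<Longrightarrow> subalgebra M (F t)"
    and mono_F: "0 \<le> s \<Longrightarrow> s \<le> t \<Longrightarrow> sets (F s) \<subseteq> sets (F t)"
    and complete_F: "null_sets M \<subseteq> sets (F 0)"

locale brownian_motion = complete_filtered_prob_space M F
  for M :: "'w measure" and F +
  fixes W :: "real \<Rightarrow> 'w \<Rightarrow> real^'n"
  assumes adapted_W: "0 \<le> t \<Longrightarrow> W t \<in> borel_measurable (F t)"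
    and start_W: "AE \<omega> in M. W 0 \<omega> = 0"
    and continuous_W: "AE \<omega> in M. continuous_on {0..} (\<lambda>t. W t \<omega>)"
    and indep_increments_W: "0 \<le> s \<Longrightarrow> s < t \<Longrightarrow>
      indep_set (sets (F s)) (sets (vimage_algebra (space M) (\<lambda>\<omega>. W t \<omega> - W s \<omega>) borel))"
    and gaussian_increments_W: "0 \<le> s \<Longrightarrow> s < t \<Longrightarrow>
      distributed M lborel (\<lambda>\<omega>. W t \<omega> - W s \<omega>)
        (\<lambda>z. ennreal (\<Prod>i\<in>UNIV. normal_density 0 (sqrt (t - s)) (z $ i)))"

text \<open>A simple integrand on \<open>[s,t]\<close> is given by grid points \<open>s = \<tau> 0 \<le> \<dots> \<le> \<tau> k = t\<close> and bounded
  matrices \<open>\<xi> i\<close>, \<open>i < k\<close>, that are measurable at time \<open>\<tau> i\<close> and act on \<open>(\<tau> i, \<tau> (i + 1)]\<close>.\<close>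

type_synonym ('w, 'n, 'd) simple_integrand =
  "nat \<times> (nat \<Rightarrow> real) \<times> (nat \<Rightarrow> 'w \<Rightarrow> real^'n^'d)"

definition is_simple_integrand ::
    "'w measure \<Rightarrow> (real \<Rightarrow> 'w measure) \<Rightarrow> real \<Rightarrow> real \<Rightarrow> ('w, 'n::finite, 'd::finite) simple_integrand \<Rightarrow> bool" where
  "is_simple_integrand M F s t = (\<lambda>(k, \<tau>, \<xi>).
     \<tau> 0 = s \<and> \<tau> k = t \<and> (\<forall>i<k. \<tau> i \<le> \<tau> (Suc i)) \<and>
     (\<forall>i<k. \<xi> i \<in> borel_measurable (F (\<tau> i)) \<and> (\<exists>C. \<forall>\<omega>\<in>space M. norm (\<xi> i \<omega>) \<le> C)))"

definition simple_value :: "('w, 'n::finite, 'd::finite) simple_integrand \<Rightarrow> real \<Rightarrow> 'w \<Rightarrow> real^'n^'d" where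
  "simple_value = (\<lambda>(k, \<tau>, \<xi>) r \<omega>. \<Sum>i<k. indicator {\<tau> i<..\<tau> (Suc i)} r *\<^sub>R \<xi> i \<omega>)"

definition simple_integral ::
    "(real \<Rightarrow> 'w \<Rightarrow> real^'n) \<Rightarrow> ('w, 'n::finite, 'd::finite) simple_integrand \<Rightarrow> 'w \<Rightarrow> real^'d" where
  "simple_integral W = (\<lambda>(k, \<tau>, \<xi>) \<omega>. \<Sum>i<k. \<xi> i \<omega> *v (W (\<tau> (Suc i)) \<omega> - W (\<tau> i) \<omega>))"

text \<open>\<open>J\<close> is (a version of) \<open>\<integral>\<^sub>s\<^sup>t H\<^sub>r dW\<^sub>r\<close> for a progressively measurable square-integrable \<open>H\<close>:
  the \<open>L\<^sup>2\<close>-limit of the integrals of simple integrands that converge to \<open>H\<close> in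
  \<open>L\<^sup>2([s,t] \<times> \<Omega>)\<close>. Square-integrability of \<open>H\<close> is implied by the existence of such an approximation,
  as simple integrands are bounded.\<close>

definition has_ito_integral ::
    "'w measure \<Rightarrow> (real \<Rightarrow> 'w measure) \<Rightarrow> (real \<Rightarrow> 'w \<Rightarrow> real^'n) \<Rightarrow> real \<Rightarrow> real \<Rightarrow>
     (real \<Rightarrow> 'w \<Rightarrow> real^'n^'d) \<Rightarrow> ('w \<Rightarrow> real^'d) \<Rightarrow> bool" where
  "has_ito_integral M F W s t H J \<longleftrightarrow>
     (\<forall>u\<in>{s..t}. (\<lambda>(r, \<omega>). H r \<omega>) \<in> borel_measurable (restrict_space borel {s..u} \<Otimes>\<^sub>M F u)) \<and>
     J \<in> borel_measurable (F t) \<and>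
     (\<exists>S. (\<forall>m. is_simple_integrand M F s t (S m)) \<and>
       (\<lambda>m. \<integral>\<^sup>+\<omega>. (\<integral>\<^sup>+r\<in>{s..t}. ennreal ((norm (simple_value (S m) r \<omega> - H r \<omega>))\<^sup>2) \<partial>lborel) \<partial>M)
         \<longlonglongrightarrow> 0 \<and>
       (\<lambda>m. \<integral>\<^sup>+\<omega>. ennreal ((norm (simple_integral W (S m) \<omega> - J \<omega>))\<^sup>2) \<partial>M) \<longlonglongrightarrow> 0)"


section \<open>Stochastic differential equations\<close>

text \<open>\<open>X\<close> solves \<open>dX\<^sub>t = \<beta>\<^sub>t(X\<^sub>t) dt + \<Sigma>\<^sub>t dW\<^sub>t\<close> on \<open>[s,\<infinity>)\<close>, where \<open>J\<close> is the continuous version of the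
  stochastic integral. Both equations below have this form, since \<open>\<sigma>\<close> does not depend on the space
  variable.\<close>

definition solves_sde ::
    "'w measure \<Rightarrow> (real \<Rightarrow> 'w measure) \<Rightarrow> (real \<Rightarrow> 'w \<Rightarrow> real^'n) \<Rightarrow> real \<Rightarrow>
     (real \<Rightarrow> real^'d \<Rightarrow> real^'d) \<Rightarrow> (real \<Rightarrow> real^'n^'d) \<Rightarrow> (real \<Rightarrow> 'w \<Rightarrow> real^'d) \<Rightarrow> bool" where
  "solves_sde M F W s \<beta> \<Sigma> X \<longleftrightarrow>
     (\<forall>t\<ge>s. X t \<in> borel_measurable (F t)) \<and>
     (AE \<omega> in M. continuous_on {s..} (\<lambda>t. X t \<omega>)) \<and>
     (AE \<omega> in M. \<forall>t\<ge>s. set_integrable lborel {s..t} (\<lambda>r. \<beta> r (X r \<omega>))) \<and>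
     (\<exists>J. (\<forall>t\<ge>s. has_ito_integral M F W s t (\<lambda>r \<omega>. \<Sigma> r) (J t)) \<and>
       (AE \<omega> in M. continuous_on {s..} (\<lambda>t. J t \<omega>)) \<and>
       (AE \<omega> in M. \<forall>t\<ge>s. X t \<omega> = X s \<omega> + (LINT r:{s..t}|lborel. \<beta> r (X r \<omega>)) + J t \<omega>))"

text \<open>\<open>X\<close> is the process \<open>(X\<^sub>s\<^sub>,\<^sub>t\<^sup>\<mu>\<^sup>,\<^sup>x)\<close>, \<open>t \<ge> s\<close>, of the decoupled equation.\<close>

definition solves_decoupled where
  "solves_decoupled M F W b \<sigma> \<mu> s x X \<longleftrightarrow>
     solves_sde M F W s (\<lambda>t y. b t y (\<mu> t)) (\<lambda>t. \<sigma> (t::real) (\<mu> t)) X \<and>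
     (AE \<omega> in M. X s \<omega> = x)"

definition law :: "'w measure \<Rightarrow> ('w \<Rightarrow> real^'d) \<Rightarrow> (real^'d) measure" where
  "law M Y = distr M borel Y"

text \<open>Solutions of the McKean--Vlasov equation with initial law \<open>\<gamma>\<close> are, as usual for distributions
  in \<open>P2\<close>, those whose law is a continuous curve in \<open>(P2, W2)\<close>.\<close>

definition solves_mckean_vlasov where
  "solves_mckean_vlasov M F W b \<sigma> \<gamma> X \<longleftrightarrow>
     (\<lambda>t. law M (X t)) \<in> C_P2 \<and> law M (X 0) = \<gamma> \<and>
     solves_sde M F W 0 (\<lambda>t y. b t y (law M (X t))) (\<lambda>t. \<sigma> (t::real) (law M (X t))) X"

text \<open>\<open>P\<^sub>s\<^sub>,\<^sub>t\<^sup>\<mu> g x = E g(X\<^sub>s\<^sub>,\<^sub>t\<^sup>\<mu>\<^sup>,\<^sup>x)\<close>, for \<open>X\<close> the process \<open>(X\<^sub>s\<^sub>,\<^sub>t\<^sup>\<mu>\<^sup>,\<^sup>x)\<close>, \<open>t \<ge> s\<close>.\<close>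

definition P_transition ::
    "'w measure \<Rightarrow> (real \<Rightarrow> 'w \<Rightarrow> real^'d) \<Rightarrow> real \<Rightarrow> (real^'d \<Rightarrow> real) \<Rightarrow> real" where
  "P_transition M X t g = (\<integral>\<omega>. g (X t \<omega>) \<partial>M)"

end

theory Submission
  imports Defs
begin

text \<open>
  Neither Ito's formula nor the gradient flow of the semigroup is used. The logarithmic Sobolev
  inequality with constant \<open>C\<close> is stated for pairs of a bounded Lipschitz function bounded away from
  \<open>0\<close> and a Lipschitz pointwise bound for its local slope, instead of a function and its gradient.
  In this form it is preserved, with \<open>C\<close> replaced by \<open>K\<^sup>2 * C\<close>, by maps with Lipschitz constant \<open>K\<close>
  (which need not be differentiable), and by almost sure limits. Adding to an
  \<open>F a\<close>-measurable variable the Ito integral over \<open>{a..b}\<close> of a deterministic integrand with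
  \<open>\<Sigma> \<Sigma>\<^sup>T \<le> \<delta> I\<close> increases \<open>C\<close> by at most \<open>\<delta> * (b - a)\<close>.

  Along the given flow \<open>\<mu>\<close> the equation has a one-sided Lipschitz drift and additive noise, so the
  implicit Euler scheme of step \<open>h\<close>, driven by the exact stochastic integral, alternates
  an independent Gaussian increment with a resolvent of Lipschitz constant \<open>1 / (1 - K h / 2)\<close>. It
  converges pathwise to the solution, and the recursion \<open>C \<mapsto> (C + \<delta> h) / (1 - K h / 2)\<^sup>2\<close> produces in
  the limit the constant \<open>exp (K t) * C + \<delta> * (exp (K t) - 1) / K\<close>. A Dirac mass has constant \<open>0\<close>.
\<close>

section \<open>Centred Gaussian measures\<close>

text \<open>The obstacle is regularity. The drift is only continuous in space and measurable in
  time, with a one-sided Lipschitz bound, so the flow of the equation need not be differentiable and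
  gradients of propagated functions are not at hand. The slope bound \<open>H\<close> is kept
  Lipschitz because a slope is an upper limit and does not pass to limits, while the continuous
  quotient \<open>H\<^sup>2 / f\<close> does. The constant is the solution of C' = K C + \<delta>:
  over a short time h the noise adds \<delta> h, and the resolvent multiplies by about 1 + K h. For
  this to come out exactly, the entropy of one small Gaussian increment is needed with a sharp
  leading term; its error is of order h^(3/2) and disappears under refinement. A second obstacle is
  that the stochastic integral is a limit of integrals of random step functions. Gaussian increments
  with fixed matrices obeying the same upper bound have to be recovered from it. Both claims concern
  one equation along a fixed curve of measures. In the nonlinear case the curve consists of the laws
  of the solution itself, so the Wasserstein term in the monotonicity hypothesis is evaluated at
  equal measures and vanishes.\<close>

lemma has_bochner_integral_lborel_vec_prod:
  fixes u :: "'n::finite \<Rightarrow> real \<Rightarrow> real"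
  assumes u: "\<And>i. integrable lborel (u i)"
  shows "has_bochner_integral lborel (\<lambda>z::real^'n. \<Prod>i\<in>UNIV. u i (z $ i)) (\<Prod>i\<in>UNIV. integral\<^sup>L lborel (u i))"
proof -
  interpret product_sigma_finite "\<lambda>_::real^'n. lborel :: real measure" ..
  \<comment> \<open>\<open>lborel\<close> on a Euclidean space is the image of a product measure
    indexed by \<open>Basis\<close>. Fubini for products applies there, and \<open>ix\<close>
    translates between basis vectors and coordinates.\<close>
  define ix :: "real^'n \<Rightarrow> 'n" where "ix = the_inv (\<lambda>i. axis i 1)"
  have inj: "inj (\<lambda>i::'n. axis i (1::real))"
    by (auto simp: inj_on_def axis_eq_axis)
  have ix: "ix (axis i 1) = i" for i
    unfolding ix_def by (rule the_inv_f_f[OF inj])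
  have B: "(Basis :: (real^'n) set) = range (\<lambda>i. axis i 1)"
    by (auto simp: Basis_vec_def)
  have comp: "(\<Sum>b\<in>Basis. f b *\<^sub>R b) $ i = f (axis i 1)" for f :: "real^'n \<Rightarrow> real" and i
  proof -
    have "(\<Sum>b\<in>Basis. f b *\<^sub>R b) $ i = (\<Sum>j\<in>UNIV. f (axis j 1) * (axis j 1 $ i))"
      unfolding B by (subst sum.reindex[OF inj]) simp
    also have "\<dots> = (\<Sum>j\<in>UNIV. if j = i then f (axis i 1) else 0)"
      by (rule sum.cong) (auto simp: axis_def)
    finally show ?thesis by simp
  qed
  let ?M = "\<Pi>\<^sub>M b\<in>(Basis :: (real^'n) set). (lborel :: real measure)"
  have prod_eq: "(\<Prod>i\<in>UNIV. u i ((\<Sum>b\<in>Basis. f b *\<^sub>R b) $ i)) = (\<Prod>b\<in>Basis. u (ix b) (f b))" for f :: "real^'n \<Rightarrow> real"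
    unfolding comp unfolding B by (subst prod.reindex[OF inj]) (simp add: ix)
  have int: "integrable ?M (\<lambda>f. \<Prod>b\<in>Basis. u (ix b) (f b))"
    by (rule product_integrable_prod) (use u in auto)
  have val: "integral\<^sup>L ?M (\<lambda>f. \<Prod>b\<in>Basis. u (ix b) (f b)) = (\<Prod>i\<in>UNIV. integral\<^sup>L lborel (u i))"
    by (subst product_integral_prod) (use u in \<open>auto simp: B prod.reindex[OF inj] ix\<close>)
  have [measurable]: "u i \<in> borel_measurable borel" for i
    using borel_measurable_integrable[OF u[of i]] by simp
  have m: "(\<lambda>f. \<Sum>b\<in>Basis. f b *\<^sub>R b) \<in> measurable ?M (borel :: (real^'n) measure)"
    by measurable
  have mu: "(\<lambda>z::real^'n. \<Prod>i\<in>UNIV. u i (z $ i)) \<in> borel_measurable borel"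
    by measurable
  have "has_bochner_integral (distr ?M borel (\<lambda>f. \<Sum>b\<in>Basis. f b *\<^sub>R b)) (\<lambda>z::real^'n. \<Prod>i\<in>UNIV. u i (z $ i)) (\<Prod>i\<in>UNIV. integral\<^sup>L lborel (u i))"
    unfolding has_bochner_integral_iff
    unfolding integrable_distr_eq[OF m mu] integral_distr[OF m mu] prod_eq using int val by simp
  then show ?thesis by (subst lborel_eq)
qed

text \<open>The parameter is the standard deviation, and the product has the shape used in
  \<open>brownian_motion\<close>, so an increment over a time span \<open>u\<close> has law
  \<open>gauss (sqrt u)\<close>.\<close>

definition gauss_density :: "real \<Rightarrow> real^'n \<Rightarrow> real" where
  "gauss_density s z = (\<Prod>i\<in>UNIV. normal_density 0 s (z $ i))"

definition gauss :: "real \<Rightarrow> (real^'n::finite) measure" where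
  "gauss s = density lborel (\<lambda>z. ennreal (gauss_density s z))"

lemma gauss_density_nonneg [simp]: "0 \<le> gauss_density s z"
  by (simp add: gauss_density_def prod_nonneg)

lemma measurable_gauss_density [measurable]: "gauss_density s \<in> borel_measurable borel"
  unfolding gauss_density_def by measurable

lemma sets_gauss [simp, measurable_cong]: "sets (gauss s) = sets borel"
  and space_gauss [simp]: "space (gauss s) = UNIV"
  by (simp_all add: gauss_def)

text \<open>A monomial is a product over all coordinates with factor \<open>1\<close> in those that
  do not occur, so the moments below reduce to one-dimensional ones.\<close>

lemma has_bochner_integral_gauss_prod:
  fixes p :: "'n::finite \<Rightarrow> real \<Rightarrow> real"
  assumes p: "\<And>i. integrable lborel (\<lambda>x. normal_density 0 s x * p i x)"
    and [measurable]: "\<And>i. p i \<in> borel_measurable borel"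
  shows "has_bochner_integral (gauss s) (\<lambda>z::real^'n. \<Prod>i\<in>UNIV. p i (z $ i))
     (\<Prod>i\<in>UNIV. \<integral>x. normal_density 0 s x * p i x \<partial>lborel)"
  unfolding gauss_def
  using has_bochner_integral_lborel_vec_prod[OF p]
  by (intro has_bochner_integral_density) (auto simp: gauss_density_def prod.distrib prod_nonneg)

lemma prob_space_gauss:
  assumes "s > 0" shows "prob_space (gauss s :: (real^'n::finite) measure)"
proof (rule prob_spaceI)
  have *: "has_bochner_integral (gauss s) (\<lambda>z::real^'n. 1::real) 1"
    using has_bochner_integral_gauss_prod[of s "\<lambda>(_::'n) _. 1"] assms
    by (simp add: integrable_normal_density integral_normal_density)
  have "integral\<^sup>N (gauss s) (\<lambda>z::real^'n. ennreal 1) = ennreal 1"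
    by (subst nn_integral_eq_integral) (use * in \<open>auto simp: has_bochner_integral_iff\<close>)
  then show "emeasure (gauss s) (space (gauss s :: (real^'n) measure)) = 1"
    by simp
qed

lemma normal_density_moments:
  assumes s: "s > 0"
  shows "has_bochner_integral lborel (\<lambda>x. normal_density 0 s x) 1"
    and "has_bochner_integral lborel (\<lambda>x. normal_density 0 s x * x) 0"
    and "has_bochner_integral lborel (\<lambda>x. normal_density 0 s x * (x * x)) (s\<^sup>2)"
    and "has_bochner_integral lborel (\<lambda>x. normal_density 0 s x * x ^ 4) (3 * s ^ 4)"
  using integrable_normal_density[OF s] integral_normal_density[OF s] normal_moment_odd[OF s, of 0 0]
    normal_moment_even[OF s, of 0 1] normal_moment_even[OF s, of 0 2] s
  by (simp_all add: has_bochner_integral_iff power2_eq_square fact_numeral field_simps power4_eq_xxxx)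

lemma gauss_mean:
  fixes i :: "'n::finite"
  assumes s: "s > 0"
  shows "has_bochner_integral (gauss s) (\<lambda>z::real^'n. z $ i) 0"
proof -
  let ?p = "\<lambda>k x. if k = i then x else (1::real)"
  have I: "has_bochner_integral lborel (\<lambda>x. normal_density 0 s x * ?p k x) (if k = i then 0 else 1)" for k
    using normal_density_moments[OF s] by (cases "k = i") simp_all
  have "has_bochner_integral (gauss s) (\<lambda>z::real^'n. \<Prod>k\<in>UNIV. ?p k (z $ k))
     (\<Prod>k\<in>UNIV. \<integral>x. normal_density 0 s x * ?p k x \<partial>lborel)"
    by (rule has_bochner_integral_gauss_prod) (use I in \<open>auto simp: has_bochner_integral_iff\<close>)
  moreover have "(\<Prod>k\<in>UNIV. ?p k (z $ k)) = z $ i" for z :: "real^'n" by (simp add: prod.delta)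
  moreover have "(\<Prod>k\<in>UNIV. \<integral>x. normal_density 0 s x * ?p k x \<partial>lborel) = 0"
    using I[of i] by (intro prod_zero bexI[of _ i]) (auto simp: has_bochner_integral_iff)
  ultimately show ?thesis by simp
qed

lemma gauss_covariance:
  fixes i j :: "'n::finite"
  assumes s: "s > 0"
  shows "has_bochner_integral (gauss s) (\<lambda>z::real^'n. z $ i * z $ j) (if i = j then s\<^sup>2 else 0)"
proof -
  let ?p = "\<lambda>k x. (if k = i then x else 1) * (if k = j then x else (1::real))"
  have I: "has_bochner_integral lborel (\<lambda>x. normal_density 0 s x * ?p k x)
      (if k = i \<and> k = j then s\<^sup>2 else if k = i \<or> k = j then 0 else 1)" for k
    using normal_density_moments[OF s] by (cases "k = i"; cases "k = j") simp_all
  have "has_bochner_integral (gauss s) (\<lambda>z::real^'n. \<Prod>k\<in>UNIV. ?p k (z $ k))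
     (\<Prod>k\<in>UNIV. \<integral>x. normal_density 0 s x * ?p k x \<partial>lborel)"
    by (rule has_bochner_integral_gauss_prod) (use I in \<open>auto simp: has_bochner_integral_iff\<close>)
  moreover have "(\<Prod>k\<in>UNIV. ?p k (z $ k)) = z $ i * z $ j" for z :: "real^'n"
    by (simp add: prod.distrib prod.delta)
  moreover have "(\<Prod>k\<in>UNIV. \<integral>x. normal_density 0 s x * ?p k x \<partial>lborel) = (if i = j then s\<^sup>2 else 0)"
  proof -
    have "(\<Prod>k\<in>UNIV. \<integral>x. normal_density 0 s x * ?p k x \<partial>lborel)
        = (\<Prod>k\<in>UNIV. (if k = i \<and> k = j then s\<^sup>2 else if k = i \<or> k = j then 0 else 1))"
      using I by (intro prod.cong refl) (simp only: has_bochner_integral_iff)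
    also have "\<dots> = (if i = j then s\<^sup>2 else 0)"
    proof (cases "i = j")
      case True then show ?thesis by (simp add: prod.delta cong: if_cong)
    next
      case False then show ?thesis by (auto intro!: prod_zero bexI[of _ i])
    qed
    finally show ?thesis .
  qed
  ultimately show ?thesis by simp
qed

lemma gauss_fourth_moment:
  fixes i :: "'n::finite"
  assumes s: "s > 0"
  shows "has_bochner_integral (gauss s) (\<lambda>z::real^'n. (z $ i) ^ 4) (3 * s ^ 4)"
proof -
  let ?p = "\<lambda>k x. if k = i then x ^ 4 else (1::real)"
  have I: "has_bochner_integral lborel (\<lambda>x. normal_density 0 s x * ?p k x)
      (if k = i then 3 * s ^ 4 else 1)" for k
    using normal_density_moments[OF s] by (cases "k = i") simp_all
  have "has_bochner_integral (gauss s) (\<lambda>z::real^'n. \<Prod>k\<in>UNIV. ?p k (z $ k))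
     (\<Prod>k\<in>UNIV. \<integral>x. normal_density 0 s x * ?p k x \<partial>lborel)"
    by (rule has_bochner_integral_gauss_prod) (use I in \<open>auto simp: has_bochner_integral_iff\<close>)
  moreover have "(\<Prod>k\<in>UNIV. ?p k (z $ k)) = z $ i ^ 4" for z :: "real^'n"
    by (simp add: prod.delta)
  moreover have "(\<Prod>k\<in>UNIV. \<integral>x. normal_density 0 s x * ?p k x \<partial>lborel) = 3 * s ^ 4"
  proof -
    have "(\<Prod>k\<in>UNIV. \<integral>x. normal_density 0 s x * ?p k x \<partial>lborel)
        = (\<Prod>k\<in>UNIV. (if k = i then 3 * s ^ 4 else 1))"
      using I by (intro prod.cong refl) (simp only: has_bochner_integral_iff)
    then show ?thesis by (simp add: prod.delta)
  qed
  ultimately show ?thesis by simp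
qed

lemma norm_power4_le: "norm (z :: real^'n::finite) ^ 4 \<le> real CARD('n) * (\<Sum>i\<in>UNIV. (z $ i) ^ 4)"
proof -
  have "norm z ^ 4 = (\<Sum>i\<in>UNIV. (z $ i)\<^sup>2 * 1)\<^sup>2"
    by (simp add: norm_eq_sqrt_inner inner_vec_def power4_eq_xxxx power2_eq_square real_sqrt_mult[symmetric] sum_nonneg
        flip: real_sqrt_pow2)
  also have "\<dots> \<le> (\<Sum>i\<in>UNIV. ((z $ i)\<^sup>2)\<^sup>2) * (\<Sum>i\<in>(UNIV::'n set). 1\<^sup>2)"
    by (rule Cauchy_Schwarz_ineq_sum)
  finally show ?thesis by (simp add: mult.commute)
qed

text \<open>The variance of a linear functional is computed exactly because it fixes the constant of
  the inequality. The fourth moment enters only error terms, where just its order in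
  \<open>s\<close> counts.\<close>

lemma gauss_moments:
  assumes s: "s > 0"
  shows "integrable (gauss s) (\<lambda>z::real^'n::finite. norm z ^ 4)"
    and "(\<integral>z. norm (z::real^'n) ^ 4 \<partial>gauss s) \<le> 3 * (real CARD('n))\<^sup>2 * s ^ 4"
    and "has_bochner_integral (gauss s) (\<lambda>z::real^'n::finite. (v \<bullet> z)\<^sup>2) (s\<^sup>2 * (norm v)\<^sup>2)"
proof -
  have S: "has_bochner_integral (gauss s) (\<lambda>z::real^'n. real CARD('n) * (\<Sum>i\<in>UNIV. (z $ i) ^ 4)) (3 * (real CARD('n))\<^sup>2 * s ^ 4)"
    using has_bochner_integral_mult_right[OF has_bochner_integral_sum[where I=UNIV and f="\<lambda>i z. (z $ i) ^ 4" and x="\<lambda>_::'n. 3 * s ^ 4", OF gauss_fourth_moment[OF s]], of "real CARD('n)"]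
    by (simp add: power2_eq_square ac_simps)
  show I: "integrable (gauss s) (\<lambda>z::real^'n::finite. norm z ^ 4)"
    by (rule Bochner_Integration.integrable_bound[where f="\<lambda>z::real^'n. real CARD('n) * (\<Sum>i\<in>UNIV. (z $ i) ^ 4)"])
      (use S norm_power4_le in \<open>auto simp: has_bochner_integral_iff intro!: AE_I2 order_trans[OF norm_power4_le]\<close>)
  show "(\<integral>z. norm (z::real^'n) ^ 4 \<partial>gauss s) \<le> 3 * (real CARD('n))\<^sup>2 * s ^ 4"
  proof -
    have "(\<integral>z. norm (z::real^'n) ^ 4 \<partial>gauss s) \<le> (\<integral>z. real CARD('n) * (\<Sum>i\<in>UNIV. ((z::real^'n) $ i) ^ 4) \<partial>gauss s)"
      by (rule integral_mono[OF I]) (use S norm_power4_le in \<open>auto simp only: has_bochner_integral_iff\<close>)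
    then show ?thesis using S by (simp only: has_bochner_integral_iff)
  qed
  have eq: "(v \<bullet> z)\<^sup>2 = (\<Sum>i\<in>UNIV. \<Sum>j\<in>UNIV. v $ i * v $ j * (z $ i * z $ j))" for z :: "real^'n"
    by (simp add: inner_vec_def power2_eq_square sum_product ac_simps)
  have "has_bochner_integral (gauss s) (\<lambda>z::real^'n. \<Sum>i\<in>UNIV. \<Sum>j\<in>UNIV. v $ i * v $ j * (z $ i * z $ j))
      (\<Sum>i\<in>UNIV. \<Sum>j\<in>UNIV. v $ i * v $ j * (if i = j then s\<^sup>2 else 0))"
    by (intro has_bochner_integral_sum has_bochner_integral_mult_right gauss_covariance s)
  moreover have "(\<Sum>i\<in>UNIV. \<Sum>j\<in>UNIV. v $ i * v $ j * (if i = j then s\<^sup>2 else 0)) = s\<^sup>2 * (norm v)\<^sup>2"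
    by (simp only: power2_norm_eq_inner)
      (simp add: inner_vec_def sum_distrib_left power2_eq_square ac_simps if_distrib[of "(*) _"] cong: if_cong)
  ultimately show "has_bochner_integral (gauss s) (\<lambda>z::real^'n::finite. (v \<bullet> z)\<^sup>2) (s\<^sup>2 * (norm v)\<^sup>2)"
    by (simp add: eq)
qed

lemma norm_add_sq_le:
  "(norm (x + y))\<^sup>2 \<le> 2 * (norm x)\<^sup>2 + 2 * (norm (y :: 'a::real_normed_vector))\<^sup>2"
proof -
  have "(norm (x + y))\<^sup>2 \<le> (norm x + norm y)\<^sup>2" by (intro power_mono norm_triangle_ineq) simp
  also have "\<dots> \<le> 2 * (norm x)\<^sup>2 + 2 * (norm y)\<^sup>2"
    using zero_le_power2[of "norm x - norm y"] by (simp add: power2_diff power2_sum)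
  finally show ?thesis .
qed

section \<open>Gaussian mollification\<close>

lemma gradient_eqI:
  assumes "(f has_derivative f') (at x)"
  shows "gradient f x $ i = f' (axis i 1)"
  using frechet_derivative_at[OF assms] by (simp add: gradient_def)

lemma gradient_has_derivative:
  assumes "f differentiable (at x)"
  shows "(f has_derivative (\<lambda>u. gradient f x \<bullet> u)) (at x)"
proof -
  have d: "(f has_derivative frechet_derivative f (at x)) (at x)"
    using assms frechet_derivative_works by blast
  then have l: "linear (frechet_derivative f (at x))"
    by (rule has_derivative_linear)
  have "frechet_derivative f (at x) u = gradient f x \<bullet> u" for u
  proof -
    have "frechet_derivative f (at x) u = frechet_derivative f (at x) (\<Sum>i\<in>UNIV. u $ i *\<^sub>R axis i 1)"
      using basis_expansion[of u] by (simp add: scalar_mult_eq_scaleR)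
    also have "\<dots> = gradient f x \<bullet> u"
      by (simp add: linear_sum[OF l] linear_cmul[OF l] gradient_def inner_vec_def mult.commute)
    finally show ?thesis .
  qed
  then show ?thesis using d by (metis (no_types, lifting) ext)
qed

text \<open>The remainders divided by the length of the increment tend to \<open>0\<close> pointwise
  and are bounded by \<open>2 * w\<close>. Dominated convergence concerns sequences, hence the
  passage to sequences of increments.\<close>

lemma has_derivative_integral_dominated:
  fixes k :: "'a::real_normed_vector \<Rightarrow> 'b \<Rightarrow> real"
  assumes int: "\<And>x. integrable M (k x)"
    and k': "\<And>y. ((\<lambda>x. k x y) has_derivative k' y) (at x0)"
    and w: "integrable M w"
    and bound: "\<And>x y. norm (x - x0) \<le> 1 \<Longrightarrow> \<bar>k x y - k x0 y\<bar> \<le> w y * norm (x - x0)"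
    and bound': "\<And>u y. \<bar>k' y u\<bar> \<le> w y * norm u"
    and meas: "\<And>u. (\<lambda>y. k' y u) \<in> borel_measurable M"
  shows "((\<lambda>x. \<integral>y. k x y \<partial>M) has_derivative (\<lambda>u. \<integral>y. k' y u \<partial>M)) (at x0)"
  unfolding has_derivative_at
proof
  have lin: "linear (k' y)" for y
    using k' by (rule has_derivative_linear)
  have int': "integrable M (\<lambda>y. k' y u)" for u
    by (rule Bochner_Integration.integrable_bound[where f="\<lambda>y. w y * norm u"])
      (use w bound' meas in \<open>auto intro!: AE_I2 order_trans[OF bound']\<close>)
  show "bounded_linear (\<lambda>u. \<integral>y. k' y u \<partial>M)"
  proof
    fix u v :: 'a and c :: real
    show "(\<integral>y. k' y (u + v) \<partial>M) = (\<integral>y. k' y u \<partial>M) + (\<integral>y. k' y v \<partial>M)"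
      using int' by (simp add: linear_add[OF lin])
    show "(\<integral>y. k' y (c *\<^sub>R u) \<partial>M) = c *\<^sub>R (\<integral>y. k' y u \<partial>M)"
      by (simp add: linear_cmul[OF lin])
    show "\<exists>K. \<forall>u. norm (\<integral>y. k' y u \<partial>M) \<le> norm u * K"
    proof (intro exI allI)
      fix u
      have "norm (\<integral>y. k' y u \<partial>M) \<le> (\<integral>y. norm (k' y u) \<partial>M)"
        by (rule integral_norm_bound)
      also have "\<dots> \<le> (\<integral>y. w y * norm u \<partial>M)"
        using int' w bound' by (intro integral_mono) auto
      finally show "norm (\<integral>y. k' y u \<partial>M) \<le> norm u * (\<integral>y. w y \<partial>M)"
        by (simp add: mult.commute)
    qed
  qed
  show "(\<lambda>h. norm ((\<integral>y. k (x0 + h) y \<partial>M) - (\<integral>y. k x0 y \<partial>M) - (\<integral>y. k' y h \<partial>M)) / norm h) \<midarrow>0\<rightarrow> 0"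
    unfolding tendsto_at_iff_sequentially
  proof (intro allI impI)
    fix X :: "nat \<Rightarrow> 'a" assume X0: "\<forall>i. X i \<in> UNIV - {0}" and X: "X \<longlonglongrightarrow> 0"
    let ?q = "\<lambda>h y. (k (x0 + h) y - k x0 y - k' y h) / norm h"
    \<comment> \<open>The increment bound holds only within distance \<open>1\<close>, so an initial
      segment of the sequence is dropped.\<close>
    have "eventually (\<lambda>n. norm (X n) < 1) sequentially"
      using tendsto_norm[OF X] by (intro order_tendstoD) auto
    then obtain N where N: "\<And>n. n \<ge> N \<Longrightarrow> norm (X n) < 1"
      by (auto simp: eventually_sequentially)
    have "(\<lambda>n. \<integral>y. ?q (X (n + N)) y \<partial>M) \<longlonglongrightarrow> (\<integral>y. 0 \<partial>M)"
    proof (rule integral_dominated_convergence[where w="\<lambda>y. 2 * w y"])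
      show "(\<lambda>y. ?q (X (n + N)) y) \<in> borel_measurable M" for n
        using borel_measurable_integrable[OF int] meas by (intro borel_measurable_divide borel_measurable_diff) auto
      show "AE y in M. (\<lambda>n. ?q (X (n + N)) y) \<longlonglongrightarrow> 0"
      proof (rule AE_I2)
        fix y
        have "(\<lambda>h. norm (k (x0 + h) y - k x0 y - k' y h) / norm h) \<midarrow>0\<rightarrow> 0"
          using k'[of y] by (simp add: has_derivative_at)
        then have "(\<lambda>n. norm (k (x0 + X n) y - k x0 y - k' y (X n)) / norm (X n)) \<longlonglongrightarrow> 0"
          unfolding tendsto_at_iff_sequentially using X0 X by (auto simp: o_def)
        then have "(\<lambda>n. norm (?q (X n) y)) \<longlonglongrightarrow> 0"
          by simp
        then have "(\<lambda>n. ?q (X n) y) \<longlonglongrightarrow> 0"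
          by (rule tendsto_norm_zero_cancel)
        then show "(\<lambda>n. ?q (X (n + N)) y) \<longlonglongrightarrow> 0"
          by (rule LIMSEQ_ignore_initial_segment)
      qed
      show "AE y in M. norm (?q (X (n + N)) y) \<le> 2 * w y" for n
      proof (rule AE_I2)
        fix y
        let ?h = "X (n + N)"
        have h: "norm ?h > 0" "norm ?h \<le> 1" using X0 N[of "n+N"] by auto
        have "\<bar>k (x0 + ?h) y - k x0 y - k' y ?h\<bar> \<le> w y * norm ?h + w y * norm ?h"
          using bound[of "x0 + ?h" y] bound'[of y ?h] h by auto
        then show "norm (?q ?h y) \<le> 2 * w y"
          using h by (simp add: field_simps abs_mult)
      qed
    qed (use w in auto)
    then have "(\<lambda>n. \<integral>y. ?q (X n) y \<partial>M) \<longlonglongrightarrow> 0"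
      by (simp add: LIMSEQ_offset[of _ N])
    then have "(\<lambda>n. norm (\<integral>y. ?q (X n) y \<partial>M)) \<longlonglongrightarrow> 0"
      by (rule tendsto_norm_zero)
    moreover have "norm (\<integral>y. ?q h y \<partial>M) = norm ((\<integral>y. k (x0 + h) y \<partial>M) - (\<integral>y. k x0 y \<partial>M) - (\<integral>y. k' y h \<partial>M)) / norm h" for h
      using int int' by simp
    ultimately show "((\<lambda>h. norm ((\<integral>y. k (x0 + h) y \<partial>M) - (\<integral>y. k x0 y \<partial>M) - (\<integral>y. k' y h \<partial>M)) / norm h) \<circ> X) \<longlonglongrightarrow> 0"
      by (simp only: o_def)
  qed
qed

text \<open>Convolution with a Gaussian is smooth because polynomials times \<open>exp (- c * (z \<bullet> z))\<close>
  form a class of kernels closed under partial derivatives.\<close>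

definition gpoly :: "real \<Rightarrow> (real^'d \<Rightarrow> real) \<Rightarrow> real^'d \<Rightarrow> real" where
  "gpoly c p z = p z * exp (- c * (z \<bullet> z))"

text \<open>The exponent is arbitrary in the induction since a product has to split it into two
  halves.\<close>

lemma real_polynomial_function_bound:
  fixes p :: "real^'d::finite \<Rightarrow> real"
  assumes "real_polynomial_function p" "\<delta> > 0"
  shows "\<exists>C. \<forall>z. \<bar>p z\<bar> \<le> C * exp (\<delta> * (z \<bullet> z))"
  using assms
proof (induction arbitrary: \<delta>)
  case (linear f)
  then obtain K where K: "\<And>z. norm (f z) \<le> norm z * K" "K > 0"
    using bounded_linear.pos_bounded by blast
  have "\<bar>f z\<bar> \<le> K * (1 + 1/\<delta>) * exp (\<delta> * (z \<bullet> z))" for z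
  proof -
    have "0 \<le> (norm z - 1/2)\<^sup>2" by simp
    then have "norm z \<le> 1 + (norm z)\<^sup>2" by (simp add: power2_diff power_divide)
    also have "\<dots> \<le> (1 + 1/\<delta>) * (1 + \<delta> * (z \<bullet> z))"
      using linear by (simp add: power2_norm_eq_inner field_simps)
    also have "\<dots> \<le> (1 + 1/\<delta>) * exp (\<delta> * (z \<bullet> z))"
      using linear exp_ge_add_one_self by (intro mult_left_mono) auto
    finally have "norm z * K \<le> (1 + 1/\<delta>) * exp (\<delta> * (z \<bullet> z)) * K"
      using K by (intro mult_right_mono) auto
    then show ?thesis using K(1)[of z] by (simp add: ac_simps)
  qed
  then show ?case by blast
next
  case (const c)
  have "\<bar>c\<bar> \<le> \<bar>c\<bar> * exp (\<delta> * (z \<bullet> z))" for z :: "real^'d"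
    using const by (simp add: mult_le_cancel_left1)
  then show ?case by blast
next
  case (add f g)
  then obtain C D where "\<forall>z. \<bar>f z\<bar> \<le> C * exp (\<delta> * (z \<bullet> z))" "\<forall>z. \<bar>g z\<bar> \<le> D * exp (\<delta> * (z \<bullet> z))"
    by blast
  then have "\<forall>z. \<bar>f z + g z\<bar> \<le> (C + D) * exp (\<delta> * (z \<bullet> z))"
    by (smt (verit, best) distrib_right)
  then show ?case by blast
next
  case (mult f g)
  then obtain C D where CD: "\<forall>z. \<bar>f z\<bar> \<le> C * exp (\<delta>/2 * (z \<bullet> z))" "\<forall>z. \<bar>g z\<bar> \<le> D * exp (\<delta>/2 * (z \<bullet> z))"
    by (meson half_gt_zero)
  have "\<bar>f z * g z\<bar> \<le> C * D * exp (\<delta> * (z \<bullet> z))" for z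
  proof -
    have "\<bar>f z * g z\<bar> \<le> (C * exp (\<delta>/2 * (z \<bullet> z))) * (D * exp (\<delta>/2 * (z \<bullet> z)))"
      unfolding abs_mult using CD by (intro mult_mono) (auto intro: order_trans[OF abs_ge_zero])
    also have "\<dots> = C * D * exp (\<delta> * (z \<bullet> z))"
      by (simp add: exp_add[symmetric] mult_ac)
    finally show ?thesis .
  qed
  then show ?case by blast
qed

lemma real_polynomial_function_partials:
  fixes p :: "real^'d::finite \<Rightarrow> real"
  assumes "real_polynomial_function p"
  shows "\<exists>q. (\<forall>i. real_polynomial_function (q i)) \<and> (\<forall>z. (p has_derivative (\<lambda>u. \<Sum>i\<in>UNIV. q i z * u $ i)) (at z))"
  using assms
proof induction
  case (linear f)
  have "f u = (\<Sum>i\<in>UNIV. f (axis i 1) * u $ i)" for u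
  proof -
    have l: "linear f" using linear by (rule bounded_linear.linear)
    have "f u = f (\<Sum>i\<in>UNIV. u $ i *\<^sub>R axis i 1)"
      using basis_expansion[of u] by (simp add: scalar_mult_eq_scaleR)
    then show ?thesis by (simp add: linear_sum[OF l] linear_cmul[OF l] mult.commute)
  qed
  then have "(f has_derivative (\<lambda>u. \<Sum>i\<in>UNIV. f (axis i 1) * u $ i)) (at z)" for z
    using bounded_linear_imp_has_derivative[OF linear] by (metis (no_types, lifting) ext)
  then show ?case by (intro exI[of _ "\<lambda>i z. f (axis i 1)"]) auto
next
  case (const c)
  then show ?case by (intro exI[of _ "\<lambda>i z. 0"]) auto
next
  case (add f g)
  then obtain q r where "\<forall>i. real_polynomial_function (q i)" "\<forall>z. (f has_derivative (\<lambda>u. \<Sum>i\<in>UNIV. q i z * u $ i)) (at z)"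
     "\<forall>i. real_polynomial_function (r i)" "\<forall>z. (g has_derivative (\<lambda>u. \<Sum>i\<in>UNIV. r i z * u $ i)) (at z)"
    by blast
  then show ?case
    by (intro exI[of _ "\<lambda>i z. q i z + r i z"])
      (auto intro!: derivative_eq_intros simp: sum.distrib distrib_right)
next
  case (mult f g)
  then obtain q r where *: "\<forall>i. real_polynomial_function (q i)" "\<forall>z. (f has_derivative (\<lambda>u. \<Sum>i\<in>UNIV. q i z * u $ i)) (at z)"
     "\<forall>i. real_polynomial_function (r i)" "\<forall>z. (g has_derivative (\<lambda>u. \<Sum>i\<in>UNIV. r i z * u $ i)) (at z)"
    by blast
  have "((\<lambda>x. f x * g x) has_derivative (\<lambda>u. \<Sum>i\<in>UNIV. (f z * r i z + q i z * g z) * u $ i)) (at z)" for z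
    using has_derivative_mult[OF *(2)[rule_format, of z] *(4)[rule_format, of z]]
    by (simp add: sum_distrib_left sum_distrib_right sum.distrib[symmetric] algebra_simps)
  then show ?case
    using * mult.hyps by (intro exI[of _ "\<lambda>i z. f z * r i z + q i z * g z"])
      (intro conjI allI real_polynomial_function.intros(3,4); blast)
qed

text \<open>Differentiating the exponential brings down the polynomial
  \<open>- 2 * c * (z $ i)\<close>, so only the polynomial factor changes.\<close>

lemma gpoly_partials:
  fixes p :: "real^'d::finite \<Rightarrow> real"
  assumes "real_polynomial_function p"
  obtains q where "\<And>i. real_polynomial_function (q i)"
    "\<And>z. (gpoly c p has_derivative (\<lambda>u. \<Sum>i\<in>UNIV. gpoly c (q i) z * u $ i)) (at z)"
proof -
  obtain r where r: "\<And>i. real_polynomial_function (r i)" "\<And>z. (p has_derivative (\<lambda>u. \<Sum>i\<in>UNIV. r i z * u $ i)) (at z)"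
    using real_polynomial_function_partials[OF assms] by blast
  define q where "q i z = r i z - 2 * c * (z $ i) * p z" for i z
  have "real_polynomial_function (\<lambda>z::real^'d. z $ i)" for i
    by (rule real_polynomial_function.intros(1)) (rule bounded_linear_vec_nth)
  then have "real_polynomial_function (q i)" for i
    unfolding q_def using r(1) assms by (intro real_polynomial_function_diff real_polynomial_function.intros(2-4))
  moreover have "(gpoly c p has_derivative (\<lambda>u. \<Sum>i\<in>UNIV. gpoly c (q i) z * u $ i)) (at z)" for z
  proof -
    have "((\<lambda>z. p z * exp (- c * (z \<bullet> z))) has_derivative (\<lambda>u. p z * (exp (- c * (z \<bullet> z)) * (- c * (z \<bullet> u + u \<bullet> z))) + (\<Sum>i\<in>UNIV. r i z * u $ i) * exp (- c * (z \<bullet> z)))) (at z)"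
      by (auto intro!: derivative_eq_intros r(2))
    moreover have "p z * (exp (- c * (z \<bullet> z)) * (- c * (z \<bullet> u + u \<bullet> z))) + (\<Sum>i\<in>UNIV. r i z * u $ i) * exp (- c * (z \<bullet> z))
       = (\<Sum>i\<in>UNIV. gpoly c (q i) z * u $ i)" for u
      by (simp add: gpoly_def q_def inner_commute[of u z] inner_vec_def[of z u] sum_distrib_left sum_distrib_right sum_subtractf[symmetric] sum.distrib[symmetric] sum_negf[symmetric] algebra_simps)
    ultimately show ?thesis unfolding gpoly_def[abs_def] by (simp add: gpoly_def)
  qed
  ultimately show ?thesis using that by blast
qed

text \<open>Half of the Gaussian decay absorbs the polynomial; the other half is left for
  integrability.\<close>

lemma gpoly_bound:
  fixes p :: "real^'d::finite \<Rightarrow> real"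
  assumes "real_polynomial_function p" "c > 0"
  shows "\<exists>C\<ge>0. \<forall>z. \<bar>gpoly c p z\<bar> \<le> C * exp (- (c/2) * (z \<bullet> z))"
proof -
  obtain C where C: "\<And>z. \<bar>p z\<bar> \<le> C * exp (c/2 * (z \<bullet> z))"
    using real_polynomial_function_bound[OF assms(1), of "c/2"] assms(2) by auto
  have "\<bar>gpoly c p z\<bar> \<le> \<bar>C\<bar> * exp (- (c/2) * (z \<bullet> z))" for z
  proof -
    have "\<bar>gpoly c p z\<bar> \<le> (C * exp (c/2 * (z \<bullet> z))) * exp (- c * (z \<bullet> z))"
      unfolding gpoly_def abs_mult using C[of z] by (intro mult_mono) auto
    also have "\<dots> = C * exp (- (c/2) * (z \<bullet> z))"
      by (simp add: mult.assoc exp_add[symmetric])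
    also have "\<dots> \<le> \<bar>C\<bar> * exp (- (c/2) * (z \<bullet> z))"
      by (intro mult_right_mono) auto
    finally show ?thesis .
  qed
  then show ?thesis by (intro exI[of _ "\<bar>C\<bar>"]) auto
qed

section \<open>Integrability and translation of Gaussian kernels\<close>

lemma gauss_density_eq_exp_quadratic:
  fixes z :: "real^'d::finite"
  assumes s: "s > 0"
  shows "gauss_density s z = (1 / sqrt (2 * pi * s\<^sup>2)) ^ CARD('d) * exp (- (1 / (2 * s\<^sup>2)) * (z \<bullet> z))"
proof -
  have "gauss_density s z = (\<Prod>i\<in>UNIV. (1 / sqrt (2 * pi * s\<^sup>2)) * exp (- (z $ i)\<^sup>2 / (2 * s\<^sup>2)))"
    by (simp add: gauss_density_def normal_density_def)
  also have "\<dots> = (1 / sqrt (2 * pi * s\<^sup>2)) ^ CARD('d) * (\<Prod>i\<in>UNIV. exp (- (z $ i)\<^sup>2 / (2 * s\<^sup>2)))"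
    by (subst prod.distrib) simp
  also have "(\<Prod>i\<in>UNIV. exp (- (z $ i)\<^sup>2 / (2 * s\<^sup>2))) = exp (\<Sum>i\<in>UNIV. - (z $ i)\<^sup>2 / (2 * s\<^sup>2))"
    by (simp add: exp_sum)
  also have "(\<Sum>i\<in>UNIV. - (z $ i)\<^sup>2 / (2 * s\<^sup>2)) = - (1 / (2 * s\<^sup>2)) * (z \<bullet> z)"
    by (simp add: inner_vec_def sum_divide_distrib power2_eq_square sum_negf)
  finally show ?thesis .
qed

lemma integrable_gauss_density:
  assumes "s > 0" shows "integrable lborel (gauss_density s :: real^'d::finite \<Rightarrow> real)"
proof -
  interpret prob_space "gauss s :: (real^'d) measure" using assms by (rule prob_space_gauss)
  have "integrable (gauss s) (\<lambda>_::real^'d. 1::real)" by simp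
  then show ?thesis unfolding gauss_def by (subst (asm) integrable_density) auto
qed

lemma integrable_exp_quadratic:
  assumes "c > 0" shows "integrable lborel (\<lambda>z::real^'d::finite. exp (- c * (z \<bullet> z)))"
proof -
  \<comment> \<open>The standard deviation for which the coefficient in the exponent of the Gaussian
    density is \<open>c\<close>.\<close>
  define s where "s = sqrt (1 / (2 * c))"
  have s: "s > 0" "1 / (2 * s\<^sup>2) = c" using assms by (auto simp: s_def)
  have K: "(1 / sqrt (2 * pi * s\<^sup>2)) ^ CARD('d) \<noteq> 0" using s by simp
  have "integrable lborel (\<lambda>z::real^'d. (1 / sqrt (2 * pi * s\<^sup>2)) ^ CARD('d) * exp (- c * (z \<bullet> z)))"
    using integrable_gauss_density[OF s(1), where 'd='d] unfolding gauss_density_eq_exp_quadratic[OF s(1)] s(2) by (simp add: eta_contract_eq)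
  from integrable_mult_right[OF this, of "inverse ((1 / sqrt (2 * pi * s\<^sup>2)) ^ CARD('d))"]
  show ?thesis by (simp only: mult.assoc[symmetric] left_inverse[OF K] mult_1_left)
qed

lemma integrable_lborel_translate:
  fixes g :: "'a::euclidean_space \<Rightarrow> real"
  assumes "integrable lborel g"
  shows "integrable lborel (\<lambda>y. g (y - x))" "(\<integral>y. g (y - x) \<partial>lborel) = (\<integral>y. g y \<partial>lborel)"
proof -
  have [measurable]: "g \<in> borel_measurable borel"
    using assms by (auto dest: borel_measurable_integrable)
  have e: "distr lborel borel ((+) (-x)) = (lborel :: 'a measure)"
    by (rule lborel_distr_plus)
  have "integrable (distr lborel borel ((+) (-x))) g" using assms by (simp add: e)
  then show "integrable lborel (\<lambda>y. g (y - x))"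
    by (subst (asm) integrable_distr_eq) (auto simp: add.commute)
  have "(\<integral>y. g y \<partial>lborel) = integral\<^sup>L (distr lborel borel ((+) (-x))) g" by (simp add: e)
  also have "\<dots> = (\<integral>y. g (y - x) \<partial>lborel)"
    by (subst integral_distr) (auto simp: add.commute)
  finally show "(\<integral>y. g (y - x) \<partial>lborel) = (\<integral>y. g y \<partial>lborel)" ..
qed

lemma continuous_on_gpoly:
  fixes p :: "real^'d::finite \<Rightarrow> real"
  assumes "real_polynomial_function p" shows "continuous_on UNIV (gpoly c p)"
  by (rule gpoly_partials[OF assms, of c])
    (auto intro!: continuous_at_imp_continuous_on dest: has_derivative_continuous)

text \<open>The variable \<open>x\<close> occurs in the kernel alone, so every derivative falls on
  the kernel and turns it into another kernel of the same class, while \<open>f\<close> is merely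
  bounded and measurable.\<close>

definition gconv :: "real \<Rightarrow> (real^'d::finite \<Rightarrow> real) \<Rightarrow> (real^'d \<Rightarrow> real) \<Rightarrow> real^'d \<Rightarrow> real" where
  "gconv c f p x = (\<integral>y. f y * gpoly c p (y - x) \<partial>lborel)"

context
  fixes f :: "real^'d::finite \<Rightarrow> real" and B c :: real
  assumes c: "c > 0" and fm [measurable]: "f \<in> borel_measurable borel" and fB: "\<And>y. \<bar>f y\<bar> \<le> B"
begin

lemma gpoly_measurable:
  fixes p :: "real^'d \<Rightarrow> real"
  assumes "real_polynomial_function p" shows "gpoly c p \<in> borel_measurable borel"
  using continuous_on_gpoly[OF assms] by (rule borel_measurable_continuous_onI)

lemma integrable_gpoly:
  fixes p :: "real^'d \<Rightarrow> real"
  assumes p: "real_polynomial_function p" shows "integrable lborel (gpoly c p)"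
proof -
  obtain C where C: "C \<ge> 0" "\<And>z. \<bar>gpoly c p z\<bar> \<le> C * exp (- (c/2) * (z \<bullet> z))"
    using gpoly_bound[OF p c] by auto
  have "integrable lborel (\<lambda>z::real^'d. C * exp (- (c/2) * (z \<bullet> z)))"
    using c by (intro integrable_mult_right integrable_exp_quadratic) simp
  moreover have "gpoly c p \<in> borel_measurable lborel"
    using gpoly_measurable[OF p] by simp
  moreover have "AE z in lborel. norm (gpoly c p z) \<le> norm (C * exp (- (c/2) * (z \<bullet> z)))"
    using C by (intro AE_I2) (simp only: real_norm_def abs_mult abs_exp_cancel abs_of_nonneg)
  ultimately show ?thesis
    by (rule Bochner_Integration.integrable_bound)
qed

lemma integrable_gconv:
  fixes p :: "real^'d \<Rightarrow> real"
  assumes p: "real_polynomial_function p"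
  shows "integrable lborel (\<lambda>y. f y * gpoly c p (y - x))"
proof (rule Bochner_Integration.integrable_bound)
  show "integrable lborel (\<lambda>y. B * gpoly c p (y - x))"
    by (intro integrable_mult_right integrable_lborel_translate(1) integrable_gpoly[OF p])
  have [measurable]: "gpoly c p \<in> borel_measurable borel" by (rule gpoly_measurable[OF p])
  show "(\<lambda>y. f y * gpoly c p (y - x)) \<in> borel_measurable lborel" by measurable
  show "AE y in lborel. norm (f y * gpoly c p (y - x)) \<le> norm (B * gpoly c p (y - x))"
    unfolding real_norm_def abs_mult
    by (intro AE_I2 mult_right_mono order_trans[OF fB abs_ge_self] abs_ge_zero)
qed

lemma gconv_bounded:
  fixes p :: "real^'d \<Rightarrow> real"
  assumes p: "real_polynomial_function p"
  shows "\<bar>gconv c f p x\<bar> \<le> B * (\<integral>z. \<bar>gpoly c p z\<bar> \<partial>lborel)"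
proof -
  have i: "integrable lborel (\<lambda>z. \<bar>gpoly c p z\<bar>)" using integrable_gpoly[OF p] by simp
  have "\<bar>gconv c f p x\<bar> \<le> (\<integral>y. \<bar>f y * gpoly c p (y - x)\<bar> \<partial>lborel)"
    unfolding gconv_def by (rule integral_abs_bound)
  also have "\<dots> \<le> (\<integral>y. B * \<bar>gpoly c p (y - x)\<bar> \<partial>lborel)"
    using integrable_abs[OF integrable_gconv[OF p]] integrable_lborel_translate(1)[OF i] fB
    by (intro integral_mono) (auto simp: abs_mult intro!: mult_right_mono)
  also have "\<dots> = B * (\<integral>z. \<bar>gpoly c p z\<bar> \<partial>lborel)"
    using integrable_lborel_translate(2)[OF i] by simp
  finally show ?thesis .
qed

lemma gconv_has_derivative:
  fixes p :: "real^'d \<Rightarrow> real"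
  assumes p: "real_polynomial_function p"
  obtains q where "\<And>i. real_polynomial_function (q i)"
    "\<And>x. (gconv c f p has_derivative (\<lambda>u. \<Sum>i\<in>UNIV. gconv c f (q i) x * u $ i)) (at x)"
proof -
  obtain r where r: "\<And>i. real_polynomial_function (r i)"
    "\<And>z. (gpoly c p has_derivative (\<lambda>u. \<Sum>i\<in>UNIV. gpoly c (r i) z * u $ i)) (at z)"
    using gpoly_partials[OF p, of c] by blast
  have "\<forall>i. \<exists>C\<ge>0. \<forall>z. \<bar>gpoly c (r i) z\<bar> \<le> C * exp (- (c/2) * (z \<bullet> z))"
    using gpoly_bound[OF r(1) c] by blast
  then obtain C where C: "\<And>i. C i \<ge> 0" "\<And>i z. \<bar>gpoly c (r i) z\<bar> \<le> C i * exp (- (c/2) * (z \<bullet> z))"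
    by metis
  define K where "K = (\<Sum>i\<in>UNIV. C i)"
  have K0: "K \<ge> 0" unfolding K_def using C(1) by (intro sum_nonneg) auto
  have Db: "\<bar>\<Sum>i\<in>UNIV. gpoly c (r i) z * u $ i\<bar> \<le> K * exp (- (c/2) * (z \<bullet> z)) * norm u" for z u
  proof -
    have "\<bar>\<Sum>i\<in>UNIV. gpoly c (r i) z * u $ i\<bar> \<le> (\<Sum>i\<in>UNIV. \<bar>gpoly c (r i) z\<bar> * \<bar>u $ i\<bar>)"
      by (rule order_trans[OF sum_abs]) (simp add: abs_mult)
    also have "\<dots> \<le> (\<Sum>i\<in>UNIV. (C i * exp (- (c/2) * (z \<bullet> z))) * norm u)"
      using C component_le_norm_cart[of u] by (intro sum_mono mult_mono) auto
    finally show ?thesis by (simp add: K_def sum_distrib_right)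
  qed
  \<comment> \<open>If \<open>w\<close> is within distance \<open>1\<close> of \<open>z\<close>,
    then |z|^2 \<le> 2 |w|^2 + 2. A bound at \<open>w\<close> becomes one at \<open>z\<close> with
    half the exponent and the factor \<open>exp (c/2)\<close>, which yields a dominating function
    uniform over nearby points.\<close>
  have Db1: "\<bar>\<Sum>i\<in>UNIV. gpoly c (r i) w * u $ i\<bar> \<le> K * exp (c/2) * exp (- (c/4) * (z \<bullet> z)) * norm u"
    if "norm (w - z) \<le> 1" for w z u
  proof -
    have "norm z \<le> norm w + 1" using that norm_triangle_ineq2[of z w] by (simp add: norm_minus_commute)
    then have "(norm z)\<^sup>2 \<le> (norm w + 1)\<^sup>2" by (intro power_mono) auto
    also have "\<dots> \<le> 2 * (norm w)\<^sup>2 + 2" using sum_power2_ge_zero[of "norm w - 1" 0] by (simp add: power2_eq_square algebra_simps)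
    finally have "z \<bullet> z \<le> 2 * (w \<bullet> w) + 2" by (simp add: power2_norm_eq_inner)
    then have "c * (z \<bullet> z) \<le> c * (2 * (w \<bullet> w) + 2)" using c by (intro mult_left_mono) auto
    then have "- (c/2) * (w \<bullet> w) \<le> c/2 + - (c/4) * (z \<bullet> z)" by (simp add: distrib_left)
    then have "exp (- (c/2) * (w \<bullet> w)) \<le> exp (c/2) * exp (- (c/4) * (z \<bullet> z))" by (simp only: exp_add[symmetric] exp_le_cancel_iff)
    then have "K * exp (- (c/2) * (w \<bullet> w)) * norm u \<le> K * (exp (c/2) * exp (- (c/4) * (z \<bullet> z))) * norm u"
      using K0 by (intro mult_right_mono mult_left_mono) auto
    then show ?thesis using Db[of w u] by (simp add: mult.assoc)
  qed
  have lip: "\<bar>gpoly c p w - gpoly c p z\<bar> \<le> K * exp (c/2) * exp (- (c/4) * (z \<bullet> z)) * norm (w - z)"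
    if "norm (w - z) \<le> 1" for w z
  proof -
    have "norm (gpoly c p w - gpoly c p z) \<le> (K * exp (c/2) * exp (- (c/4) * (z \<bullet> z))) * norm (w - z)"
    proof (rule differentiable_bound[of "cball z 1"])
      fix v assume "v \<in> cball z 1"
      then have v: "norm (v - z) \<le> 1" by (simp add: dist_norm norm_minus_commute)
      show "(gpoly c p has_derivative (\<lambda>u. \<Sum>i\<in>UNIV. gpoly c (r i) v * u $ i)) (at v within cball z 1)"
        using r(2) by (rule has_derivative_at_withinI)
      show "onorm (\<lambda>u. \<Sum>i\<in>UNIV. gpoly c (r i) v * u $ i) \<le> K * exp (c/2) * exp (- (c/4) * (z \<bullet> z))"
        using Db1[OF v] by (intro onorm_le) auto
    qed (use that in \<open>auto simp: dist_norm norm_minus_commute\<close>)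
    then show ?thesis by simp
  qed
  define w where "w x y = B * (K * exp (c/2)) * exp (- (c/4) * ((y - x) \<bullet> (y - x)))" for x y :: "real^'d"
  have B0: "B \<ge> 0" using fB[of undefined] by linarith
  have int: "integrable lborel (w x)" for x
    unfolding w_def using integrable_lborel_translate(1)[OF integrable_exp_quadratic[of "c/4"]] c by (intro integrable_mult_right) auto
  have der: "(gconv c f p has_derivative (\<lambda>u. \<integral>y. - (f y * (\<Sum>i\<in>UNIV. gpoly c (r i) (y - x) * u $ i)) \<partial>lborel)) (at x)" for x
    unfolding gconv_def[abs_def]
  proof (rule has_derivative_integral_dominated[where w="w x"])
    show "integrable lborel (\<lambda>y. f y * gpoly c p (y - x))" for x by (rule integrable_gconv[OF p])
    show "((\<lambda>x. f y * gpoly c p (y - x)) has_derivative (\<lambda>u. - (f y * (\<Sum>i\<in>UNIV. gpoly c (r i) (y - x) * u $ i)))) (at x)" for y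
    proof -
      have "((\<lambda>x. gpoly c p (y - x)) has_derivative (\<lambda>u. \<Sum>i\<in>UNIV. gpoly c (r i) (y - x) * (- u) $ i)) (at x)"
        by (rule has_derivative_compose[OF _ r(2)]) (auto intro!: derivative_eq_intros)
      from has_derivative_mult_right[OF this, of "f y"] show ?thesis
        by (simp add: sum_negf)
    qed
    fix x' y u
    show "\<bar>f y * gpoly c p (y - x') - f y * gpoly c p (y - x)\<bar> \<le> w x y * norm (x' - x)" if "norm (x' - x) \<le> 1"
    proof -
      have "\<bar>f y * gpoly c p (y - x') - f y * gpoly c p (y - x)\<bar> = \<bar>f y\<bar> * \<bar>gpoly c p (y - x') - gpoly c p (y - x)\<bar>"
        by (simp add: abs_mult right_diff_distrib[symmetric])
      also have "\<dots> \<le> B * (K * exp (c/2) * exp (- (c/4) * ((y - x) \<bullet> (y - x))) * norm (x' - x))"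
        using lip[of "y - x'" "y - x"] that fB B0 by (intro mult_mono) (auto simp: norm_minus_commute)
      finally show ?thesis by (simp add: w_def mult.assoc)
    qed
    show "\<bar>- (f y * (\<Sum>i\<in>UNIV. gpoly c (r i) (y - x) * u $ i))\<bar> \<le> w x y * norm u"
    proof -
      have "\<bar>f y\<bar> * \<bar>\<Sum>i\<in>UNIV. gpoly c (r i) (y - x) * u $ i\<bar> \<le> B * (K * exp (c/2) * exp (- (c/4) * ((y - x) \<bullet> (y - x))) * norm u)"
        using Db1[of "y - x" "y - x" u] fB B0 by (intro mult_mono) auto
      then show ?thesis by (simp add: w_def abs_mult mult.assoc)
    qed
  next
    fix u
    show "(\<lambda>y. - (f y * (\<Sum>i\<in>UNIV. gpoly c (r i) (y - x) * u $ i))) \<in> borel_measurable lborel"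
      using gpoly_measurable[OF r(1)] by measurable
  qed (rule int)
  \<comment> \<open>The minus sign of the inner derivative of \<open>y - x\<close> is moved into the
    polynomials.\<close>
  have val: "(\<integral>y. - (f y * (\<Sum>i\<in>UNIV. gpoly c (r i) (y - x) * u $ i)) \<partial>lborel) = (\<Sum>i\<in>UNIV. gconv c f (\<lambda>z. - r i z) x * u $ i)" for x u
  proof -
    have "(\<integral>y. - (f y * (\<Sum>i\<in>UNIV. gpoly c (r i) (y - x) * u $ i)) \<partial>lborel)
      = (\<integral>y. (\<Sum>i\<in>UNIV. f y * gpoly c (\<lambda>z. - r i z) (y - x) * u $ i) \<partial>lborel)"
      by (intro Bochner_Integration.integral_cong) (simp_all add: gpoly_def sum_distrib_left sum_negf mult_ac)
    also have "\<dots> = (\<Sum>i\<in>UNIV. gconv c f (\<lambda>z. - r i z) x * u $ i)"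
      unfolding gconv_def using integrable_gconv[OF real_polynomial_function_minus[OF r(1)]]
      by (subst Bochner_Integration.integral_sum) auto
    finally show ?thesis .
  qed
  show ?thesis
  proof (rule that[of "\<lambda>i z. - r i z"])
    show "real_polynomial_function (\<lambda>z. - r i z)" for i
      using r(1) by (rule real_polynomial_function_minus)
    show "(gconv c f p has_derivative (\<lambda>u. \<Sum>i\<in>UNIV. gconv c f (\<lambda>z. - r i z) x * u $ i)) (at x)" for x
      using der[of x] by (simp only: val)
  qed
qed

lemma partials_gconv:
  fixes p :: "real^'d \<Rightarrow> real"
  assumes "real_polynomial_function p"
  shows "\<exists>q. real_polynomial_function q \<and> partials I (gconv c f p) = gconv c f q"
proof (induction I)
  case Nil then show ?case using assms by auto
next
  case (Cons i I)
  then obtain q where q: "real_polynomial_function q" "partials I (gconv c f p) = gconv c f q" by blast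
  obtain r where r: "\<And>i. real_polynomial_function (r i)"
    "\<And>x. (gconv c f q has_derivative (\<lambda>u. \<Sum>i\<in>UNIV. gconv c f (r i) x * u $ i)) (at x)"
    using gconv_has_derivative[OF q(1)] by blast
  have "gradient (gconv c f q) x $ i = gconv c f (r i) x" for x
    using gradient_eqI[OF r(2), of x i] by (simp add: axis_def if_distrib[of "(*) _"] cong: if_cong)
  then have "partials (i # I) (gconv c f p) = gconv c f (r i)" using q(2) by auto
  then show ?case using r(1) by blast
qed

lemma gconv_Cb_infty:
  fixes p :: "real^'d \<Rightarrow> real"
  assumes p: "real_polynomial_function p"
  shows "gconv c f p \<in> Cb_infty"
  unfolding Cb_infty_def
proof (intro CollectI conjI allI impI)
  show "smooth (gconv c f p)"
    unfolding smooth_def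
  proof (intro allI)
    fix I x
    obtain q where q: "real_polynomial_function q" "partials I (gconv c f p) = gconv c f q"
      using partials_gconv[OF p] by blast
    show "partials I (gconv c f p) differentiable (at x)"
      unfolding q(2) by (rule gconv_has_derivative[OF q(1)]) (auto simp: differentiable_def)
  qed
  fix k :: nat
  have "\<exists>C. \<forall>x. \<bar>partials I (gconv c f p) x\<bar> \<le> C" for I
    using partials_gconv[OF p, of I] gconv_bounded by metis
  then obtain C where C: "\<And>I x. \<bar>partials I (gconv c f p) x\<bar> \<le> C I" by metis
  have "nabla_norm k (gconv c f p) x \<le> (\<Sum>I\<in>{I. length I = k}. C I)" for x
    unfolding nabla_norm_def
    by (rule order_trans[OF L2_set_le_sum_abs]) (intro sum_mono C)
  then show "\<exists>C. \<forall>x. nabla_norm k (gconv c f p) x \<le> C" by blast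
qed

end

lemma gauss_mollify_Cb_infty:
  fixes f :: "real^'d::finite \<Rightarrow> real"
  assumes s: "s > 0" and fm [measurable]: "f \<in> borel_measurable borel" and fB: "\<And>y. \<bar>f y\<bar> \<le> B"
  shows "(\<lambda>x. \<integral>z. f (x + z) \<partial>gauss s) \<in> Cb_infty"
proof -
  \<comment> \<open>The Gaussian density is the kernel whose polynomial factor is the constant
    \<open>?K\<close>, its normalisation.\<close>
  let ?c = "1 / (2 * s\<^sup>2)" and ?K = "(1 / sqrt (2 * pi * s\<^sup>2)) ^ CARD('d)"
  have c: "?c > 0" using s by simp
  have eq: "(\<integral>z. f (x + z) \<partial>gauss s) = gconv ?c f (\<lambda>_. ?K) x" for x
  proof -
    have 1: "gauss_density s z = gpoly ?c (\<lambda>_. ?K) z" for z :: "real^'d"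
      unfolding gpoly_def by (rule gauss_density_eq_exp_quadratic[OF s])
    have "(\<integral>z. f (x + z) \<partial>gauss s) = (\<integral>z. gauss_density s z * f (x + z) \<partial>lborel)"
      unfolding gauss_def by (subst integral_density) auto
    also have "\<dots> = (\<integral>z. f (x + z) * gauss_density s ((x + z) - x) \<partial>lborel)"
      by (simp add: mult.commute)
    also have "\<dots> = (\<integral>y. f y * gauss_density s (y - x) \<partial>distr lborel borel ((+) x))"
      by (subst integral_distr) auto
    also have "distr lborel borel ((+) x) = (lborel :: (real^'d) measure)"
      by (rule lborel_distr_plus)
    finally show ?thesis unfolding gconv_def 1 .
  qed
  have "gconv ?c f (\<lambda>_. ?K) \<in> Cb_infty"
    by (rule gconv_Cb_infty[OF c fm fB]) (rule real_polynomial_function.intros(2))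
  then show ?thesis unfolding eq[abs_def] by simp
qed

section \<open>Logarithmic Sobolev inequalities for slope bounds\<close>

text \<open>\<open>H x\<close> dominates the upper limit of the difference quotients at
  \<open>x\<close>. The product form makes the point \<open>y = x\<close> harmless, and
  \<open>e\<close> expresses the upper limit.\<close>

definition slope_bound :: "('a::real_normed_vector \<Rightarrow> real) \<Rightarrow> ('a \<Rightarrow> real) \<Rightarrow> bool" where
  "slope_bound f H \<longleftrightarrow> (\<forall>x. \<forall>e>0. \<forall>\<^sub>F y in nhds x. \<bar>f y - f x\<bar> \<le> (H x + e) * norm (y - x))"

definition lip :: "real \<Rightarrow> ('a::real_normed_vector \<Rightarrow> 'b::real_normed_vector) \<Rightarrow> bool" where
  "lip L f \<longleftrightarrow> (\<forall>x y. norm (f x - f y) \<le> L * norm (x - y))"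

text \<open>The bounds on \<open>f\<close> and \<open>H\<close> dominate the integrands in all later
  limits, \<open>c\<close> keeps the logarithm and \<open>H\<^sup>2 / f\<close> under control, and
  Lipschitz continuity of \<open>H\<close> makes that quotient continuous.\<close>

definition admissible :: "('a::real_normed_vector \<Rightarrow> real) \<Rightarrow> ('a \<Rightarrow> real) \<Rightarrow> bool" where
  "admissible f H \<longleftrightarrow> slope_bound f H \<and> (\<forall>x. 0 \<le> H x) \<and>
     (\<exists>L c B. 0 < c \<and> (\<forall>x. c \<le> f x \<and> f x \<le> B) \<and> (\<forall>x. H x \<le> B) \<and> lip L f \<and> lip L H)"

definition ent :: "'a measure \<Rightarrow> ('a \<Rightarrow> real) \<Rightarrow> real" where
  "ent \<nu> f = (\<integral>x. f x * ln (f x) \<partial>\<nu>) - (\<integral>x. f x \<partial>\<nu>) * ln (\<integral>x. f x \<partial>\<nu>)"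

text \<open>The normalisation matches the theorem: if \<open>H\<close> is the norm of the gradient,
  the right-hand side is \<open>2 * C\<close> times the integral of |grad (sqrt f)|^2, so
  \<open>C\<close> corresponds to \<open>L\<^sub>0\<close>.\<close>

definition LSI :: "'a::real_normed_vector measure \<Rightarrow> real \<Rightarrow> bool" where
  "LSI \<nu> C \<longleftrightarrow> (\<forall>f H. admissible f H \<longrightarrow> ent \<nu> f \<le> C / 2 * (\<integral>x. (H x)\<^sup>2 / f x \<partial>\<nu>))"

section \<open>Lipschitz functions, limits and images of the inequality\<close>

lemma lip_nonneg:
  assumes "lip L (f :: 'a::euclidean_space \<Rightarrow> _)" shows "0 \<le> L"
proof -
  obtain b :: 'a where b: "b \<in> Basis" using nonempty_Basis by blast
  have "0 \<le> norm (f b - f 0)" by simp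
  also have "\<dots> \<le> L * norm (b - 0)" using assms unfolding lip_def by blast
  finally show ?thesis using b by simp
qed

lemma lip_continuous:
  assumes "lip L (f :: 'a::euclidean_space \<Rightarrow> _)" shows "continuous_on UNIV f"
proof (rule lipschitz_on_continuous_on)
  show "L-lipschitz_on UNIV f"
    using assms lip_nonneg[OF assms] unfolding lip_def by (intro lipschitz_onI) (auto simp: dist_norm)
qed

lemma lip_measurable:
  assumes "lip L (f :: 'a::euclidean_space \<Rightarrow> _)" shows "f \<in> borel_measurable borel"
  using lip_continuous[OF assms] by (rule borel_measurable_continuous_onI)

lemma lip_mono: "lip L f \<Longrightarrow> L \<le> L' \<Longrightarrow> lip L' f"
  unfolding lip_def by (meson mult_right_mono norm_ge_zero order_trans)

lemma admissibleE:
  fixes f :: "'a::euclidean_space \<Rightarrow> real"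
  assumes "admissible f H"
  obtains L c B where "slope_bound f H" "\<And>x. 0 \<le> H x" "0 < c" "\<And>x. c \<le> f x" "\<And>x. f x \<le> B" "\<And>x. H x \<le> B"
    "lip L f" "lip L H" "f \<in> borel_measurable borel" "H \<in> borel_measurable borel"
  using assms lip_measurable unfolding admissible_def by blast

lemma mult_ln_bounded:
  assumes "0 < c" "c \<le> x" "x \<le> (B::real)"
  shows "\<bar>x * ln x\<bar> \<le> B * (\<bar>ln c\<bar> + \<bar>ln B\<bar>)"
proof -
  have "ln c \<le> ln x" "ln x \<le> ln B" using assms by auto
  then have "\<bar>ln x\<bar> \<le> \<bar>ln c\<bar> + \<bar>ln B\<bar>" by linarith
  then show ?thesis using assms unfolding abs_mult by (intro mult_mono) auto
qed

text \<open>The lower bound \<open>c\<close> carries over to the integral of the limit, where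
  \<open>ln\<close> is therefore continuous; the rest is dominated convergence.\<close>

lemma tendsto_ent:
  assumes "prob_space M" and c: "0 < c"
    and f: "\<And>n x. x \<in> space M \<Longrightarrow> c \<le> f n x" "\<And>n x. x \<in> space M \<Longrightarrow> f n x \<le> B"
    and [measurable]: "\<And>n. f n \<in> borel_measurable M" "g \<in> borel_measurable M"
    and lim: "AE x in M. (\<lambda>n. f n x) \<longlonglongrightarrow> g x"
  shows "(\<lambda>n. ent M (f n)) \<longlonglongrightarrow> ent M g"
proof -
  interpret prob_space M by fact
  have g: "AE x in M. c \<le> g x \<and> g x \<le> B"
    using lim AE_space
  proof eventually_elim
    case (elim x)
    then show ?case using f[of x] by (meson LIMSEQ_le_const LIMSEQ_le_const2)
  qed
  have 1: "(\<lambda>n. \<integral>x. f n x \<partial>M) \<longlonglongrightarrow> (\<integral>x. g x \<partial>M)"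
    by (rule integral_dominated_convergence[where w="\<lambda>_. B"])
      (use f c lim in \<open>auto intro!: AE_I2 simp: abs_of_nonneg order_trans[OF less_imp_le[OF c]]\<close>)
  have 2: "(\<lambda>n. \<integral>x. f n x * ln (f n x) \<partial>M) \<longlonglongrightarrow> (\<integral>x. g x * ln (g x) \<partial>M)"
  proof (rule integral_dominated_convergence[where w="\<lambda>_. B * (\<bar>ln c\<bar> + \<bar>ln B\<bar>)"])
    show "AE x in M. (\<lambda>n. f n x * ln (f n x)) \<longlonglongrightarrow> g x * ln (g x)"
      using lim g by eventually_elim (use c in \<open>auto intro!: tendsto_intros\<close>)
    show "AE x in M. norm (f n x * ln (f n x)) \<le> B * (\<bar>ln c\<bar> + \<bar>ln B\<bar>)" for n
      unfolding real_norm_def using mult_ln_bounded[OF c f(1) f(2)] by (intro AE_I2) blast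
  qed auto
  have gi: "integrable M g"
    using g c by (intro integrable_const_bound[where B=B]) auto
  have "c = (\<integral>x. c \<partial>M)" by (simp add: prob_space)
  also have "\<dots> \<le> (\<integral>x. g x \<partial>M)"
    using g gi by (intro integral_mono_AE) auto
  finally have pos: "(\<integral>x. g x \<partial>M) > 0" using c by simp
  show ?thesis unfolding ent_def using 1 2 pos by (intro tendsto_intros) auto
qed

lemma ent_distr:
  assumes "X \<in> measurable M N" "f \<in> borel_measurable N"
  shows "ent (distr M N X) f = ent M (\<lambda>\<omega>. f (X \<omega>))"
  using assms by (simp add: ent_def integral_distr)

text \<open>All variables live on one probability space, so dominated convergence takes the place of
  weak convergence. This is where continuity of \<open>H\<close> enters.\<close>

lemma LSI_distr_limit:
  fixes X :: "'w \<Rightarrow> 'a::euclidean_space"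
  assumes M: "prob_space M" and [measurable]: "\<And>n. X' n \<in> borel_measurable M" "X \<in> borel_measurable M"
    and lim: "AE \<omega> in M. (\<lambda>n. X' n \<omega>) \<longlonglongrightarrow> X \<omega>"
    and LSI: "\<And>n. LSI (distr M borel (X' n)) (C' n)" and C: "C' \<longlonglongrightarrow> C"
  shows "LSI (distr M borel X) C"
  unfolding LSI_def
proof (intro allI impI)
  interpret prob_space M by fact
  fix f H assume fH: "admissible (f :: 'a \<Rightarrow> real) H"
  obtain L c B where A: "slope_bound f H" "\<And>x. 0 \<le> H x" "0 < c" "\<And>x. c \<le> f x" "\<And>x. f x \<le> B" "\<And>x. H x \<le> B"
    "lip L f" "lip L H" and [measurable]: "f \<in> borel_measurable borel" "H \<in> borel_measurable borel"
    using admissibleE[OF fH] by metis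
  have f0: "f x > 0" for x using A(3) A(4)[of x] by linarith
  have cont: "isCont f x" "isCont H x" for x
    using lip_continuous[OF A(7)] lip_continuous[OF A(8)] by (auto simp: continuous_on_eq_continuous_at)
  have l1: "(\<lambda>n. ent M (\<lambda>\<omega>. f (X' n \<omega>))) \<longlonglongrightarrow> ent M (\<lambda>\<omega>. f (X \<omega>))"
  proof (rule tendsto_ent[OF M A(3)])
    show "AE \<omega> in M. (\<lambda>n. f (X' n \<omega>)) \<longlonglongrightarrow> f (X \<omega>)"
      using lim by eventually_elim (rule isCont_tendsto_compose[OF cont(1)])
  qed (use A in auto)
  have l2: "(\<lambda>n. \<integral>\<omega>. (H (X' n \<omega>))\<^sup>2 / f (X' n \<omega>) \<partial>M) \<longlonglongrightarrow> (\<integral>\<omega>. (H (X \<omega>))\<^sup>2 / f (X \<omega>) \<partial>M)"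
  proof (rule integral_dominated_convergence[where w="\<lambda>_. B\<^sup>2 / c"])
    show "AE \<omega> in M. (\<lambda>n. (H (X' n \<omega>))\<^sup>2 / f (X' n \<omega>)) \<longlonglongrightarrow> (H (X \<omega>))\<^sup>2 / f (X \<omega>)"
      using lim by eventually_elim
        (intro tendsto_intros isCont_tendsto_compose[OF cont(1)] isCont_tendsto_compose[OF cont(2)], use f0 in \<open>auto simp: less_imp_neq[symmetric]\<close>)
    show "AE \<omega> in M. norm ((H (X' n \<omega>))\<^sup>2 / f (X' n \<omega>)) \<le> B\<^sup>2 / c" for n
    proof (rule AE_I2)
      fix \<omega>
      have "(H (X' n \<omega>))\<^sup>2 / f (X' n \<omega>) \<le> B\<^sup>2 / c"
        using A by (intro frac_le power_mono) auto
      then show "norm ((H (X' n \<omega>))\<^sup>2 / f (X' n \<omega>)) \<le> B\<^sup>2 / c"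
        using f0[of "X' n \<omega>"] by simp
    qed
  qed auto
  have "ent M (\<lambda>\<omega>. f (X \<omega>)) \<le> C / 2 * (\<integral>\<omega>. (H (X \<omega>))\<^sup>2 / f (X \<omega>) \<partial>M)"
  proof (rule LIMSEQ_le[OF l1])
    show "(\<lambda>n. C' n / 2 * (\<integral>\<omega>. (H (X' n \<omega>))\<^sup>2 / f (X' n \<omega>) \<partial>M)) \<longlonglongrightarrow> C / 2 * (\<integral>\<omega>. (H (X \<omega>))\<^sup>2 / f (X \<omega>) \<partial>M)"
      using C l2 by (intro tendsto_intros) auto
    have "ent M (\<lambda>\<omega>. f (X' n \<omega>)) \<le> C' n / 2 * (\<integral>\<omega>. (H (X' n \<omega>))\<^sup>2 / f (X' n \<omega>) \<partial>M)" for n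
    proof -
      have "ent (distr M borel (X' n)) f \<le> C' n / 2 * (\<integral>x. (H x)\<^sup>2 / f x \<partial>distr M borel (X' n))"
        using LSI[of n] fH unfolding LSI_def by blast
      then show ?thesis by (subst (asm) ent_distr, simp, simp) (subst (asm) integral_distr, simp_all)
    qed
    then show "\<exists>N. \<forall>n\<ge>N. ent M (\<lambda>\<omega>. f (X' n \<omega>)) \<le> C' n / 2 * (\<integral>\<omega>. (H (X' n \<omega>))\<^sup>2 / f (X' n \<omega>) \<partial>M)"
      by blast
  qed
  then show "ent (distr M borel X) f \<le> C / 2 * (\<integral>x. (H x)\<^sup>2 / f x \<partial>distr M borel X)"
    by (simp add: ent_distr integral_distr)
qed

lemma admissible_compose_lip:
  fixes R :: "'a::euclidean_space \<Rightarrow> 'b::euclidean_space"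
  assumes "admissible f H" and R: "lip K R"
  shows "admissible (\<lambda>x. f (R x)) (\<lambda>x. K * H (R x))"
proof -
  obtain L c B where A: "slope_bound f H" "\<And>x. 0 \<le> H x" "0 < c" "\<And>x. c \<le> f x" "\<And>x. f x \<le> B" "\<And>x. H x \<le> B"
    "lip L f" "lip L H"
    using admissibleE[OF assms(1)] by metis
  have K: "0 \<le> K" by (rule lip_nonneg[OF R])
  have L: "0 \<le> L" by (rule lip_nonneg[OF A(7)])
  have "slope_bound (\<lambda>x. f (R x)) (\<lambda>x. K * H (R x))"
    unfolding slope_bound_def
  proof (intro allI impI)
    fix x and e :: real assume e: "e > 0"
    \<comment> \<open>Dividing by \<open>K + 1\<close> instead of \<open>K\<close> also covers
      \<open>K = 0\<close>.\<close>
    define e' where "e' = e / (K + 1)"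
    have e': "e' > 0" "K * e' \<le> e" using e K by (auto simp: e'_def field_simps)
    have "\<forall>\<^sub>F y in nhds (R x). \<bar>f y - f (R x)\<bar> \<le> (H (R x) + e') * norm (y - R x)"
      using A(1) e'(1) unfolding slope_bound_def by blast
    moreover have "filterlim R (nhds (R x)) (nhds x)"
      using lip_continuous[OF R] by (simp add: continuous_on_eq_continuous_at isCont_def tendsto_at_iff_tendsto_nhds)
    ultimately have "\<forall>\<^sub>F y in nhds x. \<bar>f (R y) - f (R x)\<bar> \<le> (H (R x) + e') * norm (R y - R x)"
      by (rule eventually_compose_filterlim)
    then show "\<forall>\<^sub>F y in nhds x. \<bar>f (R y) - f (R x)\<bar> \<le> (K * H (R x) + e) * norm (y - x)"
    proof eventually_elim
      case (elim y)
      also have "(H (R x) + e') * norm (R y - R x) \<le> (H (R x) + e') * (K * norm (y - x))"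
        using R A(2)[of "R x"] e' unfolding lip_def by (intro mult_left_mono) auto
      also have "\<dots> = (K * H (R x) + K * e') * norm (y - x)"
        by (simp add: algebra_simps)
      also have "\<dots> \<le> (K * H (R x) + e) * norm (y - x)"
        using e' by (intro mult_right_mono) auto
      finally show ?case .
    qed
  qed
  moreover have "lip (L * K) (\<lambda>x. f (R x))"
    unfolding lip_def
  proof (intro allI)
    fix x y
    have "norm (f (R x) - f (R y)) \<le> L * norm (R x - R y)" using A(7) unfolding lip_def by blast
    also have "\<dots> \<le> L * (K * norm (x - y))" using R L unfolding lip_def by (intro mult_left_mono) auto
    finally show "norm (f (R x) - f (R y)) \<le> L * K * norm (x - y)" by (simp add: mult.assoc)
  qed
  moreover have "lip (K * (L * K)) (\<lambda>x. K * H (R x))"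
    unfolding lip_def
  proof (intro allI)
    fix x y
    have "norm (H (R x) - H (R y)) \<le> L * norm (R x - R y)" using A(8) unfolding lip_def by blast
    also have "\<dots> \<le> L * (K * norm (x - y))" using R L unfolding lip_def by (intro mult_left_mono) auto
    finally have "K * norm (H (R x) - H (R y)) \<le> K * (L * (K * norm (x - y)))" using K by (rule mult_left_mono)
    then show "norm (K * H (R x) - K * H (R y)) \<le> K * (L * K) * norm (x - y)"
      using K by (simp add: mult.assoc right_diff_distrib[symmetric] abs_mult)
  qed
  ultimately show ?thesis
    unfolding admissible_def
  proof (intro conjI)
    show "\<exists>L c B. 0 < c \<and> (\<forall>x. c \<le> f (R x) \<and> f (R x) \<le> B) \<and> (\<forall>x. K * H (R x) \<le> B) \<and> lip L (\<lambda>x. f (R x)) \<and> lip L (\<lambda>x. K * H (R x))"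
    proof (intro exI conjI allI)
      show "0 < c" "c \<le> f (R x)" for x using A by auto
      show "f (R x) \<le> max B (K * B)" for x using A(5)[of "R x"] by auto
      show "K * H (R x) \<le> max B (K * B)" for x using mult_left_mono[OF A(6)[of "R x"] K] by auto
      show "lip (max (L * K) (K * (L * K))) (\<lambda>x. f (R x))" "lip (max (L * K) (K * (L * K))) (\<lambda>x. K * H (R x))"
        using \<open>lip (L * K) _\<close> \<open>lip (K * (L * K)) _\<close> by (auto intro: lip_mono)
    qed
  qed (use A K in auto)
qed

text \<open>The composition has the slope bound \<open>K * H\<close>, and the slope bound enters
  squared.\<close>

lemma LSI_distr_lip:
  fixes R :: "'a::euclidean_space \<Rightarrow> 'b::euclidean_space"
  assumes "LSI \<nu> C" and sets: "sets \<nu> = sets borel" and R: "lip K R"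
  shows "LSI (distr \<nu> borel R) (K\<^sup>2 * C)"
  unfolding LSI_def
proof (intro allI impI)
  fix f H assume fH: "admissible (f :: 'b \<Rightarrow> real) H"
  then have [measurable]: "f \<in> borel_measurable borel" "H \<in> borel_measurable borel"
    by (auto elim: admissibleE)
  have [measurable]: "R \<in> measurable \<nu> borel" using lip_measurable[OF R] sets by (simp cong: measurable_cong_sets)
  have "ent \<nu> (\<lambda>x. f (R x)) \<le> C / 2 * (\<integral>x. (K * H (R x))\<^sup>2 / f (R x) \<partial>\<nu>)"
    using assms(1) admissible_compose_lip[OF fH R] unfolding LSI_def by blast
  also have "(\<integral>x. (K * H (R x))\<^sup>2 / f (R x) \<partial>\<nu>) = (\<integral>x. K\<^sup>2 * ((H (R x))\<^sup>2 / f (R x)) \<partial>\<nu>)"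
    by (simp add: power_mult_distrib)
  also have "\<dots> = K\<^sup>2 * (\<integral>x. (H x)\<^sup>2 / f x \<partial>distr \<nu> borel R)"
    by (subst integral_distr) (simp_all del: times_divide_eq_right)
  finally show "ent (distr \<nu> borel R) f \<le> K\<^sup>2 * C / 2 * (\<integral>x. (H x)\<^sup>2 / f x \<partial>distr \<nu> borel R)"
    by (simp add: ent_distr mult_ac)
qed

text \<open>The neighbourhood in \<open>slope_bound\<close> depends on the point, so an estimate
  uniform in \<open>z\<close> is out of reach. Instead the excess of the difference quotient over
  \<open>H\<close> tends to \<open>0\<close> for each \<open>z\<close> and is at most the Lipschitz
  constant, so its mean tends to \<open>0\<close>.\<close>

lemma slope_bound_integral:
  fixes f :: "'a::euclidean_space \<Rightarrow> real"
  assumes N: "prob_space N" and [measurable]: "\<zeta> \<in> borel_measurable N"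
    and fH: "admissible f H"
  shows "slope_bound (\<lambda>x. \<integral>z. f (x + \<zeta> z) \<partial>N) (\<lambda>x. \<integral>z. H (x + \<zeta> z) \<partial>N)"
  unfolding slope_bound_def
proof (intro allI impI)
  interpret prob_space N by fact
  obtain L c B where A: "slope_bound f H" "\<And>x. 0 \<le> H x" "0 < c" "\<And>x. c \<le> f x" "\<And>x. f x \<le> B" "\<And>x. H x \<le> B"
    "lip L f" "lip L H" and [measurable]: "f \<in> borel_measurable borel" "H \<in> borel_measurable borel"
    using admissibleE[OF fH] by metis
  have L: "0 \<le> L" by (rule lip_nonneg[OF A(7)])
  have fi: "integrable N (\<lambda>z. f (x + \<zeta> z))" for x
  proof (rule integrable_const_bound[where B=B])
    have "\<bar>f v\<bar> \<le> B" for v using A(3) A(4)[of v] A(5)[of v] by auto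
    then show "AE z in N. norm (f (x + \<zeta> z)) \<le> B" by simp
  qed simp
  have Hi: "integrable N (\<lambda>z. H (x + \<zeta> z))" for x
    using A(2,6) by (intro integrable_const_bound[where B=B]) auto
  fix x :: 'a and e :: real assume e: "e > 0"
  show "\<forall>\<^sub>F y in nhds x. \<bar>(\<integral>z. f (y + \<zeta> z) \<partial>N) - (\<integral>z. f (x + \<zeta> z) \<partial>N)\<bar> \<le> ((\<integral>z. H (x + \<zeta> z) \<partial>N) + e) * norm (y - x)"
    unfolding eventually_nhds_iff_sequentially
  proof (intro allI impI)
    fix y :: "nat \<Rightarrow> 'a" assume y: "y \<longlonglongrightarrow> x"
    \<comment> \<open>The positive part of that excess. For \<open>y n = x\<close> the quotient is
      \<open>0\<close> by convention, and so is \<open>u n z\<close>.\<close>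
    define u where "u n z = max (\<bar>f (y n + \<zeta> z) - f (x + \<zeta> z)\<bar> / norm (y n - x) - H (x + \<zeta> z)) 0" for n z
    have [measurable]: "u n \<in> borel_measurable N" for n unfolding u_def by measurable
    have ub: "\<bar>u n z\<bar> \<le> L" for n z
    proof -
      have "\<bar>f (y n + \<zeta> z) - f (x + \<zeta> z)\<bar> \<le> L * norm (y n - x)"
        using A(7) unfolding lip_def by (metis add_diff_cancel_right real_norm_def)
      then have "\<bar>f (y n + \<zeta> z) - f (x + \<zeta> z)\<bar> / norm (y n - x) \<le> L"
        using L by (cases "y n = x") (auto simp: divide_le_eq)
      then show ?thesis unfolding u_def using A(2)[of "x + \<zeta> z"] L by auto
    qed
    have ui: "integrable N (u n)" for n
      using ub by (intro integrable_const_bound[where B=L]) auto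
    have "(\<lambda>n. \<integral>z. u n z \<partial>N) \<longlonglongrightarrow> (\<integral>z. 0 \<partial>N)"
    proof (rule integral_dominated_convergence[where w="\<lambda>_. L"])
      show "AE z in N. (\<lambda>n. u n z) \<longlonglongrightarrow> 0"
      proof (rule AE_I2, rule LIMSEQ_I)
        fix z and r :: real assume r: "r > 0"
        let ?p = "x + \<zeta> z"
        have "\<forall>\<^sub>F v in nhds ?p. \<bar>f v - f ?p\<bar> \<le> (H ?p + r/2) * norm (v - ?p)"
          using A(1) r unfolding slope_bound_def by (meson half_gt_zero)
        moreover have "(\<lambda>n. y n + \<zeta> z) \<longlonglongrightarrow> ?p" using y by (intro tendsto_intros)
        ultimately have "\<forall>\<^sub>F n in sequentially. \<bar>f (y n + \<zeta> z) - f ?p\<bar> \<le> (H ?p + r/2) * norm (y n + \<zeta> z - ?p)"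
          by (rule eventually_compose_filterlim)
        then have "\<forall>\<^sub>F n in sequentially. norm (u n z - 0) < r"
        proof eventually_elim
          case (elim n)
          then have "\<bar>f (y n + \<zeta> z) - f ?p\<bar> / norm (y n - x) \<le> H ?p + r/2"
            using A(2)[of ?p] r by (cases "y n = x") (auto simp: divide_le_eq)
          then show ?case unfolding u_def using r by auto
        qed
        then show "\<exists>no. \<forall>n\<ge>no. norm (u n z - 0) < r" by (simp add: eventually_sequentially)
      qed
    qed (use ub in auto)
    then have "\<forall>\<^sub>F n in sequentially. (\<integral>z. u n z \<partial>N) < e"
      using e by (intro order_tendstoD) auto
    then show "\<forall>\<^sub>F n in sequentially. \<bar>(\<integral>z. f (y n + \<zeta> z) \<partial>N) - (\<integral>z. f (x + \<zeta> z) \<partial>N)\<bar> \<le> ((\<integral>z. H (x + \<zeta> z) \<partial>N) + e) * norm (y n - x)"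
    proof eventually_elim
      case (elim n)
      have "\<bar>(\<integral>z. f (y n + \<zeta> z) \<partial>N) - (\<integral>z. f (x + \<zeta> z) \<partial>N)\<bar> = \<bar>\<integral>z. f (y n + \<zeta> z) - f (x + \<zeta> z) \<partial>N\<bar>"
        using fi by simp
      also have "\<dots> \<le> (\<integral>z. \<bar>f (y n + \<zeta> z) - f (x + \<zeta> z)\<bar> \<partial>N)"
        by (rule integral_abs_bound)
      also have "\<dots> \<le> (\<integral>z. (u n z + H (x + \<zeta> z)) * norm (y n - x) \<partial>N)"
      proof (rule integral_mono)
        fix z
        have "\<bar>f (y n + \<zeta> z) - f (x + \<zeta> z)\<bar> / norm (y n - x) \<le> u n z + H (x + \<zeta> z)"
          unfolding u_def by auto
        then show "\<bar>f (y n + \<zeta> z) - f (x + \<zeta> z)\<bar> \<le> (u n z + H (x + \<zeta> z)) * norm (y n - x)"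
          by (cases "y n = x") (auto simp: divide_le_eq)
      qed (use fi ui Hi in auto)
      also have "\<dots> = ((\<integral>z. u n z \<partial>N) + (\<integral>z. H (x + \<zeta> z) \<partial>N)) * norm (y n - x)"
        using ui Hi by simp
      also have "\<dots> \<le> ((\<integral>z. H (x + \<zeta> z) \<partial>N) + e) * norm (y n - x)"
        using elim by (intro mult_right_mono) auto
      finally show ?case .
    qed
  qed
qed

text \<open>A short step in the direction of the gradient raises \<open>f\<close> at a rate given by
  the norm of the gradient, and the slope bound limits this rate.\<close>

lemma slope_bound_gradient:
  fixes f :: "real^'d::finite \<Rightarrow> real"
  assumes "slope_bound f H" "f differentiable (at x)" "0 \<le> H x"
  shows "norm (gradient f x) \<le> H x"
proof (rule field_le_epsilon)
  let ?D = "gradient f x"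
  fix e :: real assume e: "e > 0"
  have "\<forall>\<^sub>F y in nhds x. \<bar>f y - f x\<bar> \<le> (H x + e/2) * norm (y - x)"
    using assms(1) e unfolding slope_bound_def by (meson half_gt_zero)
  then obtain d1 where d1: "d1 > 0" "\<And>y. dist y x < d1 \<Longrightarrow> \<bar>f y - f x\<bar> \<le> (H x + e/2) * norm (y - x)"
    by (auto simp: eventually_nhds_metric)
  obtain d2 where d2: "d2 > 0" "\<And>y. norm (y - x) < d2 \<Longrightarrow> norm (f y - f x - ?D \<bullet> (y - x)) \<le> e/2 * norm (y - x)"
    using gradient_has_derivative[OF assms(2)] e unfolding has_derivative_at_alt by (meson half_gt_zero)
  show "norm ?D \<le> H x + e"
  proof (cases "?D = 0")
    case True then show ?thesis using assms(3) e by simp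
  next
    case False
    \<comment> \<open>The step has length \<open>min d1 d2 / 2\<close>, inside both
      neighbourhoods.\<close>
    define t where "t = min d1 d2 / (2 * norm ?D)"
    have t: "t > 0" using d1 d2 False by (simp add: t_def)
    have n: "norm (t *\<^sub>R ?D) = min d1 d2 / 2" using d1 d2 False by (simp add: t_def)
    have a: "\<bar>f (x + t *\<^sub>R ?D) - f x\<bar> \<le> (H x + e/2) * (t * norm ?D)"
      using d1(2)[of "x + t *\<^sub>R ?D"] n d1(1) d2(1) t by (simp add: dist_norm)
    have b: "\<bar>f (x + t *\<^sub>R ?D) - f x - t * (norm ?D)\<^sup>2\<bar> \<le> e/2 * (t * norm ?D)"
      using d2(2)[of "x + t *\<^sub>R ?D"] n d1(1) d2(1) t by (simp add: power2_norm_eq_inner)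
    have "t * (norm ?D)\<^sup>2 \<le> (H x + e/2) * (t * norm ?D) + e/2 * (t * norm ?D)" using a b by linarith
    also have "\<dots> = (H x + e) * (t * norm ?D)" by (simp add: field_simps)
    finally have "t * (norm ?D)\<^sup>2 \<le> (H x + e) * (t * norm ?D)" .
    then have "(t * norm ?D) * norm ?D \<le> (t * norm ?D) * (H x + e)" by (simp add: power2_eq_square mult_ac)
    then show ?thesis using t False by (simp add: mult_le_cancel_left_pos)
  qed
qed

section \<open>Quantitative bounds for smooth test functions\<close>

lemma lip_of_gradient_bound:
  fixes g :: "real^'d::finite \<Rightarrow> real"
  assumes "\<And>x. g differentiable (at x)" "\<And>x. norm (gradient g x) \<le> L"
  shows "lip L g"
  unfolding lip_def
proof (intro allI)
  fix x y
  show "norm (g x - g y) \<le> L * norm (x - y)"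
  proof (rule differentiable_bound[of UNIV])
    fix v
    show "(g has_derivative (\<lambda>u. gradient g v \<bullet> u)) (at v within UNIV)"
      using gradient_has_derivative[OF assms(1)] by simp
    have "norm (gradient g v \<bullet> u) \<le> L * norm u" for u
      using Cauchy_Schwarz_ineq2[of "gradient g v" u] mult_right_mono[OF assms(2)[of v], of "norm u"] by simp
    then show "onorm (\<lambda>u. gradient g v \<bullet> u) \<le> L" by (rule onorm_le)
  qed auto
qed

lemma finite_lists_length: "finite {I :: 'd::finite list. length I = k}"
  using finite_lists_length_eq[of "UNIV :: 'd set" k] by simp

lemma partials_Cb_infty_bounded:
  assumes f: "f \<in> Cb_infty"
  shows "\<exists>B. \<forall>I x. length I = Suc k \<longrightarrow> \<bar>partials I f x\<bar> \<le> B"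
proof -
  obtain B where B: "\<And>x. nabla_norm (Suc k) f x \<le> B"
    using f unfolding Cb_infty_def by force
  have "\<bar>partials I f x\<bar> \<le> B" if I: "length I = Suc k" for I x
  proof -
    have "L2_set (\<lambda>I. \<bar>partials I f x\<bar>) {I. length I = Suc k} = nabla_norm (Suc k) f x"
      by (simp add: nabla_norm_def L2_set_def)
    then have "\<bar>partials I f x\<bar> \<le> nabla_norm (Suc k) f x"
      using member_le_L2_set[OF finite_lists_length, of I "Suc k" "\<lambda>I. \<bar>partials I f x\<bar>"] I by simp
    then show ?thesis using B[of x] by linarith
  qed
  then show ?thesis by blast
qed

lemma norm_le_card_bound:
  fixes v :: "real^'d::finite"
  assumes "\<And>i. \<bar>v $ i\<bar> \<le> b"
  shows "norm v \<le> real CARD('d) * b"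
proof -
  have "norm v \<le> (\<Sum>i\<in>UNIV. \<bar>v $ i\<bar>)" by (rule norm_le_l1_cart)
  also have "\<dots> \<le> (\<Sum>i\<in>(UNIV::'d set). b)" using assms by (intro sum_mono) auto
  finally show ?thesis by simp
qed

lemma Cb_infty_differentiable:
  assumes "f \<in> Cb_infty" shows "partials I f differentiable (at x)"
  using assms unfolding Cb_infty_def smooth_def by blast

text \<open>Collects the quantitative content of \<open>Cb_infty\<close> that is used later. It
  comes from the partial derivatives of orders 1 and 2; the function itself may be
  unbounded.\<close>

lemma Cb_infty_gradient:
  fixes f :: "real^'d::finite \<Rightarrow> real"
  assumes f: "f \<in> Cb_infty"
  obtains L M where "\<And>x. norm (gradient f x) \<le> L" "lip L f" "lip M (gradient f)" "M > 0"
    "\<And>x u. \<bar>f (x + u) - f x - gradient f x \<bullet> u\<bar> \<le> M * (norm u)\<^sup>2"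
proof -
  obtain B1 where B1: "\<And>I x. length I = Suc 0 \<Longrightarrow> \<bar>partials I f x\<bar> \<le> B1"
    using partials_Cb_infty_bounded[OF f] by blast
  obtain B2 where B2: "\<And>I x. length I = Suc 1 \<Longrightarrow> \<bar>partials I f x\<bar> \<le> B2"
    using partials_Cb_infty_bounded[OF f] by blast
  let ?n = "real CARD('d)"
  have df: "f differentiable (at x)" for x
    using Cb_infty_differentiable[OF f, of "[]"] by simp
  have gi: "(\<lambda>x. gradient f x $ i) = partials [i] f" for i by auto
  have L: "norm (gradient f x) \<le> ?n * B1" for x
    using B1[of "[_]" x] by (intro norm_le_card_bound) simp
  have gc: "lip (?n * B2) (\<lambda>x. gradient f x $ i)" for i
  proof (rule lip_of_gradient_bound)
    show "(\<lambda>x. gradient f x $ i) differentiable at x" for x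
      unfolding gi by (rule Cb_infty_differentiable[OF f])
    show "norm (gradient (\<lambda>x. gradient f x $ i) x) \<le> ?n * B2" for x
      using B2[of "[_, i]" x] by (intro norm_le_card_bound) simp
  qed
  \<comment> \<open>The added \<open>1\<close> makes \<open>M\<close> positive also for affine
    functions, as \<open>norm_gradient_sq_le\<close> divides by it.\<close>
  define M where "M = ?n * (?n * B2) + 1"
  have B2': "B2 \<ge> 0" using order_trans[OF abs_ge_zero B2[of "[undefined, undefined]" undefined]] by simp
  have M: "lip M (gradient f)"
    unfolding lip_def
  proof (intro allI)
    fix x y
    have "norm (gradient f x - gradient f y) \<le> ?n * (?n * B2 * norm (x - y))"
      using gc unfolding lip_def by (intro norm_le_card_bound) simp
    also have "\<dots> \<le> M * norm (x - y)" by (simp add: M_def algebra_simps)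
    finally show "norm (gradient f x - gradient f y) \<le> M * norm (x - y)" .
  qed
  have M0: "M > 0" using B2' by (simp add: M_def add_nonneg_pos)
  have T: "\<bar>f (x + u) - f x - gradient f x \<bullet> u\<bar> \<le> M * (norm u)\<^sup>2" for x u
  proof -
    \<comment> \<open>Subtracting the linear part leaves a function whose gradient is at most
      \<open>M * norm u\<close> on the ball of radius \<open>norm u\<close>.\<close>
    let ?g = "\<lambda>y. f y - gradient f x \<bullet> y"
    have "norm (?g (x + u) - ?g x) \<le> (M * norm u) * norm (x + u - x)"
    proof (rule differentiable_bound[of "cball x (norm u)"])
      fix v assume "v \<in> cball x (norm u)"
      then have v: "norm (v - x) \<le> norm u" by (simp add: dist_norm norm_minus_commute)
      show "(?g has_derivative (\<lambda>w. gradient f v \<bullet> w - gradient f x \<bullet> w)) (at v within cball x (norm u))"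
        by (intro has_derivative_diff has_derivative_at_withinI[OF gradient_has_derivative[OF df]]
            bounded_linear_imp_has_derivative bounded_linear_inner_right)
      have "norm (gradient f v \<bullet> w - gradient f x \<bullet> w) \<le> M * norm u * norm w" for w
      proof -
        have "norm ((gradient f v - gradient f x) \<bullet> w) \<le> norm (gradient f v - gradient f x) * norm w"
          using Cauchy_Schwarz_ineq2 by simp
        also have "\<dots> \<le> (M * norm u) * norm w"
        proof (rule mult_right_mono)
          have "norm (gradient f v - gradient f x) \<le> M * norm (v - x)" using M unfolding lip_def by blast
          also have "\<dots> \<le> M * norm u" using v M0 by (intro mult_left_mono) auto
          finally show "norm (gradient f v - gradient f x) \<le> M * norm u" .
        qed simp
        finally show ?thesis by (simp add: inner_diff_left)
      qed
      then show "onorm (\<lambda>w. gradient f v \<bullet> w - gradient f x \<bullet> w) \<le> M * norm u" by (rule onorm_le)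
    qed (auto simp: dist_norm)
    then show ?thesis by (simp add: inner_add_right power2_eq_square algebra_simps)
  qed
  show ?thesis
    by (rule that[OF L lip_of_gradient_bound[OF df L] M M0 T])
qed

text \<open>The minimum of the quadratic upper bound along the gradient has to stay positive.
  Consequently |grad f|^2 / f is bounded even where \<open>f\<close> comes close to
  \<open>0\<close>.\<close>

lemma norm_gradient_sq_le:
  fixes f :: "real^'d::finite \<Rightarrow> real"
  assumes pos: "\<And>x. 0 < f x" and M: "M > 0"
    and T: "\<And>x u. \<bar>f (x + u) - f x - gradient f x \<bullet> u\<bar> \<le> M * (norm u)\<^sup>2"
  shows "(norm (gradient f x))\<^sup>2 \<le> 4 * M * f x"
proof -
  \<comment> \<open>The minimiser of
    \<open>gradient f x \<bullet> u + M * (norm u)\<^sup>2\<close>.\<close>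
  let ?u = "- (1 / (2 * M)) *\<^sub>R gradient f x"
  have "0 < f (x + ?u)" by (rule pos)
  also have "\<dots> \<le> f x + gradient f x \<bullet> ?u + M * (norm ?u)\<^sup>2" using T[of x ?u] by linarith
  also have "gradient f x \<bullet> ?u = - (1 / (2 * M)) * (norm (gradient f x))\<^sup>2" by (simp add: power2_norm_eq_inner)
  also have "M * (norm ?u)\<^sup>2 = (1 / (4 * M)) * (norm (gradient f x))\<^sup>2"
    using M by (simp add: power_mult_distrib power_divide) (simp add: power2_eq_square)
  finally show ?thesis using M by (simp add: field_simps)
qed

lemma norm_gradient_sqrt_sq:
  fixes f :: "real^'d::finite \<Rightarrow> real"
  assumes "f differentiable (at x)" "f x > 0"
  shows "(norm (gradient (\<lambda>z. sqrt (f z)) x))\<^sup>2 = (norm (gradient f x))\<^sup>2 / f x / 4"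
proof -
  have "((\<lambda>z. sqrt (f z)) has_derivative (\<lambda>u. (gradient f x \<bullet> u) * (inverse (sqrt (f x)) / 2))) (at x)"
    using gradient_has_derivative[OF assms(1)] assms(2)
    by (auto intro!: derivative_eq_intros)
  then have "gradient (\<lambda>z. sqrt (f z)) x $ i = gradient f x $ i * (inverse (sqrt (f x)) / 2)" for i
    by (subst gradient_eqI) (auto simp: inner_axis)
  then have "gradient (\<lambda>z. sqrt (f z)) x = (inverse (sqrt (f x)) / 2) *\<^sub>R gradient f x"
    by (simp add: vec_eq_iff)
  then show ?thesis using assms(2)
    by (simp add: power_mult_distrib power_divide field_simps)
qed

text \<open>\<open>D\<close> is an arbitrary field with a quadratic remainder, so that pairs
  obtained by averaging over translations are covered without identifying the averaged field as a
  gradient.\<close>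

lemma slope_bound_norm_gradient:
  fixes f :: "real^'d::finite \<Rightarrow> real" and D :: "real^'d \<Rightarrow> real^'d"
  assumes T: "\<And>x u. \<bar>f (x + u) - f x - D x \<bullet> u\<bar> \<le> M * (norm u)\<^sup>2"
  shows "slope_bound f (\<lambda>x. norm (D x))"
  unfolding slope_bound_def
proof (intro allI impI)
  fix x :: "real^'d" and e :: real assume e: "e > 0"
  have "((\<lambda>y. M * norm (y - x)) \<longlongrightarrow> M * norm (x - x)) (nhds x)"
    by (intro tendsto_intros filterlim_ident)
  then have "\<forall>\<^sub>F y in nhds x. M * norm (y - x) < e" using e by (intro order_tendstoD(2)) auto
  then show "\<forall>\<^sub>F y in nhds x. \<bar>f y - f x\<bar> \<le> (norm (D x) + e) * norm (y - x)"
  proof eventually_elim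
    case (elim y)
    have "\<bar>f y - f x\<bar> \<le> \<bar>D x \<bullet> (y - x)\<bar> + M * (norm (y - x))\<^sup>2" using T[of x "y - x"] by simp
    also have "\<dots> \<le> norm (D x) * norm (y - x) + e * norm (y - x)"
      using Cauchy_Schwarz_ineq2[of "D x" "y - x"] mult_right_mono[OF less_imp_le[OF elim], of "norm (y - x)"]
      by (simp add: power2_eq_square)
    finally show ?case by (simp add: distrib_right)
  qed
qed

lemma gauss_first_moment:
  assumes s: "s > 0"
  shows "integrable (gauss s) (\<lambda>z::real^'d::finite. norm z)"
    and "(\<integral>z. norm (z::real^'d) \<partial>gauss s) \<le> s * (1 + real CARD('d))"
proof -
  interpret prob_space "gauss s :: (real^'d) measure" using s by (rule prob_space_gauss)
  have "has_bochner_integral (gauss s) (\<lambda>z::real^'d. \<Sum>i\<in>UNIV. z $ i * z $ i) (\<Sum>i\<in>(UNIV::'d set). if i = i then s\<^sup>2 else 0)"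
    by (intro has_bochner_integral_sum gauss_covariance s)
  then have 2: "has_bochner_integral (gauss s) (\<lambda>z::real^'d. (norm z)\<^sup>2) (real CARD('d) * s\<^sup>2)"
    by (simp add: power2_norm_eq_inner inner_vec_def)
  then have i2: "integrable (gauss s) (\<lambda>z::real^'d. s + (norm z)\<^sup>2 / s)"
    by (auto simp: has_bochner_integral_iff)
  \<comment> \<open>Young's inequality with weight \<open>s\<close>, chosen so that the integrated
    bound has order \<open>s\<close>.\<close>
  have le: "norm z \<le> s + (norm z)\<^sup>2 / s" for z :: "real^'d"
  proof -
    have "0 \<le> (norm z - s / 2)\<^sup>2" by simp
    also have "\<dots> = (norm z)\<^sup>2 - s * norm z + s\<^sup>2 / 4" by (simp add: power2_diff power_divide)
    finally have "s * norm z \<le> s\<^sup>2 + (norm z)\<^sup>2" using zero_le_power2[of s] by linarith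
    then have "s * norm z \<le> s * (s + (norm z)\<^sup>2 / s)" using s by (simp add: distrib_left power2_eq_square)
    then show ?thesis using s by (simp only: mult_le_cancel_left_pos)
  qed
  show i: "integrable (gauss s) (\<lambda>z::real^'d. norm z)"
    by (rule Bochner_Integration.integrable_bound[OF i2]) (use le in \<open>auto intro!: AE_I2 intro: order_trans[OF _ abs_ge_self]\<close>)
  have "(\<integral>z. norm (z::real^'d) \<partial>gauss s) \<le> (\<integral>z. s + (norm (z::real^'d))\<^sup>2 / s \<partial>gauss s)"
    by (rule integral_mono[OF i i2 le])
  also have "\<dots> = s + (real CARD('d) * s\<^sup>2) / s"
    using 2 by (subst Bochner_Integration.integral_add) (auto simp: has_bochner_integral_iff prob_space[simplified])
  finally show "(\<integral>z. norm (z::real^'d) \<partial>gauss s) \<le> s * (1 + real CARD('d))"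
    using s by (simp add: power2_eq_square algebra_simps)
qed

lemma gauss_mollify_error:
  fixes f :: "real^'d::finite \<Rightarrow> real"
  assumes s: "s > 0" and f: "lip L f" and B: "\<And>x. \<bar>f x\<bar> \<le> B"
  shows "\<bar>(\<integral>z. f (x + z) \<partial>gauss s) - f x\<bar> \<le> L * (s * (1 + real CARD('d)))"
proof -
  interpret prob_space "gauss s :: (real^'d) measure" using s by (rule prob_space_gauss)
  have [measurable]: "f \<in> borel_measurable borel" by (rule lip_measurable[OF f])
  have L: "0 \<le> L" by (rule lip_nonneg[OF f])
  have fi: "integrable (gauss s) (\<lambda>z. f (x + z))"
    using B by (intro integrable_const_bound[where B=B]) auto
  have "\<bar>(\<integral>z. f (x + z) \<partial>gauss s) - f x\<bar> = \<bar>\<integral>z. f (x + z) - f x \<partial>gauss s\<bar>"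
    using fi prob_space[simplified] by simp
  also have "\<dots> \<le> (\<integral>z. \<bar>f (x + z) - f x\<bar> \<partial>gauss s)" by (rule integral_abs_bound)
  also have "\<dots> \<le> (\<integral>z. L * norm (z::real^'d) \<partial>gauss s)"
  proof (rule integral_mono)
    show "\<bar>f (x + z) - f x\<bar> \<le> L * norm z" for z
      using f unfolding lip_def by (metis add_diff_cancel_left' real_norm_def)
  qed (use gauss_first_moment(1)[OF s, where 'd='d] fi in auto)
  also have "\<dots> \<le> L * (s * (1 + real CARD('d)))"
    using gauss_first_moment(2)[OF s, where 'd='d] L by (simp add: mult_left_mono)
  finally show ?thesis .
qed

text \<open>The function and its slope bound are averaged with the same Gaussian. The averaged
  function is smooth, its gradient is at most the averaged slope bound, and Lipschitz continuity
  lets both averages converge back as the variance tends to \<open>0\<close>.\<close>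

lemma LSI_of_Cb_infty:
  fixes \<nu> :: "(real^'d::finite) measure"
  assumes \<nu>: "prob_space \<nu>" "sets \<nu> = sets borel" and C: "0 \<le> C"
    and H: "\<And>f c B. f \<in> Cb_infty \<Longrightarrow> 0 < c \<Longrightarrow> (\<And>x. c \<le> f x) \<Longrightarrow> (\<And>x. f x \<le> B) \<Longrightarrow>
       ent \<nu> f \<le> C / 2 * (\<integral>x. (norm (gradient f x))\<^sup>2 / f x \<partial>\<nu>)"
  shows "LSI \<nu> C"
  unfolding LSI_def
proof (intro allI impI)
  interpret prob_space \<nu> by fact
  note \<nu>(2)[measurable_cong]
  fix f H' assume fH: "admissible (f :: real^'d \<Rightarrow> real) H'"
  obtain L c B where A: "slope_bound f H'" "\<And>x. 0 \<le> H' x" "0 < c" "\<And>x. c \<le> f x" "\<And>x. f x \<le> B" "\<And>x. H' x \<le> B"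
    "lip L f" "lip L H'" and [measurable]: "f \<in> borel_measurable borel" "H' \<in> borel_measurable borel"
    using admissibleE[OF fH] by metis
  have f0: "f x > 0" for x using A(3) A(4)[of x] by linarith
  have fB: "\<bar>f x\<bar> \<le> B" "\<bar>H' x\<bar> \<le> B" for x using f0[of x] A(5,6)[of x] A(2)[of x] by auto
  define s where "s n = 1 / real (Suc n)" for n
  have s: "s n > 0" for n by (simp add: s_def)
  define g where "g n x = (\<integral>z. f (x + z) \<partial>gauss (s n))" for n x
  define G where "G n x = (\<integral>z. H' (x + z) \<partial>gauss (s n))" for n x
  have s0: "(\<lambda>n. L * (s n * (1 + real CARD('d)))) \<longlonglongrightarrow> 0"
    using tendsto_mult_right_zero[OF LIMSEQ_inverse_real_of_nat, of "L * (1 + real CARD('d))"]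
    by (simp add: s_def divide_inverse mult_ac)
  have moll: "(\<lambda>n. \<integral>z. k (x + z) \<partial>gauss (s n)) \<longlonglongrightarrow> k x" if "lip L k" "\<And>x. \<bar>k x\<bar> \<le> B" for k :: "real^'d \<Rightarrow> real" and x
  proof (rule LIM_zero_cancel, rule Lim_null_comparison[OF always_eventually s0], rule allI)
    show "norm ((\<integral>z. k (x + z) \<partial>gauss (s n)) - k x) \<le> L * (s n * (1 + real CARD('d)))" for n
      using gauss_mollify_error[OF s that] by simp
  qed
  have gl: "(\<lambda>n. g n x) \<longlonglongrightarrow> f x" and Gl: "(\<lambda>n. G n x) \<longlonglongrightarrow> H' x" for x
    unfolding g_def G_def using moll A(7,8) fB by auto
  have gC: "g n \<in> Cb_infty" for n
    unfolding g_def[abs_def] by (rule gauss_mollify_Cb_infty[OF s _ fB(1)]) simp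
  have gb: "c \<le> g n x" "g n x \<le> B" "G n x \<le> B" "0 \<le> G n x" for n x
  proof -
    interpret N: prob_space "gauss (s n) :: (real^'d) measure" by (rule prob_space_gauss[OF s])
    have fi: "integrable (gauss (s n)) (\<lambda>z. f (x + z))" "integrable (gauss (s n)) (\<lambda>z. H' (x + z))"
      using fB by (auto intro!: N.integrable_const_bound[where B=B])
    have "(\<integral>z. c \<partial>(gauss (s n) :: (real^'d) measure)) \<le> g n x" unfolding g_def by (intro integral_mono fi A) simp
    then show "c \<le> g n x" by (simp add: N.prob_space[simplified])
    have "g n x \<le> (\<integral>z. B \<partial>(gauss (s n) :: (real^'d) measure))" unfolding g_def by (intro integral_mono fi A) simp
    then show "g n x \<le> B" by (simp add: N.prob_space[simplified])
    have "G n x \<le> (\<integral>z. B \<partial>(gauss (s n) :: (real^'d) measure))" unfolding G_def by (intro integral_mono fi A) simp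
    then show "G n x \<le> B" by (simp add: N.prob_space[simplified])
    show "0 \<le> G n x" unfolding G_def using A(2) by (intro Bochner_Integration.integral_nonneg)
  qed
  have sb: "slope_bound (g n) (G n)" for n
    unfolding g_def[abs_def] G_def[abs_def]
    by (rule slope_bound_integral[OF prob_space_gauss[OF s] _ fH]) simp
  have gd: "g n differentiable (at x)" for n x
    using Cb_infty_differentiable[OF gC, of "[]"] by simp
  have gG: "norm (gradient (g n) x) \<le> G n x" for n x
    by (rule slope_bound_gradient[OF sb gd gb(4)])
  have [measurable]: "g n \<in> borel_measurable borel" for n
  proof -
    obtain L' where "lip L' (g n)" using Cb_infty_gradient[OF gC[of n]] by metis
    then show ?thesis by (rule lip_measurable)
  qed
  have [measurable]: "(\<lambda>x. norm (gradient (g n) x)) \<in> borel_measurable borel" for n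
  proof -
    obtain L' where "lip L' (gradient (g n))" using Cb_infty_gradient[OF gC[of n]] by metis
    then have [measurable]: "gradient (g n) \<in> borel_measurable borel" by (rule lip_measurable)
    show ?thesis by measurable
  qed
  have [measurable]: "G n \<in> borel_measurable borel" for n
    unfolding G_def[abs_def]
  proof (rule sigma_finite_measure.borel_measurable_lebesgue_integral)
    show "sigma_finite_measure (gauss (s n) :: (real^'d) measure)"
      using prob_space_gauss[OF s, of n] prob_space_imp_sigma_finite by blast
  qed measurable
  have l1: "(\<lambda>n. ent \<nu> (g n)) \<longlonglongrightarrow> ent \<nu> f"
    by (rule tendsto_ent[OF \<nu>(1) A(3)]) (use gb gl in auto)
  have l2: "(\<lambda>n. \<integral>x. (G n x)\<^sup>2 / g n x \<partial>\<nu>) \<longlonglongrightarrow> (\<integral>x. (H' x)\<^sup>2 / f x \<partial>\<nu>)"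
  proof (rule integral_dominated_convergence[where w="\<lambda>_. B\<^sup>2 / c"])
    show "AE x in \<nu>. (\<lambda>n. (G n x)\<^sup>2 / g n x) \<longlonglongrightarrow> (H' x)\<^sup>2 / f x"
      using f0 by (intro AE_I2 tendsto_intros gl Gl) (auto simp: less_imp_neq[symmetric])
    show "AE x in \<nu>. norm ((G n x)\<^sup>2 / g n x) \<le> B\<^sup>2 / c" for n
    proof (rule AE_I2)
      fix x
      have "(G n x)\<^sup>2 / g n x \<le> B\<^sup>2 / c"
        using A gb by (intro frac_le power_mono) auto
      moreover have "0 < g n x" using A(3) gb(1)[of n x] by linarith
      ultimately show "norm ((G n x)\<^sup>2 / g n x) \<le> B\<^sup>2 / c" by simp
    qed
  qed auto
  have le: "ent \<nu> (g n) \<le> C / 2 * (\<integral>x. (G n x)\<^sup>2 / g n x \<partial>\<nu>)" for n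
  proof -
    have gp: "0 < g n x" for x using A(3) gb(1)[of n x] by linarith
    have sq: "(norm (gradient (g n) x))\<^sup>2 / g n x \<le> (G n x)\<^sup>2 / g n x" "(G n x)\<^sup>2 / g n x \<le> B\<^sup>2 / c" for x
      using gp[of x] gG[of n x] gb(1)[of n x] gb(2)[of n x] gb(3)[of n x] gb(4)[of n x] A(3) by (auto intro!: divide_right_mono power_mono frac_le)
    have "ent \<nu> (g n) \<le> C / 2 * (\<integral>x. (norm (gradient (g n) x))\<^sup>2 / g n x \<partial>\<nu>)"
      by (rule H[OF gC A(3) gb(1,2)])
    also have "\<dots> \<le> C / 2 * (\<integral>x. (G n x)\<^sup>2 / g n x \<partial>\<nu>)"
    proof (intro mult_left_mono integral_mono)
      show "integrable \<nu> (\<lambda>x. (G n x)\<^sup>2 / g n x)"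
        using sq gp by (intro integrable_const_bound[where B="B\<^sup>2 / c"]) (auto simp: less_imp_le)
      show "integrable \<nu> (\<lambda>x. (norm (gradient (g n) x))\<^sup>2 / g n x)"
        using order_trans[OF sq] gp by (intro integrable_const_bound[where B="B\<^sup>2 / c"]) (auto simp: less_imp_le)
    qed (use sq C in auto)
    finally show ?thesis .
  qed
  show "ent \<nu> f \<le> C / 2 * (\<integral>x. (H' x)\<^sup>2 / f x \<partial>\<nu>)"
    by (rule LIMSEQ_le[OF l1 tendsto_mult_left[OF l2]]) (use le in auto)
qed

text \<open>Fatou's lemma, in a form that delivers integrability of the limit. It is applied to
  truncations of \<open>f\<close> and of \<open>f * ln f\<close>.\<close>

lemma integrable_of_bounded_integrals:
  fixes u :: "nat \<Rightarrow> 'a \<Rightarrow> real"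
  assumes int: "\<And>n. integrable M (u n)" and nonneg: "\<And>n x. 0 \<le> u n x"
    and K: "\<And>n. (\<integral>x. u n x \<partial>M) \<le> K" and lim: "\<And>x. (\<lambda>n. u n x) \<longlonglongrightarrow> v x"
  shows "integrable M v"
proof -
  have [measurable]: "\<And>n. u n \<in> borel_measurable M" using int by (rule borel_measurable_integrable)
  have [measurable]: "v \<in> borel_measurable M"
    by (rule borel_measurable_LIMSEQ_real[OF lim]) simp
  have v0: "0 \<le> v x" for x by (rule LIMSEQ_le_const[OF lim]) (use nonneg in auto)
  have "(\<integral>\<^sup>+x. ennreal (v x) \<partial>M) = (\<integral>\<^sup>+x. liminf (\<lambda>n. ennreal (u n x)) \<partial>M)"
    using lim by (intro nn_integral_cong lim_imp_Liminf[symmetric] tendsto_ennrealI) auto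
  also have "\<dots> \<le> liminf (\<lambda>n. \<integral>\<^sup>+x. ennreal (u n x) \<partial>M)"
    by (rule nn_integral_liminf) simp
  also have "\<dots> = liminf (\<lambda>n. ennreal (\<integral>x. u n x \<partial>M))"
    using int nonneg by (simp add: nn_integral_eq_integral)
  also have "\<dots> \<le> ennreal K"
    using K by (intro Liminf_le) (auto intro!: always_eventually ennreal_leI)
  finally have "(\<integral>\<^sup>+x. ennreal (v x) \<partial>M) < \<infinity>"
    by (auto simp: top_unique less_top[symmetric])
  then show ?thesis using v0 by (intro integrableI_nonneg) auto
qed

section \<open>Entropy inequalities and unbounded test functions\<close>

lemma mult_ln_ge: "x - 1 \<le> x * ln x" if "x > 0" for x :: real
proof -
  have "ln (1 / x) \<le> 1 / x - 1" using that by (intro ln_le_minus_one) simp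
  then have "x * (1 - 1 / x) \<le> x * ln x" using that by (intro mult_left_mono) (auto simp: ln_div)
  then show ?thesis using that by (simp add: right_diff_distrib)
qed

text \<open>Legendre duality between \<open>a * ln a\<close> and \<open>exp\<close> in the scale
  \<open>m\<close>, with equality for \<open>exp y = a / m\<close>.\<close>

lemma Young_ln:
  fixes a m y :: real
  assumes "a > 0" "m > 0"
  shows "a * y \<le> a * ln a - a * ln m - a + m * exp y"
proof -
  have "1 + (y + ln m - ln a) \<le> exp (y + ln m - ln a)" by (rule exp_ge_add_one_self)
  also have "\<dots> = m * exp y / a" using assms by (simp add: exp_add exp_diff)
  finally have "a * (1 + (y + ln m - ln a)) \<le> a * (m * exp y / a)" using assms by (intro mult_left_mono) auto
  then show ?thesis using assms by (simp add: algebra_simps)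
qed

text \<open>Controls \<open>\<integral> f\<close> by the entropy and by the values of \<open>f\<close> off a small set. It yields the
  integrability of an unbounded \<open>f\<close> with finite Fisher information, for which an infinite integral would
  otherwise be the junk value \<open>0\<close>.\<close>

lemma integral_le_of_ent_le:
  assumes M: "prob_space M" and c: "0 < c" and f: "\<And>x. c \<le> f x" "\<And>x. f x \<le> B"
    and [measurable]: "f \<in> borel_measurable M" "A \<in> sets M"
    and A: "measure M A \<le> 1 / 10" and K: "\<And>x. x \<notin> A \<Longrightarrow> f x \<le> K" "0 \<le> K"
    and E: "ent M f \<le> E"
  shows "(\<integral>x. f x \<partial>M) \<le> 2 * (K + E)"
proof -
  interpret prob_space M by fact
  have f0: "f x > 0" for x using c f(1)[of x] by linarith
  have fi: "integrable M f"
    using f0 f(2) by (intro integrable_const_bound[where B=B]) (auto simp: abs_of_pos)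
  have fl: "integrable M (\<lambda>x. f x * ln (f x))"
    using mult_ln_bounded[OF c f] by (intro integrable_const_bound[where B="B * (\<bar>ln c\<bar> + \<bar>ln B\<bar>)"]) auto
  have fA: "integrable M (\<lambda>x. f x * indicator A x)"
    using f0 f(2) by (intro integrable_const_bound[where B=B]) (auto simp: abs_of_pos indicator_def less_imp_le[OF order_less_le_trans[OF f0 f(2)]])
  define m where "m = (\<integral>x. f x \<partial>M)"
  have "(\<integral>x. c \<partial>M) \<le> m" unfolding m_def by (intro integral_mono fi f) simp
  then have m0: "m > 0" using c by (simp add: prob_space)
  have ei: "integrable M (\<lambda>x. exp (indicator A x :: real))"
    by (rule integrable_const_bound[where B="exp 1"]) (auto simp: indicator_def)
  have "(\<integral>x. exp (indicator A x :: real) \<partial>M) = (\<integral>x. 1 + (exp 1 - 1) * indicator A x \<partial>M)"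
    by (intro Bochner_Integration.integral_cong) (auto simp: indicator_def)
  also have "\<dots> = 1 + (exp 1 - 1) * measure M A"
    by (subst Bochner_Integration.integral_add)
      (auto simp: prob_space intro!: integrable_real_indicator simp: emeasure_eq_measure)
  \<comment> \<open>As \<open>exp 1 \<le> 3\<close>, measure at most 1/10 gives the value 6/5. The
    surplus over \<open>1\<close> becomes \<open>m / 5\<close> below and is absorbed by
    \<open>m\<close> on the left.\<close>
  also have "\<dots> \<le> 1 + 2 * (1 / 10)"
    using A exp_le by (intro add_left_mono mult_mono) auto
  finally have e: "(\<integral>x. exp (indicator A x :: real) \<partial>M) \<le> 6 / 5" by simp
  \<comment> \<open>Young's inequality with the indicator of \<open>A\<close> as exponent and the
    mean \<open>m\<close> as scale; the logarithmic terms integrate to the entropy.\<close>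
  have "(\<integral>x. f x * indicator A x \<partial>M) \<le> (\<integral>x. f x * ln (f x) - f x * ln m - f x + m * exp (indicator A x) \<partial>M)"
    using fi fl fA ei Young_ln[OF f0 m0] by (intro integral_mono) auto
  also have "\<dots> = ent M f - m + m * (\<integral>x. exp (indicator A x) \<partial>M)"
    using fi fl ei by (simp add: ent_def m_def)
  also have "\<dots> \<le> E - m + m * (6 / 5)"
    using E e m0 by (intro add_mono diff_mono mult_left_mono) auto
  finally have 1: "(\<integral>x. f x * indicator A x \<partial>M) \<le> E + m / 5" by simp
  have "m \<le> (\<integral>x. f x * indicator A x + K \<partial>M)"
    unfolding m_def using fi fA K by (intro integral_mono) (auto simp: indicator_def)
  also have "\<dots> = (\<integral>x. f x * indicator A x \<partial>M) + K"
    using fA by (simp add: prob_space)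
  finally have "m \<le> E + m / 5 + K" using 1 by linarith
  then have "m * 4 \<le> 5 * (K + E)" by (simp add: field_simps)
  then have "m \<le> 2 * (K + E)" using m0 by (simp add: algebra_simps)
  then show ?thesis by (simp add: m_def)
qed

text \<open>Truncation of \<open>f\<close> to values between \<open>1 / (n + 1)\<close> and
  \<open>n + 1\<close> gives admissible functions with one common slope bound. Their Fisher
  information is bounded uniformly in \<open>n\<close>, hence so are their entropies. This forces
  integrability of \<open>f\<close> and of \<open>f * ln f\<close>, after which dominated
  convergence removes the truncation.\<close>

lemma LSI_Cb_infty:
  fixes \<nu> :: "(real^'d::finite) measure"
  assumes \<nu>: "prob_space \<nu>" "sets \<nu> = sets borel" and LSI: "LSI \<nu> C" and C: "0 \<le> C"
    and f: "f \<in> Cb_infty" and pos: "\<And>x. f x > 0"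
  shows "ent \<nu> f \<le> 2 * C * (\<integral>x. (norm (gradient (\<lambda>z. sqrt (f z)) x))\<^sup>2 \<partial>\<nu>)"
proof -
  interpret prob_space \<nu> by fact
  note \<nu>(2)[measurable_cong]
  obtain L M where G: "\<And>x. norm (gradient f x) \<le> L" "lip L f" "lip M (gradient f)" "M > 0"
    "\<And>x u. \<bar>f (x + u) - f x - gradient f x \<bullet> u\<bar> \<le> M * (norm u)\<^sup>2"
    using Cb_infty_gradient[OF f] by metis
  have df: "f differentiable (at x)" for x using Cb_infty_differentiable[OF f, of "[]"] by simp
  have L: "0 \<le> L" by (rule lip_nonneg[OF G(2)])
  have [measurable]: "f \<in> borel_measurable borel" "gradient f \<in> borel_measurable borel"
    using lip_measurable G(2,3) by blast+
  define H where "H x = norm (gradient f x)" for x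
  have [measurable]: "H \<in> borel_measurable borel" unfolding H_def by measurable
  have H0: "0 \<le> H x" for x by (simp add: H_def)
  have Hf: "(H x)\<^sup>2 \<le> 4 * M * f x" for x
    unfolding H_def by (rule norm_gradient_sq_le[OF pos G(4,5)])
  have HL: "(H x)\<^sup>2 \<le> L\<^sup>2" for x using G(1) by (auto simp: H_def intro!: power_mono)
  define g where "g n x = max (1 / real (Suc n)) (min (real (Suc n)) (f x))" for n x
  have [measurable]: "g n \<in> borel_measurable borel" for n unfolding g_def by measurable
  have gb: "1 / real (Suc n) \<le> g n x" "g n x \<le> real (Suc n)" for n x
  proof -
    have "1 / real (Suc n) \<le> 1" "1 \<le> real (Suc n)" by auto
    then have "1 / real (Suc n) \<le> real (Suc n)" by (rule order_trans)
    then show "1 / real (Suc n) \<le> g n x" "g n x \<le> real (Suc n)" unfolding g_def by auto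
  qed
  have g0: "g n x > 0" for n x using order_less_le_trans[OF _ gb(1)[of n x]] by simp
  \<comment> \<open>Clamping is 1-Lipschitz, so \<open>g n\<close> inherits the slope bound of
    \<open>f\<close> even at points where the clamp destroys differentiability.\<close>
  have gf: "\<bar>g n y - g n x\<bar> \<le> \<bar>f y - f x\<bar>" for n x y unfolding g_def by (auto simp: max_def min_def)
  have sb: "slope_bound f H"
    unfolding H_def[abs_def] using G(5) by (rule slope_bound_norm_gradient)
  have adm: "admissible (g n) H" for n
    unfolding admissible_def
  proof (intro conjI exI allI)
    show "slope_bound (g n) H"
      unfolding slope_bound_def
    proof (intro allI impI)
      fix x and e :: real assume "e > 0"
      then have "\<forall>\<^sub>F y in nhds x. \<bar>f y - f x\<bar> \<le> (H x + e) * norm (y - x)"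
        using sb unfolding slope_bound_def by blast
      then show "\<forall>\<^sub>F y in nhds x. \<bar>g n y - g n x\<bar> \<le> (H x + e) * norm (y - x)"
        by eventually_elim (rule order_trans[OF gf])
    qed
    show "0 < 1 / real (Suc n)" by simp
    show "g n x \<le> max L (real (Suc n))" for x using gb(2)[of n x] by simp
    show "H x \<le> max L (real (Suc n))" for x using G(1)[of x] by (simp add: H_def)
    show "lip (max L M) (g n)"
      unfolding lip_def
    proof (intro allI)
      fix x y
      have "norm (g n x - g n y) \<le> norm (f x - f y)" using gf[of n x y] by simp
      also have "\<dots> \<le> max L M * norm (x - y)" using lip_mono[OF G(2), of "max L M"] unfolding lip_def by simp
      finally show "norm (g n x - g n y) \<le> max L M * norm (x - y)" .
    qed
    show "lip (max L M) H"
      unfolding lip_def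
    proof (intro allI)
      fix x y
      have "norm (H x - H y) \<le> norm (gradient f x - gradient f y)" unfolding H_def by (simp add: norm_triangle_ineq3)
      also have "\<dots> \<le> max L M * norm (x - y)" using lip_mono[OF G(3), of "max L M"] unfolding lip_def by simp
      finally show "norm (H x - H y) \<le> max L M * norm (x - y)" .
    qed
  qed (use gb H0 in auto)
  define Q where "Q = 4 * M + L\<^sup>2"
  \<comment> \<open>Where \<open>f\<close> is not cut from above, \<open>g n\<close> is at least
    \<open>f\<close> and the quadratic bound \<open>Hf\<close> applies. Elsewhere \<open>g n\<close>
    is at least \<open>1\<close> and the bound \<open>L\<close> on the gradient suffices.\<close>
  have Q: "(H x)\<^sup>2 / g n x \<le> Q" for n x
  proof (cases "f x \<le> real (Suc n)")
    case True
    then have "(H x)\<^sup>2 / g n x \<le> (H x)\<^sup>2 / f x"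
      using pos[of x] by (intro divide_left_mono mult_pos_pos g0) (auto simp: g_def)
    also have "\<dots> \<le> 4 * M" using Hf[of x] pos[of x] by (simp add: divide_le_eq)
    finally show ?thesis by (simp add: Q_def add_increasing2)
  next
    case False
    then have "g n x \<ge> 1" by (simp add: g_def)
    then have "(H x)\<^sup>2 / g n x \<le> (H x)\<^sup>2" by (simp add: divide_le_eq mult_le_cancel_left1)
    then show ?thesis using HL[of x] G(4) by (simp add: Q_def)
  qed
  have lim: "(\<lambda>n. g n x) \<longlonglongrightarrow> f x" for x
  proof (rule tendsto_eventually)
    obtain N where N: "f x < real N" "1 / f x < real N" using reals_Archimedean2 by (metis max_less_iff_conj)
    show "\<forall>\<^sub>F n in sequentially. g n x = f x"
      unfolding eventually_sequentially
    proof (intro exI allI impI)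
      fix n assume "n \<ge> N"
      then have "f x \<le> real (Suc n)" "1 / f x \<le> real (Suc n)" using N by linarith+
      then show "g n x = f x" using pos[of x] by (auto simp: g_def field_simps max_def min_def)
    qed
  qed
  have I: "integrable \<nu> (\<lambda>x. (H x)\<^sup>2 / g n x)" for n
    using Q g0 by (intro integrable_const_bound[where B=Q]) (auto simp: less_imp_le)
  have ent_le: "ent \<nu> (g n) \<le> C / 2 * (\<integral>x. (H x)\<^sup>2 / g n x \<partial>\<nu>)" for n
    using LSI adm unfolding LSI_def by blast
  have ent_Q: "ent \<nu> (g n) \<le> C / 2 * Q" for n
  proof -
    have "(\<integral>x. (H x)\<^sup>2 / g n x \<partial>\<nu>) \<le> (\<integral>x. Q \<partial>\<nu>)" by (intro integral_mono I Q) simp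
    then show ?thesis using order_trans[OF ent_le mult_left_mono[of _ Q "C / 2"]] C by (simp add: prob_space)
  qed
  have gi: "integrable \<nu> (g n)" for n
    using gb(2) g0 by (intro integrable_const_bound[where B="real (Suc n)"]) (auto simp: abs_of_pos)
  have gl: "integrable \<nu> (\<lambda>x. g n x * ln (g n x))" for n
    using mult_ln_bounded[OF _ gb] by (intro integrable_const_bound) auto
  \<comment> \<open>Since \<open>f\<close> is finite everywhere, some level \<open>k\<close> is
    exceeded only on a set of small measure. The same set serves for all \<open>n\<close> in
    \<open>integral_le_of_ent_le\<close>.\<close>
  have "(\<lambda>k. measure \<nu> {x\<in>space \<nu>. f x > real k}) \<longlonglongrightarrow> measure \<nu> (\<Inter>k. {x\<in>space \<nu>. f x > real k})"
    by (rule finite_Lim_measure_decseq) (auto simp: decseq_def)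
  moreover have "(\<Inter>k. {x\<in>space \<nu>. f x > real k}) = {}"
    by auto (metis less_asym reals_Archimedean2)
  ultimately have "\<forall>\<^sub>F k in sequentially. measure \<nu> {x\<in>space \<nu>. f x > real k} < 1 / 10"
    by (intro order_tendstoD) auto
  then obtain k where k: "measure \<nu> {x\<in>space \<nu>. f x > real k} < 1 / 10"
    by (auto simp: eventually_sequentially)
  define m where "m = 2 * (max 1 (real k) + C / 2 * Q)"
  have sp: "space \<nu> = UNIV" using sets_eq_imp_space_eq[OF \<nu>(2)] by simp
  have gm: "(\<integral>x. g n x \<partial>\<nu>) \<le> m" for n
    unfolding m_def
  proof (rule integral_le_of_ent_le[OF \<nu>(1), where A="{x\<in>space \<nu>. f x > real k}" and c="1 / real (Suc n)" and B="real (Suc n)"])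
    fix x assume "x \<notin> {x\<in>space \<nu>. f x > real k}"
    then have "f x \<le> real k" by (simp add: sp not_less)
    moreover have "1 / real (Suc n) \<le> 1" by simp
    ultimately show "g n x \<le> max 1 (real k)" unfolding g_def by linarith
  qed (use gb ent_Q k in auto)
  have fi: "integrable \<nu> f"
    by (rule integrable_of_bounded_integrals[OF gi _ gm lim]) (use g0 in \<open>auto simp: less_imp_le\<close>)
  have gm0: "(\<integral>x. g n x \<partial>\<nu>) > 0" for n
  proof -
    have "(\<integral>x. 1 / real (Suc n) \<partial>\<nu>) \<le> (\<integral>x. g n x \<partial>\<nu>)" by (intro integral_mono gi gb) simp
    then show ?thesis by (simp add: prob_space) (meson divide_pos_pos less_le_trans of_nat_0_less_iff zero_less_Suc zero_less_one add_pos_nonneg of_nat_0_le_iff)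
  qed
  \<comment> \<open>The summand \<open>1\<close> makes the truncated integrands nonnegative, because
    \<open>x * ln x \<ge> x - 1\<close>.\<close>
  have "integrable \<nu> (\<lambda>x. f x * ln (f x) + 1)"
  proof (rule integrable_of_bounded_integrals)
    show "integrable \<nu> (\<lambda>x. g n x * ln (g n x) + 1)" for n using gl by simp
    show "0 \<le> g n x * ln (g n x) + 1" for n x using mult_ln_ge[OF g0, of n x] g0[of n x] by linarith
    show "(\<lambda>n. g n x * ln (g n x) + 1) \<longlonglongrightarrow> f x * ln (f x) + 1" for x
      using pos[of x] by (intro tendsto_intros lim) auto
    show "(\<integral>x. g n x * ln (g n x) + 1 \<partial>\<nu>) \<le> C / 2 * Q + m * m + 1" for n
    proof -
      let ?m = "\<integral>x. g n x \<partial>\<nu>"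
      \<comment> \<open>The integral of \<open>g n * ln (g n)\<close> is the entropy plus this term,
        which the uniform bound on the means controls.\<close>
      have "?m * ln ?m \<le> ?m * ?m" using gm0[of n] ln_le_minus_one[OF gm0[of n]] by (intro mult_left_mono) auto
      also have "\<dots> \<le> m * m" using gm gm0 by (intro mult_mono) (auto simp: less_imp_le intro: order_trans[OF less_imp_le[OF gm0] gm])
      finally show ?thesis using ent_Q[of n] gl[of n] by (simp add: ent_def prob_space)
    qed
  qed
  from Bochner_Integration.integrable_diff[OF this, of "\<lambda>_. 1"]
  have fl: "integrable \<nu> (\<lambda>x. f x * ln (f x))" by simp
  have l1: "(\<lambda>n. \<integral>x. g n x \<partial>\<nu>) \<longlonglongrightarrow> (\<integral>x. f x \<partial>\<nu>)"
  proof (rule integral_dominated_convergence[where w="\<lambda>x. f x + 1"])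
    show "AE x in \<nu>. norm (g n x) \<le> f x + 1" for n
    proof (rule AE_I2)
      fix x
      have "1 / real (Suc n) \<le> 1" by simp
      then have "g n x \<le> f x + 1" using pos[of x] unfolding g_def by linarith
      then show "norm (g n x) \<le> f x + 1" using g0[of n x] by simp
    qed
  qed (use fi lim in auto)
  have l2: "(\<lambda>n. \<integral>x. g n x * ln (g n x) \<partial>\<nu>) \<longlonglongrightarrow> (\<integral>x. f x * ln (f x) \<partial>\<nu>)"
  proof (rule integral_dominated_convergence[where w="\<lambda>x. \<bar>f x * ln (f x)\<bar> + 1"])
    show "AE x in \<nu>. (\<lambda>n. g n x * ln (g n x)) \<longlonglongrightarrow> f x * ln (f x)"
      using pos by (intro AE_I2 tendsto_intros lim) (auto simp: less_imp_neq[symmetric])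
    show "AE x in \<nu>. norm (g n x * ln (g n x)) \<le> \<bar>f x * ln (f x)\<bar> + 1" for n
    proof (rule AE_I2)
      fix x
      \<comment> \<open>A clamp from above only lowers \<open>x * ln x\<close>, which increases for
        \<open>x \<ge> 1\<close>; a clamp from below leaves a value between \<open>-1\<close> and
        \<open>0\<close>.\<close>
      consider "g n x = f x" | "f x > real (Suc n)" "g n x = real (Suc n)" | "g n x = 1 / real (Suc n)"
      proof -
        have clamp: "max a (min b v) = v \<or> (b < v \<and> max a (min b v) = b) \<or> max a (min b v) = a" if "a \<le> b" for a b v :: real
          using that by (auto simp: max_def min_def)
        show ?thesis
          using clamp[OF order_trans[OF gb(1)[of n x] gb(2)[of n x]], of "f x"] that unfolding g_def by blast
      qed
      then show "norm (g n x * ln (g n x)) \<le> \<bar>f x * ln (f x)\<bar> + 1"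
      proof cases
        case 2
        then have "g n x * ln (g n x) \<le> f x * ln (f x)" by (intro mult_mono) auto
        moreover have "0 \<le> g n x * ln (g n x)" using 2(2) by simp
        ultimately show ?thesis unfolding real_norm_def by linarith
      next
        case 3
        have "g n x \<le> 1" using 3 by simp
        then have "g n x * ln (g n x) \<le> 0" using g0[of n x] by (simp add: mult_nonneg_nonpos)
        moreover have "-1 \<le> g n x * ln (g n x)" using mult_ln_ge[OF g0, of n x] g0[of n x] by linarith
        ultimately show ?thesis unfolding real_norm_def by linarith
      qed simp
    qed
  qed (use fl in auto)
  have "(\<integral>x. f x \<partial>\<nu>) \<noteq> 0"
  proof
    assume "(\<integral>x. f x \<partial>\<nu>) = 0"
    then have "AE x in \<nu>. f x = 0" using fi pos by (subst (asm) integral_nonneg_eq_0_iff_AE) (auto simp: less_imp_le)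
    then have "AE x in \<nu>. False"
    proof eventually_elim
      case (elim x) then show False using pos[of x] by simp
    qed
    then show False by simp
  qed
  then have l3: "(\<lambda>n. ent \<nu> (g n)) \<longlonglongrightarrow> ent \<nu> f"
    unfolding ent_def by (intro tendsto_intros l1 l2) auto
  have l4: "(\<lambda>n. \<integral>x. (H x)\<^sup>2 / g n x \<partial>\<nu>) \<longlonglongrightarrow> (\<integral>x. (H x)\<^sup>2 / f x \<partial>\<nu>)"
  proof (rule integral_dominated_convergence[where w="\<lambda>x. Q"])
    show "AE x in \<nu>. (\<lambda>n. (H x)\<^sup>2 / g n x) \<longlonglongrightarrow> (H x)\<^sup>2 / f x"
      using pos by (intro AE_I2 tendsto_intros lim) (auto simp: less_imp_neq[symmetric])
    show "AE x in \<nu>. norm ((H x)\<^sup>2 / g n x) \<le> Q" for n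
      using Q g0 by (auto simp: less_imp_le)
  qed auto
  have "ent \<nu> f \<le> C / 2 * (\<integral>x. (H x)\<^sup>2 / f x \<partial>\<nu>)"
    by (rule LIMSEQ_le[OF l3 tendsto_mult_left[OF l4]]) (use ent_le in auto)
  also have "(\<integral>x. (H x)\<^sup>2 / f x \<partial>\<nu>) = (\<integral>x. 4 * (norm (gradient (\<lambda>z. sqrt (f z)) x))\<^sup>2 \<partial>\<nu>)"
    by (intro Bochner_Integration.integral_cong) (auto simp: norm_gradient_sqrt_sq[OF df pos] H_def)
  finally show ?thesis by simp
qed

section \<open>Independent Gaussian increments\<close>

text \<open>The difference of the two sides has derivative \<open>w ^ 3 / (1 + w)\<close>, which has
  the sign of \<open>w\<close>, so its minimum is at \<open>0\<close>.\<close>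

lemma ln_le_cubic:
  fixes v :: real assumes v: "v > -1"
  shows "ln (1 + v) \<le> v - v\<^sup>2 / 2 + v ^ 3 / 3"
proof -
  define h where "h v = v - v\<^sup>2 / 2 + v ^ 3 / 3 - ln (1 + v)" for v :: real
  have d: "(h has_real_derivative w ^ 3 / (1 + w)) (at w)" if "w > -1" for w
  proof -
    have "(h has_real_derivative 1 - w + w\<^sup>2 - 1 / (1 + w)) (at w)"
      unfolding h_def[abs_def] using that by (auto intro!: derivative_eq_intros)
    moreover have "1 - w + w\<^sup>2 - 1 / (1 + w) = w ^ 3 / (1 + w)"
    proof -
      have "(1 - w + w\<^sup>2) * (1 + w) = 1 + w ^ 3" by (simp add: algebra_simps power2_eq_square power3_eq_cube)
      then have "1 - w + w\<^sup>2 = (1 + w ^ 3) / (1 + w)" using that by (simp add: eq_divide_eq)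
      then show ?thesis by (simp add: add_divide_distrib)
    qed
    ultimately show ?thesis by simp
  qed
  have "h 0 \<le> h v"
  proof (cases "v \<ge> 0")
    case True
    show ?thesis
    proof (rule DERIV_nonneg_imp_nondecreasing[OF True])
      fix w :: real assume "0 \<le> w"
      then show "\<exists>y. (h has_real_derivative y) (at w) \<and> 0 \<le> y"
        using d[of w] by (intro exI[of _ "w ^ 3 / (1 + w)"]) auto
    qed
  next
    case False
    then have "v \<le> 0" by simp
    then show ?thesis
    proof (rule DERIV_nonpos_imp_nonincreasing)
      fix w :: real assume "v \<le> w" "w \<le> 0"
      then show "\<exists>y. (h has_real_derivative y) (at w) \<and> y \<le> 0"
        using d[of w] v by (intro exI[of _ "w ^ 3 / (1 + w)"]) (auto simp: divide_le_0_iff power_le_zero_eq)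
    qed
  qed
  then show ?thesis by (simp add: h_def)
qed

text \<open>Expansion around \<open>m\<close> in the relative deviation \<open>v\<close>. The
  coefficient \<open>1 / (2 * m)\<close> is exact because it determines the final constant; the
  cubic remainder is uniform for values between \<open>c\<close> and \<open>B\<close>.\<close>

lemma entropy_integrand_le:
  fixes F m :: real
  assumes c: "0 < c" "c \<le> F" "c \<le> m" "F \<le> B" "m \<le> B"
  shows "F * ln F - F * ln m - F + m \<le> (F - m)\<^sup>2 / (2 * m) + (1 + B / c) / c\<^sup>2 * \<bar>F - m\<bar> ^ 3"
proof -
  define v where "v = (F - m) / m"
  have m: "m > 0" "F > 0" using c by auto
  have F: "F = m * (1 + v)" using m by (simp add: v_def field_simps)
  have v1: "1 + v > 0" using F m by (simp add: zero_less_mult_iff)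
  have vB: "\<bar>v\<bar> \<le> B / c"
  proof -
    have "\<bar>F - m\<bar> \<le> B" using c m by auto
    then show ?thesis unfolding v_def abs_divide using c m by (intro frac_le) auto
  qed
  have Bc: "0 \<le> B / c" using vB by linarith
  have lnF: "ln F = ln m + ln (1 + v)" unfolding F by (subst ln_mult) (use m(1) v1 in auto)
  have "F * ln F - F * ln m - F + m = F * ln (1 + v) - F + m" by (simp add: lnF distrib_left)
  also have "\<dots> = m * ((1 + v) * ln (1 + v) - v)" unfolding F by (simp add: algebra_simps)
  also have "\<dots> \<le> m * ((1 + v) * (v - v\<^sup>2 / 2 + v ^ 3 / 3) - v)"
    using m v1 ln_le_cubic[of v] by (intro mult_left_mono diff_right_mono) auto
  also have "(1 + v) * (v - v\<^sup>2 / 2 + v ^ 3 / 3) - v = v\<^sup>2 / 2 - v ^ 3 / 6 + v ^ 4 / 3"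
    by (simp add: field_simps power2_eq_square power3_eq_cube power4_eq_xxxx)
  also have "\<dots> \<le> v\<^sup>2 / 2 + (1 + B / c) * \<bar>v\<bar> ^ 3"
  proof -
    \<comment> \<open>The quartic term is reduced to a cubic one by the bound \<open>B / c\<close>
      on |v|.\<close>
    have "v ^ 4 = \<bar>v\<bar> * \<bar>v\<bar> ^ 3" by (simp add: power3_eq_cube power4_eq_xxxx)
    also have "\<dots> \<le> B / c * \<bar>v\<bar> ^ 3" using vB by (intro mult_right_mono) auto
    finally have "v ^ 4 \<le> B / c * \<bar>v\<bar> ^ 3" .
    moreover have "- (v ^ 3) \<le> \<bar>v\<bar> ^ 3" by (metis abs_le_D2 order_refl power_abs)
    moreover have "0 \<le> B / c * \<bar>v\<bar> ^ 3" by (rule mult_nonneg_nonneg[OF Bc]) simp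
    moreover have "0 \<le> \<bar>v\<bar> ^ 3" by simp
    ultimately show ?thesis unfolding distrib_right mult_1_left by linarith
  qed
  also have "m * (v\<^sup>2 / 2 + (1 + B / c) * \<bar>v\<bar> ^ 3) = (F - m)\<^sup>2 / (2 * m) + (1 + B / c) / m\<^sup>2 * \<bar>F - m\<bar> ^ 3"
    using m by (simp add: v_def power_divide abs_divide) (simp add: field_simps power2_eq_square power3_eq_cube)
  also have "\<dots> \<le> (F - m)\<^sup>2 / (2 * m) + (1 + B / c) / c\<^sup>2 * \<bar>F - m\<bar> ^ 3"
    using c Bc by (intro add_left_mono mult_right_mono frac_le power_mono) auto
  finally show ?thesis using m by (simp add: mult_left_mono)
qed

text \<open>The mean minimizes the right-hand side over \<open>m\<close>; any other \<open>m\<close> may be used for an upper bound.\<close>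

lemma ent_le_relative:
  assumes N: "prob_space N" and int: "integrable N F" "integrable N (\<lambda>z. F z * ln (F z))"
    and pos: "(\<integral>z. F z \<partial>N) > 0" and m: "m > 0"
  shows "ent N F \<le> (\<integral>z. F z * ln (F z) - F z * ln m - F z + m \<partial>N)"
proof -
  interpret prob_space N by fact
  let ?e = "\<integral>z. F z \<partial>N"
  have "?e * ln m - ?e * ln ?e + ?e - m \<le> 0"
    using Young_ln[OF pos m, of 0] by simp
  moreover have "(\<integral>z. F z * ln (F z) - F z * ln m - F z + m \<partial>N) = (\<integral>z. F z * ln (F z) \<partial>N) - ?e * ln m - ?e + m"
    using int by (simp add: prob_space)
  ultimately show ?thesis by (simp add: ent_def)
qed

text \<open>A function with a candidate derivative \<open>D\<close> and explicit constants. The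
  constants are parameters because the error of one Gaussian step has to be uniform over all
  functions produced by repeated averaging.\<close>

definition C11 :: "real \<Rightarrow> real \<Rightarrow> real \<Rightarrow> real \<Rightarrow> (real^'d::finite \<Rightarrow> real) \<Rightarrow> (real^'d \<Rightarrow> real^'d) \<Rightarrow> bool" where
  "C11 c B L M f D \<longleftrightarrow> 0 < c \<and> 0 < M \<and> (\<forall>x. c \<le> f x \<and> f x \<le> B \<and> norm (D x) \<le> L) \<and> lip L f \<and> lip M D \<and>
     (\<forall>x u. \<bar>f (x + u) - f x - D x \<bullet> u\<bar> \<le> M * (norm u)\<^sup>2)"

lemma C11D:
  assumes "C11 c B L M f D"
  shows "0 < c" "0 < M" "c \<le> f x" "f x \<le> B" "norm (D x) \<le> L" "lip L f" "lip M D" "0 \<le> L"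
    "\<bar>f (x + u) - f x - D x \<bullet> u\<bar> \<le> M * (norm u)\<^sup>2" "0 < f x"
    "f \<in> borel_measurable borel" "D \<in> borel_measurable borel" "\<bar>f x\<bar> \<le> B"
proof -
  show 1: "0 < c" "0 < M" "c \<le> f x" "f x \<le> B" "norm (D x) \<le> L" "lip L f" "lip M D"
    "\<bar>f (x + u) - f x - D x \<bullet> u\<bar> \<le> M * (norm u)\<^sup>2"
    using assms unfolding C11_def by auto
  show "0 \<le> L" by (rule lip_nonneg[OF 1(6)])
  show "0 < f x" using 1(1,3) by linarith
  then show "\<bar>f x\<bar> \<le> B" using 1 by simp
  show "f \<in> borel_measurable borel" "D \<in> borel_measurable borel" using 1(6,7) by (auto intro: lip_measurable)
qed

lemma C11_of_Cb_infty:
  assumes "f \<in> Cb_infty" "0 < c" "\<And>x. c \<le> f x" "\<And>x. f x \<le> B"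
  obtains L M where "C11 c B L M f (gradient f)"
  using Cb_infty_gradient[OF assms(1)] assms(2-4) unfolding C11_def by metis

lemma C11_admissible:
  assumes "C11 c B L M f D"
  shows "admissible f (\<lambda>x. norm (D x))"
  unfolding admissible_def
proof (intro conjI exI allI)
  note C = C11D[OF assms]
  show "slope_bound f (\<lambda>x. norm (D x))" using C(9) by (rule slope_bound_norm_gradient)
  show "0 < c" "c \<le> f x" for x using C by auto
  show "f x \<le> max B L" "norm (D x) \<le> max B L" for x using C(4)[of x] C(5)[of x] by auto
  show "lip (max L M) f" using C(6) by (rule lip_mono) simp
  show "lip (max L M) (\<lambda>x. norm (D x))"
    using lip_mono[OF C(7), of "max L M"] unfolding lip_def
    by (auto intro: order_trans[OF norm_triangle_ineq3])
qed simp

section \<open>Averages over random translations\<close>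

context
  fixes N :: "'z measure" and \<zeta> :: "'z \<Rightarrow> real^'d::finite"
  assumes N: "prob_space N" and \<zeta>[measurable]: "\<zeta> \<in> borel_measurable N"
begin

interpretation prob_space N by (rule N)

lemma C11_integrable:
  assumes "C11 c B L M f D"
  shows "integrable N (\<lambda>z. f (y + \<zeta> z))" "integrable N (\<lambda>z. D (y + \<zeta> z))"
    "integrable N (\<lambda>z. (norm (D (y + \<zeta> z)))\<^sup>2 / f (y + \<zeta> z))"
proof -
  note C = C11D[OF assms]
  note C(11,12)[measurable]
  show "integrable N (\<lambda>z. f (y + \<zeta> z))" using C(13) by (intro integrable_const_bound[where B=B]) auto
  show "integrable N (\<lambda>z. D (y + \<zeta> z))" using C(5) by (intro integrable_const_bound[where B=L]) auto
  have "(norm (D x))\<^sup>2 / f x \<le> L\<^sup>2 / c" for x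
    using C(1,8) C(3)[of x] C(5)[of x] by (intro frac_le power_mono) auto
  then show "integrable N (\<lambda>z. (norm (D (y + \<zeta> z)))\<^sup>2 / f (y + \<zeta> z))"
    using C(10) by (intro integrable_const_bound[where B="L\<^sup>2 / c"]) (auto simp: less_imp_le)
qed

text \<open>Each defining inequality is stable under averaging over translations, with unchanged
  constants. The field \<open>D\<close> is averaged along with \<open>f\<close>, so no derivative of
  an integral has to be taken.\<close>

lemma C11_convolution:
  assumes "C11 c B L M f D"
  shows "C11 c B L M (\<lambda>y. \<integral>z. f (y + \<zeta> z) \<partial>N) (\<lambda>y. \<integral>z. D (y + \<zeta> z) \<partial>N)"
  unfolding C11_def
proof (intro conjI allI)
  note C = C11D[OF assms]
  note I = C11_integrable[OF assms]
  show "0 < c" "0 < M" by (fact C)+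
  fix x u
  have "(\<integral>z. c \<partial>N) \<le> (\<integral>z. f (x + \<zeta> z) \<partial>N)" by (intro integral_mono I C) simp
  then show "c \<le> (\<integral>z. f (x + \<zeta> z) \<partial>N)" by (simp add: prob_space)
  have "(\<integral>z. f (x + \<zeta> z) \<partial>N) \<le> (\<integral>z. B \<partial>N)" by (intro integral_mono I C) simp
  then show "(\<integral>z. f (x + \<zeta> z) \<partial>N) \<le> B" by (simp add: prob_space)
  have "norm (\<integral>z. D (x + \<zeta> z) \<partial>N) \<le> (\<integral>z. norm (D (x + \<zeta> z)) \<partial>N)" by (rule integral_norm_bound)
  also have "\<dots> \<le> (\<integral>z. L \<partial>N)" by (intro integral_mono integrable_norm I C) simp
  finally show "norm (\<integral>z. D (x + \<zeta> z) \<partial>N) \<le> L" by (simp add: prob_space)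
  have "\<bar>(\<integral>z. f (x + u + \<zeta> z) \<partial>N) - (\<integral>z. f (x + \<zeta> z) \<partial>N) - (\<integral>z. D (x + \<zeta> z) \<partial>N) \<bullet> u\<bar>
     = \<bar>\<integral>z. f (x + u + \<zeta> z) - f (x + \<zeta> z) - D (x + \<zeta> z) \<bullet> u \<partial>N\<bar>"
    using I by simp
  also have "\<dots> \<le> (\<integral>z. \<bar>f (x + u + \<zeta> z) - f (x + \<zeta> z) - D (x + \<zeta> z) \<bullet> u\<bar> \<partial>N)" by (rule integral_abs_bound)
  also have "\<dots> \<le> (\<integral>z. M * (norm u)\<^sup>2 \<partial>N)"
  proof (rule integral_mono)
    show "\<bar>f (x + u + \<zeta> z) - f (x + \<zeta> z) - D (x + \<zeta> z) \<bullet> u\<bar> \<le> M * (norm u)\<^sup>2" for z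
      using C(9)[of "x + \<zeta> z" u] by (simp add: add_ac)
  qed (use I in auto)
  finally show "\<bar>(\<integral>z. f (x + u + \<zeta> z) \<partial>N) - (\<integral>z. f (x + \<zeta> z) \<partial>N) - (\<integral>z. D (x + \<zeta> z) \<partial>N) \<bullet> u\<bar> \<le> M * (norm u)\<^sup>2"
    by (simp add: prob_space)
next
  note C = C11D[OF assms]
  note I = C11_integrable[OF assms]
  show "lip L (\<lambda>y. \<integral>z. f (y + \<zeta> z) \<partial>N)"
    unfolding lip_def
  proof (intro allI)
    fix x y
    have "norm ((\<integral>z. f (x + \<zeta> z) \<partial>N) - (\<integral>z. f (y + \<zeta> z) \<partial>N)) = norm (\<integral>z. f (x + \<zeta> z) - f (y + \<zeta> z) \<partial>N)"
      using I by simp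
    also have "\<dots> \<le> (\<integral>z. norm (f (x + \<zeta> z) - f (y + \<zeta> z)) \<partial>N)" by (rule integral_norm_bound)
    also have "\<dots> \<le> (\<integral>z. L * norm (x - y) \<partial>N)"
    proof (rule integral_mono)
      show "norm (f (x + \<zeta> z) - f (y + \<zeta> z)) \<le> L * norm (x - y)" for z
        using C(6) unfolding lip_def by (metis add_diff_cancel_right)
    qed (use I in auto)
    finally show "norm ((\<integral>z. f (x + \<zeta> z) \<partial>N) - (\<integral>z. f (y + \<zeta> z) \<partial>N)) \<le> L * norm (x - y)"
      by (simp add: prob_space)
  qed
  show "lip M (\<lambda>y. \<integral>z. D (y + \<zeta> z) \<partial>N)"
    unfolding lip_def
  proof (intro allI)
    fix x y
    have "norm ((\<integral>z. D (x + \<zeta> z) \<partial>N) - (\<integral>z. D (y + \<zeta> z) \<partial>N)) = norm (\<integral>z. D (x + \<zeta> z) - D (y + \<zeta> z) \<partial>N)"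
      using I by simp
    also have "\<dots> \<le> (\<integral>z. norm (D (x + \<zeta> z) - D (y + \<zeta> z)) \<partial>N)" by (rule integral_norm_bound)
    also have "\<dots> \<le> (\<integral>z. M * norm (x - y) \<partial>N)"
    proof (rule integral_mono)
      show "norm (D (x + \<zeta> z) - D (y + \<zeta> z)) \<le> M * norm (x - y)" for z
        using C(7) unfolding lip_def by (metis add_diff_cancel_right)
    qed (use I in auto)
    finally show "norm ((\<integral>z. D (x + \<zeta> z) \<partial>N) - (\<integral>z. D (y + \<zeta> z) \<partial>N)) \<le> M * norm (x - y)"
      by (simp add: prob_space)
  qed
qed

text \<open>Joint convexity of a^2 / b for positive b, used in the form that a^2 / b is the maximum
  over \<open>t\<close> of the linear expressions \<open>2 * t * a - t\<^sup>2 * b\<close>.\<close>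

lemma C11_Cauchy_Schwarz:
  assumes "C11 c B L M f D"
  shows "(norm (\<integral>z. D (y + \<zeta> z) \<partial>N))\<^sup>2 / (\<integral>z. f (y + \<zeta> z) \<partial>N) \<le> (\<integral>z. (norm (D (y + \<zeta> z)))\<^sup>2 / f (y + \<zeta> z) \<partial>N)"
proof -
  note C = C11D[OF assms]
  note I = C11_integrable[OF assms]
  let ?F = "\<integral>z. f (y + \<zeta> z) \<partial>N" and ?A = "\<integral>z. norm (D (y + \<zeta> z)) \<partial>N"
  have F: "?F > 0" using C11D(10)[OF C11_convolution[OF assms]] .
  \<comment> \<open>The value of \<open>t\<close> for which the linear bound is an equality at the
    averaged pair.\<close>
  define t where "t = ?A / ?F"
  have 1: "2 * t * a - t\<^sup>2 * b \<le> a\<^sup>2 / b" if "b > 0" for a b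
  proof -
    have "0 \<le> (a - t * b)\<^sup>2 / b" using that by simp
    also have "\<dots> = a\<^sup>2 / b - (2 * t * a - t\<^sup>2 * b)" using that by (simp add: field_simps power2_eq_square)
    finally show ?thesis by simp
  qed
  have "(norm (\<integral>z. D (y + \<zeta> z) \<partial>N))\<^sup>2 / ?F \<le> ?A\<^sup>2 / ?F"
    using F by (intro divide_right_mono power_mono integral_norm_bound) auto
  also have "\<dots> = 2 * t * ?A - t\<^sup>2 * ?F"
    using F by (simp add: t_def field_simps power2_eq_square)
  also have "\<dots> = (\<integral>z. 2 * t * norm (D (y + \<zeta> z)) - t\<^sup>2 * f (y + \<zeta> z) \<partial>N)"
    using I by simp
  also have "\<dots> \<le> (\<integral>z. (norm (D (y + \<zeta> z)))\<^sup>2 / f (y + \<zeta> z) \<partial>N)"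
    using I 1[OF C(10)] by (intro integral_mono) auto
  finally show ?thesis .
qed

end

text \<open>Allows the Fisher integrand at a point to be exchanged for its Gaussian average around
  that point at a cost of order \<open>s\<close>.\<close>

lemma C11_quotient_lip:
  assumes "C11 c B L M f D"
  shows "lip (2 * L * M / c + L ^ 3 / c\<^sup>2) (\<lambda>x. (norm (D x))\<^sup>2 / f x)"
  unfolding lip_def
proof (intro allI)
  note C = C11D[OF assms]
  fix x y
  let ?a = "norm (D x)" and ?b = "norm (D y)"
  have 1: "\<bar>?a\<^sup>2 - ?b\<^sup>2\<bar> \<le> 2 * L * M * norm (x - y)"
  proof -
    have "\<bar>?a\<^sup>2 - ?b\<^sup>2\<bar> = \<bar>?a - ?b\<bar> * (?a + ?b)"
    proof -
      have "?a\<^sup>2 - ?b\<^sup>2 = (?a - ?b) * (?a + ?b)" by (simp add: power2_eq_square algebra_simps)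
      then show ?thesis by (simp only: abs_mult abs_of_nonneg[OF add_nonneg_nonneg[OF norm_ge_zero norm_ge_zero]])
    qed
    also have "\<dots> \<le> (M * norm (x - y)) * (L + L)"
    proof (rule mult_mono)
      show "\<bar>?a - ?b\<bar> \<le> M * norm (x - y)"
        using C(7) norm_triangle_ineq3[of "D x" "D y"] unfolding lip_def by (meson order_trans)
      show "?a + ?b \<le> L + L" using C(5) by (intro add_mono)
    qed (use C(2) in auto)
    finally show ?thesis by (simp add: mult_ac)
  qed
  have 2: "\<bar>1 / f x - 1 / f y\<bar> \<le> L * norm (x - y) / c\<^sup>2"
  proof -
    have "1 / f x - 1 / f y = (f y - f x) / (f x * f y)" using C(10)[of x] C(10)[of y] by (simp add: field_simps)
    then have "\<bar>1 / f x - 1 / f y\<bar> = \<bar>f x - f y\<bar> / (f x * f y)" using C(10)[of x] C(10)[of y] by (simp add: abs_minus_commute abs_mult)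
    also have "\<dots> \<le> L * norm (x - y) / c\<^sup>2"
    proof (rule frac_le)
      show "\<bar>f x - f y\<bar> \<le> L * norm (x - y)" using C(6) unfolding lip_def by simp
      show "c\<^sup>2 \<le> f x * f y" unfolding power2_eq_square using C(1,3,10) by (intro mult_mono) (auto simp: less_imp_le)
    qed (use C(1,8) in auto)
    finally show ?thesis .
  qed
  have "?a\<^sup>2 / f x - ?b\<^sup>2 / f y = (?a\<^sup>2 - ?b\<^sup>2) * (1 / f x) + ?b\<^sup>2 * (1 / f x - 1 / f y)" by (simp add: algebra_simps)
  then have "\<bar>?a\<^sup>2 / f x - ?b\<^sup>2 / f y\<bar> \<le> \<bar>?a\<^sup>2 - ?b\<^sup>2\<bar> * (1 / f x) + ?b\<^sup>2 * \<bar>1 / f x - 1 / f y\<bar>"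
    using C(10)[of x] abs_triangle_ineq[of "(?a\<^sup>2 - ?b\<^sup>2) * (1 / f x)" "?b\<^sup>2 * (1 / f x - 1 / f y)"] by (simp add: abs_mult)
  also have "\<dots> \<le> (2 * L * M * norm (x - y)) * (1 / c) + L\<^sup>2 * (L * norm (x - y) / c\<^sup>2)"
  proof (intro add_mono mult_mono 1 2)
    show "1 / f x \<le> 1 / c" using C(1) C(3)[of x] by (simp add: frac_le)
    show "?b\<^sup>2 \<le> L\<^sup>2" using C(5) by (intro power_mono) auto
  qed (use C(1,2,8) C(10)[of x] in \<open>auto simp: less_imp_le\<close>)
  finally show "norm (?a\<^sup>2 / f x - ?b\<^sup>2 / f y) \<le> (2 * L * M / c + L ^ 3 / c\<^sup>2) * norm (x - y)"
    by (simp add: algebra_simps power2_eq_square power3_eq_cube)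
qed

text \<open>Interpolated from the fourth moment by
  \<open>norm z ^ 3 \<le> s ^ 3 + norm z ^ 4 / s\<close>, which keeps the order
  \<open>s ^ 3\<close>.\<close>

lemma gauss_third_moment:
  assumes s: "s > 0"
  shows "integrable (gauss s) (\<lambda>z::real^'n::finite. norm z ^ 3)"
    and "(\<integral>z. norm (z::real^'n) ^ 3 \<partial>gauss s) \<le> (1 + 3 * (real CARD('n))\<^sup>2) * s ^ 3"
proof -
  interpret prob_space "gauss s :: (real^'n) measure" using s by (rule prob_space_gauss)
  have i4: "integrable (gauss s) (\<lambda>z::real^'n. s ^ 3 + norm z ^ 4 / s)"
    using gauss_moments(1)[OF s, where 'n='n] by simp
  have le: "norm z ^ 3 \<le> s ^ 3 + norm z ^ 4 / s" for z :: "real^'n"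
  proof (cases "norm z \<le> s")
    case True
    then have "norm z ^ 3 \<le> s ^ 3" by (intro power_mono) auto
    then show ?thesis using s by (simp add: add_increasing2)
  next
    case False
    then have "norm z ^ 3 * s \<le> norm z ^ 3 * norm z" by (intro mult_left_mono) auto
    then have "norm z ^ 3 \<le> norm z ^ 4 / s" using s by (simp add: pos_le_divide_eq power3_eq_cube power4_eq_xxxx)
    then show ?thesis using s by (simp add: add_increasing)
  qed
  show i: "integrable (gauss s) (\<lambda>z::real^'n. norm z ^ 3)"
    by (rule Bochner_Integration.integrable_bound[OF i4]) (use le in \<open>auto intro!: AE_I2 intro: order_trans[OF _ abs_ge_self]\<close>)
  have "(\<integral>z. norm (z::real^'n) ^ 3 \<partial>gauss s) \<le> (\<integral>z. s ^ 3 + norm (z::real^'n) ^ 4 / s \<partial>gauss s)"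
    by (rule integral_mono[OF i i4 le])
  also have "\<dots> = s ^ 3 + (\<integral>z. norm (z::real^'n) ^ 4 \<partial>gauss s) / s"
    using gauss_moments(1)[OF s, where 'n='n] prob_space[simplified] by simp
  also have "\<dots> \<le> s ^ 3 + (3 * (real CARD('n))\<^sup>2 * s ^ 4) / s"
    using gauss_moments(2)[OF s, where 'n='n] s by (intro add_left_mono divide_right_mono) auto
  finally show "(\<integral>z. norm (z::real^'n) ^ 3 \<partial>gauss s) \<le> (1 + 3 * (real CARD('n))\<^sup>2) * s ^ 3"
    using s by (simp add: algebra_simps power3_eq_cube power4_eq_xxxx)
qed

section \<open>Matrices and the entropy of one Gaussian step\<close>

lemma borel_measurable_vec_nth [measurable (raw)]:
  fixes f :: "'a \<Rightarrow> ('b::euclidean_space)^'m::finite"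
  assumes "f \<in> borel_measurable N"
  shows "(\<lambda>x. f x $ i) \<in> borel_measurable N"
  by (rule measurable_compose[OF assms]) (intro borel_measurable_continuous_onI continuous_intros)

lemma borel_measurable_matrix_vector_mult [measurable (raw)]:
  fixes A :: "'a \<Rightarrow> real^'m::finite^'d::finite"
  assumes [measurable]: "A \<in> borel_measurable N" "g \<in> borel_measurable N"
  shows "(\<lambda>x. A x *v g x) \<in> borel_measurable N"
proof (subst borel_measurable_euclidean_space, rule ballI)
  fix b :: "real^'d" assume "b \<in> Basis"
  then obtain p where "b = axis p 1" by (auto simp: Basis_vec_def)
  then have "(A x *v g x) \<bullet> b = (\<Sum>q\<in>UNIV. A x $ p $ q * g x $ q)" for x
    by (simp add: inner_axis matrix_vector_mult_def)
  then show "(\<lambda>x. (A x *v g x) \<bullet> b) \<in> borel_measurable N" by simp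
qed

lemma inner_gram_eq:
  fixes \<xi> :: "real^'n::finite^'d::finite"
  shows "v \<bullet> ((\<xi> ** transpose \<xi>) *v v) = (norm (v v* \<xi>))\<^sup>2"
proof -
  have "(norm (v v* \<xi>))\<^sup>2 = (v v* \<xi>) \<bullet> (v v* \<xi>)" by (simp add: power2_norm_eq_inner)
  also have "\<dots> = v \<bullet> (\<xi> *v (v v* \<xi>))" by (rule dot_lmul_matrix)
  also have "\<xi> *v (v v* \<xi>) = \<xi> *v (transpose \<xi> *v v)" by simp
  also have "\<dots> = (\<xi> ** transpose \<xi>) *v v" by (rule matrix_vector_mul_assoc)
  finally show ?thesis by simp
qed

lemma norm_vector_matrix_sq_le:
  fixes \<xi> :: "real^'n::finite^'d::finite"
  assumes "loewner_le (\<xi> ** transpose \<xi>) (\<delta> *\<^sub>R mat 1)"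
  shows "(norm (v v* \<xi>))\<^sup>2 \<le> \<delta> * (norm v)\<^sup>2"
proof -
  have "(norm (v v* \<xi>))\<^sup>2 = v \<bullet> ((\<xi> ** transpose \<xi>) *v v)" by (rule inner_gram_eq[symmetric])
  also have "\<dots> \<le> v \<bullet> ((\<delta> *\<^sub>R mat 1) *v v)"
    using assms unfolding loewner_le_def by blast
  also have "\<dots> = \<delta> * (norm v)\<^sup>2"
    by (simp add: scaleR_matrix_vector_assoc[symmetric] power2_norm_eq_inner)
  finally show ?thesis .
qed

text \<open>The entropy is bounded relative to the central value \<open>f y\<close> and expanded to
  second order. The linear part of \<open>f\<close> contributes at most
  \<open>s\<^sup>2 * \<delta> * (norm (D y))\<^sup>2 / (2 * f y)\<close>; everything else is of
  order \<open>s ^ 3\<close>. \<open>K\<close> is chosen before the inner \<open>f\<close> and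
  \<open>D\<close>, so it is uniform over the class; the outer pair supplies the signs of the
  constants.\<close>

lemma gauss_ent_step:
  fixes \<xi> :: "real^'n::finite^'d::finite"
  assumes C11: "C11 c B L M f D" and \<xi>: "loewner_le (\<xi> ** transpose \<xi>) (\<delta> *\<^sub>R mat 1)" and \<delta>: "0 \<le> \<delta>"
  shows "\<exists>K\<ge>0. \<forall>f D. C11 c B L M f D \<longrightarrow> (\<forall>s>0. \<forall>y. ent (gauss s) (\<lambda>z. f (y + \<xi> *v z)) \<le>
      s\<^sup>2 * \<delta> / 2 * (\<integral>z. (norm (D (y + \<xi> *v z)))\<^sup>2 / f (y + \<xi> *v z) \<partial>gauss s) + K * s ^ 3)"
proof -
  obtain k where k: "k > 0" "\<And>z. norm (\<xi> *v z) \<le> norm z * k"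
    using bounded_linear.pos_bounded[OF matrix_vector_mul_bounded_linear[of \<xi>]] by blast
  define Q where "Q = 2 * L * M / c + L ^ 3 / c\<^sup>2"
  define n where "n = real CARD('n)"
  define R where "R = M * L * k ^ 3 / c + (1 + B / c) / c\<^sup>2 * (L * k) ^ 3"
  define K where "K = R * (1 + 3 * n\<^sup>2) + \<delta> / 2 * (Q * k * (1 + n))"
  have c: "0 < c" "0 < M" "0 \<le> L" "0 \<le> B" using C11D(1,2,8,13)[OF C11] by (auto intro: order_trans[OF abs_ge_zero])
  have R0: "R \<ge> 0" and Q0: "Q \<ge> 0" using c k by (auto simp: R_def Q_def)
  have K0: "K \<ge> 0" unfolding K_def using c k \<delta> R0 Q0 by (auto intro!: add_nonneg_nonneg mult_nonneg_nonneg simp: n_def)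
  have main: "ent (gauss s) (\<lambda>z. f (y + \<xi> *v z)) \<le>
      s\<^sup>2 * \<delta> / 2 * (\<integral>z. (norm (D (y + \<xi> *v z)))\<^sup>2 / f (y + \<xi> *v z) \<partial>gauss s) + K * s ^ 3"
    if A: "C11 c B L M f D" and s: "s > 0" for f D s y
  proof -
    interpret prob_space "gauss s :: (real^'n) measure" using s by (rule prob_space_gauss)
    note C = C11D[OF A]
    have \<zeta>[measurable]: "(\<lambda>z. \<xi> *v z) \<in> borel_measurable (gauss s)" by measurable
    note C(11,12)[measurable]
    note I = C11_integrable[OF prob_space_axioms \<zeta> A, of y]
    let ?F = "\<lambda>z. f (y + \<xi> *v z)" and ?m = "f y" and ?w = "\<lambda>z. \<xi> *v z"
    have il: "integrable (gauss s) (\<lambda>z. ?F z * ln (?F z))"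
      using mult_ln_bounded[OF C(1,3,4)] by (intro integrable_const_bound[where B="B * (\<bar>ln c\<bar> + \<bar>ln B\<bar>)"]) auto
    have eF: "(\<integral>z. ?F z \<partial>gauss s) > 0" using C11D(10)[OF C11_convolution[OF prob_space_axioms \<zeta> A]] .
    have w3: "norm (?w z) ^ 3 \<le> k ^ 3 * norm z ^ 3" for z
      using power_mono[OF k(2)[of z], of 3] by (simp add: power_mult_distrib mult.commute)
    \<comment> \<open>The increment \<open>?d\<close> of \<open>f\<close> is replaced by its linear
      part \<open>?e\<close>. Both are of first order and differ by second order, so their squares
      differ by third order.\<close>
    have pt: "?F z * ln (?F z) - ?F z * ln ?m - ?F z + ?m \<le> (D y \<bullet> ?w z)\<^sup>2 / (2 * ?m) + R * norm z ^ 3" for z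
    proof -
      let ?d = "?F z - ?m" and ?e = "D y \<bullet> ?w z"
      have d1: "\<bar>?d\<bar> \<le> L * norm (?w z)" using C(6) unfolding lip_def by (metis add_diff_cancel_left' real_norm_def)
      have e1: "\<bar>?e\<bar> \<le> L * norm (?w z)"
        using Cauchy_Schwarz_ineq2[of "D y" "?w z"] mult_right_mono[OF C(5)[of y], of "norm (?w z)"] by simp
      have de: "\<bar>?d - ?e\<bar> \<le> M * (norm (?w z))\<^sup>2" using C(9)[of y "?w z"] by simp
      have "?d\<^sup>2 - ?e\<^sup>2 = (?d - ?e) * (?d + ?e)" by (simp add: power2_eq_square algebra_simps)
      also have "\<dots> \<le> \<bar>?d - ?e\<bar> * \<bar>?d + ?e\<bar>" by (metis abs_ge_self abs_mult)
      also have "\<dots> \<le> (M * (norm (?w z))\<^sup>2) * (2 * (L * norm (?w z)))"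
        using de d1 e1 c by (intro mult_mono) (auto intro: mult_nonneg_nonneg)
      also have "\<dots> = 2 * M * L * norm (?w z) ^ 3" by (simp add: power2_eq_square power3_eq_cube)
      finally have d2: "?d\<^sup>2 \<le> ?e\<^sup>2 + 2 * M * L * norm (?w z) ^ 3" by simp
      have "?d\<^sup>2 / (2 * ?m) \<le> (?e\<^sup>2 + 2 * M * L * norm (?w z) ^ 3) / (2 * ?m)"
        using d2 C(10)[of y] by (intro divide_right_mono) auto
      also have "\<dots> = ?e\<^sup>2 / (2 * ?m) + (M * L * norm (?w z) ^ 3) / ?m" by (simp add: add_divide_distrib)
      also have "(M * L * norm (?w z) ^ 3) / ?m \<le> (M * L * (k ^ 3 * norm z ^ 3)) / c"
        using C(1) C(3)[of y] c w3[of z] k(1) by (intro frac_le mult_left_mono) auto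
      finally have 1: "?d\<^sup>2 / (2 * ?m) \<le> ?e\<^sup>2 / (2 * ?m) + M * L * k ^ 3 / c * norm z ^ 3" by (simp add: mult_ac)
      have "\<bar>?d\<bar> ^ 3 \<le> (L * (norm z * k)) ^ 3"
        using order_trans[OF d1 mult_left_mono[OF k(2)[of z] c(3)]] by (intro power_mono) auto
      then have 2: "(1 + B / c) / c\<^sup>2 * \<bar>?d\<bar> ^ 3 \<le> (1 + B / c) / c\<^sup>2 * ((L * k) ^ 3 * norm z ^ 3)"
        using c by (intro mult_left_mono) (auto simp: power_mult_distrib mult_ac)
      have "?F z * ln (?F z) - ?F z * ln ?m - ?F z + ?m \<le> ?d\<^sup>2 / (2 * ?m) + (1 + B / c) / c\<^sup>2 * \<bar>?d\<bar> ^ 3"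
        by (rule entropy_integrand_le[OF C(1) C(3) C(3) C(4) C(4)])
      then show ?thesis using 1 2 unfolding R_def distrib_right mult.assoc by linarith
    qed
    have q: "has_bochner_integral (gauss s) (\<lambda>z. (D y \<bullet> ?w z)\<^sup>2) (s\<^sup>2 * (norm (D y v* \<xi>))\<^sup>2)"
      using gauss_moments(3)[OF s, of "D y v* \<xi>"] by (simp add: dot_lmul_matrix)
    have n3: "integrable (gauss s) (\<lambda>z::real^'n. norm z ^ 3)" "(\<integral>z. norm (z::real^'n) ^ 3 \<partial>gauss s) \<le> (1 + 3 * n\<^sup>2) * s ^ 3"
      using gauss_third_moment[OF s, where 'n='n] by (auto simp: n_def)
    have "ent (gauss s) ?F \<le> (\<integral>z. ?F z * ln (?F z) - ?F z * ln ?m - ?F z + ?m \<partial>gauss s)"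
      by (rule ent_le_relative[OF prob_space_axioms I(1) il eF C(10)])
    also have "\<dots> \<le> (\<integral>z. (D y \<bullet> ?w z)\<^sup>2 / (2 * ?m) + R * norm z ^ 3 \<partial>gauss s)"
      using I(1) il q n3(1) pt by (intro integral_mono) (auto simp: has_bochner_integral_iff)
    also have "\<dots> = (s\<^sup>2 * (norm (D y v* \<xi>))\<^sup>2) / (2 * ?m) + R * (\<integral>z. norm (z::real^'n) ^ 3 \<partial>gauss s)"
      using q n3(1) by (simp add: has_bochner_integral_iff)
    also have "\<dots> \<le> (s\<^sup>2 * (\<delta> * (norm (D y))\<^sup>2)) / (2 * ?m) + R * ((1 + 3 * n\<^sup>2) * s ^ 3)"
      using norm_vector_matrix_sq_le[OF \<xi>, of "D y"] C(10)[of y] R0 n3(2)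
      by (intro add_mono divide_right_mono mult_left_mono) auto
    also have "(s\<^sup>2 * (\<delta> * (norm (D y))\<^sup>2)) / (2 * ?m) = s\<^sup>2 * \<delta> / 2 * ((norm (D y))\<^sup>2 / ?m)" by simp
    \<comment> \<open>The value at \<open>y\<close> is traded for the Gaussian average. The error is
      linear in \<open>s\<close>, hence of order \<open>s ^ 3\<close> after multiplication by
      \<open>s\<^sup>2\<close>.\<close>
    also have "(norm (D y))\<^sup>2 / ?m \<le> (\<integral>z. (norm (D (y + \<xi> *v z)))\<^sup>2 / f (y + \<xi> *v z) \<partial>gauss s) + Q * k * (s * (1 + n))"
    proof -
      let ?q = "\<lambda>x. (norm (D x))\<^sup>2 / f x"
      have ql: "?q y \<le> ?q (y + \<xi> *v z) + Q * k * norm z" for z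
      proof -
        have "\<bar>?q y - ?q (y + \<xi> *v z)\<bar> \<le> Q * norm (y - (y + \<xi> *v z))"
          using C11_quotient_lip[OF A] unfolding lip_def Q_def real_norm_def by blast
        also have "\<dots> \<le> Q * (norm z * k)" using k(2)[of z] Q0 by (intro mult_left_mono) auto
        finally show ?thesis by (simp add: mult_ac)
      qed
      have "?q y = (\<integral>z. ?q y \<partial>(gauss s :: (real^'n) measure))" using prob_space[simplified] by simp
      also have "\<dots> \<le> (\<integral>z. ?q (y + \<xi> *v z) + Q * k * norm z \<partial>gauss s)"
        using I(3) gauss_first_moment(1)[OF s, where 'd='n] ql by (intro integral_mono) auto
      also have "\<dots> = (\<integral>z. ?q (y + \<xi> *v z) \<partial>gauss s) + Q * k * (\<integral>z. norm (z::real^'n) \<partial>gauss s)"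
        using I(3) gauss_first_moment(1)[OF s, where 'd='n] by simp
      also have "\<dots> \<le> (\<integral>z. ?q (y + \<xi> *v z) \<partial>gauss s) + Q * k * (s * (1 + n))"
        using gauss_first_moment(2)[OF s, where 'd='n] Q0 k(1) unfolding n_def by (intro add_left_mono mult_left_mono) auto
      finally show ?thesis .
    qed
    finally have "ent (gauss s) ?F \<le> s\<^sup>2 * \<delta> / 2 * ((\<integral>z. (norm (D (y + \<xi> *v z)))\<^sup>2 / f (y + \<xi> *v z) \<partial>gauss s) + Q * k * (s * (1 + n))) + R * ((1 + 3 * n\<^sup>2) * s ^ 3)"
      using \<delta> by (simp add: mult_left_mono)
    also have "\<dots> = s\<^sup>2 * \<delta> / 2 * (\<integral>z. (norm (D (y + \<xi> *v z)))\<^sup>2 / f (y + \<xi> *v z) \<partial>gauss s) + K * s ^ 3"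
      unfolding K_def by (simp add: algebra_simps power2_eq_square power3_eq_cube)
    finally show ?thesis .
  qed
  show ?thesis using K0 main by blast
qed

section \<open>Independence and conditioning\<close>

lemma (in prob_space) indep_var_of_subalgebra:
  assumes G: "subalgebra M G" and Y: "Y \<in> measurable G S" and V: "V \<in> measurable M T" and h: "h \<in> measurable T S"
    and indep: "indep_set (sets G) (sets (vimage_algebra (space M) V T))"
  shows "indep_var S Y S (\<lambda>\<omega>. h (V \<omega>))"
  unfolding indep_var_eq indep_sets2_eq
proof (intro conjI ballI)
  have Y': "Y \<in> measurable M S" by (rule measurable_from_subalg[OF G Y])
  show "random_variable S Y" "random_variable S (\<lambda>\<omega>. h (V \<omega>))" using Y' V h by measurable
  have sG: "space G = space M" using G by (simp add: subalgebra_def)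
  have 1: "sigma_sets (space M) {Y -` A \<inter> space M |A. A \<in> sets S} \<subseteq> sets G"
    using measurable_sets[OF Y] unfolding sG[symmetric] by (intro sets.sigma_sets_subset) auto
  have "V \<in> measurable (vimage_algebra (space M) V T) T"
    by (rule measurable_vimage_algebra1) (use V measurable_space in auto)
  then have "(\<lambda>\<omega>. h (V \<omega>)) \<in> measurable (vimage_algebra (space M) V T) S"
    using h by (rule measurable_compose)
  from measurable_sets[OF this]
  have 2: "sigma_sets (space M) {(\<lambda>\<omega>. h (V \<omega>)) -` A \<inter> space M |A. A \<in> sets S} \<subseteq> sets (vimage_algebra (space M) V T)"
    using sets.sigma_sets_subset[of "{(\<lambda>\<omega>. h (V \<omega>)) -` A \<inter> space M |A. A \<in> sets S}" "vimage_algebra (space M) V T"]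
    by auto
  have "sets G \<subseteq> events" using G by (simp add: subalgebra_def)
  then show "sigma_sets (space M) {Y -` A \<inter> space M |A. A \<in> sets S} \<subseteq> events" using 1 by blast
  show "sigma_sets (space M) {(\<lambda>\<omega>. h (V \<omega>)) -` A \<inter> space M |A. A \<in> sets S} \<subseteq> events"
    using indep 2 unfolding indep_sets2_eq by blast
  fix a b assume "a \<in> sigma_sets (space M) {Y -` A \<inter> space M |A. A \<in> sets S}"
    "b \<in> sigma_sets (space M) {(\<lambda>\<omega>. h (V \<omega>)) -` A \<inter> space M |A. A \<in> sets S}"
  then show "prob (a \<inter> b) = prob a * prob b"
    using 1 2 indep unfolding indep_sets2_eq by blast
qed

text \<open>Independence is expressed through the joint law, so that \<open>Y\<close> and
  \<open>V\<close> may take values in spaces of different dimension.\<close>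

definition (in prob_space) indep_pair :: "('a \<Rightarrow> 'b::topological_space) \<Rightarrow> ('a \<Rightarrow> 'c::topological_space) \<Rightarrow> bool" where
  "indep_pair Y V \<longleftrightarrow> Y \<in> borel_measurable M \<and> V \<in> borel_measurable M \<and>
    distr M (borel \<Otimes>\<^sub>M borel) (\<lambda>\<omega>. (Y \<omega>, V \<omega>)) = distr M borel Y \<Otimes>\<^sub>M distr M borel V"

lemma (in prob_space) indep_pair_of_subalgebra:
  assumes G: "subalgebra M G" and Y: "Y \<in> borel_measurable G" and V: "V \<in> borel_measurable M"
    and indep: "indep_set (sets G) (sets (vimage_algebra (space M) V borel))"
  shows "indep_pair Y V"
  unfolding indep_pair_def
proof (intro conjI)
  show Y'[measurable]: "Y \<in> borel_measurable M" by (rule measurable_from_subalg[OF G Y])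
  show V'[measurable]: "V \<in> borel_measurable M" by fact
  have sG: "space G = space M" using G by (simp add: subalgebra_def)
  interpret Y: prob_space "distr M borel Y" by (rule prob_space_distr) simp
  interpret V: prob_space "distr M borel V" by (rule prob_space_distr) simp
  show "distr M (borel \<Otimes>\<^sub>M borel) (\<lambda>\<omega>. (Y \<omega>, V \<omega>)) = distr M borel Y \<Otimes>\<^sub>M distr M borel V"
  proof (rule pair_measure_eqI[symmetric])
    fix A B assume "A \<in> sets (distr M borel Y)" "B \<in> sets (distr M borel V)"
    then have AB[measurable]: "A \<in> sets borel" "B \<in> sets borel" by auto
    have a: "Y -` A \<inter> space M \<in> sets G" using measurable_sets[OF Y AB(1)] by (simp add: sG)
    have b: "V -` B \<inter> space M \<in> sets (vimage_algebra (space M) V borel)"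
      by (subst sets_vimage_algebra2) (use AB in auto)
    have "prob ((Y -` A \<inter> space M) \<inter> (V -` B \<inter> space M)) = prob (Y -` A \<inter> space M) * prob (V -` B \<inter> space M)"
      using indep a b unfolding indep_sets2_eq by blast
    moreover have "(Y -` A \<inter> space M) \<inter> (V -` B \<inter> space M) = (\<lambda>\<omega>. (Y \<omega>, V \<omega>)) -` (A \<times> B) \<inter> space M" by auto
    ultimately show "emeasure (distr M borel Y) A * emeasure (distr M borel V) B = emeasure (distr M (borel \<Otimes>\<^sub>M borel) (\<lambda>\<omega>. (Y \<omega>, V \<omega>))) (A \<times> B)"
      by (simp add: emeasure_distr emeasure_eq_measure ennreal_mult)
  qed (use Y.sigma_finite_measure_axioms V.sigma_finite_measure_axioms in \<open>auto cong: sets_pair_measure_cong\<close>)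
qed

text \<open>Conditioning on \<open>Y\<close> amounts to Fubini's theorem for the product law. The
  integrability of the inner integral is recorded because further expectations are split along
  it.\<close>

lemma (in prob_space) expectation_indep_gauss:
  fixes Y :: "'a \<Rightarrow> real^'d::finite" and V :: "'a \<Rightarrow> real^'n::finite" and g :: "real^'d \<Rightarrow> real"
  assumes indep: "indep_pair Y V" and V: "distr M borel V = gauss s" and s: "s > 0"
    and [measurable]: "g \<in> borel_measurable borel" and g: "\<And>x. \<bar>g x\<bar> \<le> B"
  shows "expectation (\<lambda>\<omega>. g (Y \<omega> + \<xi> *v V \<omega>)) = expectation (\<lambda>\<omega>. \<integral>z. g (Y \<omega> + \<xi> *v z) \<partial>gauss s)"
    and "integrable M (\<lambda>\<omega>. \<integral>z. g (Y \<omega> + \<xi> *v z) \<partial>gauss s)"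
proof -
  have [measurable]: "Y \<in> borel_measurable M" "V \<in> borel_measurable M"
    using indep by (auto simp: indep_pair_def)
  interpret N: prob_space "gauss s :: (real^'n) measure" using s by (rule prob_space_gauss)
  interpret Y: prob_space "distr M borel Y" by (rule prob_space_distr) simp
  interpret P: pair_prob_space "distr M borel Y" "gauss s :: (real^'n) measure" ..
  have eq: "distr M (borel \<Otimes>\<^sub>M borel) (\<lambda>\<omega>. (Y \<omega>, V \<omega>)) = distr M borel Y \<Otimes>\<^sub>M gauss s"
    using indep V unfolding indep_pair_def by simp
  let ?h = "\<lambda>p. g (fst p + \<xi> *v snd p)"
  have hm: "?h \<in> borel_measurable (borel \<Otimes>\<^sub>M borel)" by measurable
  have hm': "?h \<in> borel_measurable (distr M borel Y \<Otimes>\<^sub>M gauss s)" using hm by (simp cong: measurable_cong_sets)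
  have hi: "integrable (distr M borel Y \<Otimes>\<^sub>M gauss s) ?h"
    using g hm' by (intro P.integrable_const_bound[where B=B]) auto
  have pm: "(\<lambda>y. \<integral>z. g (y + \<xi> *v z) \<partial>gauss s) \<in> borel_measurable borel"
    by measurable
  have "expectation (\<lambda>\<omega>. g (Y \<omega> + \<xi> *v V \<omega>)) = integral\<^sup>L (distr M (borel \<Otimes>\<^sub>M borel) (\<lambda>\<omega>. (Y \<omega>, V \<omega>))) ?h"
    by (subst integral_distr) (use hm in auto)
  also have "\<dots> = (\<integral>y. \<integral>z. g (y + \<xi> *v z) \<partial>gauss s \<partial>distr M borel Y)"
    unfolding eq using P.integral_fst'[OF hi] by simp
  also have "\<dots> = expectation (\<lambda>\<omega>. \<integral>z. g (Y \<omega> + \<xi> *v z) \<partial>gauss s)"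
    by (subst integral_distr) (use pm in auto)
  finally show "expectation (\<lambda>\<omega>. g (Y \<omega> + \<xi> *v V \<omega>)) = expectation (\<lambda>\<omega>. \<integral>z. g (Y \<omega> + \<xi> *v z) \<partial>gauss s)" .
  show "integrable M (\<lambda>\<omega>. \<integral>z. g (Y \<omega> + \<xi> *v z) \<partial>gauss s)"
    using P.integrable_fst'[OF hi] pm by (simp add: integrable_distr_eq)
qed

text \<open>Chain rule for the entropy: condition on \<open>Y\<close>, apply \<open>step\<close> to the inner law and \<open>IH\<close> to
  the averaged function, whose gradient satisfies \<open>(norm (PD y))\<^sup>2 / Pf y \<le> P ((norm D)\<^sup>2 / f) y\<close> by Cauchy-Schwarz.
  The errors \<open>R\<close> and \<open>R'\<close> vanish when the increment is cut into ever shorter pieces.\<close>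

lemma (in prob_space) ent_chain_step:
  fixes Y :: "'a \<Rightarrow> real^'d::finite" and V :: "'a \<Rightarrow> real^'n::finite"
  assumes indep: "indep_pair Y V" and V: "distr M borel V = gauss s" and s: "s > 0"
    and A: "C11 c B L K f D" and C: "0 \<le> C"
    and step: "\<And>y. ent (gauss s) (\<lambda>z. f (y + \<xi> *v z)) \<le>
      s\<^sup>2 * \<delta> / 2 * (\<integral>z. (norm (D (y + \<xi> *v z)))\<^sup>2 / f (y + \<xi> *v z) \<partial>gauss s) + R"
    and IH: "\<And>f D. C11 c B L K f D \<Longrightarrow> ent M (\<lambda>\<omega>. f (Y \<omega>)) \<le> C / 2 * expectation (\<lambda>\<omega>. (norm (D (Y \<omega>)))\<^sup>2 / f (Y \<omega>)) + R'"
  shows "ent M (\<lambda>\<omega>. f (Y \<omega> + \<xi> *v V \<omega>)) \<le>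
    (C + s\<^sup>2 * \<delta>) / 2 * expectation (\<lambda>\<omega>. (norm (D (Y \<omega> + \<xi> *v V \<omega>)))\<^sup>2 / f (Y \<omega> + \<xi> *v V \<omega>)) + (R + R')"
proof -
  note F = C11D[OF A]
  note F(11,12)[measurable]
  have [measurable]: "Y \<in> borel_measurable M" "V \<in> borel_measurable M"
    using indep by (auto simp: indep_pair_def)
  let ?N = "gauss s :: (real^'n) measure"
  have N: "prob_space ?N" using s by (rule prob_space_gauss)
  interpret N: prob_space ?N by (rule N)
  have \<zeta>: "(\<lambda>z. \<xi> *v z) \<in> borel_measurable ?N" by measurable
  define Pf where "Pf y = (\<integral>z. f (y + \<xi> *v z) \<partial>?N)" for y
  define PD where "PD y = (\<integral>z. D (y + \<xi> *v z) \<partial>?N)" for y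
  define q where "q x = (norm (D x))\<^sup>2 / f x" for x
  define l where "l x = f x * ln (f x)" for x
  have qm[measurable]: "q \<in> borel_measurable borel" and lm[measurable]: "l \<in> borel_measurable borel"
    unfolding q_def[abs_def] l_def[abs_def] by measurable
  have P: "C11 c B L K Pf PD"
    unfolding Pf_def[abs_def] PD_def[abs_def] by (rule C11_convolution[OF N \<zeta> A])
  note PF = C11D[OF P]
  note PF(11,12)[measurable]
  have qb: "\<bar>q x\<bar> \<le> L\<^sup>2 / c" for x
  proof -
    have "q x \<le> L\<^sup>2 / c" unfolding q_def using F(1,8) F(3)[of x] F(5)[of x] by (intro frac_le power_mono) auto
    moreover have "0 \<le> q x" unfolding q_def using F(10)[of x] by simp
    ultimately show ?thesis by simp
  qed
  have Pqb: "\<bar>(norm (PD x))\<^sup>2 / Pf x\<bar> \<le> L\<^sup>2 / c" for x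
  proof -
    have "(norm (PD x))\<^sup>2 / Pf x \<le> L\<^sup>2 / c" using PF(1,8) PF(3)[of x] PF(5)[of x] by (intro frac_le power_mono) auto
    moreover have "0 \<le> (norm (PD x))\<^sup>2 / Pf x" using PF(10)[of x] by simp
    ultimately show ?thesis by simp
  qed
  have lb: "\<bar>l x\<bar> \<le> B * (\<bar>ln c\<bar> + \<bar>ln B\<bar>)" "\<bar>Pf x * ln (Pf x)\<bar> \<le> B * (\<bar>ln c\<bar> + \<bar>ln B\<bar>)" for x
    unfolding l_def by (rule mult_ln_bounded[OF F(1,3,4)], rule mult_ln_bounded[OF PF(1,3,4)])
  note Ef = expectation_indep_gauss[OF indep V s F(11,13), where \<xi>=\<xi>, folded Pf_def]
  note El = expectation_indep_gauss[OF indep V s lm lb(1), where \<xi>=\<xi>]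
  note Eq = expectation_indep_gauss[OF indep V s qm qb, where \<xi>=\<xi>]
  have Pli: "integrable M (\<lambda>\<omega>. Pf (Y \<omega>) * ln (Pf (Y \<omega>)))"
    using lb(2) by (intro integrable_const_bound[where B="B * (\<bar>ln c\<bar> + \<bar>ln B\<bar>)"]) auto
  have Pqi: "integrable M (\<lambda>\<omega>. (norm (PD (Y \<omega>)))\<^sup>2 / Pf (Y \<omega>))"
    using Pqb by (intro integrable_const_bound[where B="L\<^sup>2 / c"]) auto
  have e: "ent ?N (\<lambda>z. f (y + \<xi> *v z)) = (\<integral>z. l (y + \<xi> *v z) \<partial>?N) - Pf y * ln (Pf y)" for y
    by (simp add: ent_def l_def Pf_def)
  have "ent M (\<lambda>\<omega>. f (Y \<omega> + \<xi> *v V \<omega>)) = expectation (\<lambda>\<omega>. l (Y \<omega> + \<xi> *v V \<omega>)) - expectation (\<lambda>\<omega>. Pf (Y \<omega>)) * ln (expectation (\<lambda>\<omega>. Pf (Y \<omega>)))"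
    using Ef(1) by (simp add: ent_def l_def)
  also have "\<dots> = expectation (\<lambda>\<omega>. \<integral>z. l (Y \<omega> + \<xi> *v z) \<partial>?N) - expectation (\<lambda>\<omega>. Pf (Y \<omega>)) * ln (expectation (\<lambda>\<omega>. Pf (Y \<omega>)))"
    using El(1) by simp
  also have "\<dots> = expectation (\<lambda>\<omega>. ent ?N (\<lambda>z. f (Y \<omega> + \<xi> *v z))) + ent M (\<lambda>\<omega>. Pf (Y \<omega>))"
    unfolding e using El(2) Pli by (simp add: ent_def[of M])
  also have "expectation (\<lambda>\<omega>. ent ?N (\<lambda>z. f (Y \<omega> + \<xi> *v z))) \<le> expectation (\<lambda>\<omega>. s\<^sup>2 * \<delta> / 2 * (\<integral>z. q (Y \<omega> + \<xi> *v z) \<partial>?N) + R)"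
  proof (rule integral_mono)
    show "integrable M (\<lambda>\<omega>. ent ?N (\<lambda>z. f (Y \<omega> + \<xi> *v z)))" unfolding e using El(2) Pli by simp
    show "integrable M (\<lambda>\<omega>. s\<^sup>2 * \<delta> / 2 * (\<integral>z. q (Y \<omega> + \<xi> *v z) \<partial>?N) + R)" using Eq(2) by simp
  qed (use step in \<open>simp add: q_def\<close>)
  also have "\<dots> = s\<^sup>2 * \<delta> / 2 * expectation (\<lambda>\<omega>. q (Y \<omega> + \<xi> *v V \<omega>)) + R"
    using Eq by (simp add: prob_space)
  finally have 1: "ent M (\<lambda>\<omega>. f (Y \<omega> + \<xi> *v V \<omega>)) \<le> s\<^sup>2 * \<delta> / 2 * expectation (\<lambda>\<omega>. q (Y \<omega> + \<xi> *v V \<omega>)) + R + ent M (\<lambda>\<omega>. Pf (Y \<omega>))"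
    by simp
  have "ent M (\<lambda>\<omega>. Pf (Y \<omega>)) \<le> C / 2 * expectation (\<lambda>\<omega>. (norm (PD (Y \<omega>)))\<^sup>2 / Pf (Y \<omega>)) + R'"
    by (rule IH[OF P])
  also have "expectation (\<lambda>\<omega>. (norm (PD (Y \<omega>)))\<^sup>2 / Pf (Y \<omega>)) \<le> expectation (\<lambda>\<omega>. \<integral>z. q (Y \<omega> + \<xi> *v z) \<partial>?N)"
  proof (rule integral_mono[OF Pqi Eq(2)])
    show "(norm (PD (Y \<omega>)))\<^sup>2 / Pf (Y \<omega>) \<le> (\<integral>z. q (Y \<omega> + \<xi> *v z) \<partial>?N)" for \<omega>
      unfolding PD_def Pf_def q_def by (rule C11_Cauchy_Schwarz[OF N \<zeta> A])
  qed
  also have "\<dots> = expectation (\<lambda>\<omega>. q (Y \<omega> + \<xi> *v V \<omega>))" using Eq(1) by simp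
  finally have "ent M (\<lambda>\<omega>. Pf (Y \<omega>)) \<le> C / 2 * expectation (\<lambda>\<omega>. q (Y \<omega> + \<xi> *v V \<omega>)) + R'"
    using C by (simp add: mult_left_mono)
  then show ?thesis using 1 unfolding q_def[symmetric] by (simp add: add_divide_distrib distrib_right)
qed

section \<open>The inequality along Brownian increments\<close>

context brownian_motion
begin

lemma measurable_F_M:
  "0 \<le> t \<Longrightarrow> Y \<in> measurable (F t) N \<Longrightarrow> Y \<in> measurable M N"
  by (rule measurable_from_subalg[OF subalgebra_F])

lemma measurable_F_mono:
  assumes "0 \<le> s" "s \<le> t" "Y \<in> measurable (F s) N" shows "Y \<in> measurable (F t) N"
proof -
  have "space (F s) = space (F t)" "sets (F s) \<subseteq> sets (F t)"
    using subalgebra_F[of s] subalgebra_F[of t] assms mono_F by (auto simp: subalgebra_def)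
  then show ?thesis using assms(3) by (intro measurable_from_subalg[of "F t" "F s"]) (auto simp: subalgebra_def)
qed

lemma W_measurable [measurable]: "0 \<le> t \<Longrightarrow> W t \<in> borel_measurable M"
  using measurable_F_M adapted_W by blast

lemma distr_increment_W:
  assumes "0 \<le> s" "s < t"
  shows "distr M borel (\<lambda>\<omega>. W t \<omega> - W s \<omega>) = gauss (sqrt (t - s))"
proof -
  have "distr M borel (\<lambda>\<omega>. W t \<omega> - W s \<omega>) = distr M lborel (\<lambda>\<omega>. W t \<omega> - W s \<omega>)"
    by (rule distr_cong) auto
  also have "\<dots> = gauss (sqrt (t - s))"
    using distributed_distr_eq_density[OF gaussian_increments_W[OF assms]]
    by (simp add: gauss_def gauss_density_def)
  finally show ?thesis .
qed

lemma indep_pair_increment_W: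
  assumes "0 \<le> s" "s < t" "Y \<in> borel_measurable (F s)"
  shows "indep_pair Y (\<lambda>\<omega>. W t \<omega> - W s \<omega>)"
  using assms by (intro indep_pair_of_subalgebra[OF subalgebra_F _ _ indep_increments_W]) auto

text \<open>The time span is cut into \<open>n + 1\<close> equal pieces. One piece of length \<tau>
  contributes \<delta> \<tau> to the constant and an error of order \<tau>^(3/2), so the total error
  is of order sqrt \<tau> and vanishes as \<open>n\<close> grows. By \<open>LSI_of_Cb_infty\<close>
  it suffices to test a single smooth function at a time, which fixes one class \<open>C11\<close>
  and one error constant.\<close>

lemma LSI_add_increment:
  fixes Y :: "'w \<Rightarrow> real^'d::finite" and \<xi> :: "real^'n^'d"
  assumes ab: "0 \<le> a" "a \<le> b" and Y: "Y \<in> borel_measurable (F a)" and LSI: "LSI (distr M borel Y) C" and C: "0 \<le> C"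
    and \<xi>: "loewner_le (\<xi> ** transpose \<xi>) (\<delta> *\<^sub>R mat 1)" and \<delta>: "0 \<le> \<delta>"
  shows "LSI (distr M borel (\<lambda>\<omega>. Y \<omega> + \<xi> *v (W b \<omega> - W a \<omega>))) (C + \<delta> * (b - a))"
proof (cases "a = b")
  case True
  then show ?thesis using LSI by simp
next
  case False
  with ab have ab': "a < b" by simp
  have b: "0 \<le> b" using ab by simp
  have [measurable]: "Y \<in> borel_measurable M" by (rule measurable_F_M[OF ab(1) Y])
  have [measurable]: "W a \<in> borel_measurable M" "W b \<in> borel_measurable M" using ab b by auto
  let ?X = "\<lambda>\<omega>. Y \<omega> + \<xi> *v (W b \<omega> - W a \<omega>)"
  show ?thesis
  proof (rule LSI_of_Cb_infty)
    show "prob_space (distr M borel ?X)" by (rule prob_space_distr) simp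
    show "0 \<le> C + \<delta> * (b - a)" using C \<delta> ab by simp
    fix f :: "real^'d \<Rightarrow> real" and c B assume f: "f \<in> Cb_infty" and c: "0 < c" "\<And>x. c \<le> f x" "\<And>x. f x \<le> (B::real)"
    obtain L K where A: "C11 c B L K f (gradient f)" using C11_of_Cb_infty[OF f c] by blast
    note [measurable] = C11D(11,12)[OF A]
    obtain R where R: "R \<ge> 0" "\<And>f D s y. C11 c B L K f D \<Longrightarrow> s > 0 \<Longrightarrow> ent (gauss s) (\<lambda>z. f (y + \<xi> *v z)) \<le>
      s\<^sup>2 * \<delta> / 2 * (\<integral>z. (norm (D (y + \<xi> *v z)))\<^sup>2 / f (y + \<xi> *v z) \<partial>gauss s) + R * s ^ 3"
      using gauss_ent_step[OF A \<xi> \<delta>] by blast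
    let ?E = "expectation (\<lambda>\<omega>. (norm (gradient f (?X \<omega>)))\<^sup>2 / f (?X \<omega>))"
    have N: "ent M (\<lambda>\<omega>. f (?X \<omega>)) \<le> (C + \<delta> * (b - a)) / 2 * ?E + R * (b - a) * sqrt (b - a) * sqrt (1 / real (Suc n))" for n
    proof -
      define \<tau> where "\<tau> = (b - a) / real (Suc n)"
      define t where "t j = a + real j * \<tau>" for j
      have \<tau>: "\<tau> > 0" using ab' by (simp add: \<tau>_def)
      have t0: "0 \<le> t j" and t1: "t j < t (Suc j)" and ta: "a \<le> t j" for j using \<tau> ab by (auto simp: t_def algebra_simps)
      define Z where "Z j \<omega> = Y \<omega> + \<xi> *v (W (t j) \<omega> - W a \<omega>)" for j \<omega>
      have Zm: "Z j \<in> borel_measurable (F (t j))" for j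
      proof -
        have [measurable]: "Y \<in> borel_measurable (F (t j))" "W a \<in> borel_measurable (F (t j))" "W (t j) \<in> borel_measurable (F (t j))"
          using measurable_F_mono[OF ab(1) ta] Y adapted_W ab(1) t0 by auto
        show ?thesis unfolding Z_def[abs_def] by measurable
      qed
      have ZS: "Z (Suc j) \<omega> = Z j \<omega> + \<xi> *v (W (t (Suc j)) \<omega> - W (t j) \<omega>)" for j \<omega>
        by (simp add: Z_def matrix_vector_mult_diff_distrib)
      \<comment> \<open>The claim ranges over the whole class, since the induction step applies it
        to an averaged function.\<close>
      have claim: "ent M (\<lambda>\<omega>. f (Z j \<omega>)) \<le> (C + real j * (\<tau> * \<delta>)) / 2 * expectation (\<lambda>\<omega>. (norm (D (Z j \<omega>)))\<^sup>2 / f (Z j \<omega>)) + real j * (R * sqrt \<tau> ^ 3)"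
        if "C11 c B L K f D" for f D j
        using that
      proof (induction j arbitrary: f D)
        case 0
        note [measurable] = C11D(11,12)[OF 0]
        have "ent (distr M borel Y) f \<le> C / 2 * (\<integral>x. (norm (D x))\<^sup>2 / f x \<partial>distr M borel Y)"
          using LSI C11_admissible[OF 0] unfolding LSI_def by blast
        moreover have "Z 0 = Y" by (simp add: Z_def t_def fun_eq_iff)
        ultimately show ?case by (simp add: ent_distr integral_distr)
      next
        case (Suc j)
        have "ent M (\<lambda>\<omega>. f (Z j \<omega> + \<xi> *v (W (t (Suc j)) \<omega> - W (t j) \<omega>))) \<le>
           (C + real j * (\<tau> * \<delta>) + (sqrt \<tau>)\<^sup>2 * \<delta>) / 2 * expectation (\<lambda>\<omega>. (norm (D (Z j \<omega> + \<xi> *v (W (t (Suc j)) \<omega> - W (t j) \<omega>))))\<^sup>2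
             / f (Z j \<omega> + \<xi> *v (W (t (Suc j)) \<omega> - W (t j) \<omega>))) + (R * sqrt \<tau> ^ 3 + real j * (R * sqrt \<tau> ^ 3))"
        proof (rule ent_chain_step[OF indep_pair_increment_W[OF t0 t1 Zm] _ _ Suc.prems _ R(2)[OF Suc.prems] Suc.IH])
          have "t (Suc j) - t j = \<tau>" by (simp add: t_def algebra_simps)
          then show "distr M borel (\<lambda>\<omega>. W (t (Suc j)) \<omega> - W (t j) \<omega>) = gauss (sqrt \<tau>)"
            using distr_increment_W[OF t0 t1, of j] by simp
        qed (use \<tau> C \<delta> in auto)
        then show ?case unfolding ZS using \<tau> by (simp add: algebra_simps)
      qed
      have tb: "t (Suc n) = b" by (simp add: t_def \<tau>_def)
      then have ZX: "Z (Suc n) = ?X" by (simp add: Z_def fun_eq_iff)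
      have nt: "real (Suc n) * \<tau> = b - a" by (simp add: \<tau>_def)
      \<comment> \<open>The \<open>n + 1\<close> errors \<open>R * sqrt \<tau> ^ 3\<close> add up to
        \<open>R * (b - a) * sqrt \<tau>\<close>.\<close>
      have "real (Suc n) * (R * sqrt \<tau> ^ 3) = R * (real (Suc n) * \<tau>) * sqrt \<tau>"
        using \<tau> by (simp add: power3_eq_cube)
      also have "\<dots> = R * (b - a) * sqrt (b - a) * sqrt (1 / real (Suc n))"
        unfolding nt by (simp add: \<tau>_def real_sqrt_divide)
      finally have r: "real (Suc n) * (R * sqrt \<tau> ^ 3) = R * (b - a) * sqrt (b - a) * sqrt (1 / real (Suc n))" .
      have k: "real (Suc n) * (\<tau> * \<delta>) = \<delta> * (b - a)" using nt by (metis mult.assoc mult.commute)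
      show ?thesis using claim[OF A, of "Suc n"] unfolding ZX r k .
    qed
    have "(\<lambda>n. (C + \<delta> * (b - a)) / 2 * ?E + R * (b - a) * sqrt (b - a) * sqrt (1 / real (Suc n)))
       \<longlonglongrightarrow> (C + \<delta> * (b - a)) / 2 * ?E + R * (b - a) * sqrt (b - a) * sqrt 0"
      by (intro tendsto_intros LIMSEQ_Suc lim_1_over_n)
    then have "ent M (\<lambda>\<omega>. f (?X \<omega>)) \<le> (C + \<delta> * (b - a)) / 2 * ?E"
      using N by (intro LIMSEQ_le_const[of _ "(C + \<delta> * (b - a)) / 2 * ?E"]) auto
    then show "ent (distr M borel ?X) f \<le> (C + \<delta> * (b - a)) / 2 * (\<integral>x. (norm (gradient f x))\<^sup>2 / f x \<partial>distr M borel ?X)"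
      by (simp add: ent_distr integral_distr)
  qed simp
qed

end

section \<open>Ito integrals of deterministic integrands\<close>

context brownian_motion
begin

lemma expectation_mult_increment:
  assumes st: "0 \<le> s" "s < t" and U: "U \<in> borel_measurable (F s)" "integrable M U"
    and h: "h \<in> borel_measurable borel" "has_bochner_integral (gauss (sqrt (t - s))) h v"
  shows "has_bochner_integral M (\<lambda>\<omega>. U \<omega> * (h (W t \<omega> - W s \<omega>) :: real)) (expectation U * v)"
proof -
  have [measurable]: "W s \<in> borel_measurable M" "W t \<in> borel_measurable M" using st by auto
  have ind: "indep_var borel U borel (\<lambda>\<omega>. h (W t \<omega> - W s \<omega>))"
    using st U h by (intro indep_var_of_subalgebra[OF subalgebra_F _ _ _ indep_increments_W]) auto
  have hi: "has_bochner_integral M (\<lambda>\<omega>. h (W t \<omega> - W s \<omega>)) v"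
    using h unfolding distr_increment_W[OF st, symmetric] has_bochner_integral_iff
    by (subst (asm) integrable_distr_eq, simp, simp, subst (asm) integral_distr, simp_all)
  show ?thesis
    using indep_var_lebesgue_integral[OF ind U(2)] indep_var_integrable[OF ind U(2)] hi
    by (simp add: has_bochner_integral_iff)
qed

lemma increment_mean_zero:
  assumes st: "0 \<le> s" "s < t" and U: "U \<in> borel_measurable (F s)" "integrable M U"
  shows "has_bochner_integral M (\<lambda>\<omega>. U \<omega> * (W t \<omega> - W s \<omega>) $ i) 0"
  using expectation_mult_increment[OF st U _ gauss_mean[of "sqrt (t - s)" i]] st by simp

lemma increment_covariance:
  assumes st: "0 \<le> s" "s < t" and U: "U \<in> borel_measurable (F s)" "integrable M U"
  shows "has_bochner_integral M (\<lambda>\<omega>. U \<omega> * ((W t \<omega> - W s \<omega>) $ i * (W t \<omega> - W s \<omega>) $ j)) (expectation U * (if i = j then t - s else 0))"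
proof -
  have "has_bochner_integral (gauss (sqrt (t - s))) (\<lambda>z::real^'n. z $ i * z $ j) (if i = j then t - s else 0)"
    using gauss_covariance[of "sqrt (t - s)" i j] st by (simp cong: if_cong)
  from expectation_mult_increment[OF st U _ this] show ?thesis by simp
qed

lemma matrix_mult_inner:
  fixes A B :: "real^'n^'d::finite"
  shows "(A *v u) \<bullet> (B *v v) = (\<Sum>p\<in>UNIV. \<Sum>q\<in>UNIV. \<Sum>q'\<in>UNIV. A $ p $ q * B $ p $ q' * (u $ q * v $ q'))"
  by (simp add: inner_vec_def matrix_vector_mult_def sum_product mult_ac)

text \<open>\<open>\<eta>\<close> and \<open>I\<close> are known at time \<open>s\<close>, hence
  independent of the increment after \<open>s\<close>. \<open>I\<close> stands for the sum of the
  earlier terms, so the second statement is the orthogonality that makes the isometry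
  additive.\<close>

lemma simple_term_isometry:
  fixes \<eta> :: "'w \<Rightarrow> real^'n^'d::finite" and I :: "'w \<Rightarrow> real^'d"
  assumes st: "0 \<le> s" "s \<le> t" and \<eta>: "\<eta> \<in> borel_measurable (F s)" "\<And>\<omega>. \<omega> \<in> space M \<Longrightarrow> norm (\<eta> \<omega>) \<le> c"
    and I: "I \<in> borel_measurable (F s)" "integrable M (\<lambda>\<omega>. (norm (I \<omega>))\<^sup>2)"
  shows "has_bochner_integral M (\<lambda>\<omega>. (norm (\<eta> \<omega> *v (W t \<omega> - W s \<omega>)))\<^sup>2) ((t - s) * expectation (\<lambda>\<omega>. (norm (\<eta> \<omega>))\<^sup>2))"
    and "has_bochner_integral M (\<lambda>\<omega>. I \<omega> \<bullet> (\<eta> \<omega> *v (W t \<omega> - W s \<omega>))) 0"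
proof -
  have F_M: "\<And>Y N. Y \<in> measurable (F s) N \<Longrightarrow> Y \<in> measurable M N" by (rule measurable_F_M[OF st(1)])
  have sF: "space (F s) = space M" using subalgebra_F[OF st(1)] by (simp add: subalgebra_def)
  have comp: "\<bar>\<eta> \<omega> $ p $ q\<bar> \<le> c" if "\<omega> \<in> space M" for p q \<omega>
    using \<eta>(2)[OF that] component_le_norm_cart[of "\<eta> \<omega> $ p" q] Finite_Cartesian_Product.norm_nth_le[of "\<eta> \<omega>" p] by linarith
  have [measurable]: "(\<lambda>\<omega>. \<eta> \<omega> $ p $ q) \<in> borel_measurable (F s)" for p q
    using \<eta>(1) by (intro measurable_compose[OF \<eta>(1)] borel_measurable_continuous_onI continuous_intros)
  note [measurable] = I(1)
  have [measurable]: "(\<lambda>\<omega>. \<eta> \<omega> $ p $ q) \<in> borel_measurable M" "I \<in> borel_measurable M" for p q by (rule F_M, measurable)+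
  show "has_bochner_integral M (\<lambda>\<omega>. (norm (\<eta> \<omega> *v (W t \<omega> - W s \<omega>)))\<^sup>2) ((t - s) * expectation (\<lambda>\<omega>. (norm (\<eta> \<omega>))\<^sup>2))"
  proof (cases "s = t")
    case True then show ?thesis by (simp add: has_bochner_integral_zero)
  next
    case False
    then have st': "s < t" using st by simp
    have ii: "integrable M (\<lambda>\<omega>. \<eta> \<omega> $ p $ q * \<eta> \<omega> $ p $ q')" for p q q'
    proof (rule integrable_const_bound[where B="c * c"])
      show "AE \<omega> in M. norm (\<eta> \<omega> $ p $ q * \<eta> \<omega> $ p $ q') \<le> c * c"
        unfolding real_norm_def abs_mult
        by (intro AE_I2 mult_mono comp order_trans[OF abs_ge_zero comp]) auto
    qed simp
    have "has_bochner_integral M (\<lambda>\<omega>. \<Sum>p\<in>UNIV. \<Sum>q\<in>UNIV. \<Sum>q'\<in>UNIV. \<eta> \<omega> $ p $ q * \<eta> \<omega> $ p $ q' * ((W t \<omega> - W s \<omega>) $ q * (W t \<omega> - W s \<omega>) $ q'))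
       (\<Sum>p\<in>UNIV. \<Sum>q\<in>UNIV. \<Sum>q'\<in>UNIV. expectation (\<lambda>\<omega>. \<eta> \<omega> $ p $ q * \<eta> \<omega> $ p $ q') * (if q = q' then t - s else 0))"
      by (intro has_bochner_integral_sum increment_covariance[OF st(1) st' _ ii]) measurable
    moreover have "(\<Sum>p\<in>UNIV. \<Sum>q\<in>UNIV. \<Sum>q'\<in>UNIV. expectation (\<lambda>\<omega>. \<eta> \<omega> $ p $ q * \<eta> \<omega> $ p $ q') * (if q = q' then t - s else 0))
       = (t - s) * expectation (\<lambda>\<omega>. (norm (\<eta> \<omega>))\<^sup>2)"
    proof -
      have "expectation (\<lambda>\<omega>. (norm (\<eta> \<omega>))\<^sup>2) = (\<Sum>p\<in>UNIV. \<Sum>q\<in>UNIV. expectation (\<lambda>\<omega>. \<eta> \<omega> $ p $ q * \<eta> \<omega> $ p $ q))"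
        unfolding power2_norm_eq_inner inner_vec_def using ii by (simp add: Bochner_Integration.integral_sum)
      moreover have "x * (if q = q' then y else 0) = (if q = q' then x * y else 0)" for x y :: real and q q' :: 'n by simp
      ultimately show ?thesis by (simp add: sum_distrib_right mult.commute[of "t - s"])
    qed
    ultimately show ?thesis unfolding power2_norm_eq_inner[of "_ *v _"] matrix_mult_inner by simp
  qed
  show "has_bochner_integral M (\<lambda>\<omega>. I \<omega> \<bullet> (\<eta> \<omega> *v (W t \<omega> - W s \<omega>))) 0"
  proof (cases "s = t")
    case True then show ?thesis by (simp add: has_bochner_integral_zero)
  next
    case False
    then have st': "s < t" using st by simp
    have Ii: "integrable M (\<lambda>\<omega>. I \<omega> $ p * \<eta> \<omega> $ p $ q)" for p q
    proof (rule Bochner_Integration.integrable_bound)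
      show "integrable M (\<lambda>\<omega>. \<bar>c\<bar> * (1 + (norm (I \<omega>))\<^sup>2))" using I(2) by simp
      show "AE \<omega> in M. norm (I \<omega> $ p * \<eta> \<omega> $ p $ q) \<le> norm (\<bar>c\<bar> * (1 + (norm (I \<omega>))\<^sup>2))"
      proof (rule AE_I2)
        fix \<omega> assume \<omega>: "\<omega> \<in> space M"
        have "0 \<le> (norm (I \<omega>) - 1)\<^sup>2" by simp
        then have "norm (I \<omega>) \<le> 1 + (norm (I \<omega>))\<^sup>2" unfolding power2_diff using norm_ge_zero[of "I \<omega>"] by (simp; linarith?)
        then have i: "\<bar>I \<omega> $ p\<bar> \<le> 1 + (norm (I \<omega>))\<^sup>2" using component_le_norm_cart[of "I \<omega>" p] by linarith
        have "norm (I \<omega> $ p * \<eta> \<omega> $ p $ q) = \<bar>\<eta> \<omega> $ p $ q\<bar> * \<bar>I \<omega> $ p\<bar>" by (simp add: abs_mult)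
        also have "\<dots> \<le> \<bar>c\<bar> * (1 + (norm (I \<omega>))\<^sup>2)"
          using comp[OF \<omega>, of p q] i by (intro mult_mono) auto
        finally show "norm (I \<omega> $ p * \<eta> \<omega> $ p $ q) \<le> norm (\<bar>c\<bar> * (1 + (norm (I \<omega>))\<^sup>2))" by simp
      qed
    qed measurable
    have "has_bochner_integral M (\<lambda>\<omega>. \<Sum>p\<in>UNIV. \<Sum>q\<in>UNIV. I \<omega> $ p * \<eta> \<omega> $ p $ q * (W t \<omega> - W s \<omega>) $ q)
       (\<Sum>p\<in>(UNIV::'d set). \<Sum>q\<in>(UNIV::'n set). 0)"
      by (intro has_bochner_integral_sum increment_mean_zero[OF st(1) st' _ Ii]) measurable
    moreover have "I \<omega> \<bullet> (\<eta> \<omega> *v (W t \<omega> - W s \<omega>)) = (\<Sum>p\<in>UNIV. \<Sum>q\<in>UNIV. I \<omega> $ p * \<eta> \<omega> $ p $ q * (W t \<omega> - W s \<omega>) $ q)" for \<omega>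
      by (simp add: inner_vec_def[of "I \<omega>"] matrix_vector_mult_def sum_distrib_left mult_ac)
    ultimately show ?thesis by simp
  qed
qed

text \<open>Induction on the number of terms. Measurability of the partial sum at time
  \<open>\<tau> k\<close> and \<open>0 \<le> \<tau> k\<close> are carried along because
  \<open>simple_term_isometry\<close> asks for them at the next increment.\<close>

lemma simple_integral_isometry:
  fixes \<eta> :: "nat \<Rightarrow> 'w \<Rightarrow> real^'n^'d::finite"
  assumes "0 \<le> \<tau> 0" and "\<And>i. i < k \<Longrightarrow> \<tau> i \<le> \<tau> (Suc i)"
    and "\<And>i. i < k \<Longrightarrow> \<eta> i \<in> borel_measurable (F (\<tau> i))" and "\<And>i. i < k \<Longrightarrow> \<exists>c. \<forall>\<omega>\<in>space M. norm (\<eta> i \<omega>) \<le> c"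
  shows "(\<lambda>\<omega>. \<Sum>i<k. \<eta> i \<omega> *v (W (\<tau> (Suc i)) \<omega> - W (\<tau> i) \<omega>)) \<in> borel_measurable (F (\<tau> k)) \<and> 0 \<le> \<tau> k \<and>
     has_bochner_integral M (\<lambda>\<omega>. (norm (\<Sum>i<k. \<eta> i \<omega> *v (W (\<tau> (Suc i)) \<omega> - W (\<tau> i) \<omega>)))\<^sup>2)
       (\<Sum>i<k. (\<tau> (Suc i) - \<tau> i) * expectation (\<lambda>\<omega>. (norm (\<eta> i \<omega>))\<^sup>2))"
  using assms
proof (induction k)
  case 0
  then show ?case by (simp add: has_bochner_integral_zero)
next
  case (Suc k)
  define I where "I \<omega> = (\<Sum>i<k. \<eta> i \<omega> *v (W (\<tau> (Suc i)) \<omega> - W (\<tau> i) \<omega>))" for \<omega>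
  have IH: "I \<in> borel_measurable (F (\<tau> k))" "0 \<le> \<tau> k"
    "has_bochner_integral M (\<lambda>\<omega>. (norm (I \<omega>))\<^sup>2) (\<Sum>i<k. (\<tau> (Suc i) - \<tau> i) * expectation (\<lambda>\<omega>. (norm (\<eta> i \<omega>))\<^sup>2))"
    using Suc unfolding I_def[abs_def] by (auto simp: less_Suc_eq)
  obtain c where c: "\<And>\<omega>. \<omega> \<in> space M \<Longrightarrow> norm (\<eta> k \<omega>) \<le> c" using Suc.prems(4)[of k] by auto
  have le: "\<tau> k \<le> \<tau> (Suc k)" using Suc.prems(2)[of k] by simp
  have \<eta>k: "\<eta> k \<in> borel_measurable (F (\<tau> k))" using Suc.prems(3)[of k] by simp
  let ?J = "\<lambda>\<omega>. \<eta> k \<omega> *v (W (\<tau> (Suc k)) \<omega> - W (\<tau> k) \<omega>)"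
  note J = simple_term_isometry[OF IH(2) le \<eta>k c IH(1)]
  have I2: "integrable M (\<lambda>\<omega>. (norm (I \<omega>))\<^sup>2)" using IH(3) by (simp add: has_bochner_integral_iff)
  have "has_bochner_integral M (\<lambda>\<omega>. (norm (I \<omega>))\<^sup>2 + 2 * (I \<omega> \<bullet> ?J \<omega>) + (norm (?J \<omega>))\<^sup>2)
     ((\<Sum>i<k. (\<tau> (Suc i) - \<tau> i) * expectation (\<lambda>\<omega>. (norm (\<eta> i \<omega>))\<^sup>2)) + 2 * 0 + (\<tau> (Suc k) - \<tau> k) * expectation (\<lambda>\<omega>. (norm (\<eta> k \<omega>))\<^sup>2))"
    by (intro has_bochner_integral_add has_bochner_integral_mult_right IH(3) J I2)
  moreover have "(norm (I \<omega> + ?J \<omega>))\<^sup>2 = (norm (I \<omega>))\<^sup>2 + 2 * (I \<omega> \<bullet> ?J \<omega>) + (norm (?J \<omega>))\<^sup>2" for \<omega>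
    by (simp add: power2_norm_eq_inner inner_add inner_commute)
  moreover have "(\<lambda>\<omega>. I \<omega> + ?J \<omega>) \<in> borel_measurable (F (\<tau> (Suc k)))"
  proof -
    have t: "0 \<le> \<tau> (Suc k)" using IH(2) le by simp
    have [measurable]: "I \<in> borel_measurable (F (\<tau> (Suc k)))" "W (\<tau> (Suc k)) \<in> borel_measurable (F (\<tau> (Suc k)))"
      "W (\<tau> k) \<in> borel_measurable (F (\<tau> (Suc k)))" "\<eta> k \<in> borel_measurable (F (\<tau> (Suc k)))"
      using measurable_F_mono[OF IH(2) le] IH(1) \<eta>k adapted_W t IH(2) by auto
    show ?thesis by measurable
  qed
  ultimately show ?case using IH(2) le by (simp add: I_def[symmetric])
qed

section \<open>Covariances of overlapping increments\<close>

lemma W_covariance: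
  assumes "0 \<le> x" "x \<le> y"
  shows "has_bochner_integral M (\<lambda>\<omega>. (W x \<omega> - W 0 \<omega>) $ p * (W y \<omega> - W 0 \<omega>) $ q) (if p = q then x else 0)"
proof (cases "x = 0")
  case True then show ?thesis by (simp add: has_bochner_integral_zero cong: if_cong)
next
  case False
  then have x: "0 < x" using assms by simp
  have 1: "has_bochner_integral M (\<lambda>\<omega>. (W x \<omega> - W 0 \<omega>) $ p * (W x \<omega> - W 0 \<omega>) $ q) (if p = q then x else 0)"
  proof -
    have "has_bochner_integral M (\<lambda>\<omega>. 1 * ((W x \<omega> - W 0 \<omega>) $ p * (W x \<omega> - W 0 \<omega>) $ q)) (expectation (\<lambda>_. 1) * (if p = q then x - 0 else 0))"
      by (rule increment_covariance[OF order_refl x]) simp_all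
    moreover have "expectation (\<lambda>_. 1) = (1::real)" by (simp add: prob_space)
    ultimately show ?thesis by (simp only: mult_1_left diff_zero)
  qed
  have m: "(\<lambda>\<omega>. (W x \<omega> - W 0 \<omega>) $ p) \<in> borel_measurable (F x)"
  proof -
    have [measurable]: "W 0 \<in> borel_measurable (F x)" "W x \<in> borel_measurable (F x)"
      using measurable_F_mono[of 0 x "W 0"] adapted_W assms by auto
    show ?thesis by measurable
  qed
  have i: "integrable M (\<lambda>\<omega>. (W x \<omega> - W 0 \<omega>) $ p)"
  proof -
    have "has_bochner_integral M (\<lambda>\<omega>. 1 * (W x \<omega> - W 0 \<omega>) $ p) 0"
      by (rule increment_mean_zero[OF order_refl x]) simp_all
    then show ?thesis unfolding mult_1_left has_bochner_integral_iff by (rule conjunct1)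
  qed
  have 2: "has_bochner_integral M (\<lambda>\<omega>. (W x \<omega> - W 0 \<omega>) $ p * (W y \<omega> - W x \<omega>) $ q) 0"
  proof (cases "x = y")
    case True then show ?thesis by (simp add: has_bochner_integral_zero)
  next
    case False
    then show ?thesis using assms by (intro increment_mean_zero[OF assms(1) _ m i]) simp
  qed
  have "(W x \<omega> - W 0 \<omega>) $ p * (W x \<omega> - W 0 \<omega>) $ q + (W x \<omega> - W 0 \<omega>) $ p * (W y \<omega> - W x \<omega>) $ q
     = (W x \<omega> - W 0 \<omega>) $ p * (W y \<omega> - W 0 \<omega>) $ q" for \<omega>
    by (simp add: distrib_left[symmetric])
  then show ?thesis using has_bochner_integral_add[OF 1 2] by (simp only: add_0_right)
qed

text \<open>Bilinear expansion of the covariance \<open>min x y\<close>. The result is written as an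
  integral of indicators, the length of the overlap, so that sums of such terms assemble into
  squared norms in time.\<close>

lemma increments_covariance:
  assumes "0 \<le> a" "a \<le> b" "0 \<le> c" "c \<le> d"
  shows "has_bochner_integral M (\<lambda>\<omega>. (W b \<omega> - W a \<omega>) $ p * (W d \<omega> - W c \<omega>) $ q)
     (if p = q then \<integral>r. indicator {a<..b} r * indicator {c<..d} r \<partial>lborel else 0)"
proof -
  have C: "has_bochner_integral M (\<lambda>\<omega>. (W x \<omega> - W 0 \<omega>) $ p * (W y \<omega> - W 0 \<omega>) $ q) (if p = q then min x y else 0)"
    if "0 \<le> x" "0 \<le> y" for x y
  proof (cases "x \<le> y")
    case True then show ?thesis using W_covariance[OF that(1) True, of p q] by (simp only: min_absorb1)
  next
    case False
    then have "min x y = y" by simp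
    then show ?thesis using W_covariance[of y x q p] that False by (simp only: mult.commute[of "(W x _ - W 0 _) $ p"] eq_commute[of p q])
  qed
  have "has_bochner_integral M (\<lambda>\<omega>. (W b \<omega> - W 0 \<omega>) $ p * (W d \<omega> - W 0 \<omega>) $ q - (W b \<omega> - W 0 \<omega>) $ p * (W c \<omega> - W 0 \<omega>) $ q
      - ((W a \<omega> - W 0 \<omega>) $ p * (W d \<omega> - W 0 \<omega>) $ q - (W a \<omega> - W 0 \<omega>) $ p * (W c \<omega> - W 0 \<omega>) $ q))
      ((if p = q then min b d else 0) - (if p = q then min b c else 0) - ((if p = q then min a d else 0) - (if p = q then min a c else 0)))"
    by (intro has_bochner_integral_diff C) (use assms in auto)
  moreover have "(\<integral>r. indicator {a<..b} r * indicator {c<..d} r \<partial>lborel) = min b d - min b c - (min a d - min a c)"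
  proof -
    have "(\<integral>r. indicator {a<..b} r * indicator {c<..d} r \<partial>lborel) = (\<integral>r. indicator {max a c<..min b d} r \<partial>lborel :: real)"
      by (intro Bochner_Integration.integral_cong) (auto simp: indicator_def)
    also have "\<dots> = max 0 (min b d - max a c)"
      by (cases "max a c \<le> min b d") (auto simp: max_def)
    also have "\<dots> = min b d - min b c - (min a d - min a c)"
      using assms by (auto simp: min_def max_def)
    finally show ?thesis .
  qed
  moreover have "(W b \<omega> - W 0 \<omega>) $ p * (W d \<omega> - W 0 \<omega>) $ q - (W b \<omega> - W 0 \<omega>) $ p * (W c \<omega> - W 0 \<omega>) $ q
      - ((W a \<omega> - W 0 \<omega>) $ p * (W d \<omega> - W 0 \<omega>) $ q - (W a \<omega> - W 0 \<omega>) $ p * (W c \<omega> - W 0 \<omega>) $ q)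
      = (W b \<omega> - W a \<omega>) $ p * (W d \<omega> - W c \<omega>) $ q" for \<omega>
    by (simp add: algebra_simps)
  ultimately show ?thesis by (cases "p = q") (simp_all only: if_True if_False simp_thms diff_self)
qed

text \<open>With deterministic coefficients the intervals may overlap, so two integrals on different
  grids can be compared without passing to a common refinement.\<close>

lemma deterministic_isometry:
  fixes \<xi> :: "'i \<Rightarrow> real^'n^'d::finite"
  assumes I: "finite I" and ab: "\<And>i. i \<in> I \<Longrightarrow> 0 \<le> \<alpha> i" "\<And>i. i \<in> I \<Longrightarrow> \<alpha> i \<le> \<beta> i"
  shows "has_bochner_integral M (\<lambda>\<omega>. (norm (\<Sum>i\<in>I. \<xi> i *v (W (\<beta> i) \<omega> - W (\<alpha> i) \<omega>)))\<^sup>2)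
     (\<integral>r. (norm (\<Sum>i\<in>I. indicator {\<alpha> i<..\<beta> i} r *\<^sub>R \<xi> i))\<^sup>2 \<partial>lborel)"
    and "integrable lborel (\<lambda>r. (norm (\<Sum>i\<in>I. indicator {\<alpha> i<..\<beta> i} r *\<^sub>R \<xi> i))\<^sup>2)"
proof -
  let ?c = "\<lambda>i j. \<integral>r. indicator {\<alpha> i<..\<beta> i} r * indicator {\<alpha> j<..\<beta> j} r \<partial>lborel :: real"
  have 1: "has_bochner_integral M (\<lambda>\<omega>. (\<xi> i *v (W (\<beta> i) \<omega> - W (\<alpha> i) \<omega>)) \<bullet> (\<xi> j *v (W (\<beta> j) \<omega> - W (\<alpha> j) \<omega>))) ((\<xi> i \<bullet> \<xi> j) * ?c i j)"
    if ij: "i \<in> I" "j \<in> I" for i j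
  proof -
    have "has_bochner_integral M (\<lambda>\<omega>. \<Sum>p\<in>UNIV. \<Sum>q\<in>UNIV. \<Sum>q'\<in>UNIV. \<xi> i $ p $ q * \<xi> j $ p $ q' * ((W (\<beta> i) \<omega> - W (\<alpha> i) \<omega>) $ q * (W (\<beta> j) \<omega> - W (\<alpha> j) \<omega>) $ q'))
      (\<Sum>p\<in>UNIV. \<Sum>q\<in>UNIV. \<Sum>q'\<in>UNIV. \<xi> i $ p $ q * \<xi> j $ p $ q' * (if q = q' then ?c i j else 0))"
      using ij ab by (intro has_bochner_integral_sum has_bochner_integral_mult_right increments_covariance) auto
    moreover have "(\<Sum>p\<in>UNIV. \<Sum>q\<in>UNIV. \<Sum>q'\<in>UNIV. \<xi> i $ p $ q * \<xi> j $ p $ q' * (if q = q' then ?c i j else 0)) = (\<xi> i \<bullet> \<xi> j) * ?c i j"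
      by (simp add: inner_vec_def sum_distrib_right if_distrib[of "(*) _"] cong: if_cong)
    ultimately show ?thesis unfolding matrix_mult_inner by simp
  qed
  have fin: "emeasure lborel {u<..v} < top" for u v :: real by (cases "u \<le> v") auto
  have ci: "integrable lborel (\<lambda>r. indicator {\<alpha> i<..\<beta> i} r * indicator {\<alpha> j<..\<beta> j} r :: real)" for i j
    by (rule Bochner_Integration.integrable_bound[where f="indicator {\<alpha> i<..\<beta> i} :: real \<Rightarrow> real"])
      (auto simp: indicator_def fin intro!: integrable_real_indicator)
  have e: "(norm (\<Sum>i\<in>I. indicator {\<alpha> i<..\<beta> i} r *\<^sub>R \<xi> i))\<^sup>2 = (\<Sum>i\<in>I. \<Sum>j\<in>I. (\<xi> i \<bullet> \<xi> j) * (indicator {\<alpha> i<..\<beta> i} r * indicator {\<alpha> j<..\<beta> j} r))" for r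
    by (simp add: power2_norm_eq_inner inner_sum_left inner_sum_right sum_distrib_left mult_ac inner_commute)
  show "integrable lborel (\<lambda>r. (norm (\<Sum>i\<in>I. indicator {\<alpha> i<..\<beta> i} r *\<^sub>R \<xi> i))\<^sup>2)"
    unfolding e using ci by (intro Bochner_Integration.integrable_sum integrable_mult_right)
  have "(\<integral>r. (norm (\<Sum>i\<in>I. indicator {\<alpha> i<..\<beta> i} r *\<^sub>R \<xi> i))\<^sup>2 \<partial>lborel) = (\<Sum>i\<in>I. \<Sum>j\<in>I. (\<xi> i \<bullet> \<xi> j) * ?c i j)"
    unfolding e using ci by (simp add: Bochner_Integration.integral_sum)
  moreover have "has_bochner_integral M (\<lambda>\<omega>. \<Sum>i\<in>I. \<Sum>j\<in>I. (\<xi> i *v (W (\<beta> i) \<omega> - W (\<alpha> i) \<omega>)) \<bullet> (\<xi> j *v (W (\<beta> j) \<omega> - W (\<alpha> j) \<omega>)))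
     (\<Sum>i\<in>I. \<Sum>j\<in>I. (\<xi> i \<bullet> \<xi> j) * ?c i j)"
    by (intro has_bochner_integral_sum 1)
  ultimately show "has_bochner_integral M (\<lambda>\<omega>. (norm (\<Sum>i\<in>I. \<xi> i *v (W (\<beta> i) \<omega> - W (\<alpha> i) \<omega>)))\<^sup>2)
     (\<integral>r. (norm (\<Sum>i\<in>I. indicator {\<alpha> i<..\<beta> i} r *\<^sub>R \<xi> i))\<^sup>2 \<partial>lborel)"
    by (simp only: power2_norm_eq_inner inner_sum_left) (simp only: inner_sum_right)
qed

end

definition diffusion_set :: "real \<Rightarrow> (real^'n::finite^'d::finite) set" where
  "diffusion_set \<delta> = {\<xi>. loewner_le (\<xi> ** transpose \<xi>) (\<delta> *\<^sub>R mat 1)}"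

text \<open>The quadratic condition bounds the operator norm of the transpose by
  \<open>sqrt \<delta>\<close>. By duality this is an intersection of half-spaces in \<xi>, from
  which closedness and convexity are immediate.\<close>

lemma diffusion_set_eq:
  assumes "0 \<le> \<delta>"
  shows "(diffusion_set \<delta> :: (real^'n::finite^'d::finite) set) = (\<Inter>v w. {\<xi>. (\<chi> p q. v $ p * w $ q) \<bullet> \<xi> \<le> sqrt \<delta> * norm v * norm w})"
proof -
  have ip: "(\<chi> p q. v $ p * w $ q) \<bullet> \<xi> = v \<bullet> (\<xi> *v w)" for v :: "real^'d" and w :: "real^'n" and \<xi>
    by (simp add: inner_vec_def matrix_vector_mult_def sum_distrib_left mult_ac)
  have id: "v \<bullet> ((\<delta> *\<^sub>R mat 1) *v v) = (sqrt \<delta> * norm v)\<^sup>2" for v :: "real^'d"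
    using assms by (simp add: scaleR_matrix_vector_assoc[symmetric] power_mult_distrib power2_norm_eq_inner)
  have "\<xi> \<in> diffusion_set \<delta> \<longleftrightarrow> (\<forall>v. norm (v v* \<xi>) \<le> sqrt \<delta> * norm v)" for \<xi> :: "real^'n^'d"
    unfolding diffusion_set_def loewner_le_def mem_Collect_eq inner_gram_eq id using assms
    by (auto simp: power_mono intro: power2_le_imp_le)
  moreover have "(\<forall>v. norm (v v* \<xi>) \<le> sqrt \<delta> * norm v) \<longleftrightarrow> (\<forall>v w. v \<bullet> (\<xi> *v w) \<le> sqrt \<delta> * norm v * norm w)" for \<xi> :: "real^'n^'d"
  proof (intro iffI allI)
    fix v :: "real^'d" and w :: "real^'n" assume "\<forall>v. norm (v v* \<xi>) \<le> sqrt \<delta> * norm v"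
    then have "norm (v v* \<xi>) * norm w \<le> sqrt \<delta> * norm v * norm w" by (intro mult_right_mono) auto
    then show "v \<bullet> (\<xi> *v w) \<le> sqrt \<delta> * norm v * norm w"
      unfolding dot_lmul_matrix[symmetric] using norm_cauchy_schwarz[of "v v* \<xi>" w] by linarith
  next
    fix v :: "real^'d" assume a: "\<forall>v w. v \<bullet> (\<xi> *v w) \<le> sqrt \<delta> * norm v * norm w"
    \<comment> \<open>Testing with \<open>w = v v* \<xi>\<close> turns the bilinear bound into one
      for the norm.\<close>
    have "(norm (v v* \<xi>))\<^sup>2 \<le> sqrt \<delta> * norm v * norm (v v* \<xi>)"
      using a[rule_format, of v "v v* \<xi>"] unfolding dot_lmul_matrix[symmetric] power2_norm_eq_inner .
    then show "norm (v v* \<xi>) \<le> sqrt \<delta> * norm v"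
      using assms by (cases "v v* \<xi> = 0") (auto simp: power2_eq_square mult_le_cancel_right)
  qed
  ultimately show ?thesis by (auto simp: ip)
qed

lemma closed_convex_diffusion_set:
  assumes "0 \<le> \<delta>"
  shows "closed (diffusion_set \<delta> :: (real^'n::finite^'d::finite) set)" "convex (diffusion_set \<delta> :: (real^'n^'d) set)"
    "diffusion_set \<delta> \<noteq> ({} :: (real^'n^'d) set)"
proof -
  show "closed (diffusion_set \<delta> :: (real^'n^'d) set)"
    unfolding diffusion_set_eq[OF assms] by (intro closed_INT ballI closed_halfspace_le)
  show "convex (diffusion_set \<delta> :: (real^'n^'d) set)"
    unfolding diffusion_set_eq[OF assms] by (intro convex_INT convex_halfspace_le)
  have "0 \<in> (diffusion_set \<delta> :: (real^'n^'d) set)"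
    unfolding diffusion_set_eq[OF assms] using assms by simp
  then show "diffusion_set \<delta> \<noteq> ({} :: (real^'n^'d) set)" by blast
qed

section \<open>Step functions on a grid\<close>

lemma grid_mono:
  fixes \<tau> :: "nat \<Rightarrow> real"
  assumes "\<And>i. i < k \<Longrightarrow> \<tau> i \<le> \<tau> (Suc i)" "i \<le> j" "j \<le> k"
  shows "\<tau> i \<le> \<tau> j"
  using assms(2,3)
proof (induction j rule: dec_induct)
  case (step j) then show ?case using assms(1)[of j] by simp
qed simp

text \<open>Cells are open on the left and closed on the right, so a point after
  \<open>\<tau> 0\<close> lies in exactly one of them; repeated grid points only produce empty
  cells.\<close>

lemma grid_value:
  fixes \<tau> :: "nat \<Rightarrow> real"
  assumes "\<And>i. i < k \<Longrightarrow> \<tau> i \<le> \<tau> (Suc i)" "\<tau> 0 < r" "r \<le> \<tau> k"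
  shows "\<exists>i<k. \<forall>j<k. indicator {\<tau> j<..\<tau> (Suc j)} r = (if j = i then 1 else 0 :: real)"
  using assms
proof (induction k)
  case (Suc k)
  show ?case
  proof (cases "r \<le> \<tau> k")
    case True
    then obtain i where "i < k" "\<forall>j<k. indicator {\<tau> j<..\<tau> (Suc j)} r = (if j = i then 1 else 0 :: real)"
      using Suc by (metis less_SucI)
    then show ?thesis using True by (intro exI[of _ i]) (auto simp: less_Suc_eq)
  next
    case False
    have "indicator {\<tau> j<..\<tau> (Suc j)} r = (0 :: real)" if "j < k" for j
      using grid_mono[of "Suc k" \<tau> "Suc j" k] Suc.prems(1) that False by auto
    then show ?thesis using False Suc.prems by (intro exI[of _ k]) (auto simp: less_Suc_eq)
  qed
qed simp

lemma grid_sum: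
  fixes \<tau> :: "nat \<Rightarrow> real"
  assumes "\<And>i. i < k \<Longrightarrow> \<tau> i \<le> \<tau> (Suc i)" "\<tau> 0 < r" "r \<le> \<tau> k"
  shows "\<exists>i<k. (\<forall>x :: nat \<Rightarrow> real. (\<Sum>j<k. indicator {\<tau> j<..\<tau> (Suc j)} r * x j) = x i) \<and>
     (\<forall>x :: nat \<Rightarrow> 'v::real_vector. (\<Sum>j<k. indicator {\<tau> j<..\<tau> (Suc j)} r *\<^sub>R x j) = x i)"
proof -
  obtain i where i: "i < k" "\<And>j. j < k \<Longrightarrow> indicator {\<tau> j<..\<tau> (Suc j)} r = (if j = i then 1 else 0 :: real)"
    using grid_value[OF assms] by blast
  have "(\<Sum>j<k. indicator {\<tau> j<..\<tau> (Suc j)} r *\<^sub>R x j) = x i" for x :: "nat \<Rightarrow> 'v"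
  proof -
    have "(\<Sum>j<k. indicator {\<tau> j<..\<tau> (Suc j)} r *\<^sub>R x j) = (\<Sum>j<k. if j = i then x j else 0)"
      using i(2) by (intro sum.cong) auto
    then show ?thesis using i(1) by simp
  qed
  moreover have "(\<Sum>j<k. indicator {\<tau> j<..\<tau> (Suc j)} r * x j) = x i" for x :: "nat \<Rightarrow> real"
  proof -
    have "(\<Sum>j<k. indicator {\<tau> j<..\<tau> (Suc j)} r * x j) = (\<Sum>j<k. if j = i then x j else 0)"
      using i(2) by (intro sum.cong) auto
    then show ?thesis using i(1) by simp
  qed
  ultimately show ?thesis using i(1) by blast
qed

text \<open>Jensen's inequality, from the nonnegative variance of the norm.\<close>

lemma (in prob_space) norm_expectation_sq_le:
  fixes X :: "'a \<Rightarrow> 'v::euclidean_space"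
  assumes [measurable]: "X \<in> borel_measurable M" and X: "\<And>\<omega>. \<omega> \<in> space M \<Longrightarrow> norm (X \<omega>) \<le> c"
  shows "(norm (expectation X))\<^sup>2 \<le> expectation (\<lambda>\<omega>. (norm (X \<omega>))\<^sup>2)" "integrable M (\<lambda>\<omega>. (norm (X \<omega>))\<^sup>2)"
proof -
  have i1: "integrable M (\<lambda>\<omega>. norm (X \<omega>))" using X by (intro integrable_const_bound[where B=c]) auto
  show i2: "integrable M (\<lambda>\<omega>. (norm (X \<omega>))\<^sup>2)" using X by (intro integrable_const_bound[where B="c\<^sup>2"]) (auto intro!: AE_I2 power_mono)
  have "(norm (expectation X))\<^sup>2 \<le> (expectation (\<lambda>\<omega>. norm (X \<omega>)))\<^sup>2"
    by (intro power_mono integral_norm_bound) simp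
  also have "\<dots> \<le> expectation (\<lambda>\<omega>. (norm (X \<omega>))\<^sup>2)"
    using variance_eq[OF i1 i2] variance_positive[of "\<lambda>\<omega>. norm (X \<omega>)"] by linarith
  finally show "(norm (expectation X))\<^sup>2 \<le> expectation (\<lambda>\<omega>. (norm (X \<omega>))\<^sup>2)" .
qed

section \<open>Deterministic approximation of the stochastic integral\<close>

context brownian_motion
begin

lemma ito_integrand_measurable:
  assumes ito: "has_ito_integral M F W s t (\<lambda>r \<omega>. \<Sigma> r) J" and st: "0 \<le> s" "s \<le> t"
  shows "\<Sigma> \<in> borel_measurable (restrict_space borel {s..t})"
proof -
  have prog: "(\<lambda>(r, \<omega>). \<Sigma> r) \<in> borel_measurable (restrict_space borel {s..t} \<Otimes>\<^sub>M F t)"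
    using ito st unfolding has_ito_integral_def by auto
  obtain \<omega>0 where "\<omega>0 \<in> space M" using not_empty by blast
  then have "\<omega>0 \<in> space (F t)" using subalgebra_F[of t] st by (simp add: subalgebra_def)
  then have "(\<lambda>r. (r, \<omega>0)) \<in> measurable (restrict_space borel {s..t}) (restrict_space borel {s..t} \<Otimes>\<^sub>M F t)" by simp
  from measurable_compose[OF this prog] show ?thesis by simp
qed

text \<open>The approximating simple integrands of the Ito integral are random. Their coefficients are replaced by
  their means, projected onto the closed convex set \<^const>\<open>diffusion_set\<close>; by the isometry neither
  operation destroys the approximation of a deterministic integrand with values in that set.\<close>

lemma ito_deterministic_approx:
  fixes \<Sigma> :: "real \<Rightarrow> real^'n^'d::finite"
  assumes ito: "has_ito_integral M F W s t (\<lambda>r \<omega>. \<Sigma> r) J" and st: "0 \<le> s" "s \<le> t"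
    and \<Sigma>: "\<And>r. r \<in> {s..t} \<Longrightarrow> \<Sigma> r \<in> diffusion_set \<delta>" and \<delta>: "0 \<le> \<delta>" and e: "e > 0"
  shows "\<exists>k \<tau> \<xi>. \<tau> 0 = s \<and> \<tau> k = t \<and> (\<forall>i<k. \<tau> i \<le> \<tau> (Suc i) \<and> \<xi> i \<in> diffusion_set \<delta>) \<and>
    (\<integral>\<^sup>+r\<in>{s..t}. ennreal ((norm ((\<Sum>i<k. indicator {\<tau> i<..\<tau> (Suc i)} r *\<^sub>R \<xi> i) - \<Sigma> r))\<^sup>2) \<partial>lborel) \<le> ennreal e \<and>
    (\<integral>\<^sup>+\<omega>. ennreal ((norm ((\<Sum>i<k. \<xi> i *v (W (\<tau> (Suc i)) \<omega> - W (\<tau> i) \<omega>)) - J \<omega>))\<^sup>2) \<partial>M) \<le> ennreal e"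
proof -
  \<comment> \<open>The final triangle inequality costs
    \<open>2 * (4 * e') + 2 * e'\<close>.\<close>
  define e' where "e' = e / 10"
  have e': "e' > 0" using e by (simp add: e'_def)
  have Jm: "J \<in> borel_measurable (F t)"
    using ito st unfolding has_ito_integral_def by auto
  have t0: "0 \<le> t" using st by simp
  have [measurable]: "J \<in> borel_measurable M" by (rule measurable_F_M[OF t0 Jm])
  obtain S where S: "\<And>m. is_simple_integrand M F s t (S m)"
    "(\<lambda>m. \<integral>\<^sup>+\<omega>. (\<integral>\<^sup>+r\<in>{s..t}. ennreal ((norm (simple_value (S m) r \<omega> - \<Sigma> r))\<^sup>2) \<partial>lborel) \<partial>M) \<longlonglongrightarrow> 0"
    "(\<lambda>m. \<integral>\<^sup>+\<omega>. ennreal ((norm (simple_integral W (S m) \<omega> - J \<omega>))\<^sup>2) \<partial>M) \<longlonglongrightarrow> 0"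
    using ito unfolding has_ito_integral_def by blast
  have "\<forall>\<^sub>F m in sequentially. (\<integral>\<^sup>+\<omega>. (\<integral>\<^sup>+r\<in>{s..t}. ennreal ((norm (simple_value (S m) r \<omega> - \<Sigma> r))\<^sup>2) \<partial>lborel) \<partial>M) < ennreal e'
     \<and> (\<integral>\<^sup>+\<omega>. ennreal ((norm (simple_integral W (S m) \<omega> - J \<omega>))\<^sup>2) \<partial>M) < ennreal e'"
    using order_tendstoD(2)[OF S(2), of "ennreal e'"] order_tendstoD(2)[OF S(3), of "ennreal e'"] e'
    by (simp add: eventually_conj_iff)
  then obtain m where m: "(\<integral>\<^sup>+\<omega>. (\<integral>\<^sup>+r\<in>{s..t}. ennreal ((norm (simple_value (S m) r \<omega> - \<Sigma> r))\<^sup>2) \<partial>lborel) \<partial>M) \<le> ennreal e'"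
     "(\<integral>\<^sup>+\<omega>. ennreal ((norm (simple_integral W (S m) \<omega> - J \<omega>))\<^sup>2) \<partial>M) \<le> ennreal e'"
    by (auto simp: eventually_sequentially intro: less_imp_le)
  obtain k \<tau> \<eta> where Sm: "S m = (k, \<tau>, \<eta>)" by (cases "S m") auto
  have \<tau>: "\<tau> 0 = s" "\<tau> k = t" "\<And>i. i < k \<Longrightarrow> \<tau> i \<le> \<tau> (Suc i)" and \<eta>F: "\<And>i. i < k \<Longrightarrow> \<eta> i \<in> borel_measurable (F (\<tau> i))"
    and "\<And>i. i < k \<Longrightarrow> \<exists>c. \<forall>\<omega>\<in>space M. norm (\<eta> i \<omega>) \<le> c"
    using S(1)[of m] unfolding Sm is_simple_integrand_def by auto
  then obtain c where c: "\<And>i \<omega>. i < k \<Longrightarrow> \<omega> \<in> space M \<Longrightarrow> norm (\<eta> i \<omega>) \<le> c i" by metis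
  have tm: "\<tau> i \<le> \<tau> j" if "i \<le> j" "j \<le> k" for i j using grid_mono[of k \<tau> i j] \<tau>(3) that by simp
  have \<tau>0: "0 \<le> \<tau> i" if "i \<le> k" for i using tm[of 0 i] that \<tau>(1) st by simp
  have \<eta>M: "\<eta> i \<in> borel_measurable M" if "i < k" for i using measurable_F_M[OF \<tau>0 \<eta>F] that by simp
  let ?O = "diffusion_set \<delta> :: (real^'n^'d) set"
  note O = closed_convex_diffusion_set[OF \<delta>, where 'n='n and 'd='d]
  define \<xi> where "\<xi> i = closest_point ?O (expectation (\<eta> i))" for i
  have \<xi>O: "\<xi> i \<in> ?O" for i unfolding \<xi>_def by (rule closest_point_in_set[OF O(1,3)])
  \<comment> \<open>Extension by \<open>0\<close> makes the integrand Borel measurable on the whole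
    line, as Fubini's theorem below requires.\<close>
  define \<Sigma>' where "\<Sigma>' r = indicator {s..t} r *\<^sub>R \<Sigma> r" for r
  have [measurable]: "\<Sigma>' \<in> borel_measurable borel"
    unfolding \<Sigma>'_def[abs_def] using ito_integrand_measurable[OF ito st]
    by (subst (asm) borel_measurable_restrict_space_iff) auto
  have g: "(norm (\<xi> i - \<Sigma> r))\<^sup>2 \<le> expectation (\<lambda>\<omega>. (norm (\<eta> i \<omega> - \<Sigma> r))\<^sup>2)"
    "integrable M (\<lambda>\<omega>. (norm (\<eta> i \<omega> - \<Sigma> r))\<^sup>2)"
    "expectation (\<lambda>\<omega>. (norm (\<eta> i \<omega> - \<xi> i))\<^sup>2) \<le> 4 * expectation (\<lambda>\<omega>. (norm (\<eta> i \<omega> - \<Sigma> r))\<^sup>2)"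
    if i: "i < k" and r: "r \<in> {s..t}" for i r
  proof -
    note [measurable] = \<eta>M[OF i]
    have \<eta>i: "integrable M (\<eta> i)" using c[OF i] by (intro integrable_const_bound[where B="c i"]) auto
    have b: "norm (\<eta> i \<omega> - v) \<le> c i + norm v" if "\<omega> \<in> space M" for \<omega> v
      using c[OF i that] norm_triangle_ineq4[of "\<eta> i \<omega>" v] by linarith
    \<comment> \<open>Projection onto a closed convex set is 1-Lipschitz and fixes
      \<open>\<Sigma> r\<close>, so projecting the mean of \<open>\<eta> i\<close> does not increase
      its distance to \<open>\<Sigma> r\<close>; Jensen's inequality then bounds that
      distance.\<close>
    have "norm (\<xi> i - \<Sigma> r) = dist (closest_point ?O (expectation (\<eta> i))) (closest_point ?O (\<Sigma> r))"
      unfolding \<xi>_def dist_norm closest_point_self[OF \<Sigma>[OF r]] ..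
    also have "\<dots> \<le> norm (expectation (\<eta> i) - \<Sigma> r)"
      using closest_point_lipschitz[OF O(2,1,3)] by (simp add: dist_norm)
    also have "expectation (\<eta> i) - \<Sigma> r = expectation (\<lambda>\<omega>. \<eta> i \<omega> - \<Sigma> r)" using \<eta>i by (simp add: prob_space)
    finally have "(norm (\<xi> i - \<Sigma> r))\<^sup>2 \<le> (norm (expectation (\<lambda>\<omega>. \<eta> i \<omega> - \<Sigma> r)))\<^sup>2" by (intro power_mono) auto
    also have "\<dots> \<le> expectation (\<lambda>\<omega>. (norm (\<eta> i \<omega> - \<Sigma> r))\<^sup>2)"
      using b by (intro norm_expectation_sq_le(1)) auto
    finally show 1: "(norm (\<xi> i - \<Sigma> r))\<^sup>2 \<le> expectation (\<lambda>\<omega>. (norm (\<eta> i \<omega> - \<Sigma> r))\<^sup>2)" .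
    show 2: "integrable M (\<lambda>\<omega>. (norm (\<eta> i \<omega> - \<Sigma> r))\<^sup>2)" using b by (intro norm_expectation_sq_le(2)) auto
    have 3: "integrable M (\<lambda>\<omega>. (norm (\<eta> i \<omega> - \<xi> i))\<^sup>2)" using b by (intro norm_expectation_sq_le(2)) auto
    have "expectation (\<lambda>\<omega>. (norm (\<eta> i \<omega> - \<xi> i))\<^sup>2) \<le> expectation (\<lambda>\<omega>. 2 * (norm (\<eta> i \<omega> - \<Sigma> r))\<^sup>2 + 2 * (norm (\<xi> i - \<Sigma> r))\<^sup>2)"
    proof (rule integral_mono[OF 3])
      show "(norm (\<eta> i \<omega> - \<xi> i))\<^sup>2 \<le> 2 * (norm (\<eta> i \<omega> - \<Sigma> r))\<^sup>2 + 2 * (norm (\<xi> i - \<Sigma> r))\<^sup>2" for \<omega>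
        using norm_add_sq_le[of "\<eta> i \<omega> - \<Sigma> r" "\<Sigma> r - \<xi> i"] by (simp add: norm_minus_commute)
    qed (use 2 in simp)
    also have "\<dots> = 2 * expectation (\<lambda>\<omega>. (norm (\<eta> i \<omega> - \<Sigma> r))\<^sup>2) + 2 * (norm (\<xi> i - \<Sigma> r))\<^sup>2"
      using 2 by (simp add: prob_space)
    finally show "expectation (\<lambda>\<omega>. (norm (\<eta> i \<omega> - \<xi> i))\<^sup>2) \<le> 4 * expectation (\<lambda>\<omega>. (norm (\<eta> i \<omega> - \<Sigma> r))\<^sup>2)"
      using 1 by linarith
  qed
  \<comment> \<open>The mean squared error of the given random approximation at time
    \<open>r\<close>. Both new errors are estimated against it pointwise in
    \<open>r\<close>.\<close>
  define G where "G r = (\<integral>\<^sup>+\<omega>. indicator {s..t} r * ennreal ((norm ((\<Sum>i<k. indicator {\<tau> i<..\<tau> (Suc i)} r *\<^sub>R \<eta> i \<omega>) - \<Sigma>' r))\<^sup>2) \<partial>M)" for r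
  have joint: "(\<lambda>(r, \<omega>). indicator {s..t} r * ennreal ((norm ((\<Sum>i<k. indicator {\<tau> i<..\<tau> (Suc i)} r *\<^sub>R \<eta> i \<omega>) - \<Sigma>' r))\<^sup>2)) \<in> borel_measurable (lborel \<Otimes>\<^sub>M M)"
  proof -
    have "(\<lambda>p. \<Sum>i<k. indicator {\<tau> i<..\<tau> (Suc i)} (fst p) *\<^sub>R \<eta> i (snd p)) \<in> borel_measurable (lborel \<Otimes>\<^sub>M M)"
    proof (rule borel_measurable_sum)
      fix i assume "i \<in> {..<k}"
      then have [measurable]: "\<eta> i \<in> borel_measurable M" using \<eta>M by simp
      show "(\<lambda>p. indicator {\<tau> i<..\<tau> (Suc i)} (fst p) *\<^sub>R \<eta> i (snd p)) \<in> borel_measurable (lborel \<Otimes>\<^sub>M M)"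
        by (intro borel_measurable_scaleR) measurable
    qed
    then show ?thesis unfolding case_prod_beta by measurable
  qed
  interpret P: pair_sigma_finite lborel M ..
  have "(\<integral>\<^sup>+r. G r \<partial>lborel) = (\<integral>\<^sup>+\<omega>. (\<integral>\<^sup>+r. indicator {s..t} r * ennreal ((norm ((\<Sum>i<k. indicator {\<tau> i<..\<tau> (Suc i)} r *\<^sub>R \<eta> i \<omega>) - \<Sigma>' r))\<^sup>2) \<partial>lborel) \<partial>M)"
    unfolding G_def using P.Fubini'[OF joint] by simp
  also have "\<dots> = (\<integral>\<^sup>+\<omega>. (\<integral>\<^sup>+r\<in>{s..t}. ennreal ((norm (simple_value (S m) r \<omega> - \<Sigma> r))\<^sup>2) \<partial>lborel) \<partial>M)"
    by (intro nn_integral_cong) (auto simp: Sm simple_value_def \<Sigma>'_def indicator_def)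
  finally have A: "(\<integral>\<^sup>+r. G r \<partial>lborel) \<le> ennreal e'" using m(1) by simp
  have Gval: "\<exists>i<k. (\<Sum>i<k. indicator {\<tau> i<..\<tau> (Suc i)} r *\<^sub>R \<xi> i) = \<xi> i \<and> G r = ennreal (expectation (\<lambda>\<omega>. (norm (\<eta> i \<omega> - \<Sigma> r))\<^sup>2)) \<and>
      (\<forall>x. (\<Sum>j<k. indicator {\<tau> j<..\<tau> (Suc j)} r * (x j :: real)) = x i)"
    if r: "s < r" "r \<le> t" for r
  proof -
    have tr: "\<tau> 0 < r" "r \<le> \<tau> k" using r \<tau> by auto
    obtain i where i: "i < k"
      "\<And>x :: nat \<Rightarrow> real. (\<Sum>j<k. indicator {\<tau> j<..\<tau> (Suc j)} r * x j) = x i"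
      "\<And>x :: nat \<Rightarrow> real^'n^'d. (\<Sum>j<k. indicator {\<tau> j<..\<tau> (Suc j)} r *\<^sub>R x j) = x i" using grid_sum[of k \<tau> r, where 'v="real^'n^'d", OF \<tau>(3) tr] by blast
    have "G r = (\<integral>\<^sup>+\<omega>. ennreal ((norm (\<eta> i \<omega> - \<Sigma> r))\<^sup>2) \<partial>M)"
      unfolding G_def i(3) using r by (simp add: \<Sigma>'_def)
    also have "\<dots> = ennreal (expectation (\<lambda>\<omega>. (norm (\<eta> i \<omega> - \<Sigma> r))\<^sup>2))"
      using g(2)[OF i(1), of r] r by (intro nn_integral_eq_integral) auto
    finally show ?thesis using i by blast
  qed
  \<comment> \<open>The left endpoint \<open>s\<close> belongs to no cell although it lies in the
    domain of integration.\<close>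
  have AEs: "AE r in lborel. r \<noteq> s" by (rule AE_lborel_singleton)
  have 1: "(\<integral>\<^sup>+r\<in>{s..t}. ennreal ((norm ((\<Sum>i<k. indicator {\<tau> i<..\<tau> (Suc i)} r *\<^sub>R \<xi> i) - \<Sigma> r))\<^sup>2) \<partial>lborel) \<le> ennreal e'"
  proof (rule order_trans[OF nn_integral_mono_AE A])
    show "AE r in lborel. ennreal ((norm ((\<Sum>i<k. indicator {\<tau> i<..\<tau> (Suc i)} r *\<^sub>R \<xi> i) - \<Sigma> r))\<^sup>2) * indicator {s..t} r \<le> G r"
      using AEs
    proof eventually_elim
      case (elim r)
      show ?case
      proof (cases "r \<in> {s..t}")
        case True
        then have "s < r" "r \<le> t" using elim by auto
        from Gval[OF this] obtain i where i: "i < k" "(\<Sum>i<k. indicator {\<tau> i<..\<tau> (Suc i)} r *\<^sub>R \<xi> i) = \<xi> i"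
           "G r = ennreal (expectation (\<lambda>\<omega>. (norm (\<eta> i \<omega> - \<Sigma> r))\<^sup>2))" by blast
        show ?thesis unfolding i(2,3) using g(1)[OF i(1) True] True by (simp add: ennreal_leI)
      qed simp
    qed
  qed
  let ?I = "\<lambda>\<omega>. \<Sum>i<k. \<xi> i *v (W (\<tau> (Suc i)) \<omega> - W (\<tau> i) \<omega>)"
  let ?IS = "\<lambda>\<omega>. \<Sum>i<k. \<eta> i \<omega> *v (W (\<tau> (Suc i)) \<omega> - W (\<tau> i) \<omega>)"
  have Wm: "W (\<tau> i) \<in> borel_measurable M" if "i \<le> k" for i using \<tau>0[OF that] by simp
  have Im: "?I \<in> borel_measurable M" "?IS \<in> borel_measurable M"
  proof -
    have [measurable]: "W (\<tau> i) \<in> borel_measurable M" "W (\<tau> (Suc i)) \<in> borel_measurable M" "\<eta> i \<in> borel_measurable M" if "i \<in> {..<k}" for i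
      using Wm \<eta>M that by auto
    show "?I \<in> borel_measurable M" "?IS \<in> borel_measurable M" by (intro borel_measurable_sum; measurable)+
  qed
  note [measurable] = Im
  have 2: "(\<integral>\<^sup>+\<omega>. ennreal ((norm (?IS \<omega> - ?I \<omega>))\<^sup>2) \<partial>M) \<le> ennreal (4 * e')"
  proof -
    define x where "x i = expectation (\<lambda>\<omega>. (norm (\<eta> i \<omega> - \<xi> i))\<^sup>2)" for i
    have x0: "0 \<le> x i" for i by (simp add: x_def)
    have "has_bochner_integral M (\<lambda>\<omega>. (norm (\<Sum>i<k. (\<eta> i \<omega> - \<xi> i) *v (W (\<tau> (Suc i)) \<omega> - W (\<tau> i) \<omega>)))\<^sup>2) (\<Sum>i<k. (\<tau> (Suc i) - \<tau> i) * x i)"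
      unfolding x_def
    proof (intro conjunct2[OF conjunct2[OF simple_integral_isometry]])
      show "0 \<le> \<tau> 0" using \<tau>(1) st by simp
      fix i assume i: "i < k"
      show "\<tau> i \<le> \<tau> (Suc i)" by (rule \<tau>(3)[OF i])
      show "(\<lambda>\<omega>. \<eta> i \<omega> - \<xi> i) \<in> borel_measurable (F (\<tau> i))" using \<eta>F[OF i] by measurable
      show "\<exists>c. \<forall>\<omega>\<in>space M. norm (\<eta> i \<omega> - \<xi> i) \<le> c"
        using c[OF i] norm_triangle_ineq4[of _ "\<xi> i"] by (intro exI[of _ "c i + norm (\<xi> i)"]) (smt (verit))
    qed
    moreover have "?IS \<omega> - ?I \<omega> = (\<Sum>i<k. (\<eta> i \<omega> - \<xi> i) *v (W (\<tau> (Suc i)) \<omega> - W (\<tau> i) \<omega>))" for \<omega>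
      by (simp add: sum_subtractf matrix_vector_mult_diff_rdistrib)
    ultimately have "has_bochner_integral M (\<lambda>\<omega>. (norm (?IS \<omega> - ?I \<omega>))\<^sup>2) (\<Sum>i<k. (\<tau> (Suc i) - \<tau> i) * x i)" by simp
    then have "(\<integral>\<^sup>+\<omega>. ennreal ((norm (?IS \<omega> - ?I \<omega>))\<^sup>2) \<partial>M) = ennreal (\<Sum>i<k. (\<tau> (Suc i) - \<tau> i) * x i)"
      by (subst nn_integral_eq_integral) (auto simp: has_bochner_integral_iff)
    \<comment> \<open>The sum given by the isometry is rewritten as a time integral so that it can
      be compared with \<open>G\<close>.\<close>
    also have "\<dots> = (\<integral>\<^sup>+r. ennreal (\<Sum>i<k. indicator {\<tau> i<..\<tau> (Suc i)} r * x i) \<partial>lborel)"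
    proof -
      have "has_bochner_integral lborel (\<lambda>r. \<Sum>i<k. indicator {\<tau> i<..\<tau> (Suc i)} r * x i) (\<Sum>i<k. (\<tau> (Suc i) - \<tau> i) * x i)"
      proof (intro has_bochner_integral_sum has_bochner_integral_mult_left)
        fix i assume "i \<in> {..<k}"
        then show "has_bochner_integral lborel (indicator {\<tau> i<..\<tau> (Suc i)}) (\<tau> (Suc i) - \<tau> i)"
          using \<tau>(3)[of i] has_bochner_integral_real_indicator[of "{\<tau> i<..\<tau> (Suc i)}" lborel] by simp
      qed
      then show ?thesis using x0
        by (subst nn_integral_eq_integral) (auto simp: has_bochner_integral_iff intro!: sum_nonneg)
    qed
    also have "\<dots> \<le> (\<integral>\<^sup>+r. 4 * G r \<partial>lborel)"
    proof (rule nn_integral_mono)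
      fix r :: real
      show "ennreal (\<Sum>i<k. indicator {\<tau> i<..\<tau> (Suc i)} r * x i) \<le> 4 * G r"
      proof (cases "s < r \<and> r \<le> t")
        case True
        then obtain i where i: "i < k" "G r = ennreal (expectation (\<lambda>\<omega>. (norm (\<eta> i \<omega> - \<Sigma> r))\<^sup>2))"
           "\<And>x. (\<Sum>j<k. indicator {\<tau> j<..\<tau> (Suc j)} r * (x j :: real)) = x i" using Gval by blast
        have "ennreal (x i) \<le> ennreal (4 * expectation (\<lambda>\<omega>. (norm (\<eta> i \<omega> - \<Sigma> r))\<^sup>2))"
          using g(3)[OF i(1), of r] True unfolding x_def by (intro ennreal_leI) auto
        then show ?thesis unfolding i(2,3) by (simp add: ennreal_mult)
      next
        case False
        have "indicator {\<tau> i<..\<tau> (Suc i)} r = (0::real)" if "i < k" for i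
          using tm[of 0 i] tm[of "Suc i" k] that False \<tau>(1,2) by auto
        then have "(\<Sum>i<k. indicator {\<tau> i<..\<tau> (Suc i)} r * x i) = 0" by (intro sum.neutral) auto
        then show ?thesis by simp
      qed
    qed
    also have "\<dots> \<le> 4 * ennreal e'"
    proof -
      have "G \<in> borel_measurable lborel" unfolding G_def[abs_def] using joint by (intro borel_measurable_nn_integral) simp
      then show ?thesis using A by (simp add: nn_integral_cmult mult_left_mono)
    qed
    finally show ?thesis using e' by (simp add: ennreal_mult)
  qed
  have m2: "(\<integral>\<^sup>+\<omega>. ennreal ((norm (?IS \<omega> - J \<omega>))\<^sup>2) \<partial>M) \<le> ennreal e'"
    using m(2) by (simp add: Sm simple_integral_def)
  have "(\<integral>\<^sup>+\<omega>. ennreal ((norm (?I \<omega> - J \<omega>))\<^sup>2) \<partial>M) \<le> (\<integral>\<^sup>+\<omega>. 2 * ennreal ((norm (?IS \<omega> - ?I \<omega>))\<^sup>2) + 2 * ennreal ((norm (?IS \<omega> - J \<omega>))\<^sup>2) \<partial>M)"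
  proof (rule nn_integral_mono)
    fix \<omega>
    have "(norm (?I \<omega> - J \<omega>))\<^sup>2 \<le> 2 * (norm (?IS \<omega> - ?I \<omega>))\<^sup>2 + 2 * (norm (?IS \<omega> - J \<omega>))\<^sup>2"
      using norm_add_sq_le[of "?I \<omega> - ?IS \<omega>" "?IS \<omega> - J \<omega>"] by (simp add: norm_minus_commute)
    then show "ennreal ((norm (?I \<omega> - J \<omega>))\<^sup>2) \<le> 2 * ennreal ((norm (?IS \<omega> - ?I \<omega>))\<^sup>2) + 2 * ennreal ((norm (?IS \<omega> - J \<omega>))\<^sup>2)"
      by (simp add: ennreal_leI ennreal_mult[symmetric] flip: ennreal_numeral ennreal_plus)
  qed
  also have "\<dots> = 2 * (\<integral>\<^sup>+\<omega>. ennreal ((norm (?IS \<omega> - ?I \<omega>))\<^sup>2) \<partial>M) + 2 * (\<integral>\<^sup>+\<omega>. ennreal ((norm (?IS \<omega> - J \<omega>))\<^sup>2) \<partial>M)"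
    by (subst nn_integral_add) (auto simp: nn_integral_cmult)
  also have "\<dots> \<le> 2 * ennreal (4 * e') + 2 * ennreal e'"
    by (intro add_mono mult_left_mono 2 m2) auto
  also have "\<dots> = ennreal e"
    using e' by (simp add: ennreal_mult[symmetric] e'_def flip: ennreal_numeral ennreal_plus)
  finally have 3: "(\<integral>\<^sup>+\<omega>. ennreal ((norm (?I \<omega> - J \<omega>))\<^sup>2) \<partial>M) \<le> ennreal e" .
  have "ennreal e' \<le> ennreal e" using e by (intro ennreal_leI) (simp add: e'_def)
  with 1 have "(\<integral>\<^sup>+r\<in>{s..t}. ennreal ((norm ((\<Sum>i<k. indicator {\<tau> i<..\<tau> (Suc i)} r *\<^sub>R \<xi> i) - \<Sigma> r))\<^sup>2) \<partial>lborel) \<le> ennreal e" by (rule order_trans)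
  with 3 show ?thesis using \<tau> \<xi>O by (intro exI[of _ k] exI[of _ \<tau>] exI[of _ \<xi>]) auto
qed

end

lemma nn_integral_of_has_bochner_integral:
  assumes "has_bochner_integral N g v" "\<And>x. 0 \<le> g x"
  shows "(\<integral>\<^sup>+x. ennreal (g x) \<partial>N) = ennreal v"
  using assms by (subst nn_integral_eq_integral) (auto simp: has_bochner_integral_iff)

section \<open>Increments of the stochastic integral\<close>

context brownian_motion
begin

text \<open>\<open>Ja\<close> and \<open>Jb\<close> are limits along unrelated approximations, while
  the increment has to be approximated by increments of \<open>W\<close> after time \<open>a\<close>
  only, since these are independent of \<open>F a\<close>. The approximation of \<open>Jb\<close> is
  therefore cut at \<open>a\<close>. Its discarded part is close to \<open>Ja\<close> by the
  isometry, because both step functions approximate \<Sigma> on \<open>{s..a}\<close>.\<close>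

lemma ito_increment_approx:
  fixes \<Sigma> :: "real \<Rightarrow> real^'n^'d::finite"
  assumes ito: "has_ito_integral M F W s a (\<lambda>r \<omega>. \<Sigma> r) Ja" "has_ito_integral M F W s b (\<lambda>r \<omega>. \<Sigma> r) Jb"
    and ab: "0 \<le> s" "s \<le> a" "a \<le> b"
    and \<Sigma>: "\<And>r. r \<in> {s..b} \<Longrightarrow> \<Sigma> r \<in> diffusion_set \<delta>" and \<delta>: "0 \<le> \<delta>" and e: "e > 0"
  shows "\<exists>k \<tau> \<xi>. \<tau> 0 = a \<and> \<tau> k = b \<and> (\<forall>i<k. \<tau> i \<le> \<tau> (Suc i) \<and> \<xi> i \<in> diffusion_set \<delta>) \<and>
    (\<integral>\<^sup>+\<omega>. ennreal ((norm ((\<Sum>i<k. \<xi> i *v (W (\<tau> (Suc i)) \<omega> - W (\<tau> i) \<omega>)) - (Jb \<omega> - Ja \<omega>)))\<^sup>2) \<partial>M) \<le> ennreal e"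
proof -
  \<comment> \<open>The errors below add up to
    \<open>2 * e' + (4 * (4 * e') + 4 * e')\<close>.\<close>
  define e' where "e' = e / 22"
  have e': "e' > 0" using e by (simp add: e'_def)
  have sb: "s \<le> b" and a0: "0 \<le> a" and b0: "0 \<le> b" using ab by auto
  obtain k \<tau> \<xi> where B: "\<tau> 0 = s" "\<tau> k = b" "\<And>i. i < k \<Longrightarrow> \<tau> i \<le> \<tau> (Suc i)" "\<And>i. i < k \<Longrightarrow> \<xi> i \<in> diffusion_set \<delta>"
    "(\<integral>\<^sup>+r\<in>{s..b}. ennreal ((norm ((\<Sum>i<k. indicator {\<tau> i<..\<tau> (Suc i)} r *\<^sub>R \<xi> i) - \<Sigma> r))\<^sup>2) \<partial>lborel) \<le> ennreal e'"
    "(\<integral>\<^sup>+\<omega>. ennreal ((norm ((\<Sum>i<k. \<xi> i *v (W (\<tau> (Suc i)) \<omega> - W (\<tau> i) \<omega>)) - Jb \<omega>))\<^sup>2) \<partial>M) \<le> ennreal e'"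
    by (insert ito_deterministic_approx[OF ito(2) ab(1) sb \<Sigma> \<delta> e'], drule meta_mp, assumption, elim exE conjE, rule that, (assumption | blast)+)
  have \<Sigma>a: "\<And>r. r \<in> {s..a} \<Longrightarrow> \<Sigma> r \<in> diffusion_set \<delta>" using \<Sigma> ab by auto
  obtain k' \<tau>' \<xi>' where A: "\<tau>' 0 = s" "\<tau>' k' = a" "\<And>i. i < k' \<Longrightarrow> \<tau>' i \<le> \<tau>' (Suc i)"
    "(\<integral>\<^sup>+r\<in>{s..a}. ennreal ((norm ((\<Sum>i<k'. indicator {\<tau>' i<..\<tau>' (Suc i)} r *\<^sub>R \<xi>' i) - \<Sigma> r))\<^sup>2) \<partial>lborel) \<le> ennreal e'"
    "(\<integral>\<^sup>+\<omega>. ennreal ((norm ((\<Sum>i<k'. \<xi>' i *v (W (\<tau>' (Suc i)) \<omega> - W (\<tau>' i) \<omega>)) - Ja \<omega>))\<^sup>2) \<partial>M) \<le> ennreal e'"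
    by (insert ito_deterministic_approx[OF ito(1) ab(1,2) \<Sigma>a \<delta> e'], drule meta_mp, assumption, elim exE conjE, rule that, (assumption | blast)+)
  have Jm: "Ja \<in> borel_measurable M" "Jb \<in> borel_measurable M"
    using ito measurable_F_M[OF a0] measurable_F_M[OF b0] unfolding has_ito_integral_def by blast+
  have tm: "\<tau> i \<le> \<tau> j" if "i \<le> j" "j \<le> k" for i j using grid_mono[of k \<tau> i j] B(3) that by simp
  have tm': "\<tau>' i \<le> \<tau>' j" if "i \<le> j" "j \<le> k'" for i j using grid_mono[of k' \<tau>' i j] A(3) that by simp
  have \<tau>0: "s \<le> \<tau> i" if "i \<le> k" for i using tm[of 0 i] that B(1) by simp
  have \<tau>0': "s \<le> \<tau>' i" "\<tau>' i \<le> a" if "i \<le> k'" for i using tm'[of 0 i] tm'[of i k'] that A(1,2) by auto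
  let ?Ib = "\<lambda>\<omega>. \<Sum>i<k. \<xi> i *v (W (\<tau> (Suc i)) \<omega> - W (\<tau> i) \<omega>)"
  let ?Ia = "\<lambda>\<omega>. \<Sum>i<k'. \<xi>' i *v (W (\<tau>' (Suc i)) \<omega> - W (\<tau>' i) \<omega>)"
  \<comment> \<open>Replacing grid points by their minimum or maximum with \<open>a\<close> splits
    the sum into the parts before and after \<open>a\<close>, without making \<open>a\<close> a grid
    point.\<close>
  let ?L = "\<lambda>\<omega>. \<Sum>i<k. \<xi> i *v (W (min (\<tau> (Suc i)) a) \<omega> - W (min (\<tau> i) a) \<omega>)"
  let ?D = "\<lambda>\<omega>. \<Sum>i<k. \<xi> i *v (W (max (\<tau> (Suc i)) a) \<omega> - W (max (\<tau> i) a) \<omega>)"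
  have Wm: "W (\<tau> i) \<in> borel_measurable M" "W (min (\<tau> i) a) \<in> borel_measurable M" "W (max (\<tau> i) a) \<in> borel_measurable M" if "i \<le> k" for i
    using \<tau>0[OF that] ab a0 by auto
  have Wm': "W (\<tau>' i) \<in> borel_measurable M" if "i \<le> k'" for i using \<tau>0'[OF that] ab by auto
  have [measurable]: "?Ib \<in> borel_measurable M" "?L \<in> borel_measurable M" "?D \<in> borel_measurable M"
    by (intro borel_measurable_sum borel_measurable_matrix_vector_mult borel_measurable_const borel_measurable_diff Wm; simp)+
  have [measurable]: "?Ia \<in> borel_measurable M"
    by (intro borel_measurable_sum borel_measurable_matrix_vector_mult borel_measurable_const borel_measurable_diff Wm'; simp)
  note [measurable] = Jm
  have DL: "?D \<omega> = ?Ib \<omega> - ?L \<omega>" for \<omega>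
    unfolding sum_subtractf[symmetric] matrix_vector_mult_diff_distrib[symmetric]
    by (intro sum.cong refl arg_cong[where f="(*v) _"]) (auto simp: min_def max_def)
  have 1: "(\<integral>\<^sup>+\<omega>. ennreal ((norm (?L \<omega> - ?Ia \<omega>))\<^sup>2) \<partial>M) \<le> ennreal (4 * e')"
  proof -
    \<comment> \<open>The disjoint union of the two index sets, with a sign on the second, turns the
      difference of two sums on different grids into one sum to which the isometry applies.\<close>
    define I where "I = {..<k} <+> {..<k'}"
    define \<alpha> where "\<alpha> = case_sum (\<lambda>i. min (\<tau> i) a) \<tau>'"
    define \<beta> where "\<beta> = case_sum (\<lambda>i. min (\<tau> (Suc i)) a) (\<lambda>i. \<tau>' (Suc i))"
    define \<zeta> where "\<zeta> = case_sum \<xi> (\<lambda>i. - \<xi>' i)"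
    have I: "finite I" by (simp add: I_def)
    have \<alpha>: "0 \<le> \<alpha> i" "\<alpha> i \<le> \<beta> i" if "i \<in> I" for i
    proof -
      have "0 \<le> \<alpha> i \<and> \<alpha> i \<le> \<beta> i"
      proof (cases i)
        case (Inl x)
        then have x: "x < k" using that by (auto simp: I_def)
        then have "min (\<tau> x) a \<le> min (\<tau> (Suc x)) a" using B(3)[of x] by (intro min.mono) auto
        then show ?thesis using Inl x \<tau>0[of x] ab(1) a0 by (simp add: \<alpha>_def \<beta>_def)
      next
        case (Inr x)
        then have x: "x < k'" using that by (auto simp: I_def)
        then show ?thesis using Inr A(3)[of x] \<tau>0'(1)[of x] ab(1) by (simp add: \<alpha>_def \<beta>_def)
      qed
      then show "0 \<le> \<alpha> i" "\<alpha> i \<le> \<beta> i" by auto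
    qed
    have neg: "(- A) *v x = - (A *v x)" for A :: "real^'n^'d" and x
      using matrix_vector_mult_diff_rdistrib[of 0 A x] by simp
    have e1: "(\<Sum>i\<in>I. \<zeta> i *v (W (\<beta> i) \<omega> - W (\<alpha> i) \<omega>)) = ?L \<omega> - ?Ia \<omega>" for \<omega>
      by (simp add: I_def sum.Plus \<zeta>_def \<alpha>_def \<beta>_def sum_negf neg o_def)
    have e2: "(\<Sum>i\<in>I. indicator {\<alpha> i<..\<beta> i} r *\<^sub>R \<zeta> i) = (\<Sum>i<k. indicator {min (\<tau> i) a<..min (\<tau> (Suc i)) a} r *\<^sub>R \<xi> i) - (\<Sum>i<k'. indicator {\<tau>' i<..\<tau>' (Suc i)} r *\<^sub>R \<xi>' i)" for r
    proof -
      have z: "\<And>i. \<zeta> (Inl i) = \<xi> i" "\<And>i. \<zeta> (Inr i) = - \<xi>' i" "\<And>i. \<alpha> (Inl i) = min (\<tau> i) a" "\<And>i. \<alpha> (Inr i) = \<tau>' i"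
        "\<And>i. \<beta> (Inl i) = min (\<tau> (Suc i)) a" "\<And>i. \<beta> (Inr i) = \<tau>' (Suc i)"
        by (simp_all add: \<zeta>_def \<alpha>_def \<beta>_def)
      show ?thesis
        unfolding I_def sum.Plus[OF finite_lessThan finite_lessThan] o_def z scaleR_minus_right sum_negf add_uminus_conv_diff ..
    qed
    have "has_bochner_integral M (\<lambda>\<omega>. (norm (\<Sum>i\<in>I. \<zeta> i *v (W (\<beta> i) \<omega> - W (\<alpha> i) \<omega>)))\<^sup>2)
       (\<integral>r. (norm (\<Sum>i\<in>I. indicator {\<alpha> i<..\<beta> i} r *\<^sub>R \<zeta> i))\<^sup>2 \<partial>lborel)"
      "integrable lborel (\<lambda>r. (norm (\<Sum>i\<in>I. indicator {\<alpha> i<..\<beta> i} r *\<^sub>R \<zeta> i))\<^sup>2)"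
      by (rule deterministic_isometry; use I \<alpha> in blast)+
    note iso = this[unfolded e1 e2]
    have "(\<integral>\<^sup>+\<omega>. ennreal ((norm (?L \<omega> - ?Ia \<omega>))\<^sup>2) \<partial>M) = (\<integral>\<^sup>+r. ennreal ((norm ((\<Sum>i<k. indicator {min (\<tau> i) a<..min (\<tau> (Suc i)) a} r *\<^sub>R \<xi> i) - (\<Sum>i<k'. indicator {\<tau>' i<..\<tau>' (Suc i)} r *\<^sub>R \<xi>' i)))\<^sup>2) \<partial>lborel)"
      unfolding nn_integral_of_has_bochner_integral[OF iso(1) zero_le_power2]
        nn_integral_eq_integral[OF iso(2) AE_I2[OF zero_le_power2]] ..
    also have "\<dots> \<le> (\<integral>\<^sup>+r. 2 * (ennreal ((norm ((\<Sum>i<k. indicator {\<tau> i<..\<tau> (Suc i)} r *\<^sub>R \<xi> i) - \<Sigma> r))\<^sup>2) * indicator {s..b} r)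
        + 2 * (ennreal ((norm ((\<Sum>i<k'. indicator {\<tau>' i<..\<tau>' (Suc i)} r *\<^sub>R \<xi>' i) - \<Sigma> r))\<^sup>2) * indicator {s..a} r) \<partial>lborel)"
    proof (rule nn_integral_mono)
      fix r :: real
      let ?x = "\<Sum>i<k. indicator {\<tau> i<..\<tau> (Suc i)} r *\<^sub>R \<xi> i" and ?y = "\<Sum>i<k'. indicator {\<tau>' i<..\<tau>' (Suc i)} r *\<^sub>R \<xi>' i"
      let ?x' = "\<Sum>i<k. indicator {min (\<tau> i) a<..min (\<tau> (Suc i)) a} r *\<^sub>R \<xi> i"
      show "ennreal ((norm (?x' - ?y))\<^sup>2) \<le> 2 * (ennreal ((norm (?x - \<Sigma> r))\<^sup>2) * indicator {s..b} r) + 2 * (ennreal ((norm (?y - \<Sigma> r))\<^sup>2) * indicator {s..a} r)"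
      proof (cases "s < r \<and> r \<le> a")
        case True
        \<comment> \<open>Between \<open>s\<close> and \<open>a\<close> the cut does not change the
          step function; at other times both compared step functions vanish.\<close>
        have x: "?x' = ?x" using True by (intro sum.cong refl) (auto simp: indicator_def)
        have "(norm (?x - ?y))\<^sup>2 \<le> 2 * (norm (?x - \<Sigma> r))\<^sup>2 + 2 * (norm (?y - \<Sigma> r))\<^sup>2"
          using norm_add_sq_le[of "?x - \<Sigma> r" "\<Sigma> r - ?y"] by (simp add: norm_minus_commute)
        then have "ennreal ((norm (?x - ?y))\<^sup>2) \<le> 2 * ennreal ((norm (?x - \<Sigma> r))\<^sup>2) + 2 * ennreal ((norm (?y - \<Sigma> r))\<^sup>2)"
          by (simp add: ennreal_leI ennreal_mult[symmetric] flip: ennreal_numeral ennreal_plus)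
        moreover have "r \<in> {s..b}" "r \<in> {s..a}" using True ab by auto
        ultimately show ?thesis unfolding x by simp
      next
        case False
        have "?x' = 0"
        proof (rule sum.neutral, rule ballI)
          fix i assume "i \<in> {..<k}"
          then show "indicator {min (\<tau> i) a<..min (\<tau> (Suc i)) a} r *\<^sub>R \<xi> i = 0"
            using \<tau>0[of i] False ab by (auto simp: indicator_def)
        qed
        moreover have "?y = 0"
        proof (rule sum.neutral, rule ballI)
          fix i assume "i \<in> {..<k'}"
          then show "indicator {\<tau>' i<..\<tau>' (Suc i)} r *\<^sub>R \<xi>' i = 0"
            using \<tau>0'[of i] \<tau>0'[of "Suc i"] False by (auto simp: indicator_def)
        qed
        ultimately show ?thesis by simp
      qed
    qed
    also have "\<dots> \<le> 2 * ennreal e' + 2 * ennreal e'"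
    proof -
      have m: "(\<lambda>r. (\<Sum>i<k. indicator {\<tau> i<..\<tau> (Suc i)} r *\<^sub>R \<xi> i)) \<in> borel_measurable borel"
        "(\<lambda>r. (\<Sum>i<k'. indicator {\<tau>' i<..\<tau>' (Suc i)} r *\<^sub>R \<xi>' i)) \<in> borel_measurable borel" by measurable
      note sm = ito_integrand_measurable[OF ito(2) ab(1) sb]
      have gm: "(\<lambda>r. ennreal ((norm (g r - \<Sigma> r))\<^sup>2) * indicator {s..c} r) \<in> borel_measurable lborel"
        if g: "g \<in> borel_measurable borel" and c: "c \<le> b" for g :: "real \<Rightarrow> real^'n^'d" and c
      proof -
        have [measurable]: "\<Sigma> \<in> borel_measurable (restrict_space borel {s..c})" "g \<in> borel_measurable (restrict_space borel {s..c})"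
          using c measurable_restrict_space1[OF g] by (auto intro: measurable_restrict_mono[OF sm])
        have "(\<lambda>r. ennreal ((norm (g r - \<Sigma> r))\<^sup>2)) \<in> borel_measurable (restrict_space borel {s..c})" by measurable
        then show ?thesis by (subst (asm) borel_measurable_restrict_space_iff_ennreal) auto
      qed
      show ?thesis
        using gm[OF m(1) order_refl] gm[OF m(2) ab(3)] B(5) A(4)
        by (subst nn_integral_add) (auto simp: nn_integral_cmult intro!: add_mono mult_left_mono)
    qed
    also have "\<dots> = ennreal (4 * e')"
      using e' by (simp add: ennreal_mult[symmetric] flip: ennreal_numeral ennreal_plus)
    finally show ?thesis .
  qed
  have "(\<integral>\<^sup>+\<omega>. ennreal ((norm (?D \<omega> - (Jb \<omega> - Ja \<omega>)))\<^sup>2) \<partial>M) \<le>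
     (\<integral>\<^sup>+\<omega>. 2 * ennreal ((norm (?Ib \<omega> - Jb \<omega>))\<^sup>2) + (4 * ennreal ((norm (?L \<omega> - ?Ia \<omega>))\<^sup>2) + 4 * ennreal ((norm (?Ia \<omega> - Ja \<omega>))\<^sup>2)) \<partial>M)"
  proof (rule nn_integral_mono)
    fix \<omega>
    have "(norm (?D \<omega> - (Jb \<omega> - Ja \<omega>)))\<^sup>2 \<le> 2 * (norm (?Ib \<omega> - Jb \<omega>))\<^sup>2 + 2 * (norm (- (?L \<omega> - Ja \<omega>)))\<^sup>2"
      using norm_add_sq_le[of "?Ib \<omega> - Jb \<omega>" "- (?L \<omega> - Ja \<omega>)"] unfolding DL by (simp add: algebra_simps)
    also have "(norm (- (?L \<omega> - Ja \<omega>)))\<^sup>2 \<le> 2 * (norm (?L \<omega> - ?Ia \<omega>))\<^sup>2 + 2 * (norm (?Ia \<omega> - Ja \<omega>))\<^sup>2"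
      using norm_add_sq_le[of "?L \<omega> - ?Ia \<omega>" "?Ia \<omega> - Ja \<omega>"] by (simp add: norm_minus_commute)
    finally have "(norm (?D \<omega> - (Jb \<omega> - Ja \<omega>)))\<^sup>2 \<le> 2 * (norm (?Ib \<omega> - Jb \<omega>))\<^sup>2 + (4 * (norm (?L \<omega> - ?Ia \<omega>))\<^sup>2 + 4 * (norm (?Ia \<omega> - Ja \<omega>))\<^sup>2)" by simp
    then show "ennreal ((norm (?D \<omega> - (Jb \<omega> - Ja \<omega>)))\<^sup>2) \<le> 2 * ennreal ((norm (?Ib \<omega> - Jb \<omega>))\<^sup>2) + (4 * ennreal ((norm (?L \<omega> - ?Ia \<omega>))\<^sup>2) + 4 * ennreal ((norm (?Ia \<omega> - Ja \<omega>))\<^sup>2))"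
      by (simp add: ennreal_leI ennreal_mult[symmetric] flip: ennreal_numeral ennreal_plus)
  qed
  also have "\<dots> = 2 * (\<integral>\<^sup>+\<omega>. ennreal ((norm (?Ib \<omega> - Jb \<omega>))\<^sup>2) \<partial>M) + (4 * (\<integral>\<^sup>+\<omega>. ennreal ((norm (?L \<omega> - ?Ia \<omega>))\<^sup>2) \<partial>M) + 4 * (\<integral>\<^sup>+\<omega>. ennreal ((norm (?Ia \<omega> - Ja \<omega>))\<^sup>2) \<partial>M))"
    by (simp add: nn_integral_add nn_integral_cmult)
  also have "\<dots> \<le> 2 * ennreal e' + (4 * ennreal (4 * e') + 4 * ennreal e')"
    by (intro add_mono mult_left_mono 1 B(6) A(5)) auto
  also have "\<dots> = ennreal e"
    using e' by (simp add: ennreal_mult[symmetric] e'_def flip: ennreal_numeral ennreal_plus)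
  finally have 2: "(\<integral>\<^sup>+\<omega>. ennreal ((norm (?D \<omega> - (Jb \<omega> - Ja \<omega>)))\<^sup>2) \<partial>M) \<le> ennreal e" .
  show ?thesis
  proof (intro exI conjI allI impI)
    show "max (\<tau> 0) a = a" "max (\<tau> k) a = b" using B(1,2) ab by auto
    fix i assume "i < k"
    then show "max (\<tau> i) a \<le> max (\<tau> (Suc i)) a" "\<xi> i \<in> diffusion_set \<delta>" using B(4) max.mono[OF B(3) order_refl] by blast+
  qed (rule 2)
qed

lemma LSI_add_simple_integral:
  fixes Y :: "'w \<Rightarrow> real^'d::finite" and \<xi> :: "nat \<Rightarrow> real^'n^'d"
  assumes \<tau>: "0 \<le> \<tau> 0" and Y: "Y \<in> borel_measurable (F (\<tau> 0))" and LSI: "LSI (distr M borel Y) C" and C: "0 \<le> C" and \<delta>: "0 \<le> \<delta>"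
    and "\<And>i. i < k \<Longrightarrow> \<tau> i \<le> \<tau> (Suc i) \<and> \<xi> i \<in> diffusion_set \<delta>"
  shows "\<tau> 0 \<le> \<tau> k \<and> (\<lambda>\<omega>. Y \<omega> + (\<Sum>i<k. \<xi> i *v (W (\<tau> (Suc i)) \<omega> - W (\<tau> i) \<omega>))) \<in> borel_measurable (F (\<tau> k)) \<and>
    LSI (distr M borel (\<lambda>\<omega>. Y \<omega> + (\<Sum>i<k. \<xi> i *v (W (\<tau> (Suc i)) \<omega> - W (\<tau> i) \<omega>)))) (C + \<delta> * (\<tau> k - \<tau> 0))"
  using assms(6)
proof (induction k)
  case 0
  then show ?case using Y LSI by simp
next
  case (Suc k)
  let ?Z = "\<lambda>\<omega>. Y \<omega> + (\<Sum>i<k. \<xi> i *v (W (\<tau> (Suc i)) \<omega> - W (\<tau> i) \<omega>))"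
  have IH: "\<tau> 0 \<le> \<tau> k" "?Z \<in> borel_measurable (F (\<tau> k))" "LSI (distr M borel ?Z) (C + \<delta> * (\<tau> k - \<tau> 0))"
    using Suc by (auto simp: less_Suc_eq)
  have k: "\<tau> k \<le> \<tau> (Suc k)" "loewner_le (\<xi> k ** transpose (\<xi> k)) (\<delta> *\<^sub>R mat 1)"
    using Suc.prems[of k] by (auto simp: diffusion_set_def)
  have t: "0 \<le> \<tau> k" "0 \<le> \<tau> (Suc k)" using IH(1) \<tau> k(1) by auto
  have C': "0 \<le> C + \<delta> * (\<tau> k - \<tau> 0)" using C \<delta> IH(1) by simp
  have "LSI (distr M borel (\<lambda>\<omega>. ?Z \<omega> + \<xi> k *v (W (\<tau> (Suc k)) \<omega> - W (\<tau> k) \<omega>))) (C + \<delta> * (\<tau> k - \<tau> 0) + \<delta> * (\<tau> (Suc k) - \<tau> k))"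
    by (rule LSI_add_increment[OF t(1) k(1) IH(2,3) C' k(2) \<delta>])
  moreover have "C + \<delta> * (\<tau> k - \<tau> 0) + \<delta> * (\<tau> (Suc k) - \<tau> k) = C + \<delta> * (\<tau> (Suc k) - \<tau> 0)" by (simp add: algebra_simps)
  moreover have "(\<lambda>\<omega>. ?Z \<omega> + \<xi> k *v (W (\<tau> (Suc k)) \<omega> - W (\<tau> k) \<omega>)) \<in> borel_measurable (F (\<tau> (Suc k)))"
  proof -
    have [measurable]: "?Z \<in> borel_measurable (F (\<tau> (Suc k)))" "W (\<tau> k) \<in> borel_measurable (F (\<tau> (Suc k)))" "W (\<tau> (Suc k)) \<in> borel_measurable (F (\<tau> (Suc k)))"
      using measurable_F_mono[OF t(1) k(1)] IH(2) adapted_W t by auto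
    show ?thesis by measurable
  qed
  ultimately show ?case using IH(1) k(1) by (simp add: add.assoc)
qed

text \<open>The approximations all satisfy the inequality with the same constant. Their L^2
  convergence becomes almost sure along a subsequence, as \<open>LSI_distr_limit\<close>
  requires.\<close>

lemma LSI_add_ito_increment:
  fixes \<Sigma> :: "real \<Rightarrow> real^'n^'d::finite" and Y :: "'w \<Rightarrow> real^'d"
  assumes ito: "has_ito_integral M F W s a (\<lambda>r \<omega>. \<Sigma> r) Ja" "has_ito_integral M F W s b (\<lambda>r \<omega>. \<Sigma> r) Jb"
    and ab: "0 \<le> s" "s \<le> a" "a \<le> b"
    and \<Sigma>: "\<And>r. r \<in> {s..b} \<Longrightarrow> \<Sigma> r \<in> diffusion_set \<delta>" and \<delta>: "0 \<le> \<delta>"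
    and Y: "Y \<in> borel_measurable (F a)" and LSI: "LSI (distr M borel Y) C" and C: "0 \<le> C"
  shows "LSI (distr M borel (\<lambda>\<omega>. Y \<omega> + (Jb \<omega> - Ja \<omega>))) (C + \<delta> * (b - a))"
proof -
  have a0: "0 \<le> a" and b0: "0 \<le> b" using ab by auto
  have [measurable]: "Ja \<in> borel_measurable M" "Jb \<in> borel_measurable M"
    using ito measurable_F_M[OF a0] measurable_F_M[OF b0] unfolding has_ito_integral_def by blast+
  have [measurable]: "Y \<in> borel_measurable M" by (rule measurable_F_M[OF a0 Y])
  have ex: "\<exists>D. D \<in> borel_measurable M \<and> LSI (distr M borel (\<lambda>\<omega>. Y \<omega> + D \<omega>)) (C + \<delta> * (b - a)) \<and>
     (\<integral>\<^sup>+\<omega>. ennreal ((norm (D \<omega> - (Jb \<omega> - Ja \<omega>)))\<^sup>2) \<partial>M) \<le> ennreal (inverse (real (Suc n)))" for n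
  proof -
    have pos: "inverse (real (Suc n)) > 0" by simp
    obtain k \<tau> \<xi> where D: "\<tau> 0 = a" "\<tau> k = b" "\<And>i. i < k \<Longrightarrow> \<tau> i \<le> \<tau> (Suc i) \<and> \<xi> i \<in> diffusion_set \<delta>"
      "(\<integral>\<^sup>+\<omega>. ennreal ((norm ((\<Sum>i<k. \<xi> i *v (W (\<tau> (Suc i)) \<omega> - W (\<tau> i) \<omega>)) - (Jb \<omega> - Ja \<omega>)))\<^sup>2) \<partial>M) \<le> ennreal (inverse (real (Suc n)))"
      by (insert ito_increment_approx[OF ito ab \<Sigma> \<delta> pos], drule meta_mp, assumption, elim exE conjE, rule that, (assumption | blast)+)
    let ?D = "\<lambda>\<omega>. \<Sum>i<k. \<xi> i *v (W (\<tau> (Suc i)) \<omega> - W (\<tau> i) \<omega>)"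
    have "0 \<le> \<tau> 0" "Y \<in> borel_measurable (F (\<tau> 0))" using a0 Y D(1) by auto
    from LSI_add_simple_integral[where \<tau>=\<tau> and k=k and \<xi>=\<xi>, OF this LSI C \<delta> D(3)]
    have "LSI (distr M borel (\<lambda>\<omega>. Y \<omega> + ?D \<omega>)) (C + \<delta> * (b - a))" unfolding D(1,2) by simp
    moreover have "?D \<in> borel_measurable M"
    proof (intro borel_measurable_sum borel_measurable_matrix_vector_mult borel_measurable_const borel_measurable_diff W_measurable)
      fix i assume "i \<in> {..<k}"
      then show "0 \<le> \<tau> i" "0 \<le> \<tau> (Suc i)"
        using grid_mono[of k \<tau> 0 i] grid_mono[of k \<tau> 0 "Suc i"] D(1,3) a0 by auto
    qed
    ultimately show ?thesis using D(4) by (intro exI[of _ ?D]) auto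
  qed
  have "\<exists>D. \<forall>n. D n \<in> borel_measurable M \<and> LSI (distr M borel (\<lambda>\<omega>. Y \<omega> + D n \<omega>)) (C + \<delta> * (b - a)) \<and>
     (\<integral>\<^sup>+\<omega>. ennreal ((norm (D n \<omega> - (Jb \<omega> - Ja \<omega>)))\<^sup>2) \<partial>M) \<le> ennreal (inverse (real (Suc n)))"
    by (rule choice, rule allI, rule ex)
  then obtain D where D': "\<forall>n. D n \<in> borel_measurable M \<and> LSI (distr M borel (\<lambda>\<omega>. Y \<omega> + D n \<omega>)) (C + \<delta> * (b - a)) \<and>
     (\<integral>\<^sup>+\<omega>. ennreal ((norm (D n \<omega> - (Jb \<omega> - Ja \<omega>)))\<^sup>2) \<partial>M) \<le> ennreal (inverse (real (Suc n)))" ..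
  have [measurable]: "\<And>n. D n \<in> borel_measurable M" and DL: "\<And>n. LSI (distr M borel (\<lambda>\<omega>. Y \<omega> + D n \<omega>)) (C + \<delta> * (b - a))"
    and D: "\<And>n. (\<integral>\<^sup>+\<omega>. ennreal ((norm (D n \<omega> - (Jb \<omega> - Ja \<omega>)))\<^sup>2) \<partial>M) \<le> ennreal (inverse (real (Suc n)))"
    using D' by simp_all
  have Di: "integrable M (\<lambda>\<omega>. (norm (D n \<omega> - (Jb \<omega> - Ja \<omega>)))\<^sup>2)" for n
    using D[of n] by (intro integrableI_nonneg) (auto simp: order.strict_trans1[OF _ ennreal_less_top])
  have Dl: "expectation (\<lambda>\<omega>. (norm (D n \<omega> - (Jb \<omega> - Ja \<omega>)))\<^sup>2) \<le> inverse (real (Suc n))" for n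
    using D[of n] by (subst (asm) nn_integral_eq_integral[OF Di]) (auto simp: ennreal_le_iff)
  have "(\<lambda>n. expectation (\<lambda>\<omega>. norm ((norm (D n \<omega> - (Jb \<omega> - Ja \<omega>)))\<^sup>2))) \<longlonglongrightarrow> 0"
    by (rule tendsto_sandwich[OF _ _ tendsto_const LIMSEQ_inverse_real_of_nat]) (use Dl in auto)
  from tendsto_L1_AE_subseq[OF Di this] obtain r where r: "strict_mono r"
    "AE \<omega> in M. (\<lambda>n. (norm (D (r n) \<omega> - (Jb \<omega> - Ja \<omega>)))\<^sup>2) \<longlonglongrightarrow> 0" by blast
  show ?thesis
  proof (rule LSI_distr_limit[OF prob_space_axioms _ _ _ DL tendsto_const])
    show "AE \<omega> in M. (\<lambda>n. Y \<omega> + D (r n) \<omega>) \<longlonglongrightarrow> Y \<omega> + (Jb \<omega> - Ja \<omega>)"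
      using r(2)
    proof eventually_elim
      case (elim \<omega>)
      then have "(\<lambda>n. sqrt ((norm (D (r n) \<omega> - (Jb \<omega> - Ja \<omega>)))\<^sup>2)) \<longlonglongrightarrow> sqrt 0" by (intro tendsto_intros)
      then have "(\<lambda>n. norm (D (r n) \<omega> - (Jb \<omega> - Ja \<omega>))) \<longlonglongrightarrow> 0"
        by (simp only: real_sqrt_abs abs_norm_cancel real_sqrt_zero)
      then have "(\<lambda>n. D (r n) \<omega> - (Jb \<omega> - Ja \<omega>)) \<longlonglongrightarrow> 0" by (rule tendsto_norm_zero_cancel)
      then have "(\<lambda>n. D (r n) \<omega>) \<longlonglongrightarrow> Jb \<omega> - Ja \<omega>" by (rule LIM_zero_cancel)
      then show ?case by (intro tendsto_intros)
    qed
  qed measurable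
qed

end

section \<open>Implicit Euler scheme for monotone drifts\<close>

text \<open>\<open>G\<close> is only continuous and one-sided Lipschitz, which excludes a
  contraction argument. The map \<open>y - G y\<close> expands distances by at least the factor
  \<open>1 - \<kappa>\<close>, so it is injective with closed range; invariance of domain makes the
  range open, and connectedness makes it the whole space.\<close>

lemma exists_resolvent:
  fixes G :: "'a::euclidean_space \<Rightarrow> 'a"
  assumes cont: "continuous_on UNIV G" and mono: "\<And>x y. (G x - G y) \<bullet> (x - y) \<le> \<kappa> * (norm (x - y))\<^sup>2" and \<kappa>: "\<kappa> < 1"
  shows "\<exists>R. lip (1 / (1 - \<kappa>)) R \<and> (\<forall>x. R x - G (R x) = x)"
proof -
  define T where "T y = y - G y" for y
  have contT: "continuous_on UNIV T" unfolding T_def[abs_def] by (intro continuous_intros cont)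
  have exp: "(1 - \<kappa>) * norm (x - y) \<le> norm (T x - T y)" for x y
  proof (cases "x = y")
    case False
    have "(1 - \<kappa>) * (norm (x - y))\<^sup>2 \<le> (norm (x - y))\<^sup>2 - (G x - G y) \<bullet> (x - y)" using mono[of x y] by (simp add: algebra_simps)
    also have "\<dots> = (T x - T y) \<bullet> (x - y)" by (simp add: T_def power2_norm_eq_inner algebra_simps inner_diff_left inner_diff_right)
    also have "\<dots> \<le> norm (T x - T y) * norm (x - y)" by (rule norm_cauchy_schwarz)
    finally show ?thesis using False by (simp add: power2_eq_square mult.assoc[symmetric] mult_le_cancel_right)
  qed simp
  have inj: "inj T"
  proof (rule injI)
    fix x y assume "T x = T y"
    then have "(1 - \<kappa>) * norm (x - y) \<le> 0" using exp[of x y] by simp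
    then show "x = y" using \<kappa> by (simp add: mult_le_0_iff)
  qed
  have "open (range T)" by (rule invariance_of_domain[OF contT open_UNIV inj])
  moreover have "closed (range T)"
    unfolding closed_sequential_limits
  proof (intro allI impI)
    fix z l assume zl: "(\<forall>n. z n \<in> range T) \<and> z \<longlonglongrightarrow> l"
    then have "\<forall>n. \<exists>x. z n = T x" by blast
    from choice[OF this] obtain x where x: "\<And>n. z n = T (x n)" by blast
    have "Cauchy x"
    proof (rule metric_CauchyI)
      fix e :: real assume e: "e > 0"
      have "Cauchy z" using zl LIMSEQ_imp_Cauchy by blast
      then obtain N where N: "\<And>m n. m \<ge> N \<Longrightarrow> n \<ge> N \<Longrightarrow> dist (z m) (z n) < (1 - \<kappa>) * e"
        using metric_CauchyD[of z "(1 - \<kappa>) * e"] e \<kappa> by auto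
      have "dist (x m) (x n) < e" if "m \<ge> N" "n \<ge> N" for m n
      proof -
        have "(1 - \<kappa>) * norm (x m - x n) < (1 - \<kappa>) * e"
          using exp[of "x m" "x n"] N[OF that] by (simp add: x dist_norm)
        then show ?thesis using \<kappa> by (simp add: dist_norm)
      qed
      then show "\<exists>N. \<forall>m\<ge>N. \<forall>n\<ge>N. dist (x m) (x n) < e" by blast
    qed
    then obtain y where "x \<longlonglongrightarrow> y" using Cauchy_convergent convergent_def by blast
    then have "(\<lambda>n. T (x n)) \<longlonglongrightarrow> T y"
      using contT by (simp add: continuous_on_eq_continuous_at isCont_tendsto_compose)
    moreover have "(\<lambda>n. T (x n)) \<longlonglongrightarrow> l" using zl by (simp add: x[symmetric])
    ultimately have "l = T y" by (rule LIMSEQ_unique[rotated])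
    then show "l \<in> range T" by simp
  qed
  ultimately have surj: "surj T" using clopen[of "range T"] by auto
  have R: "T (inv T x) = x" for x using surj by (rule surj_f_inv_f)
  have "lip (1 / (1 - \<kappa>)) (inv T)"
    unfolding lip_def
  proof (intro allI)
    fix x y
    show "norm (inv T x - inv T y) \<le> 1 / (1 - \<kappa>) * norm (x - y)"
      using exp[of "inv T x" "inv T y"] \<kappa> by (simp add: R field_simps)
  qed
  then show ?thesis using R by (intro exI[of _ "inv T"]) (simp add: T_def)
qed

text \<open>What remains of the drift once the curve of measures is fixed. Boundedness is local in
  space because no growth condition on the drift is available.\<close>

locale monotone_drift =
  fixes \<beta> :: "real \<Rightarrow> 'a::euclidean_space \<Rightarrow> 'a" and s T K :: real
  assumes sT: "s < T" and K: "0 < K"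
    and meas: "\<And>y. (\<lambda>r. indicator {s..T} r *\<^sub>R \<beta> r y) \<in> borel_measurable borel"
    and cont: "\<And>r. r \<in> {s..T} \<Longrightarrow> continuous_on UNIV (\<beta> r)"
    and bdd: "\<And>R. \<exists>C. \<forall>r\<in>{s..T}. \<forall>y. norm y \<le> R \<longrightarrow> norm (\<beta> r y) \<le> C"
    and mono: "\<And>r x y. r \<in> {s..T} \<Longrightarrow> 2 * ((\<beta> r x - \<beta> r y) \<bullet> (x - y)) \<le> K * (norm (x - y))\<^sup>2"
begin

text \<open>The integral over one cell, not divided by its length, with the space variable frozen.
  Integrating instead of evaluating at a time is forced by a drift that is merely measurable in
  time.\<close>

definition avg :: "real \<Rightarrow> real \<Rightarrow> 'a \<Rightarrow> 'a" where
  "avg a b y = (\<integral>r. indicator {a<..b} r *\<^sub>R \<beta> r y \<partial>lborel)"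

lemma interval_finite: "integrable lborel (\<lambda>r. indicator {a<..b::real} r * (C::real))"
proof -
  have "emeasure lborel {a<..b} < top" by (cases "a \<le> b") auto
  then show ?thesis by (intro integrable_mult_left integrable_real_indicator) auto
qed

lemma interval_measurable:
  assumes "s \<le> a" "b \<le> T" shows "(\<lambda>r. indicator {a<..b} r *\<^sub>R \<beta> r y) \<in> borel_measurable borel"
proof -
  have "(\<lambda>r. indicator {a<..b} r *\<^sub>R (indicator {s..T} r *\<^sub>R \<beta> r y)) \<in> borel_measurable borel"
    by (intro borel_measurable_scaleR meas borel_measurable_indicator) auto
  moreover have "(\<lambda>r. indicator {a<..b} r *\<^sub>R (indicator {s..T} r *\<^sub>R \<beta> r y)) = (\<lambda>r. indicator {a<..b} r *\<^sub>R \<beta> r y)"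
    using assms by (auto simp: indicator_def)
  ultimately show ?thesis by simp
qed

lemma interval_integrable:
  assumes "s \<le> a" "b \<le> T" shows "integrable lborel (\<lambda>r. indicator {a<..b} r *\<^sub>R \<beta> r y)"
proof -
  obtain C where C: "\<forall>r\<in>{s..T}. \<forall>z. norm z \<le> norm y \<longrightarrow> norm (\<beta> r z) \<le> C" using bdd by blast
  show ?thesis
  proof (rule Bochner_Integration.integrable_bound[OF interval_finite[of a b "\<bar>C\<bar>"]])
    show "AE r in lborel. norm (indicator {a<..b} r *\<^sub>R \<beta> r y) \<le> norm (indicator {a<..b} r * \<bar>C\<bar>)"
    proof (rule AE_I2)
      fix r show "norm (indicator {a<..b} r *\<^sub>R \<beta> r y) \<le> norm (indicator {a<..b} r * \<bar>C\<bar>)"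
        using C[rule_format, of r y] assms by (auto simp: indicator_def)
    qed
  qed (use interval_measurable[OF assms] in simp)
qed

lemma continuous_avg:
  assumes "s \<le> a" "b \<le> T" shows "continuous_on UNIV (avg a b)"
  unfolding continuous_on_sequentially
proof (intro allI ballI impI)
  fix x :: 'a and u assume u: "(\<forall>n. u n \<in> UNIV) \<and> u \<longlonglongrightarrow> x"
  then obtain B where B: "\<And>n. norm (u n) \<le> B" using convergent_imp_Bseq[of u] unfolding Bseq_def convergent_def by blast
  obtain C where C: "\<forall>r\<in>{s..T}. \<forall>z. norm z \<le> B \<longrightarrow> norm (\<beta> r z) \<le> C" using bdd by blast
  have "(\<lambda>n. \<integral>r. indicator {a<..b} r *\<^sub>R \<beta> r (u n) \<partial>lborel) \<longlonglongrightarrow> (\<integral>r. indicator {a<..b} r *\<^sub>R \<beta> r x \<partial>lborel)"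
  proof (rule integral_dominated_convergence[where w="\<lambda>r. indicator {a<..b} r * C"])
    show "AE r in lborel. (\<lambda>n. indicator {a<..b} r *\<^sub>R \<beta> r (u n)) \<longlonglongrightarrow> indicator {a<..b} r *\<^sub>R \<beta> r x"
    proof (rule AE_I2)
      fix r show "(\<lambda>n. indicator {a<..b} r *\<^sub>R \<beta> r (u n)) \<longlonglongrightarrow> indicator {a<..b} r *\<^sub>R \<beta> r x"
      proof (cases "r \<in> {a<..b}")
        case True
        then have "r \<in> {s..T}" using assms by auto
        then have "isCont (\<beta> r) x" using cont by (simp add: continuous_on_eq_continuous_at)
        then have "(\<lambda>n. \<beta> r (u n)) \<longlonglongrightarrow> \<beta> r x" using u isCont_tendsto_compose by blast
        then show ?thesis by (intro tendsto_intros)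
      qed simp
    qed
    show "AE r in lborel. norm (indicator {a<..b} r *\<^sub>R \<beta> r (u n)) \<le> indicator {a<..b} r * C" for n
    proof (rule AE_I2)
      fix r show "norm (indicator {a<..b} r *\<^sub>R \<beta> r (u n)) \<le> indicator {a<..b} r * C"
        using C[rule_format, of r "u n"] B[of n] assms by (auto simp: indicator_def)
    qed
  qed (use interval_measurable[OF assms] interval_finite in auto)
  then show "(avg a b \<circ> u) \<longlonglongrightarrow> avg a b x" by (simp add: avg_def o_def)
qed

lemma avg_mono:
  assumes "s \<le> a" "a \<le> b" "b \<le> T"
  shows "(avg a b x - avg a b y) \<bullet> (x - y) \<le> (K * (b - a) / 2) * (norm (x - y))\<^sup>2"
proof -
  have i: "integrable lborel (\<lambda>r. indicator {a<..b} r *\<^sub>R \<beta> r x - indicator {a<..b} r *\<^sub>R \<beta> r y)"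
    using interval_integrable assms by auto
  have "(avg a b x - avg a b y) \<bullet> (x - y) = (\<integral>r. (indicator {a<..b} r *\<^sub>R \<beta> r x - indicator {a<..b} r *\<^sub>R \<beta> r y) \<bullet> (x - y) \<partial>lborel)"
    unfolding avg_def using interval_integrable assms i by simp
  also have "\<dots> \<le> (\<integral>r. indicator {a<..b} r * (K / 2 * (norm (x - y))\<^sup>2) \<partial>lborel)"
  proof (rule integral_mono)
    show "integrable lborel (\<lambda>r. (indicator {a<..b} r *\<^sub>R \<beta> r x - indicator {a<..b} r *\<^sub>R \<beta> r y) \<bullet> (x - y))" using i by (rule integrable_inner_left)
    show "(indicator {a<..b} r *\<^sub>R \<beta> r x - indicator {a<..b} r *\<^sub>R \<beta> r y) \<bullet> (x - y) \<le> indicator {a<..b} r * (K / 2 * (norm (x - y))\<^sup>2)" for r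
      using mono[of r x y] assms by (auto simp: indicator_def)
  qed (rule interval_finite)
  also have "\<dots> = (K * (b - a) / 2) * (norm (x - y))\<^sup>2"
    using assms by simp
  finally show ?thesis .
qed

definition h :: "nat \<Rightarrow> real" where "h N = (T - s) / real N"
definition t :: "nat \<Rightarrow> nat \<Rightarrow> real" where "t N k = s + real k * h N"
text \<open>The factor 2 in \<open>mono\<close> gives \<open>avg\<close> over one cell the one-sided
  Lipschitz constant \<open>K * h N / 2\<close>; \<open>q N\<close> is the resulting Lipschitz
  constant of the resolvent.\<close>

definition q :: "nat \<Rightarrow> real" where "q N = 1 / (1 - K * h N / 2)"
definition res :: "nat \<Rightarrow> nat \<Rightarrow> 'a \<Rightarrow> 'a" where
  "res N k = (SOME R. lip (q N) R \<and> (\<forall>x. R x - avg (t N k) (t N (Suc k)) (R x) = x))"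

section \<open>The grid and its resolvents\<close>

lemma t_Suc: "t N (Suc k) = t N k + h N" by (simp add: t_def algebra_simps)
lemma t_0: "t N 0 = s" by (simp add: t_def)
lemma t_N: "N > 0 \<Longrightarrow> t N N = T" by (simp add: t_def h_def)
lemma h_pos: "N > 0 \<Longrightarrow> h N > 0" using sT by (simp add: h_def)
lemma t_mono: "N > 0 \<Longrightarrow> t N k \<le> t N (Suc k)" using h_pos[of N] by (simp add: t_Suc)
lemma t_bounds: "N > 0 \<Longrightarrow> k \<le> N \<Longrightarrow> s \<le> t N k \<and> t N k \<le> T"
proof -
  assume a: "N > 0" "k \<le> N"
  have "t N k \<le> t N N" "s \<le> t N k" using a h_pos[of N] by (simp_all add: t_def)
  then show ?thesis using t_N[OF a(1)] by simp
qed

lemma res: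
  assumes N: "N > 0" "K * h N / 2 < 1" and k: "k < N"
  shows "lip (q N) (res N k)" "res N k x - avg (t N k) (t N (Suc k)) (res N k x) = x"
proof -
  have b: "s \<le> t N k" "t N k \<le> t N (Suc k)" "t N (Suc k) \<le> T"
    using t_bounds[of N k] t_bounds[of N "Suc k"] t_mono[of N k] N k by auto
  have "\<exists>R. lip (1 / (1 - K * h N / 2)) R \<and> (\<forall>x. R x - avg (t N k) (t N (Suc k)) (R x) = x)"
  proof (rule exists_resolvent)
    show "continuous_on UNIV (avg (t N k) (t N (Suc k)))" using b by (intro continuous_avg)
    show "(avg (t N k) (t N (Suc k)) x - avg (t N k) (t N (Suc k)) y) \<bullet> (x - y) \<le> K * h N / 2 * (norm (x - y))\<^sup>2" for x y
      using avg_mono[OF b, of x y] by (simp add: t_Suc)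
  qed (rule N(2))
  then have "\<exists>R. lip (q N) R \<and> (\<forall>x. R x - avg (t N k) (t N (Suc k)) (R x) = x)" by (simp add: q_def)
  from someI_ex[OF this] show "lip (q N) (res N k)" "res N k x - avg (t N k) (t N (Suc k)) (res N k x) = x"
    unfolding res_def[symmetric] by auto
qed

text \<open>The driving path \<open>J\<close> is an arbitrary function, so convergence is a
  deterministic statement that is later applied to each sample path.\<close>

fun euler :: "(real \<Rightarrow> 'a) \<Rightarrow> 'a \<Rightarrow> nat \<Rightarrow> nat \<Rightarrow> 'a" where
  "euler J x N 0 = x"
| "euler J x N (Suc k) = res N k (euler J x N k + (J (t N (Suc k)) - J (t N k)))"

text \<open>\<open>\<epsilon>\<close> is the defect of \<open>X\<close> in the implicit equation.
  Pairing the difference of the two implicit equations with itself leaves a drift term that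
  monotonicity alone controls.\<close>

lemma euler_step_error:
  assumes N: "N > 0" "K * h N / 2 < 1" and k: "k < N"
    and X: "X (t N (Suc k)) = X (t N k) + (J (t N (Suc k)) - J (t N k)) + (avg (t N k) (t N (Suc k)) (X (t N (Suc k))) + \<epsilon>)"
  shows "norm (X (t N (Suc k)) - euler J x N (Suc k)) \<le> q N * (norm (X (t N k) - euler J x N k) + norm \<epsilon>)"
proof -
  let ?B = "avg (t N k) (t N (Suc k))"
  let ?Y = "euler J x N (Suc k)" and ?X = "X (t N (Suc k))"
  let ?E = "X (t N k) - euler J x N k"
  have b: "s \<le> t N k" "t N k \<le> t N (Suc k)" "t N (Suc k) \<le> T"
    using t_bounds[of N k] t_bounds[of N "Suc k"] t_mono[of N k] N k by auto
  have Y: "?Y = euler J x N k + (J (t N (Suc k)) - J (t N k)) + ?B ?Y"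
    using res(2)[OF N k, of "euler J x N k + (J (t N (Suc k)) - J (t N k))"] by (simp add: algebra_simps)
  have E: "?X - ?Y = ?E + \<epsilon> + (?B ?X - ?B ?Y)"
    by (subst X, subst Y) (simp add: algebra_simps)
  have "(norm (?X - ?Y))\<^sup>2 = (?E + \<epsilon>) \<bullet> (?X - ?Y) + (?B ?X - ?B ?Y) \<bullet> (?X - ?Y)"
    unfolding power2_norm_eq_inner by (subst E) (simp only: inner_add_left)
  also have "(?E + \<epsilon>) \<bullet> (?X - ?Y) \<le> (norm ?E + norm \<epsilon>) * norm (?X - ?Y)"
    by (rule order_trans[OF norm_cauchy_schwarz]) (intro mult_right_mono norm_triangle_ineq norm_ge_zero)
  also have "(?B ?X - ?B ?Y) \<bullet> (?X - ?Y) \<le> K * h N / 2 * (norm (?X - ?Y))\<^sup>2"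
    using avg_mono[OF b, of ?X ?Y] by (simp only: t_Suc add_diff_cancel_left')
  finally have "(1 - K * h N / 2) * norm (?X - ?Y) * norm (?X - ?Y) \<le> (norm ?E + norm \<epsilon>) * norm (?X - ?Y)"
    by (simp add: power2_eq_square algebra_simps)
  then have "(1 - K * h N / 2) * norm (?X - ?Y) \<le> norm ?E + norm \<epsilon>"
    by (cases "?X = ?Y") (auto simp: mult_le_cancel_right)
  then show ?thesis using N(2) by (simp add: q_def field_simps)
qed

lemma q_ge_1: "N > 0 \<Longrightarrow> K * h N / 2 < 1 \<Longrightarrow> 1 \<le> q N"
  using h_pos[of N] K by (simp add: q_def)

section \<open>Convergence of the scheme\<close>

lemma K_h_tendsto_0: "(\<lambda>N. K * h N / 2) \<longlonglongrightarrow> 0"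
proof -
  have "(\<lambda>N. K * (T - s) / 2 * (1 / real N)) \<longlonglongrightarrow> K * (T - s) / 2 * 0"
    by (intro tendsto_intros lim_1_over_n)
  then show ?thesis by (simp add: h_def mult.commute)
qed

lemma q_power_tendsto: "(\<lambda>N. q N ^ N) \<longlonglongrightarrow> exp (K * (T - s) / 2)"
proof -
  have "(\<lambda>N. (1 + (- (K * (T - s) / 2)) / real N) ^ N) \<longlonglongrightarrow> exp (- (K * (T - s) / 2))"
    by (rule tendsto_exp_limit_sequentially)
  then have "(\<lambda>N. inverse ((1 + (- (K * (T - s) / 2)) / real N) ^ N)) \<longlonglongrightarrow> inverse (exp (- (K * (T - s) / 2)))"
    by (intro tendsto_inverse) auto
  moreover have "q N = inverse (1 + (- (K * (T - s) / 2)) / real N)" for N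
    by (simp add: q_def h_def inverse_eq_divide mult.commute)
  ultimately show ?thesis by (simp only: power_inverse exp_minus inverse_inverse_eq)
qed

text \<open>A discrete Gronwall inequality: each step multiplies the accumulated error by at most
  \<open>q N\<close>, and \<open>q N ^ N\<close> stays bounded.\<close>

lemma euler_error:
  assumes N: "N > 0" "K * h N / 2 < 1"
    and X: "\<And>k. k < N \<Longrightarrow> X (t N (Suc k)) = X (t N k) + (J (t N (Suc k)) - J (t N k)) + (avg (t N k) (t N (Suc k)) (X (t N (Suc k))) + \<epsilon> k)"
    and "k \<le> N"
  shows "norm (X (t N k) - euler J (X s) N k) \<le> q N ^ k * (\<Sum>j<k. norm (\<epsilon> j))"
  using assms(4)
proof (induction k)
  case 0 then show ?case by (simp add: t_0)
next
  case (Suc k)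
  have q: "1 \<le> q N" by (rule q_ge_1[OF N])
  have "norm (X (t N (Suc k)) - euler J (X s) N (Suc k)) \<le> q N * (norm (X (t N k) - euler J (X s) N k) + norm (\<epsilon> k))"
    using Suc.prems by (intro euler_step_error[OF N _ X]) auto
  also have "\<dots> \<le> q N * (q N ^ k * (\<Sum>j<k. norm (\<epsilon> j)) + q N ^ k * norm (\<epsilon> k))"
  proof (intro mult_left_mono add_mono)
    show "norm (\<epsilon> k) \<le> q N ^ k * norm (\<epsilon> k)" using one_le_power[OF q, of k] by (simp add: mult_le_cancel_right1)
  qed (use Suc q in auto)
  also have "\<dots> = q N ^ Suc k * (\<Sum>j<Suc k. norm (\<epsilon> j))" by (simp add: algebra_simps)
  finally show ?case .
qed

text \<open>The defects add up to at most the L^1 distance between the drift along \<open>X\<close>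
  and the drift with \<open>X\<close> frozen at the right end of each cell. Path continuity and
  continuity of the drift in space make the integrand vanish in the limit, and the path stays in a
  bounded set, so dominated convergence applies.\<close>

lemma euler_tendsto:
  assumes X: "continuous_on {s..T} X"
    and m: "set_integrable lborel {s..T} (\<lambda>r. \<beta> r (X r))"
    and eq: "\<And>u. u \<in> {s..T} \<Longrightarrow> X u = X s + (LINT r:{s..u}|lborel. \<beta> r (X r)) + J u"
  shows "(\<lambda>N. euler J (X s) N N) \<longlonglongrightarrow> X T"
proof -
  have "bounded (X ` {s..T})" by (intro compact_imp_bounded compact_continuous_image X) simp
  then obtain R where R': "\<forall>x\<in>X ` {s..T}. norm x \<le> R" unfolding bounded_iff by blast
  have R: "norm (X r) \<le> R" if "r \<in> {s..T}" for r using R' that by blast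
  obtain C where C: "\<And>r y. r \<in> {s..T} \<Longrightarrow> norm y \<le> R \<Longrightarrow> norm (\<beta> r y) \<le> C" using bdd[of R] by blast
  \<comment> \<open>\<open>X\<close> is frozen at the right end of the cell because the scheme is
    implicit.\<close>
  define g where "g N r = (\<Sum>k<N. indicator {t N k<..t N (Suc k)} r *\<^sub>R \<beta> r (X (t N (Suc k))))" for N r
  define b where "b r = indicator {s..T} r *\<^sub>R \<beta> r (X r)" for r
  have bi: "integrable lborel b" using m unfolding set_integrable_def b_def .
  have g_meas: "g N \<in> borel_measurable borel" if "N > 0" for N
    unfolding g_def[abs_def]
  proof (rule borel_measurable_sum)
    fix k assume "k \<in> {..<N}"
    then show "(\<lambda>r. indicator {t N k<..t N (Suc k)} r *\<^sub>R \<beta> r (X (t N (Suc k)))) \<in> borel_measurable borel"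
      using t_bounds[OF that, of k] t_bounds[OF that, of "Suc k"] by (intro interval_measurable) auto
  qed
  have gval: "\<exists>k<N. r \<in> {t N k<..t N (Suc k)} \<and> g N r = \<beta> r (X (t N (Suc k)))" if N: "N > 0" and r: "s < r" "r \<le> T" for N r
  proof -
    have "t N 0 < r" "r \<le> t N N" using r N by (auto simp: t_0 t_N)
    then obtain k where k: "k < N" "\<And>j. j < N \<Longrightarrow> indicator {t N j<..t N (Suc j)} r = (if j = k then 1 else 0 :: real)"
      using grid_value[of N "t N" r] t_mono[OF N] by blast
    have "r \<in> {t N k<..t N (Suc k)}" using k(2)[OF k(1)] by (auto simp: indicator_def split: if_splits)
    moreover have "g N r = (\<Sum>j<N. if j = k then \<beta> r (X (t N (Suc j))) else 0)"
      unfolding g_def using k(2) by (intro sum.cong) auto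
    ultimately show ?thesis using k(1) by auto
  qed
  have h0: "(\<lambda>N. h N) \<longlonglongrightarrow> 0"
  proof -
    have "(\<lambda>N. (T - s) * (1 / real N)) \<longlonglongrightarrow> (T - s) * 0" by (intro tendsto_intros lim_1_over_n)
    then show ?thesis by (simp add: h_def[abs_def])
  qed
  \<comment> \<open>Indices are shifted to \<open>Suc N\<close> to exclude the degenerate grid
    without cells.\<close>
  have conv: "(\<lambda>N. \<integral>r. indicator {s<..T} r * norm (\<beta> r (X r) - g (Suc N) r) \<partial>lborel) \<longlonglongrightarrow> (\<integral>r. 0 \<partial>(lborel :: real measure))"
  proof (rule integral_dominated_convergence[where w="\<lambda>r. indicator {s<..T} r * (2 * C)"])
    show "(\<lambda>r. indicator {s<..T} r * norm (\<beta> r (X r) - g (Suc N) r)) \<in> borel_measurable lborel" for N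
    proof -
      have "(\<lambda>r. indicator {s<..T} r * norm (b r - g (Suc N) r)) \<in> borel_measurable lborel"
        using g_meas[of "Suc N"] borel_measurable_integrable[OF bi] by measurable
      moreover have "(\<lambda>r. indicator {s<..T} r * norm (b r - g (Suc N) r)) = (\<lambda>r. indicator {s<..T} r * norm (\<beta> r (X r) - g (Suc N) r))"
        by (auto simp: b_def indicator_def)
      ultimately show ?thesis by simp
    qed
    show "AE r in lborel. norm (indicator {s<..T} r * norm (\<beta> r (X r) - g (Suc N) r)) \<le> indicator {s<..T} r * (2 * C)" for N
    proof (rule AE_I2)
      fix r
      show "norm (indicator {s<..T} r * norm (\<beta> r (X r) - g (Suc N) r)) \<le> indicator {s<..T} r * (2 * C)"
      proof (cases "r \<in> {s<..T}")
        case True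
        then obtain k where k: "k < Suc N" "g (Suc N) r = \<beta> r (X (t (Suc N) (Suc k)))" using gval[of "Suc N" r] by auto
        have "t (Suc N) (Suc k) \<in> {s..T}" using t_bounds[of "Suc N" "Suc k"] k(1) by auto
        then have "norm (g (Suc N) r) \<le> C" "norm (\<beta> r (X r)) \<le> C" using C R True k(2) by auto
        then show ?thesis using True norm_triangle_ineq4[of "\<beta> r (X r)" "g (Suc N) r"] by simp
      qed simp
    qed
    show "AE r in lborel. (\<lambda>N. indicator {s<..T} r * norm (\<beta> r (X r) - g (Suc N) r)) \<longlonglongrightarrow> 0"
    proof (rule AE_I2)
      fix r
      show "(\<lambda>N. indicator {s<..T} r * norm (\<beta> r (X r) - g (Suc N) r)) \<longlonglongrightarrow> 0"
      proof (cases "r \<in> {s<..T}")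
        case True
        then have "\<forall>N. \<exists>k<Suc N. r \<in> {t (Suc N) k<..t (Suc N) (Suc k)} \<and> g (Suc N) r = \<beta> r (X (t (Suc N) (Suc k)))"
          using gval[of "Suc _" r] by auto
        from choice[OF this] obtain k where k: "\<And>N. k N < Suc N" "\<And>N. r \<in> {t (Suc N) (k N)<..t (Suc N) (Suc (k N))}"
          "\<And>N. g (Suc N) r = \<beta> r (X (t (Suc N) (Suc (k N))))" by blast
        let ?u = "\<lambda>N. t (Suc N) (Suc (k N))"
        have u: "?u N \<in> {s..T}" for N using t_bounds[of "Suc N" "Suc (k N)"] k(1)[of N] by auto
        have "?u \<longlonglongrightarrow> r"
        proof (rule LIM_zero_cancel, rule Lim_null_comparison[OF always_eventually LIMSEQ_Suc[OF h0]], rule allI)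
          show "norm (?u N - r) \<le> h (Suc N)" for N using k(2)[of N] by (auto simp: t_Suc)
        qed
        then have "(\<lambda>N. X (?u N)) \<longlonglongrightarrow> X r"
          using X True u unfolding continuous_on_sequentially by (auto simp: o_def)
        moreover have "isCont (\<beta> r) (X r)" using cont[of r] True by (simp add: continuous_on_eq_continuous_at)
        ultimately have "(\<lambda>N. \<beta> r (X (?u N))) \<longlonglongrightarrow> \<beta> r (X r)" by (rule isCont_tendsto_compose[rotated])
        then have "(\<lambda>N. indicator {s<..T} r * norm (\<beta> r (X r) - \<beta> r (X (?u N)))) \<longlonglongrightarrow> indicator {s<..T} r * norm (\<beta> r (X r) - \<beta> r (X r))"
          by (intro tendsto_intros)
        then show ?thesis by (simp add: k(3))
      qed simp
    qed
  qed (use interval_finite in auto)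
  have ev: "\<forall>\<^sub>F N in sequentially. K * h (Suc N) / 2 < 1"
    using LIMSEQ_Suc[OF K_h_tendsto_0] by (rule order_tendstoD) simp
  have bound: "norm (euler J (X s) (Suc N) (Suc N) - X T) \<le> q (Suc N) ^ Suc N * (\<integral>r. indicator {s<..T} r * norm (\<beta> r (X r) - g (Suc N) r) \<partial>lborel)"
    if N: "K * h (Suc N) / 2 < 1" for N
  proof -
    let ?N = "Suc N"
    have tb: "s \<le> t ?N k" "t ?N k \<le> T" if "k \<le> ?N" for k using t_bounds[of ?N k] that by auto
    \<comment> \<open>The defect on a cell: the error of replacing the path by its value at the
      right end inside the drift.\<close>
    define \<epsilon> where "\<epsilon> k = (\<integral>r. indicator {t ?N k<..t ?N (Suc k)} r *\<^sub>R (\<beta> r (X r) - \<beta> r (X (t ?N (Suc k)))) \<partial>lborel)" for k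
    have i1: "integrable lborel (\<lambda>r. indicator {a<..c} r *\<^sub>R \<beta> r (X r))" if "s \<le> a" "c \<le> T" for a c
    proof -
      have "integrable lborel (\<lambda>r. indicator {a<..c} r *\<^sub>R b r)" by (rule integrable_mult_indicator[OF _ bi]) simp
      moreover have "(\<lambda>r. indicator {a<..c} r *\<^sub>R b r) = (\<lambda>r. indicator {a<..c} r *\<^sub>R \<beta> r (X r))"
        using that by (auto simp: b_def indicator_def)
      ultimately show ?thesis by simp
    qed
    have i3: "integrable lborel (\<lambda>r. indicator {t ?N k<..t ?N (Suc k)} r *\<^sub>R (\<beta> r (X r) - \<beta> r (X (t ?N (Suc k)))))" if "k < ?N" for k
      using Bochner_Integration.integrable_diff[OF i1[of "t ?N k" "t ?N (Suc k)"] interval_integrable[of "t ?N k" "t ?N (Suc k)" "X (t ?N (Suc k))"]] tb[of k] tb[of "Suc k"] that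
      by (simp add: scaleR_diff_right)
    have eps: "X (t ?N (Suc k)) = X (t ?N k) + (J (t ?N (Suc k)) - J (t ?N k)) + (avg (t ?N k) (t ?N (Suc k)) (X (t ?N (Suc k))) + \<epsilon> k)"
      if k: "k < ?N" for k
    proof -
      have b: "s \<le> t ?N k" "t ?N k \<le> t ?N (Suc k)" "t ?N (Suc k) \<le> T" using tb[of k] tb[of "Suc k"] t_mono[of ?N k] k by auto
      have ic: "integrable lborel (\<lambda>r. indicator {s..t ?N k} r *\<^sub>R \<beta> r (X r))"
      proof -
        have "integrable lborel (\<lambda>r. indicator {s..t ?N k} r *\<^sub>R b r)" by (rule integrable_mult_indicator[OF _ bi]) simp
        moreover have "(\<lambda>r. indicator {s..t ?N k} r *\<^sub>R b r) = (\<lambda>r. indicator {s..t ?N k} r *\<^sub>R \<beta> r (X r))"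
          using b by (auto simp: b_def indicator_def)
        ultimately show ?thesis by simp
      qed
      have "(LINT r:{s..t ?N (Suc k)}|lborel. \<beta> r (X r)) = (\<integral>r. indicator {s..t ?N k} r *\<^sub>R \<beta> r (X r) + indicator {t ?N k<..t ?N (Suc k)} r *\<^sub>R \<beta> r (X r) \<partial>lborel)"
        unfolding set_lebesgue_integral_def using b by (intro Bochner_Integration.integral_cong) (auto simp: indicator_def)
      also have "\<dots> = (LINT r:{s..t ?N k}|lborel. \<beta> r (X r)) + (\<integral>r. indicator {t ?N k<..t ?N (Suc k)} r *\<^sub>R \<beta> r (X r) \<partial>lborel)"
        unfolding set_lebesgue_integral_def using ic i1 b by (intro Bochner_Integration.integral_add) auto
      also have "(\<integral>r. indicator {t ?N k<..t ?N (Suc k)} r *\<^sub>R \<beta> r (X r) \<partial>lborel) = avg (t ?N k) (t ?N (Suc k)) (X (t ?N (Suc k))) + \<epsilon> k"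
      proof -
        have "avg (t ?N k) (t ?N (Suc k)) (X (t ?N (Suc k))) + \<epsilon> k = (\<integral>r. indicator {t ?N k<..t ?N (Suc k)} r *\<^sub>R \<beta> r (X (t ?N (Suc k))) + indicator {t ?N k<..t ?N (Suc k)} r *\<^sub>R (\<beta> r (X r) - \<beta> r (X (t ?N (Suc k)))) \<partial>lborel)"
          unfolding avg_def \<epsilon>_def using i3[OF k] interval_integrable b by (intro Bochner_Integration.integral_add[symmetric]) auto
        then show ?thesis by (simp add: scaleR_add_right[symmetric])
      qed
      finally show ?thesis using eq[of "t ?N k"] eq[of "t ?N (Suc k)"] b by (simp add: algebra_simps)
    qed
    have "(\<Sum>k<?N. norm (\<epsilon> k)) \<le> (\<Sum>k<?N. \<integral>r. indicator {t ?N k<..t ?N (Suc k)} r * norm (\<beta> r (X r) - \<beta> r (X (t ?N (Suc k)))) \<partial>lborel)"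
    proof (rule sum_mono)
      fix k
      have "norm (\<epsilon> k) \<le> (\<integral>r. norm (indicator {t ?N k<..t ?N (Suc k)} r *\<^sub>R (\<beta> r (X r) - \<beta> r (X (t ?N (Suc k))))) \<partial>lborel)"
        unfolding \<epsilon>_def by (rule integral_norm_bound)
      then show "norm (\<epsilon> k) \<le> (\<integral>r. indicator {t ?N k<..t ?N (Suc k)} r * norm (\<beta> r (X r) - \<beta> r (X (t ?N (Suc k)))) \<partial>lborel)" by simp
    qed
    also have "\<dots> = (\<integral>r. (\<Sum>k<?N. indicator {t ?N k<..t ?N (Suc k)} r * norm (\<beta> r (X r) - \<beta> r (X (t ?N (Suc k))))) \<partial>lborel)"
    proof (rule Bochner_Integration.integral_sum[symmetric])
      fix k assume "k \<in> {..<?N}"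
      then show "integrable lborel (\<lambda>r. indicator {t ?N k<..t ?N (Suc k)} r * norm (\<beta> r (X r) - \<beta> r (X (t ?N (Suc k)))))"
        using integrable_norm[OF i3[of k]] by simp
    qed
    also have "\<dots> = (\<integral>r. indicator {s<..T} r * norm (\<beta> r (X r) - g ?N r) \<partial>lborel)"
    proof (rule Bochner_Integration.integral_cong[OF refl])
      fix r :: real
      show "(\<Sum>k<?N. indicator {t ?N k<..t ?N (Suc k)} r * norm (\<beta> r (X r) - \<beta> r (X (t ?N (Suc k))))) = indicator {s<..T} r * norm (\<beta> r (X r) - g ?N r)"
      proof (cases "r \<in> {s<..T}")
        case True
        then have "t ?N 0 < r" "r \<le> t ?N ?N" using t_N[of ?N] by (auto simp: t_0)
        then obtain k where k: "k < ?N" "\<And>j. j < ?N \<Longrightarrow> indicator {t ?N j<..t ?N (Suc j)} r = (if j = k then 1 else 0 :: real)"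
          using grid_value[of ?N "t ?N" r] t_mono[of ?N] by blast
        have "g ?N r = (\<Sum>j<?N. if j = k then \<beta> r (X (t ?N (Suc j))) else 0)"
          unfolding g_def using k(2) by (intro sum.cong) auto
        moreover have "(\<Sum>j<?N. indicator {t ?N j<..t ?N (Suc j)} r * norm (\<beta> r (X r) - \<beta> r (X (t ?N (Suc j))))) = (\<Sum>j<?N. if j = k then norm (\<beta> r (X r) - \<beta> r (X (t ?N (Suc j)))) else 0)"
          using k(2) by (intro sum.cong) auto
        ultimately show ?thesis using True k(1) by (simp add: sum.delta)
      next
        case False
        have "indicator {t ?N k<..t ?N (Suc k)} r = (0::real)" if "k < ?N" for k
          using tb[of k] tb[of "Suc k"] that False by auto
        then have "(\<Sum>k<?N. indicator {t ?N k<..t ?N (Suc k)} r * norm (\<beta> r (X r) - \<beta> r (X (t ?N (Suc k))))) = 0" by (intro sum.neutral) auto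
        then show ?thesis using False by simp
      qed
    qed
    finally have S: "(\<Sum>k<?N. norm (\<epsilon> k)) \<le> (\<integral>r. indicator {s<..T} r * norm (\<beta> r (X r) - g ?N r) \<partial>lborel)" .
    have "norm (X (t ?N ?N) - euler J (X s) ?N ?N) \<le> q ?N ^ ?N * (\<Sum>j<?N. norm (\<epsilon> j))"
      by (rule euler_error[OF _ N eps]) auto
    also have "\<dots> \<le> q ?N ^ ?N * (\<integral>r. indicator {s<..T} r * norm (\<beta> r (X r) - g ?N r) \<partial>lborel)"
      using S q_ge_1[of ?N] N by (intro mult_left_mono) auto
    finally show ?thesis using t_N[of ?N] by (simp add: norm_minus_commute)
  qed
  have "(\<lambda>N. q (Suc N) ^ Suc N * (\<integral>r. indicator {s<..T} r * norm (\<beta> r (X r) - g (Suc N) r) \<partial>lborel)) \<longlonglongrightarrow> exp (K * (T - s) / 2) * (\<integral>r. 0 \<partial>(lborel :: real measure))"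
    by (intro tendsto_mult LIMSEQ_Suc[OF q_power_tendsto] conv)
  then have lim: "(\<lambda>N. q (Suc N) ^ Suc N * (\<integral>r. indicator {s<..T} r * norm (\<beta> r (X r) - g (Suc N) r) \<partial>lborel)) \<longlonglongrightarrow> 0"
    by (simp only: Bochner_Integration.integral_zero mult_zero_right)
  have "(\<lambda>N. euler J (X s) (Suc N) (Suc N) - X T) \<longlonglongrightarrow> 0"
    by (rule Lim_null_comparison[OF eventually_mono[OF ev bound] lim])
  then have "(\<lambda>N. euler J (X s) (Suc N) (Suc N)) \<longlonglongrightarrow> X T" by (rule LIM_zero_cancel)
  then show ?thesis by (rule LIMSEQ_imp_Suc)
qed

end

section \<open>Curves in the Wasserstein space\<close>

lemma P2D:
  assumes "\<gamma> \<in> P2"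
  shows "prob_space \<gamma>" "sets \<gamma> = sets borel" "space \<gamma> = UNIV" "integrable \<gamma> (\<lambda>x. (norm x)\<^sup>2)"
  using assms sets_eq_imp_space_eq[of \<gamma> borel] by (auto simp: P2_def)

definition coupling_cost :: "((real^'d::finite) \<times> (real^'d)) measure \<Rightarrow> real" where
  "coupling_cost \<pi> = (\<integral>z. (norm (fst z - snd z))\<^sup>2 \<partial>\<pi>)"

lemma coupling_cost_nonneg: "0 \<le> coupling_cost \<pi>"
  by (simp add: coupling_cost_def)

lemma W2_eq: "W2 \<gamma> \<nu> = sqrt (INF \<pi>\<in>couplings \<gamma> \<nu>. coupling_cost \<pi>)"
  by (simp add: W2_def coupling_cost_def)

lemma bdd_below_cost: "bdd_below (coupling_cost ` A)"
  using coupling_cost_nonneg by (auto simp: bdd_below_def)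

lemma W2_le_coupling:
  assumes "\<pi> \<in> couplings \<gamma> \<nu>"
  shows "W2 \<gamma> \<nu> \<le> sqrt (coupling_cost \<pi>)"
  unfolding W2_eq using assms by (intro real_sqrt_le_mono cINF_lower bdd_below_cost)

lemma pair_coupling:
  fixes f g :: "'a \<Rightarrow> real^'d::finite"
  assumes [measurable]: "f \<in> borel_measurable N" "g \<in> borel_measurable N"
  shows "distr N (borel \<Otimes>\<^sub>M borel) (\<lambda>x. (f x, g x)) \<in> couplings (distr N borel f) (distr N borel g)"
    and "coupling_cost (distr N (borel \<Otimes>\<^sub>M borel) (\<lambda>x. (f x, g x))) = (\<integral>x. (norm (f x - g x))\<^sup>2 \<partial>N)"
proof -
  show "distr N (borel \<Otimes>\<^sub>M borel) (\<lambda>x. (f x, g x)) \<in> couplings (distr N borel f) (distr N borel g)"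
    by (simp add: couplings_def distr_distr o_def)
  show "coupling_cost (distr N (borel \<Otimes>\<^sub>M borel) (\<lambda>x. (f x, g x))) = (\<integral>x. (norm (f x - g x))\<^sup>2 \<partial>N)"
    unfolding coupling_cost_def by (subst integral_distr) auto
qed

lemma distr_id_borel: "sets \<gamma> = sets borel \<Longrightarrow> distr \<gamma> borel (\<lambda>x. x) = \<gamma>"
  by (rule distr_id2) simp

lemma W2_self:
  assumes "\<gamma> \<in> P2" shows "W2 \<gamma> \<gamma> = 0"
proof -
  have m: "(\<lambda>x. x) \<in> borel_measurable \<gamma>" using P2D(2)[OF assms] by (simp cong: measurable_cong_sets)
  let ?\<pi> = "distr \<gamma> (borel \<Otimes>\<^sub>M borel) (\<lambda>x. (x, x))"
  have "?\<pi> \<in> couplings \<gamma> \<gamma>" using pair_coupling(1)[OF m m] by (simp add: distr_id_borel[OF P2D(2)[OF assms]])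
  then have "W2 \<gamma> \<gamma> \<le> sqrt (coupling_cost ?\<pi>)" by (rule W2_le_coupling)
  also have "coupling_cost ?\<pi> = 0" using pair_coupling(2)[OF m m] by simp
  finally have le: "W2 \<gamma> \<gamma> \<le> 0" by simp
  have "0 \<le> (INF \<pi>\<in>couplings \<gamma> \<gamma>. coupling_cost \<pi>)"
    using \<open>?\<pi> \<in> couplings \<gamma> \<gamma>\<close> by (intro cINF_greatest coupling_cost_nonneg) auto
  then show ?thesis using le unfolding W2_eq by simp
qed

text \<open>Needed because \<open>C_P2\<close> and the open sets in \<open>P2_borel\<close> put the
  reference measure in opposite arguments of \<open>W2\<close>.\<close>

lemma W2_sym: "W2 \<gamma> \<nu> = W2 \<nu> (\<gamma> :: (real^'d::finite) measure)"
proof -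
  have sub: "coupling_cost ` couplings \<gamma> \<nu> \<subseteq> coupling_cost ` couplings \<nu> \<gamma>" for \<gamma> \<nu> :: "(real^'d) measure"
  proof
    fix c assume "c \<in> coupling_cost ` couplings \<gamma> \<nu>"
    then obtain \<pi> where \<pi>: "\<pi> \<in> couplings \<gamma> \<nu>" "c = coupling_cost \<pi>" by blast
    then have s: "sets \<pi> = sets (borel \<Otimes>\<^sub>M borel)" and d: "distr \<pi> borel fst = \<gamma>" "distr \<pi> borel snd = \<nu>" by (auto simp: couplings_def)
    have [measurable]: "fst \<in> borel_measurable \<pi>" "snd \<in> borel_measurable \<pi>"
      using s by (auto cong: measurable_cong_sets)
    let ?\<pi> = "distr \<pi> (borel \<Otimes>\<^sub>M borel) (\<lambda>z. (snd z, fst z))"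
    have "?\<pi> \<in> couplings \<nu> \<gamma>" using pair_coupling(1)[of snd \<pi> fst] d by simp
    moreover have "coupling_cost ?\<pi> = c"
      using pair_coupling(2)[of snd \<pi> fst] by (simp add: \<pi>(2) coupling_cost_def norm_minus_commute)
    ultimately show "c \<in> coupling_cost ` couplings \<nu> \<gamma>" by blast
  qed
  have "coupling_cost ` couplings \<gamma> \<nu> = coupling_cost ` couplings \<nu> \<gamma>" using sub by blast
  then show ?thesis unfolding W2_eq by simp
qed

lemma W2_dirac_le:
  assumes "\<gamma> \<in> P2"
  shows "W2 \<gamma> (return borel 0) \<le> sqrt (\<integral>x. (norm x)\<^sup>2 \<partial>\<gamma>)"
proof -
  interpret prob_space \<gamma> by (rule P2D(1)[OF assms])
  have m: "(\<lambda>x. x) \<in> borel_measurable \<gamma>" using P2D(2)[OF assms] by (simp cong: measurable_cong_sets)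
  have c: "(\<lambda>x. 0) \<in> borel_measurable \<gamma>" by simp
  have r: "distr \<gamma> borel (\<lambda>x. 0) = return borel 0"
  proof (rule measure_eqI)
    fix A assume "A \<in> sets (distr \<gamma> borel (\<lambda>x. 0))"
    then show "emeasure (distr \<gamma> borel (\<lambda>x. 0)) A = emeasure (return borel 0) A"
      by (subst emeasure_distr) (auto simp: indicator_def emeasure_space_1)
  qed simp
  show ?thesis
    using W2_le_coupling[OF pair_coupling(1)[OF m c]] pair_coupling(2)[OF m c]
    by (simp add: r distr_id_borel[OF P2D(2)[OF assms]])
qed

text \<open>The product measure is a coupling. This excludes an infimum over the empty set, about
  which lower bounds would say nothing.\<close>

lemma couplings_nonempty:
  assumes "\<gamma> \<in> P2" "\<nu> \<in> P2"
  shows "couplings \<gamma> \<nu> \<noteq> {}"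
proof -
  note \<gamma> = P2D[OF assms(1)] and \<nu> = P2D[OF assms(2)]
  interpret \<gamma>: prob_space \<gamma> by (rule \<gamma>(1))
  interpret \<nu>: prob_space \<nu> by (rule \<nu>(1))
  interpret P: pair_prob_space \<gamma> \<nu> ..
  have "sets (\<gamma> \<Otimes>\<^sub>M \<nu>) = sets (borel \<Otimes>\<^sub>M borel)" by (rule sets_pair_measure_cong[OF \<gamma>(2) \<nu>(2)])
  moreover have "distr (\<gamma> \<Otimes>\<^sub>M \<nu>) borel fst = \<gamma>"
  proof -
    have "distr (\<gamma> \<Otimes>\<^sub>M \<nu>) borel fst = distr (\<gamma> \<Otimes>\<^sub>M \<nu>) \<gamma> fst" by (rule distr_cong) (auto simp: \<gamma>(2))
    then show ?thesis using \<nu>.distr_pair_fst[of \<gamma>] by simp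
  qed
  moreover have "distr (\<gamma> \<Otimes>\<^sub>M \<nu>) borel snd = \<nu>"
  proof -
    have "distr (\<gamma> \<Otimes>\<^sub>M \<nu>) borel snd = distr (\<gamma> \<Otimes>\<^sub>M \<nu>) \<nu> snd" by (rule distr_cong) (auto simp: \<nu>(2))
    moreover have "distr (\<gamma> \<Otimes>\<^sub>M \<nu>) \<nu> snd = \<nu>"
    proof (rule measure_eqI)
      fix A assume "A \<in> sets (distr (\<gamma> \<Otimes>\<^sub>M \<nu>) \<nu> snd)"
      then have A: "A \<in> sets \<nu>" by simp
      have "snd -` A \<inter> space (\<gamma> \<Otimes>\<^sub>M \<nu>) = space \<gamma> \<times> A" using sets.sets_into_space[OF A] by (auto simp: space_pair_measure)
      then show "emeasure (distr (\<gamma> \<Otimes>\<^sub>M \<nu>) \<nu> snd) A = emeasure \<nu> A"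
        using A by (simp add: emeasure_distr \<nu>.emeasure_pair_measure_Times \<gamma>.emeasure_space_1)
    qed simp
    ultimately show ?thesis by simp
  qed
  ultimately show ?thesis unfolding couplings_def by blast
qed

lemma W2_nonneg:
  assumes "\<gamma> \<in> P2" "\<nu> \<in> P2"
  shows "0 \<le> W2 \<gamma> \<nu>"
  unfolding W2_eq by (intro real_sqrt_ge_zero cINF_greatest coupling_cost_nonneg couplings_nonempty[OF assms])

text \<open>Serves in place of the triangle inequality for \<open>W2\<close>, whose proof would
  require gluing couplings: distances to the Dirac mass at the origin are controlled through second
  moments.\<close>

lemma second_moment_le_W2:
  fixes \<gamma> \<nu> :: "(real^'d::finite) measure"
  assumes "\<gamma> \<in> P2" "\<nu> \<in> P2"
  shows "(\<integral>x. (norm x)\<^sup>2 \<partial>\<gamma>) \<le> 2 * (W2 \<gamma> \<nu>)\<^sup>2 + 2 * (\<integral>x. (norm x)\<^sup>2 \<partial>\<nu>)"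
proof -
  note \<gamma> = P2D[OF assms(1)] and \<nu> = P2D[OF assms(2)]
  note ne = couplings_nonempty[OF assms]
  \<comment> \<open>Rearranged so that the infimum stands alone and each coupling can be treated
    separately.\<close>
  have "((\<integral>x. (norm x)\<^sup>2 \<partial>\<gamma>) - 2 * (\<integral>x. (norm x)\<^sup>2 \<partial>\<nu>)) / 2 \<le> (INF \<pi>\<in>couplings \<gamma> \<nu>. coupling_cost \<pi>)"
  proof (rule cINF_greatest[OF ne])
    fix \<pi> assume "\<pi> \<in> couplings \<gamma> \<nu>"
    then have s: "sets \<pi> = sets (borel \<Otimes>\<^sub>M borel)" and d: "distr \<pi> borel fst = \<gamma>" "distr \<pi> borel snd = \<nu>" by (auto simp: couplings_def)
    have [measurable]: "fst \<in> borel_measurable \<pi>" "snd \<in> borel_measurable \<pi>" using s by (auto cong: measurable_cong_sets)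
    have i1: "integrable \<pi> (\<lambda>z. (norm (fst z))\<^sup>2)" using \<gamma>(4) unfolding d(1)[symmetric] by (subst (asm) integrable_distr_eq) auto
    have i2: "integrable \<pi> (\<lambda>z. (norm (snd z))\<^sup>2)" using \<nu>(4) unfolding d(2)[symmetric] by (subst (asm) integrable_distr_eq) auto
    have i3: "integrable \<pi> (\<lambda>z. (norm (fst z - snd z))\<^sup>2)"
    proof (rule Bochner_Integration.integrable_bound)
      show "integrable \<pi> (\<lambda>z. 2 * (norm (fst z))\<^sup>2 + 2 * (norm (snd z))\<^sup>2)" using i1 i2 by simp
      show "AE z in \<pi>. norm ((norm (fst z - snd z))\<^sup>2) \<le> norm (2 * (norm (fst z))\<^sup>2 + 2 * (norm (snd z))\<^sup>2)"
        using norm_add_sq_le[of "fst _" "- snd _"] by (intro AE_I2) simp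
    qed measurable
    have "(\<integral>x. (norm x)\<^sup>2 \<partial>\<gamma>) = (\<integral>z. (norm (fst z))\<^sup>2 \<partial>\<pi>)"
      unfolding d(1)[symmetric] by (subst integral_distr) auto
    also have "\<dots> \<le> (\<integral>z. 2 * (norm (fst z - snd z))\<^sup>2 + 2 * (norm (snd z))\<^sup>2 \<partial>\<pi>)"
    proof (rule integral_mono)
      show "(norm (fst z))\<^sup>2 \<le> 2 * (norm (fst z - snd z))\<^sup>2 + 2 * (norm (snd z))\<^sup>2" for z :: "(real^'d) \<times> (real^'d)"
        using norm_add_sq_le[of "fst z - snd z" "snd z"] by simp
    qed (use i1 i2 i3 in auto)
    also have "\<dots> = 2 * coupling_cost \<pi> + 2 * (\<integral>z. (norm (snd z))\<^sup>2 \<partial>\<pi>)"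
      using i2 i3 by (simp add: coupling_cost_def)
    also have "(\<integral>z. (norm (snd z))\<^sup>2 \<partial>\<pi>) = (\<integral>x. (norm x)\<^sup>2 \<partial>\<nu>)"
      unfolding d(2)[symmetric] by (subst integral_distr) auto
    finally show "((\<integral>x. (norm x)\<^sup>2 \<partial>\<gamma>) - 2 * (\<integral>x. (norm x)\<^sup>2 \<partial>\<nu>)) / 2 \<le> coupling_cost \<pi>" by simp
  qed
  moreover have "0 \<le> (INF \<pi>\<in>couplings \<gamma> \<nu>. coupling_cost \<pi>)" by (rule cINF_greatest[OF ne coupling_cost_nonneg])
  ultimately show ?thesis by (simp add: W2_eq)
qed

text \<open>Distances growing without bound along times in a compact interval would contradict
  continuity at a limit time: near that time second moments are bounded, hence so is the distance to
  the Dirac mass.\<close>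

lemma C_P2_W2_bounded:
  assumes \<mu>: "\<mu> \<in> C_P2" and s: "0 \<le> s"
  shows "\<exists>R. \<forall>t\<in>{s..T}. W2 (\<mu> t) (return borel 0) \<le> R"
proof (rule ccontr)
  assume "\<not> ?thesis"
  then have "\<forall>n. \<exists>t\<in>{s..T}. W2 (\<mu> t) (return borel 0) > real n" by (meson not_le)
  then obtain t where t: "\<And>n. t n \<in> {s..T}" "\<And>n. W2 (\<mu> (t n)) (return borel 0) > real n" by metis
  have P2: "\<mu> r \<in> P2" if "r \<in> {s..T}" for r using \<mu> that s unfolding C_P2_def by auto
  obtain l \<phi> where l: "l \<in> {s..T}" "strict_mono \<phi>" "(t \<circ> \<phi>) \<longlonglongrightarrow> l"
    using compact_Icc[of s T] t(1) unfolding compact_def by blast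
  have "((\<lambda>r. W2 (\<mu> r) (\<mu> l)) \<longlongrightarrow> 0) (at l within {0..})" using \<mu> l(1) s unfolding C_P2_def by auto
  then have "\<forall>\<^sub>F r in at l within {0..}. W2 (\<mu> r) (\<mu> l) < 1" by (rule order_tendstoD) simp
  then obtain S where S: "open S" "l \<in> S" "\<And>r. r \<in> S \<Longrightarrow> r \<noteq> l \<Longrightarrow> r \<in> {0..} \<Longrightarrow> W2 (\<mu> r) (\<mu> l) < 1"
    unfolding eventually_at_topological by blast
  have "\<forall>\<^sub>F n in sequentially. (t \<circ> \<phi>) n \<in> S" using topological_tendstoD[OF l(3) S(1,2)] .
  then obtain N where N: "\<And>n. n \<ge> N \<Longrightarrow> t (\<phi> n) \<in> S" by (auto simp: eventually_sequentially)
  define m where "m = 2 + 2 * (\<integral>x. (norm x)\<^sup>2 \<partial>\<mu> l)"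
  have b: "W2 (\<mu> (t (\<phi> n))) (return borel 0) \<le> sqrt m" if "n \<ge> N" for n
  proof -
    let ?r = "t (\<phi> n)"
    have r: "?r \<in> {s..T}" by (rule t)
    have "W2 (\<mu> ?r) (\<mu> l) \<le> 1"
      \<comment> \<open>The limit in \<open>C_P2\<close> excludes the time \<open>l\<close> itself,
        where the distance is \<open>0\<close>.\<close>
      using S(3)[OF N[OF that]] W2_self[OF P2[OF l(1)]] r s by (cases "?r = l") auto
    then have "(W2 (\<mu> ?r) (\<mu> l))\<^sup>2 \<le> 1" using W2_nonneg[OF P2[OF r] P2[OF l(1)]] by (simp add: power_le_one)
    then have "(\<integral>x. (norm x)\<^sup>2 \<partial>\<mu> ?r) \<le> m"
      using second_moment_le_W2[OF P2[OF r] P2[OF l(1)]] by (simp add: m_def)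
    then show ?thesis using W2_dirac_le[OF P2[OF r]] by (meson order_trans real_sqrt_le_mono)
  qed
  obtain k where k: "sqrt m < real k" using reals_Archimedean2 by blast
  let ?n = "max N k"
  have "real k \<le> real (\<phi> ?n)" using seq_suble[OF l(2), of ?n] by simp
  then show False using b[of ?n] t(2)[of "\<phi> ?n"] k by simp
qed

text \<open>Preimages of open sets are relatively open by continuity. The result allows the curve to
  be inserted into the jointly measurable drift.\<close>

lemma C_P2_measurable:
  fixes \<mu> :: "real \<Rightarrow> (real^'d::finite) measure"
  assumes \<mu>: "\<mu> \<in> C_P2"
  shows "\<mu> \<in> measurable (restrict_space borel {0..}) P2_borel"
  unfolding P2_borel_def
proof (rule measurable_measure_of)
  show "{U. U \<subseteq> P2 \<and> (\<forall>\<gamma>\<in>U. \<exists>r>0. \<forall>\<nu>\<in>P2. W2 \<gamma> \<nu> < r \<longrightarrow> \<nu> \<in> U)} \<subseteq> Pow P2" by auto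
  show "\<mu> \<in> space (restrict_space borel {0..}) \<rightarrow> P2" using \<mu> by (auto simp: C_P2_def space_restrict_space)
  fix U :: "(real^'d) measure set" assume "U \<in> {U. U \<subseteq> P2 \<and> (\<forall>\<gamma>\<in>U. \<exists>r>0. \<forall>\<nu>\<in>P2. W2 \<gamma> \<nu> < r \<longrightarrow> \<nu> \<in> U)}"
  then have U: "\<And>\<gamma>. \<gamma> \<in> U \<Longrightarrow> \<exists>r>0. \<forall>\<nu>\<in>P2. W2 \<gamma> \<nu> < r \<longrightarrow> \<nu> \<in> U" by auto
  \<comment> \<open>The largest open set of the line whose nonnegative times are mapped into
    \<open>U\<close>.\<close>
  define V where "V = \<Union>{S. open S \<and> S \<inter> {0..} \<subseteq> {t. \<mu> t \<in> U}}"
  have "open V" unfolding V_def by (intro open_Union) auto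
  moreover have "\<mu> -` U \<inter> space (restrict_space borel {0..}) = V \<inter> {0..}"
  proof (intro equalityI subsetI)
    fix t assume "t \<in> \<mu> -` U \<inter> space (restrict_space borel {0..})"
    then have t: "0 \<le> t" "\<mu> t \<in> U" by (auto simp: space_restrict_space)
    obtain r where r: "r > 0" "\<And>\<nu>. \<nu> \<in> P2 \<Longrightarrow> W2 (\<mu> t) \<nu> < r \<Longrightarrow> \<nu> \<in> U" using U[OF t(2)] by blast
    have "((\<lambda>r. W2 (\<mu> r) (\<mu> t)) \<longlongrightarrow> 0) (at t within {0..})" using \<mu> t unfolding C_P2_def by auto
    then have "\<forall>\<^sub>F u in at t within {0..}. W2 (\<mu> u) (\<mu> t) < r" using r(1) by (rule order_tendstoD)
    then obtain S where S: "open S" "t \<in> S" "\<And>u. u \<in> S \<Longrightarrow> u \<noteq> t \<Longrightarrow> u \<in> {0..} \<Longrightarrow> W2 (\<mu> u) (\<mu> t) < r"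
      unfolding eventually_at_topological by blast
    have "\<mu> u \<in> U" if "u \<in> S" "u \<in> {0..}" for u
    proof (cases "u = t")
      case False
      have "\<mu> u \<in> P2" using \<mu> that by (auto simp: C_P2_def)
      then show ?thesis using S(3)[OF that(1) False that(2)] r(2) by (simp add: W2_sym)
    qed (use t in simp)
    then have "S \<inter> {0..} \<subseteq> {t. \<mu> t \<in> U}" by auto
    then show "t \<in> V \<inter> {0..}" using S(1,2) t(1) unfolding V_def by blast
  qed (auto simp: V_def space_restrict_space)
  ultimately show "\<mu> -` U \<inter> space (restrict_space borel {0..}) \<in> sets (restrict_space borel {0..})"
    unfolding sets_restrict_space by (intro image_eqI[of _ _ V]) auto
qed

section \<open>Propagation of the logarithmic Sobolev inequality\<close>

text \<open>With \<open>Q = (q N)\<^sup>2\<close> the recursion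
  \<open>C \<mapsto> Q * (C + \<delta> * h)\<close> has this closed form, where the geometric sum
  produces the factor \<open>h * Q / (Q - 1)\<close>. That factor tends to \<open>1 / K\<close>
  because \<open>Q - 1\<close> behaves like \<open>K * h\<close>.\<close>

lemma (in monotone_drift) LSI_constant_tendsto:
  "(\<lambda>N. (q N)\<^sup>2 ^ N * C + \<delta> * (h N * (q N)\<^sup>2 / ((q N)\<^sup>2 - 1)) * ((q N)\<^sup>2 ^ N - 1))
    \<longlonglongrightarrow> exp (K * (T - s)) * C + \<delta> * (1 / K) * (exp (K * (T - s)) - 1)"
proof -
  have "(\<lambda>N. (q N ^ N)\<^sup>2) \<longlonglongrightarrow> (exp (K * (T - s) / 2))\<^sup>2" by (intro tendsto_intros q_power_tendsto)
  moreover have "(exp (K * (T - s) / 2))\<^sup>2 = exp (K * (T - s))" by (simp add: power2_eq_square exp_add[symmetric])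
  moreover have "(q N ^ N)\<^sup>2 = (q N)\<^sup>2 ^ N" for N by (simp add: power_mult[symmetric] mult.commute)
  ultimately have 1: "(\<lambda>N. (q N)\<^sup>2 ^ N) \<longlonglongrightarrow> exp (K * (T - s))" by simp
  have lim: "(\<lambda>N. (2 / K) / (2 - K * h N / 2)) \<longlonglongrightarrow> (2 / K) / (2 - 0)"
    by (intro tendsto_divide tendsto_diff tendsto_const K_h_tendsto_0) simp
  have 2: "(\<lambda>N. h N * (q N)\<^sup>2 / ((q N)\<^sup>2 - 1)) \<longlonglongrightarrow> 1 / K"
  proof (rule Lim_transform_eventually)
    show "(\<lambda>N. (2 / K) / (2 - K * h N / 2)) \<longlonglongrightarrow> 1 / K" using lim by simp
    have "\<forall>\<^sub>F N in sequentially. K * h N / 2 < 1" using K_h_tendsto_0 by (rule order_tendstoD) simp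
    then show "\<forall>\<^sub>F N in sequentially. (2 / K) / (2 - K * h N / 2) = h N * (q N)\<^sup>2 / ((q N)\<^sup>2 - 1)"
      using eventually_gt_at_top[of 0]
    proof eventually_elim
      case (elim N)
      \<comment> \<open>In terms of \<open>x\<close> one has \<open>Q = 1 / (1 - x)\<^sup>2\<close>,
        and the factor simplifies to \<open>(2 / K) / (2 - x)\<close>.\<close>
      define x where "x = K * h N / 2"
      have x: "0 < x" "x < 1" using elim h_pos[of N] K by (auto simp: x_def)
      have h: "h N = 2 / K * x" using K by (simp add: x_def)
      have "(q N)\<^sup>2 = 1 / (1 - x)\<^sup>2" by (simp add: q_def x_def power_divide)
      moreover have "(1 / w) / (1 / w - 1) = 1 / (1 - w)" if "0 < w" for w :: real
      proof -
        have "1 / w - 1 = (1 - w) / w" using that by (simp add: diff_divide_distrib)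
        then show ?thesis using that by simp
      qed
      ultimately have "(q N)\<^sup>2 / ((q N)\<^sup>2 - 1) = 1 / (1 - (1 - x)\<^sup>2)" using x by (simp only: zero_less_power diff_gt_0_iff_gt)
      also have "1 - (1 - x)\<^sup>2 = x * (2 - x)" by (simp add: power2_eq_square algebra_simps)
      finally have "h N * (q N)\<^sup>2 / ((q N)\<^sup>2 - 1) = 2 / K * x * (1 / (x * (2 - x)))"
        unfolding h by (metis times_divide_eq_right)
      also have "\<dots> = (2 / K) / (2 - x)" using x by simp
      finally show ?case by (simp add: x_def)
    qed
  qed
  show ?thesis by (intro tendsto_intros 1 2)
qed

context brownian_motion
begin

text \<open>One Euler step first adds a noise increment after the current grid time, to which
  \<open>LSI_add_ito_increment\<close> applies, and then a resolvent, to which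
  \<open>LSI_distr_lip\<close> applies. Pathwise convergence transfers the inequality to
  \<open>X T\<close>.\<close>

lemma LSI_monotone_drift:
  fixes X :: "real \<Rightarrow> 'w \<Rightarrow> real^'d::finite" and \<Sigma> :: "real \<Rightarrow> real^'n^'d"
  assumes D: "monotone_drift \<beta> s T K" and s: "0 \<le> s" and \<delta>: "0 \<le> \<delta>" and C: "0 \<le> C"
    and \<Sigma>: "\<And>r. r \<in> {s..T} \<Longrightarrow> \<Sigma> r \<in> diffusion_set \<delta>"
    and X: "solves_sde M F W s \<beta> \<Sigma> X" and LSI: "LSI (distr M borel (X s)) C"
  shows "LSI (distr M borel (X T)) (exp (K * (T - s)) * C + \<delta> * (1 / K) * (exp (K * (T - s)) - 1))"
proof -
  interpret D: monotone_drift \<beta> s T K by (rule D)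
  have sT: "s < T" by (rule D.sT)
  have T0: "0 \<le> T" using s sT by simp
  have XF: "X t \<in> borel_measurable (F t)" if "s \<le> t" for t using X that unfolding solves_sde_def by blast
  obtain J where ito: "\<And>t. s \<le> t \<Longrightarrow> has_ito_integral M F W s t (\<lambda>r \<omega>. \<Sigma> r) (J t)"
    and eq: "AE \<omega> in M. \<forall>t\<ge>s. X t \<omega> = X s \<omega> + (LINT r:{s..t}|lborel. \<beta> r (X r \<omega>)) + J t \<omega>"
    using X unfolding solves_sde_def by blast
  have JF: "J t \<in> borel_measurable (F t)" if "s \<le> t" for t using ito[OF that] unfolding has_ito_integral_def by blast
  define Y where "Y N k \<omega> = D.euler (\<lambda>t. J t \<omega>) (X s \<omega>) N k" for N k \<omega>
  have YS: "Y N (Suc k) \<omega> = D.res N k (Y N k \<omega> + (J (D.t N (Suc k)) \<omega> - J (D.t N k) \<omega>))" for N k \<omega> by (simp add: Y_def)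
  have conv: "AE \<omega> in M. (\<lambda>N. Y N N \<omega>) \<longlonglongrightarrow> X T \<omega>"
  proof -
    have "AE \<omega> in M. continuous_on {s..} (\<lambda>t. X t \<omega>)"
      "AE \<omega> in M. \<forall>t\<ge>s. set_integrable lborel {s..t} (\<lambda>r. \<beta> r (X r \<omega>))"
      using X unfolding solves_sde_def by blast+
    then show ?thesis using eq
    proof eventually_elim
      case (elim \<omega>)
      show ?case unfolding Y_def
      proof (rule D.euler_tendsto[of "\<lambda>t. X t \<omega>"])
        show "continuous_on {s..T} (\<lambda>t. X t \<omega>)" using elim(1) by (rule continuous_on_subset) auto
        show "set_integrable lborel {s..T} (\<lambda>r. \<beta> r (X r \<omega>))" using elim(2) sT by simp
        show "X u \<omega> = X s \<omega> + (LINT r:{s..u}|lborel. \<beta> r (X r \<omega>)) + J u \<omega>" if "u \<in> {s..T}" for u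
          by (rule elim(3)[rule_format]) (use that in simp)
      qed
    qed
  qed
  have step: "Y N k \<in> borel_measurable (F (D.t N k)) \<and>
      LSI (distr M borel (Y N k)) ((D.q N)\<^sup>2 ^ k * C + \<delta> * (D.h N * (D.q N)\<^sup>2 / ((D.q N)\<^sup>2 - 1)) * ((D.q N)\<^sup>2 ^ k - 1))"
    if N: "N > 0" "K * D.h N / 2 < 1" and "k \<le> N" for N k
    using that(3)
  proof (induction k)
    case 0
    have "Y N 0 = X s" by (simp add: Y_def fun_eq_iff)
    then show ?case using XF[of s] LSI by (simp add: D.t_0)
  next
    case (Suc k)
    let ?Q = "(D.q N)\<^sup>2" and ?a = "D.t N k" and ?b = "D.t N (Suc k)"
    let ?A = "D.h N * ?Q / (?Q - 1)"
    \<comment> \<open>The closed form of the recursion after \<open>k\<close> steps;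
      \<open>Q > 1\<close> makes it nonnegative.\<close>
    let ?c = "?Q ^ k * C + \<delta> * ?A * (?Q ^ k - 1)"
    have ab: "s \<le> ?a" "?a \<le> ?b" "?b \<le> T" using D.t_bounds[OF N(1), of k] D.t_bounds[OF N(1), of "Suc k"] D.t_mono[OF N(1), of k] Suc.prems by auto
    have b0: "0 \<le> ?a" "0 \<le> ?b" using ab s by auto
    have q1: "1 < D.q N" using D.h_pos[OF N(1)] D.K N(2) by (simp add: D.q_def)
    have Q1: "1 < ?Q" using q1 by simp
    have c0: "0 \<le> ?c" using C \<delta> Q1 D.h_pos[OF N(1)] by (auto intro!: add_nonneg_nonneg mult_nonneg_nonneg divide_nonneg_nonneg simp: less_imp_le)
    have IH: "Y N k \<in> borel_measurable (F ?a)" "LSI (distr M borel (Y N k)) ?c" using Suc by auto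
    note R = D.res(1)[OF N, of k]
    have Rk: "lip (D.q N) (D.res N k)" using R Suc.prems by simp
    let ?Z = "\<lambda>\<omega>. Y N k \<omega> + (J ?b \<omega> - J ?a \<omega>)"
    have Zm: "?Z \<in> borel_measurable (F ?b)"
    proof -
      have [measurable]: "Y N k \<in> borel_measurable (F ?b)" "J ?a \<in> borel_measurable (F ?b)" "J ?b \<in> borel_measurable (F ?b)"
        using measurable_F_mono[OF b0(1) ab(2)] IH(1) JF ab by auto
      show ?thesis by measurable
    qed
    have [measurable]: "D.res N k \<in> borel_measurable borel" by (rule lip_measurable[OF Rk])
    have YR: "Y N (Suc k) = (\<lambda>\<omega>. D.res N k (?Z \<omega>))" by (simp add: YS fun_eq_iff)
    have m: "Y N (Suc k) \<in> borel_measurable (F ?b)" unfolding YR using Zm by (rule measurable_compose) simp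
    have "LSI (distr M borel ?Z) (?c + \<delta> * (?b - ?a))"
    proof (rule LSI_add_ito_increment[OF ito ito s ab(1,2) _ \<delta> IH c0])
      show "s \<le> ?a" "s \<le> ?b" using ab by auto
      show "\<Sigma> r \<in> diffusion_set \<delta>" if "r \<in> {s..?b}" for r using \<Sigma> that ab by auto
    qed
    then have "LSI (distr (distr M borel ?Z) borel (D.res N k)) (?Q * (?c + \<delta> * (?b - ?a)))"
      by (rule LSI_distr_lip[OF _ _ Rk]) simp
    moreover have "distr (distr M borel ?Z) borel (D.res N k) = distr M borel (Y N (Suc k))"
      using measurable_F_M[OF b0(2) Zm] by (simp add: distr_distr o_def YR)
    moreover have "?Q * (?c + \<delta> * (?b - ?a)) = ?Q ^ Suc k * C + \<delta> * ?A * (?Q ^ Suc k - 1)"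
    proof -
      have A: "?A * (?Q - 1) = D.h N * ?Q" using Q1 by simp
      \<comment> \<open>One step of the recursion, isolated as a polynomial identity that needs only
        the defining relation of \<open>?A\<close>.\<close>
      have alg: "Q * (p * C + \<delta> * A * (p - 1) + \<delta> * h) = Q * p * C + \<delta> * A * (Q * p - 1)" if "A * (Q - 1) = h * Q" for Q A p h :: real
        using that by algebra
      have "?b - ?a = D.h N" by (simp add: D.t_Suc)
      then show ?thesis using alg[OF A] by (simp only: power_Suc)
    qed
    ultimately show ?case using m by simp
  qed
  have "\<forall>\<^sub>F N in sequentially. K * D.h N / 2 < 1 \<and> N > 0"
    by (intro eventually_conj order_tendstoD(2)[OF D.K_h_tendsto_0] eventually_gt_at_top) simp
  \<comment> \<open>The resolvents are specified only for \<open>K * h / 2 < 1\<close>, so the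
    sequence starts at a large enough index.\<close>
  then obtain N0 where N0: "\<And>N. N \<ge> N0 \<Longrightarrow> K * D.h N / 2 < 1 \<and> N > 0" by (auto simp: eventually_sequentially)
  show ?thesis
  proof (rule LSI_distr_limit[OF prob_space_axioms, where X'="\<lambda>n. Y (n + N0) (n + N0)"])
    fix n
    let ?N = "n + N0"
    have N: "?N > 0" "K * D.h ?N / 2 < 1" using N0[of ?N] by auto
    note st = step[OF N order_refl]
    show "Y ?N ?N \<in> borel_measurable M"
      using measurable_F_M[OF _ conjunct1[OF st]] T0 D.t_N[OF N(1)] by simp
    show "LSI (distr M borel (Y ?N ?N)) ((D.q ?N)\<^sup>2 ^ ?N * C + \<delta> * (D.h ?N * (D.q ?N)\<^sup>2 / ((D.q ?N)\<^sup>2 - 1)) * ((D.q ?N)\<^sup>2 ^ ?N - 1))"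
      by (rule conjunct2[OF st])
  next
    show "X T \<in> borel_measurable M" using measurable_F_M[OF T0 XF] sT by simp
    show "AE \<omega> in M. (\<lambda>n. Y (n + N0) (n + N0) \<omega>) \<longlonglongrightarrow> X T \<omega>"
      using conv by eventually_elim (rule LIMSEQ_ignore_initial_segment)
    show "(\<lambda>n. (D.q (n + N0))\<^sup>2 ^ (n + N0) * C + \<delta> * (D.h (n + N0) * (D.q (n + N0))\<^sup>2 / ((D.q (n + N0))\<^sup>2 - 1)) * ((D.q (n + N0))\<^sup>2 ^ (n + N0) - 1))
      \<longlonglongrightarrow> exp (K * (T - s)) * C + \<delta> * (1 / K) * (exp (K * (T - s)) - 1)"
      by (rule LIMSEQ_ignore_initial_segment[OF D.LSI_constant_tendsto])
  qed
qed

end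

text \<open>With both measure arguments equal to \<open>\<mu> r\<close>, the difference of the
  diffusion matrices and the Wasserstein distance vanish, which leaves a one-sided Lipschitz bound
  in space with constant \<open>K\<close>.\<close>

lemma monotone_drift_along_curve:
  fixes b :: "real \<Rightarrow> real^'d::finite \<Rightarrow> (real^'d) measure \<Rightarrow> real^'d" and \<sigma> :: "real \<Rightarrow> (real^'d) measure \<Rightarrow> real^'n::finite^'d"
  assumes meas: "(\<lambda>(t, x, \<gamma>). b t x \<gamma>) \<in> borel_measurable (restrict_space borel {0..} \<Otimes>\<^sub>M borel \<Otimes>\<^sub>M P2_borel)"
    and bdd: "bounded_on_bounded b"
    and cont: "\<And>t \<gamma>. t \<ge> 0 \<Longrightarrow> \<gamma> \<in> P2 \<Longrightarrow> continuous_on UNIV (\<lambda>x. b t x \<gamma>)"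
    and K: "K > 0"
    and mono: "\<And>t x y \<gamma> \<gamma>'. t \<ge> 0 \<Longrightarrow> \<gamma> \<in> P2 \<Longrightarrow> \<gamma>' \<in> P2 \<Longrightarrow>
      2 * ((b t x \<gamma> - b t y \<gamma>') \<bullet> (x - y)) + (hs_norm (\<sigma> t \<gamma> - \<sigma> t \<gamma>'))\<^sup>2 \<le> K * (norm (x - y))\<^sup>2 + KI * (W2 \<gamma> \<gamma>')\<^sup>2"
    and \<mu>: "\<mu> \<in> C_P2" and s: "0 \<le> s" "s < T"
  shows "monotone_drift (\<lambda>r y. b r y (\<mu> r)) s T K"
proof
  have P2: "\<mu> r \<in> P2" if "0 \<le> r" for r using \<mu> that by (auto simp: C_P2_def)
  show "s < T" "0 < K" by fact+
  fix y :: "real^'d"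
  have "(\<lambda>r. (r, y, \<mu> r)) \<in> measurable (restrict_space borel {0..}) (restrict_space borel {0..} \<Otimes>\<^sub>M borel \<Otimes>\<^sub>M P2_borel)"
    using C_P2_measurable[OF \<mu>] by measurable
  from measurable_compose[OF this meas] have "(\<lambda>r. b r y (\<mu> r)) \<in> borel_measurable (restrict_space borel {0..})" by simp
  then have "(\<lambda>r. b r y (\<mu> r)) \<in> borel_measurable (restrict_space borel {s..T})"
    by (rule measurable_restrict_mono) (use s in auto)
  then show "(\<lambda>r. indicator {s..T} r *\<^sub>R b r y (\<mu> r)) \<in> borel_measurable borel"
    by (subst (asm) borel_measurable_restrict_space_iff) auto
next
  have P2: "\<mu> r \<in> P2" if "0 \<le> r" for r using \<mu> that by (auto simp: C_P2_def)
  show "continuous_on UNIV (\<lambda>y. b r y (\<mu> r))" if "r \<in> {s..T}" for r using that s by (intro cont P2) auto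
  show "\<exists>C. \<forall>r\<in>{s..T}. \<forall>y. norm y \<le> R \<longrightarrow> norm (b r y (\<mu> r)) \<le> C" for R
  proof -
    obtain R' where R': "\<And>r. r \<in> {s..T} \<Longrightarrow> W2 (\<mu> r) (return borel 0) \<le> R'"
      using C_P2_W2_bounded[OF \<mu> s(1), of T] by blast
    \<comment> \<open>\<open>bounded_on_bounded\<close> uses a single radius for time, space and
      measure.\<close>
    define R'' where "R'' = max (max R R') T"
    obtain C where C: "\<And>t x \<gamma>. t \<in> {0..R''} \<Longrightarrow> \<gamma> \<in> P2 \<Longrightarrow> norm x \<le> R'' \<Longrightarrow> W2 \<gamma> (return borel 0) \<le> R'' \<Longrightarrow> norm (b t x \<gamma>) \<le> C"
      using bdd[unfolded bounded_on_bounded_def, rule_format, of R''] by blast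
    have "norm (b r y (\<mu> r)) \<le> C" if "r \<in> {s..T}" "norm y \<le> R" for r y
      using R'[OF that(1)] that s P2[of r] by (intro C) (auto simp: R''_def)
    then show ?thesis by blast
  qed
  show "2 * ((b r x (\<mu> r) - b r y (\<mu> r)) \<bullet> (x - y)) \<le> K * (norm (x - y))\<^sup>2" if "r \<in> {s..T}" for r x y
    using mono[of r "\<mu> r" "\<mu> r" x y] P2[of r] that s W2_self[OF P2[of r]] by (simp add: hs_norm_def)
qed

section \<open>Equations along a curve of measures\<close>

context brownian_motion
begin

text \<open>The common source of both claims. The case \<open>t = s\<close> is treated separately
  because the discretised interval must have positive length.\<close>

lemma LSI_sde:
  fixes b :: "real \<Rightarrow> real^'d::finite \<Rightarrow> (real^'d) measure \<Rightarrow> real^'d" and \<sigma> :: "real \<Rightarrow> (real^'d) measure \<Rightarrow> real^'n^'d"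
  assumes meas: "(\<lambda>(t, x, \<gamma>). b t x \<gamma>) \<in> borel_measurable (restrict_space borel {0..} \<Otimes>\<^sub>M borel \<Otimes>\<^sub>M P2_borel)"
    and bdd: "bounded_on_bounded b"
    and cont: "\<And>t \<gamma>. t \<ge> 0 \<Longrightarrow> \<gamma> \<in> P2 \<Longrightarrow> continuous_on UNIV (\<lambda>x. b t x \<gamma>)"
    and K: "K > 0" and \<delta>: "\<delta> > 0"
    and mono: "\<And>t x y \<gamma> \<gamma>'. t \<ge> 0 \<Longrightarrow> \<gamma> \<in> P2 \<Longrightarrow> \<gamma>' \<in> P2 \<Longrightarrow>
      2 * ((b t x \<gamma> - b t y \<gamma>') \<bullet> (x - y)) + (hs_norm (\<sigma> t \<gamma> - \<sigma> t \<gamma>'))\<^sup>2 \<le> K * (norm (x - y))\<^sup>2 + KI * (W2 \<gamma> \<gamma>')\<^sup>2"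
    and ell: "\<And>t \<gamma>. t \<ge> 0 \<Longrightarrow> \<gamma> \<in> P2 \<Longrightarrow> loewner_le (\<sigma> t \<gamma> ** transpose (\<sigma> t \<gamma>)) (\<delta> *\<^sub>R mat 1)"
    and \<mu>: "\<mu> \<in> C_P2" and s: "0 \<le> s" "s \<le> t" and C: "0 \<le> C"
    and X: "solves_sde M F W s (\<lambda>t y. b t y (\<mu> t)) (\<lambda>t. \<sigma> t (\<mu> t)) X" and LSI: "LSI (distr M borel (X s)) C"
  shows "LSI (distr M borel (X t)) (exp (K * (t - s)) * C + \<delta> * (1 / K) * (exp (K * (t - s)) - 1))"
proof (cases "s = t")
  case True
  then show ?thesis using LSI by simp
next
  case False
  then have st: "s < t" using s by simp
  have drift: "monotone_drift (\<lambda>r y. b r y (\<mu> r)) s t K"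
    by (rule monotone_drift_along_curve[OF meas bdd cont K mono \<mu> s(1) st]) assumption+
  show ?thesis
  proof (rule LSI_monotone_drift[OF drift s(1) _ C _ X LSI])
    show "0 \<le> \<delta>" using \<delta> by simp
    show "\<sigma> r (\<mu> r) \<in> diffusion_set \<delta>" if "r \<in> {s..t}" for r
      using that s \<mu> unfolding diffusion_set_def C_P2_def by (auto intro!: ell)
  qed
qed

end

lemma LSI_AE_const:
  fixes X :: "'w \<Rightarrow> 'a::euclidean_space"
  assumes M: "prob_space M" and [measurable]: "X \<in> borel_measurable M" and x: "AE \<omega> in M. X \<omega> = x"
  shows "LSI (distr M borel X) 0"
  unfolding LSI_def
proof (intro allI impI)
  interpret prob_space M by fact
  fix f H assume "admissible (f :: 'a \<Rightarrow> real) H"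
  then have [measurable]: "f \<in> borel_measurable borel" by (auto elim: admissibleE)
  have "expectation (\<lambda>\<omega>. f (X \<omega>) * ln (f (X \<omega>))) = expectation (\<lambda>\<omega>. f x * ln (f x))"
    using x by (intro integral_cong_AE) (auto elim: eventually_mono)
  moreover have "expectation (\<lambda>\<omega>. f (X \<omega>)) = expectation (\<lambda>\<omega>. f x)"
    using x by (intro integral_cong_AE) (auto elim: eventually_mono)
  ultimately have "ent M (\<lambda>\<omega>. f (X \<omega>)) = 0" by (simp add: ent_def prob_space)
  then show "ent (distr M borel X) f \<le> 0 / 2 * (\<integral>x. (H x)\<^sup>2 / f x \<partial>distr M borel X)"
    by (simp add: ent_distr)
qed

lemma Cb_infty_measurable:
  fixes f :: "real^'d::finite \<Rightarrow> real"
  assumes "f \<in> Cb_infty" "\<And>x. f x > 0"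
  shows "f \<in> borel_measurable borel" "(\<lambda>x. (norm (gradient (\<lambda>z. sqrt (f z)) x))\<^sup>2) \<in> borel_measurable borel"
proof -
  obtain L M where G: "lip L f" "lip M (gradient f)" using Cb_infty_gradient[OF assms(1)] by metis
  show [measurable]: "f \<in> borel_measurable borel" by (rule lip_measurable[OF G(1)])
  have [measurable]: "gradient f \<in> borel_measurable borel" by (rule lip_measurable[OF G(2)])
  have df: "f differentiable (at x)" for x using Cb_infty_differentiable[OF assms(1), of "[]"] by simp
  show "(\<lambda>x. (norm (gradient (\<lambda>z. sqrt (f z)) x))\<^sup>2) \<in> borel_measurable borel"
    unfolding norm_gradient_sqrt_sq[OF df assms(2)] by measurable
qed

theorem theorem2p1:
  fixes M :: "'w measure"
    and F :: "real \<Rightarrow> 'w measure"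
    and W :: "real \<Rightarrow> 'w \<Rightarrow> real^'n"
    and b :: "real \<Rightarrow> real^'d \<Rightarrow> (real^'d) measure \<Rightarrow> real^'d"
    and \<sigma> :: "real \<Rightarrow> (real^'d) measure \<Rightarrow> real^'n^'d"
    and K1 KI \<delta>1 :: real
  assumes "brownian_motion M F W"
    and "(\<lambda>(t, x, \<gamma>). b t x \<gamma>) \<in>
      borel_measurable (restrict_space borel {0..} \<Otimes>\<^sub>M borel \<Otimes>\<^sub>M P2_borel)"
    and "(\<lambda>(t, \<gamma>). \<sigma> t \<gamma>) \<in> borel_measurable (restrict_space borel {0..} \<Otimes>\<^sub>M P2_borel)"
    and "bounded_on_bounded b"
    and "\<And>t \<gamma>. t \<ge> 0 \<Longrightarrow> \<gamma> \<in> P2 \<Longrightarrow> continuous_on UNIV (\<lambda>x. b t x \<gamma>)"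
    and "K1 > 0" "KI > 0" "\<delta>1 > 0"
    and "\<And>t x y \<gamma> \<gamma>'. t \<ge> 0 \<Longrightarrow> \<gamma> \<in> P2 \<Longrightarrow> \<gamma>' \<in> P2 \<Longrightarrow>
      2 * ((b t x \<gamma> - b t y \<gamma>') \<bullet> (x - y)) + (hs_norm (\<sigma> t \<gamma> - \<sigma> t \<gamma>'))\<^sup>2
        \<le> K1 * (norm (x - y))\<^sup>2 + KI * (W2 \<gamma> \<gamma>')\<^sup>2"
    and "\<And>t (x::real^'d) \<gamma>. t \<ge> 0 \<Longrightarrow> \<gamma> \<in> P2 \<Longrightarrow>
      (hs_norm (\<sigma> t \<gamma>))\<^sup>2 \<le> K1 * (1 + (norm x)\<^sup>2 + (\<integral>z. (norm z)\<^sup>2 \<partial>\<gamma>))"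
    and "\<And>t \<gamma>. t \<ge> 0 \<Longrightarrow> \<gamma> \<in> P2 \<Longrightarrow>
      loewner_le (\<sigma> t \<gamma> ** transpose (\<sigma> t \<gamma>)) (\<delta>1 *\<^sub>R mat 1)"
  shows
    "(\<forall>\<mu>\<in>C_P2. \<forall>s\<ge>0. \<forall>x X. solves_decoupled M F W b \<sigma> \<mu> s x X \<longrightarrow>
       (\<forall>f\<in>Cb_infty. (\<forall>y. f y > 0) \<longrightarrow> (\<forall>t\<ge>s.
          P_transition M X t (\<lambda>y. f y * ln (f y))
              - P_transition M X t f * ln (P_transition M X t f)
            \<le> 2 * \<delta>1 / K1 * (exp (K1 * (t - s)) - 1)
              * P_transition M X t (\<lambda>y. (norm (gradient (\<lambda>z. sqrt (f z)) y))\<^sup>2)))) \<and>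
     (\<forall>\<gamma>\<in>P2. \<forall>L\<^sub>0\<ge>0.
       (\<forall>f\<in>Cb_infty. (\<forall>y. f y > 0) \<longrightarrow>
          (\<integral>y. f y * ln (f y) \<partial>\<gamma>)
            \<le> (\<integral>y. f y \<partial>\<gamma>) * ln (\<integral>y. f y \<partial>\<gamma>)
              + 2 * L\<^sub>0 * (\<integral>y. (norm (gradient (\<lambda>z. sqrt (f z)) y))\<^sup>2 \<partial>\<gamma>)) \<longrightarrow>
       (\<forall>X. solves_mckean_vlasov M F W b \<sigma> \<gamma> X \<longrightarrow>
         (\<forall>t\<ge>0. \<forall>f\<in>Cb_infty. (\<forall>y. f y > 0) \<longrightarrow>
            (\<integral>y. f y * ln (f y) \<partial>law M (X t))
                - (\<integral>y. f y \<partial>law M (X t)) * ln (\<integral>y. f y \<partial>law M (X t))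
              \<le> 2 * (L\<^sub>0 * exp (K1 * t) + \<delta>1 / K1 * (exp (K1 * t) - 1))
                * (\<integral>y. (norm (gradient (\<lambda>z. sqrt (f z)) y))\<^sup>2 \<partial>law M (X t)))))"
proof -
  interpret brownian_motion M F W by (rule assms(1))
  \<comment> \<open>Used twice: along the given curve with a constant initial value, and along the
    laws of the solution with initial constant \<open>L\<^sub>0\<close>.\<close>
  have sde: "LSI (distr M borel (X t)) (exp (K1 * (t - s)) * C + \<delta>1 * (1 / K1) * (exp (K1 * (t - s)) - 1))"
    if "\<mu> \<in> C_P2" "0 \<le> s" "s \<le> t" "0 \<le> C" "solves_sde M F W s (\<lambda>t y. b t y (\<mu> t)) (\<lambda>t. \<sigma> t (\<mu> t)) X" "LSI (distr M borel (X s)) C"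
    for \<mu> s t C X
    by (rule LSI_sde[OF assms(2,4,5,6,8,9,11)]) (assumption | rule that)+
  have XM: "X t \<in> borel_measurable M" if "solves_sde M F W s \<beta> \<Sigma> X" "0 \<le> s" "s \<le> t" for s t \<beta> \<Sigma> and X :: "real \<Rightarrow> 'w \<Rightarrow> real^'d"
    using that measurable_F_M[of t "X t"] unfolding solves_sde_def by auto
  show ?thesis
  proof (intro conjI ballI allI impI)
    fix \<mu> :: "real \<Rightarrow> (real^'d) measure" and s t :: real and x :: "real^'d" and X :: "real \<Rightarrow> 'w \<Rightarrow> real^'d" and f :: "real^'d \<Rightarrow> real"
    assume \<mu>: "\<mu> \<in> C_P2" and s: "0 \<le> s" "s \<le> t" and X: "solves_decoupled M F W b \<sigma> \<mu> s x X"
      and f: "f \<in> Cb_infty" "\<forall>y. f y > 0"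
    have X': "solves_sde M F W s (\<lambda>t y. b t y (\<mu> t)) (\<lambda>t. \<sigma> t (\<mu> t)) X" "AE \<omega> in M. X s \<omega> = x"
      using X unfolding solves_decoupled_def by auto
    have pos: "f y > 0" for y using f(2) by blast
    note [measurable] = XM[OF X'(1) s] Cb_infty_measurable[OF f(1) pos]
    let ?C = "exp (K1 * (t - s)) * 0 + \<delta>1 * (1 / K1) * (exp (K1 * (t - s)) - 1)"
    have LSI: "LSI (distr M borel (X t)) ?C"
      by (rule sde[OF \<mu> s order_refl X'(1) LSI_AE_const[OF prob_space_axioms XM[OF X'(1) s(1) order_refl] X'(2)]])
    have C: "0 \<le> ?C" using assms(6,8) s by simp
    \<comment> \<open>\<open>LSI_Cb_infty\<close> contributes the factor \<open>2\<close>, which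
      turns \<open>\<delta>1 * (1 / K1)\<close> into the constant
      \<open>2 * \<delta>1 / K1\<close>.\<close>
    have "ent (distr M borel (X t)) f \<le> 2 * ?C * (\<integral>y. (norm (gradient (\<lambda>z. sqrt (f z)) y))\<^sup>2 \<partial>distr M borel (X t))"
      by (rule LSI_Cb_infty[OF prob_space_distr _ LSI C f(1) pos]) simp_all
    then show "P_transition M X t (\<lambda>y. f y * ln (f y)) - P_transition M X t f * ln (P_transition M X t f)
        \<le> 2 * \<delta>1 / K1 * (exp (K1 * (t - s)) - 1) * P_transition M X t (\<lambda>y. (norm (gradient (\<lambda>z. sqrt (f z)) y))\<^sup>2)"
      by (simp add: ent_distr ent_def[of M] P_transition_def integral_distr)
  next
    fix \<gamma> :: "(real^'d) measure" and L\<^sub>0 t :: real and X :: "real \<Rightarrow> 'w \<Rightarrow> real^'d" and f :: "real^'d \<Rightarrow> real"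
    assume \<gamma>: "\<gamma> \<in> P2" and L0: "0 \<le> L\<^sub>0"
      and H: "\<forall>f\<in>Cb_infty. (\<forall>y. f y > 0) \<longrightarrow> (\<integral>y. f y * ln (f y) \<partial>\<gamma>)
            \<le> (\<integral>y. f y \<partial>\<gamma>) * ln (\<integral>y. f y \<partial>\<gamma>) + 2 * L\<^sub>0 * (\<integral>y. (norm (gradient (\<lambda>z. sqrt (f z)) y))\<^sup>2 \<partial>\<gamma>)"
      and X: "solves_mckean_vlasov M F W b \<sigma> \<gamma> X" and t: "0 \<le> t" and f: "f \<in> Cb_infty" "\<forall>y. f y > 0"
    \<comment> \<open>Along its own laws the solution of the nonlinear equation solves the decoupled
      one with a random initial value.\<close>
    let ?\<mu> = "\<lambda>t. law M (X t)"
    have X': "?\<mu> \<in> C_P2" "law M (X 0) = \<gamma>" "solves_sde M F W 0 (\<lambda>t y. b t y (?\<mu> t)) (\<lambda>t. \<sigma> t (?\<mu> t)) X"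
      using X unfolding solves_mckean_vlasov_def by auto
    have pos: "f y > 0" for y using f(2) by blast
    note [measurable] = XM[OF X'(3) order_refl t]
    \<comment> \<open>The hypothesis on the initial law concerns smooth functions and square roots;
      \<open>LSI_of_Cb_infty\<close> extends it to slope bounds, with constant exactly
      \<open>L\<^sub>0\<close>.\<close>
    have "LSI \<gamma> L\<^sub>0"
    proof (rule LSI_of_Cb_infty[OF P2D(1,2)[OF \<gamma>] L0])
      fix g :: "real^'d \<Rightarrow> real" and c B assume g: "g \<in> Cb_infty" "0 < c" "\<And>x. c \<le> g x"
      have gpos: "g x > 0" for x using g(2) g(3)[of x] by linarith
      have dg: "g differentiable (at x)" for x using Cb_infty_differentiable[OF g(1), of "[]"] by simp
      have i: "(\<integral>y. (norm (gradient (\<lambda>z. sqrt (g z)) y))\<^sup>2 \<partial>\<gamma>) = (\<integral>x. (norm (gradient g x))\<^sup>2 / g x \<partial>\<gamma>) / 4"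
        unfolding norm_gradient_sqrt_sq[OF dg gpos] by (rule integral_divide_zero)
      have "ent \<gamma> g \<le> 2 * L\<^sub>0 * (\<integral>y. (norm (gradient (\<lambda>z. sqrt (g z)) y))\<^sup>2 \<partial>\<gamma>)"
        using H[rule_format, OF g(1) gpos] by (simp add: ent_def)
      also have "\<dots> = L\<^sub>0 / 2 * (\<integral>x. (norm (gradient g x))\<^sup>2 / g x \<partial>\<gamma>)"
        unfolding i by simp
      finally show "ent \<gamma> g \<le> L\<^sub>0 / 2 * (\<integral>x. (norm (gradient g x))\<^sup>2 / g x \<partial>\<gamma>)" .
    qed
    then have "LSI (distr M borel (X 0)) L\<^sub>0" using X'(2) by (simp add: law_def)
    then have LSI: "LSI (distr M borel (X t)) (exp (K1 * (t - 0)) * L\<^sub>0 + \<delta>1 * (1 / K1) * (exp (K1 * (t - 0)) - 1))"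
      by (rule sde[OF X'(1) order_refl t L0 X'(3)])
    have C: "0 \<le> exp (K1 * (t - 0)) * L\<^sub>0 + \<delta>1 * (1 / K1) * (exp (K1 * (t - 0)) - 1)" using assms(6,8) t L0 by simp
    have "ent (distr M borel (X t)) f \<le> 2 * (exp (K1 * (t - 0)) * L\<^sub>0 + \<delta>1 * (1 / K1) * (exp (K1 * (t - 0)) - 1))
        * (\<integral>y. (norm (gradient (\<lambda>z. sqrt (f z)) y))\<^sup>2 \<partial>distr M borel (X t))"
      by (rule LSI_Cb_infty[OF prob_space_distr _ LSI C f(1) pos]) simp_all
    then show "(\<integral>y. f y * ln (f y) \<partial>law M (X t)) - (\<integral>y. f y \<partial>law M (X t)) * ln (\<integral>y. f y \<partial>law M (X t))
        \<le> 2 * (L\<^sub>0 * exp (K1 * t) + \<delta>1 / K1 * (exp (K1 * t) - 1)) * (\<integral>y. (norm (gradient (\<lambda>z. sqrt (f z)) y))\<^sup>2 \<partial>law M (X t))"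
      by (simp add: ent_def law_def mult.commute)
  qed
qed

end
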